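(* Let $M$ be an $F$-crystal over $\Omega=\mathcal{O}[[t]]$. Then the special Newton polygon of $M$ equals the Newton polygon of the reduction of $M$ modulo $t$ (an $F$-crystal over $\mathcal{O}$).
   Context: Let $k$ be an algebraically closed field of characteristic $p>0$, $\mathcal{O}$ a finite extension of the Witt ring $W(k)$ (the ring of integers of a finite totally ramified extension of $\mathrm{Frac}\,W(k)$), $\sigma$ an automorphism of $\mathcal{O}$ lifting the absolute Frobenius of $k$. Let $v_p$ be the valuation with $v_p(p)=1$ and $|x|=p^{-v_p(x)}$, both extended to $\mathcal{O}[1/p]$ and its finite extensions. A finite extension $\mathcal{O}'$ of $\mathcal{O}$ means the ring of integers of a finite extension of $\mathrm{Frac}\,\mathcal{O}$ equipped with an automorphism $\sigma$ extending that of $\mathcal{O}$. On $\Omega=\mathcal{O}[[t]]$, $\sigma$ denotes an endomorphism lifting $x\mapsto x^p$ on $k[[t]]$, compatible with $\sigma$ on $\mathcal{O}$, with $\sigma(t\Omega)\subseteq t\Omega$. Rings. $\Gamma^{\mathrm{imm}}$ is the ring of series $x=\sum_{i\in\mathbb{Q}}x_it^i$, $x_i\in\mathcal{O}$, such that for each $r>0$ the set $\{i:|x_i|>p^{-r}\}$ is a well-ordered subset of $\mathbb{Q}$; $\Gamma^{\mathrm{imm}}_{\mathrm{con}}$ is the subring of those $x$ for which there is $c>0$ with $|x_i|<p^{ci}$ for all sufficiently negative $i$. $\Gamma^{\mathrm{imm}}_{\mathrm{an,con}}$ is the ring of series $x=\sum_{i\in\mathbb{Q}}x_it^i$ with $x_i\in\mathcal{O}[1/p]$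 such that: (1) for each $r\in\mathbb{R}$ the set $\{i:|x_i|>p^r\}$ is well-ordered, and for each $j$ the set $\{|x_i|:i<j\}$ is bounded; (2) there is $c>0$ with $|x_i|<p^{ci}$ for $i$ sufficiently negative; (3) for every $d>0$, $|x_i|<p^{di}$ for $i$ sufficiently positive. On these rings $\sigma$ acts by $\sum x_it^i\mapsto\sum x_i^\sigma t^{pi}$. There is a unique $\sigma$-equivariant $\mathcal{O}$-algebra embedding of $\Omega$ into $\Gamma^{\mathrm{imm}}_{\mathrm{con}}$ lifting the inclusion of $k[[t]]$ into the residue field (generalized power series over $k$ with well-ordered support in $\mathbb{Q}$); base extension from $\Omega$ is along this embedding. An $F$-crystal over a ring $S$ with endomorphism $\sigma$ is a finite free $S$-module $M$ with an additive, $\sigma$-semilinear map $F:M\to M$ ($F(rm)=r^\sigma F(m)$) whose matrix on a basis is invertible over $S[1/p]$. Special Newton polygon: for some finite extension $\mathcal{O}'$ of $\mathcal{O}$, the base extension of $M$ to $\Gamma^{\mathrm{imm}}_{\mathrm{an,con}}\otimes_{\mathcal{O}}\mathcal{O}'$ has a basis $\mathbf{v}_1,\dots,\mathbf{v}_n$ with $F\mathbf{v}_i=\lambda_i\mathbf{v}_i$, $\lambda_i\in\mathcal{O}'[1/p]$ nonzero; the multiset of special slopes $v_p(\lambda_i)$ is independent of choices, and the special Newton polygon is the convex polygon starting at $(0,0)$ whose slopes (each over horizontal length 1, in increasing order) are the special slopes. The Newton polygon of an $F$-crystal $N$ over $\mathcal{O}$ is defined likewise from the valuations of the eigenvalues of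 a basis of eigenvectors of $N\otimes_{\mathcal{O}}\mathcal{O}'[1/p]$ for a suitable $\mathcal{O}'$ (which exists by Dieudonné–Manin). *)

theory Defs
  imports
    "HOL-Analysis.Line_Segment"
    "HOL-Computational_Algebra.Formal_Power_Series"
    "HOL-Computational_Algebra.Polynomial"
    "HOL-Computational_Algebra.Primes"
    "HOL-Library.Multiset"
    "HOL-Algebra.Module"
    "HOL-Algebra.QuotRing"
    "HOL-Algebra.Subrings"
    "HOL-Algebra.Embedded_Algebras"
    "HOL-Algebra.Algebraic_Closure_Type"
begin

section \<open>Coefficient rings\<close>

text \<open>
  All coefficient rings live inside one algebraically closed field \<open>'a\<close>, which plays the role of an
  algebraic closure of \<open>K = Frac \<O>\<close>. Every finite extension of \<open>K\<close> is \<open>K\<close>-isomorphic to a subfield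
  of \<open>'a\<close>, so a finite extension \<open>\<O>'\<close> of \<open>\<O>\<close> is given by a subfield \<open>K' \<supseteq> K\<close> of \<open>'a\<close>.
  The function \<open>v\<close> is the valuation \<open>v\<^sub>p\<close>; its value at \<open>0\<close> is irrelevant (it stands for \<open>\<infinity>\<close>).
\<close>

definition is_valuation :: "nat \<Rightarrow> ('a::field \<Rightarrow> real) \<Rightarrow> bool" where
  "is_valuation p v \<longleftrightarrow>
     (\<forall>x y. x \<noteq> 0 \<longrightarrow> y \<noteq> 0 \<longrightarrow> v (x * y) = v x + v y) \<and>
     (\<forall>x y. x \<noteq> 0 \<longrightarrow> y \<noteq> 0 \<longrightarrow> x + y \<noteq> 0 \<longrightarrow> v (x + y) \<ge> min (v x) (v y)) \<and>
     (of_nat p :: 'a) \<noteq> 0 \<and> v (of_nat p) = 1"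

definition pabs :: "nat \<Rightarrow> ('a::field \<Rightarrow> real) \<Rightarrow> 'a \<Rightarrow> real" where
  "pabs p v x = (if x = 0 then 0 else real p powr (- v x))"

definition integers_of :: "('a::field \<Rightarrow> real) \<Rightarrow> 'a set \<Rightarrow> 'a set" where
  "integers_of v K = {x \<in> K. x = 0 \<or> v x \<ge> 0}"

definition subring_of_type :: "'a::comm_ring_1 set \<Rightarrow> 'a ring" where
  "subring_of_type A = ring_of_type_algebra\<lparr>carrier := A\<rparr>"

definition fractions :: "'a::field set \<Rightarrow> 'a set" where
  "fractions A = {a / b | a b. a \<in> A \<and> b \<in> A \<and> b \<noteq> 0}"

text \<open>
  \<open>W\<close> is the Witt ring of the perfect field \<open>'k\<close>, i.e. the strict \<open>p\<close>-ring with residue field \<open>'k\<close>: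
  \<open>p\<close> is not a zero divisor (automatic in a field where \<open>p \<noteq> 0\<close>), \<open>W / pW = 'k\<close> via \<open>res\<close>, and \<open>W\<close>
  is separated and complete for the \<open>p\<close>-adic topology.
\<close>
definition is_witt_ring :: "nat \<Rightarrow> ('a::field \<Rightarrow> 'k::field) \<Rightarrow> 'a set \<Rightarrow> bool" where
  "is_witt_ring p res W \<longleftrightarrow>
     subring W ring_of_type_algebra \<and>
     (of_nat p :: 'a) \<noteq> 0 \<and>
     res \<in> ring_hom (subring_of_type W) ring_of_type_algebra \<and>
     res ` W = UNIV \<and>
     {x \<in> W. res x = 0} = (\<lambda>w. of_nat p * w) ` W \<and>
     (\<forall>x :: nat \<Rightarrow> 'a.
        (\<forall>n. x n \<in> W) \<and> (\<forall>n. x (Suc n) - x n \<in> (\<lambda>w. of_nat p ^ n * w) ` W) \<longrightarrow>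
        (\<exists>!y. y \<in> W \<and> (\<forall>n. y - x n \<in> (\<lambda>w. of_nat p ^ n * w) ` W)))"

text \<open>
  \<open>\<O> = integers_of v K\<close> is a finite extension of \<open>W\<close>. That \<open>res\<close> identifies the residue field of
  \<open>\<O>\<close> with the residue field \<open>'k\<close> of \<open>W\<close> says that \<open>K\<close> is totally ramified over \<open>Frac W\<close>. The
  condition \<open>v \<ge> 0\<close> on \<open>W\<close> makes \<open>v\<close> extend the \<open>p\<close>-adic valuation of \<open>Frac W\<close>; the
  extension to finite extensions of \<open>K\<close> is then determined, as \<open>K\<close> is complete.
\<close>
definition coefficient_setting ::
  "nat \<Rightarrow> ('a::alg_closed_field \<Rightarrow> real) \<Rightarrow> ('a \<Rightarrow> 'k::alg_closed_field) \<Rightarrow> 'a set \<Rightarrow> 'a set \<Rightarrow> bool" where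
  "coefficient_setting p v res W K \<longleftrightarrow>
     p > 0 \<and> CHAR('k) = p \<and>
     is_valuation p v \<and>
     is_witt_ring p res W \<and>
     (\<forall>x\<in>W. x \<noteq> 0 \<longrightarrow> v x \<ge> 0) \<and>
     subfield K ring_of_type_algebra \<and>
     W \<subseteq> K \<and>
     ring.finite_dimension ring_of_type_algebra (fractions W) K \<and>
     res \<in> ring_hom (subring_of_type (integers_of v K)) ring_of_type_algebra \<and>
     {x \<in> integers_of v K. res x = 0} = {x \<in> K. x = 0 \<or> v x > 0}"

text \<open>
  An automorphism of \<open>\<O>\<close> is the same as an automorphism of \<open>K\<close> preserving \<open>\<O>\<close>; \<open>\<sigma>\<close> denotes both.
  Its values outside \<open>K\<close> are irrelevant.
\<close>
definition integral_automorphism :: "('a::field \<Rightarrow> real) \<Rightarrow> 'a set \<Rightarrow> ('a \<Rightarrow> 'a) \<Rightarrow> bool" where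
  "integral_automorphism v K \<sigma> \<longleftrightarrow>
     \<sigma> \<in> ring_iso (subring_of_type K) (subring_of_type K) \<and>
     \<sigma> ` integers_of v K = integers_of v K"

definition frobenius_lift ::
  "nat \<Rightarrow> ('a::field \<Rightarrow> real) \<Rightarrow> ('a \<Rightarrow> 'k::field) \<Rightarrow> 'a set \<Rightarrow> ('a \<Rightarrow> 'a) \<Rightarrow> bool" where
  "frobenius_lift p v res K \<sigma> \<longleftrightarrow>
     integral_automorphism v K \<sigma> \<and> (\<forall>x \<in> integers_of v K. res (\<sigma> x) = res x ^ p)"

definition finite_extension ::
  "('a::field \<Rightarrow> real) \<Rightarrow> 'a set \<Rightarrow> ('a \<Rightarrow> 'a) \<Rightarrow> 'a set \<Rightarrow> ('a \<Rightarrow> 'a) \<Rightarrow> bool" where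
  "finite_extension v K \<sigma> K' \<sigma>' \<longleftrightarrow>
     subfield K' ring_of_type_algebra \<and>
     K \<subseteq> K' \<and>
     ring.finite_dimension ring_of_type_algebra K K' \<and>
     integral_automorphism v K' \<sigma>' \<and>
     (\<forall>x\<in>K. \<sigma>' x = \<sigma> x)"


section \<open>The ring \<open>\<Omega> = \<O>[[t]]\<close>\<close>

definition Omega_set :: "('a::field \<Rightarrow> real) \<Rightarrow> 'a set \<Rightarrow> 'a fps set" where
  "Omega_set v K = {f. \<forall>n. fps_nth f n \<in> integers_of v K}"

definition Omega :: "('a::field \<Rightarrow> real) \<Rightarrow> 'a set \<Rightarrow> 'a fps ring" where
  "Omega v K = subring_of_type (Omega_set v K)"

definition fps_res :: "('a::field \<Rightarrow> 'k::field) \<Rightarrow> 'a fps \<Rightarrow> 'k fps" where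
  "fps_res res f = Abs_fps (\<lambda>n. res (fps_nth f n))"

definition Omega_frobenius ::
  "nat \<Rightarrow> ('a::field \<Rightarrow> real) \<Rightarrow> ('a \<Rightarrow> 'k::field) \<Rightarrow> 'a set \<Rightarrow> ('a \<Rightarrow> 'a) \<Rightarrow> ('a fps \<Rightarrow> 'a fps) \<Rightarrow> bool" where
  "Omega_frobenius p v res K \<sigma> \<phi> \<longleftrightarrow>
     \<phi> \<in> ring_hom (Omega v K) (Omega v K) \<and>
     (\<forall>c \<in> integers_of v K. \<phi> (fps_const c) = fps_const (\<sigma> c)) \<and>
     (\<forall>f \<in> Omega_set v K. fps_res res (\<phi> f) = fps_res res f ^ p) \<and>
     \<phi> ` ((\<lambda>f. fps_X * f) ` Omega_set v K) \<subseteq> (\<lambda>f. fps_X * f) ` Omega_set v K"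


section \<open>Generalized power series\<close>

text \<open>The series \<open>\<Sum>\<^sub>i x\<^sub>i t\<^sup>i\<close> is the function \<open>i \<mapsto> x\<^sub>i\<close>.\<close>

type_synonym 'a series = "rat \<Rightarrow> 'a"

definition well_ordered :: "rat set \<Rightarrow> bool" where
  "well_ordered A \<longleftrightarrow> well_order_on A {(i, j). i \<in> A \<and> j \<in> A \<and> i \<le> j}"

text \<open>
  The coefficients of a product are in general infinite sums, convergent for the absolute value
  \<open>pabs p v\<close>; the limit is along the finite subsets of the index set.
\<close>
definition psum :: "nat \<Rightarrow> ('a::field \<Rightarrow> real) \<Rightarrow> (rat \<Rightarrow> 'a) \<Rightarrow> 'a" where
  "psum p v f =
     (THE s. \<forall>\<epsilon>>0. \<exists>A. finite A \<and> (\<forall>B. finite B \<longrightarrow> A \<subseteq> B \<longrightarrow> pabs p v (sum f B - s) < \<epsilon>))"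

definition series_const :: "'a::field \<Rightarrow> 'a series" where
  "series_const c = (\<lambda>i. if i = 0 then c else 0)"

definition series_ring :: "nat \<Rightarrow> ('a::field \<Rightarrow> real) \<Rightarrow> 'a series set \<Rightarrow> 'a series ring" where
  "series_ring p v A =
     \<lparr>carrier = A,
      monoid.mult = (\<lambda>x y k. psum p v (\<lambda>i. x i * y (k - i))),
      one = series_const 1,
      ring.zero = series_const 0,
      add = (\<lambda>x y i. x i + y i)\<rparr>"

definition series_frob :: "nat \<Rightarrow> ('a \<Rightarrow> 'a) \<Rightarrow> 'a series \<Rightarrow> 'a series" where
  "series_frob p \<sigma> x = (\<lambda>i. \<sigma> (x (i / of_nat p)))"

definition Gamma_imm :: "nat \<Rightarrow> ('a::field \<Rightarrow> real) \<Rightarrow> 'a set \<Rightarrow> 'a series set" where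
  "Gamma_imm p v K =
     {x. (\<forall>i. x i \<in> integers_of v K) \<and>
         (\<forall>r>0. well_ordered {i. pabs p v (x i) > real p powr (- r)})}"

definition Gamma_imm_con :: "nat \<Rightarrow> ('a::field \<Rightarrow> real) \<Rightarrow> 'a set \<Rightarrow> 'a series set" where
  "Gamma_imm_con p v K =
     {x \<in> Gamma_imm p v K.
        \<exists>c>0. \<forall>\<^sub>F i in at_bot. pabs p v (x i) < real p powr (c * of_rat i)}"

text \<open>Here \<open>K\<close> is \<open>\<O>[1/p]\<close>.\<close>
definition Gamma_imm_an_con :: "nat \<Rightarrow> ('a::field \<Rightarrow> real) \<Rightarrow> 'a set \<Rightarrow> 'a series set" where
  "Gamma_imm_an_con p v K =
     {x. (\<forall>i. x i \<in> K) \<and>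
         (\<forall>r. well_ordered {i. pabs p v (x i) > real p powr r}) \<and>
         (\<forall>j. bounded {pabs p v (x i) | i. i < j}) \<and>
         (\<exists>c>0. \<forall>\<^sub>F i in at_bot. pabs p v (x i) < real p powr (c * of_rat i)) \<and>
         (\<forall>d>0. \<forall>\<^sub>F i in at_top. pabs p v (x i) < real p powr (d * of_rat i))}"

text \<open>
  \<open>\<Gamma> \<otimes>\<^bsub>\<O>\<^esub> \<O>'\<close> for \<open>\<Gamma> = Gamma_imm_an_con p v K\<close>, realized as the ring of series over \<open>K'\<close> generated by
  \<open>\<Gamma>\<close> and \<open>\<O>'\<close>: the multiplication map \<open>\<Sum> x\<^sub>l \<otimes> e\<^sub>l \<mapsto> \<Sum> e\<^sub>l x\<^sub>l\<close> is injective, as \<open>\<O>'\<close> is free over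
  \<open>\<O>\<close> on a basis of \<open>K'\<close> over \<open>K\<close>. Under it \<open>\<sigma> \<otimes> \<sigma>'\<close> becomes \<open>series_frob p \<sigma>'\<close>.
\<close>
definition Gamma_ext ::
  "nat \<Rightarrow> ('a::field \<Rightarrow> real) \<Rightarrow> 'a set \<Rightarrow> 'a set \<Rightarrow> 'a series ring" where
  "Gamma_ext p v K K' = series_ring p v
     {(\<lambda>i. \<Sum>l<m. e l * x l i) | (m :: nat) e x.
        \<forall>l<m. e l \<in> integers_of v K' \<and> x l \<in> Gamma_imm_an_con p v K}"

text \<open>
  The \<open>\<sigma>\<close>-equivariant \<open>\<O>\<close>-algebra embedding of \<open>\<Omega>\<close> that lifts the inclusion of \<open>k[[t]]\<close> into the
  generalized power series over \<open>k\<close>.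
\<close>
definition Omega_embedding ::
  "nat \<Rightarrow> ('a::field \<Rightarrow> real) \<Rightarrow> ('a \<Rightarrow> 'k::field) \<Rightarrow> 'a set \<Rightarrow> ('a \<Rightarrow> 'a) \<Rightarrow> ('a fps \<Rightarrow> 'a fps)
     \<Rightarrow> ('a fps \<Rightarrow> 'a series) \<Rightarrow> bool" where
  "Omega_embedding p v res K \<sigma> \<phi> \<psi> \<longleftrightarrow>
     \<psi> \<in> ring_hom (Omega v K) (series_ring p v (Gamma_imm_con p v K)) \<and>
     inj_on \<psi> (Omega_set v K) \<and>
     (\<forall>c \<in> integers_of v K. \<psi> (fps_const c) = series_const c) \<and>
     (\<forall>f \<in> Omega_set v K. \<psi> (\<phi> f) = series_frob p \<sigma> (\<psi> f)) \<and>
     (\<forall>f \<in> Omega_set v K. \<forall>n. res (\<psi> f (of_nat n)) = fps_nth (fps_res res f) n) \<and>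
     (\<forall>f \<in> Omega_set v K. \<forall>i. i \<notin> \<nat> \<longrightarrow> res (\<psi> f i) = 0)"


section \<open>\<open>F\<close>-crystals and base extension\<close>

definition is_basis ::
  "('r, 'x) ring_scheme \<Rightarrow> ('r, 'm, 'y) module_scheme \<Rightarrow> nat \<Rightarrow> (nat \<Rightarrow> 'm) \<Rightarrow> bool" where
  "is_basis R M n b \<longleftrightarrow>
     b \<in> {..<n} \<rightarrow> carrier M \<and>
     (\<forall>m \<in> carrier M. \<exists>!c. c \<in> {..<n} \<rightarrow>\<^sub>E carrier R \<and> m = (\<Oplus>\<^bsub>M\<^esub>i\<in>{..<n}. c i \<odot>\<^bsub>M\<^esub> b i))"

text \<open>
  A matrix over \<open>R\<close> is invertible over \<open>R[1/p]\<close> iff it divides some scalar matrix \<open>p\<^sup>N\<close> from both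
  sides, clearing the denominators in the inverse (and, if \<open>R\<close> has \<open>p\<close>-torsion, multiplying by a
  further power of \<open>p\<close>).
\<close>
definition invertible_away_from_p ::
  "nat \<Rightarrow> ('r, 'x) ring_scheme \<Rightarrow> nat \<Rightarrow> (nat \<Rightarrow> nat \<Rightarrow> 'r) \<Rightarrow> bool" where
  "invertible_away_from_p p R n A \<longleftrightarrow>
     (\<exists>B N. (\<forall>i<n. \<forall>j<n. B i j \<in> carrier R) \<and>
        (\<forall>i<n. \<forall>j<n.
           (\<Oplus>\<^bsub>R\<^esub>l\<in>{..<n}. A i l \<otimes>\<^bsub>R\<^esub> B l j) = (if i = j then add_pow R (p ^ N) \<one>\<^bsub>R\<^esub> else \<zero>\<^bsub>R\<^esub>) \<and>
           (\<Oplus>\<^bsub>R\<^esub>l\<in>{..<n}. B i l \<otimes>\<^bsub>R\<^esub> A l j) = (if i = j then add_pow R (p ^ N) \<one>\<^bsub>R\<^esub> else \<zero>\<^bsub>R\<^esub>)))"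

definition F_crystal ::
  "nat \<Rightarrow> ('r, 'x) ring_scheme \<Rightarrow> ('r \<Rightarrow> 'r) \<Rightarrow> ('r, 'm, 'y) module_scheme \<Rightarrow> ('m \<Rightarrow> 'm) \<Rightarrow> bool" where
  "F_crystal p R \<phi> M F \<longleftrightarrow>
     Module.module R M \<and>
     F \<in> carrier M \<rightarrow> carrier M \<and>
     (\<forall>x \<in> carrier M. \<forall>y \<in> carrier M. F (x \<oplus>\<^bsub>M\<^esub> y) = F x \<oplus>\<^bsub>M\<^esub> F y) \<and>
     (\<forall>r \<in> carrier R. \<forall>x \<in> carrier M. F (r \<odot>\<^bsub>M\<^esub> x) = \<phi> r \<odot>\<^bsub>M\<^esub> F x) \<and>
     (\<exists>n b A. is_basis R M n b \<and>
        (\<forall>i<n. \<forall>j<n. A i j \<in> carrier R) \<and>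
        (\<forall>j<n. F (b j) = (\<Oplus>\<^bsub>M\<^esub>i\<in>{..<n}. A i j \<odot>\<^bsub>M\<^esub> b i)) \<and>
        invertible_away_from_p p R n A)"

text \<open>
  The tensor product \<open>S \<otimes>\<^bsub>R\<^esub> M\<close> along \<open>h : R \<rightarrow> S\<close>: finite formal sums of pairs \<open>(s, m)\<close>, as multisets,
  modulo the congruence generated by the tensor relations.
\<close>
inductive tensor_eq ::
  "('r, 'x) ring_scheme \<Rightarrow> ('s, 'z) ring_scheme \<Rightarrow> ('r \<Rightarrow> 's) \<Rightarrow> ('r, 'm, 'y) module_scheme
     \<Rightarrow> ('s \<times> 'm) multiset \<Rightarrow> ('s \<times> 'm) multiset \<Rightarrow> bool"
  for R S h M where
  refl: "set_mset A \<subseteq> carrier S \<times> carrier M \<Longrightarrow> tensor_eq R S h M A A"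
| sym: "tensor_eq R S h M A B \<Longrightarrow> tensor_eq R S h M B A"
| trans: "tensor_eq R S h M A B \<Longrightarrow> tensor_eq R S h M B C \<Longrightarrow> tensor_eq R S h M A C"
| plus: "tensor_eq R S h M A A' \<Longrightarrow> tensor_eq R S h M B B' \<Longrightarrow> tensor_eq R S h M (A + B) (A' + B')"
| zero: "m \<in> carrier M \<Longrightarrow> tensor_eq R S h M {#(\<zero>\<^bsub>S\<^esub>, m)#} {#}"
| add_left: "s \<in> carrier S \<Longrightarrow> s' \<in> carrier S \<Longrightarrow> m \<in> carrier M \<Longrightarrow>
    tensor_eq R S h M {#(s \<oplus>\<^bsub>S\<^esub> s', m)#} {#(s, m), (s', m)#}"
| add_right: "s \<in> carrier S \<Longrightarrow> m \<in> carrier M \<Longrightarrow> m' \<in> carrier M \<Longrightarrow>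
    tensor_eq R S h M {#(s, m \<oplus>\<^bsub>M\<^esub> m')#} {#(s, m), (s, m')#}"
| balanced: "r \<in> carrier R \<Longrightarrow> s \<in> carrier S \<Longrightarrow> m \<in> carrier M \<Longrightarrow>
    tensor_eq R S h M {#(s \<otimes>\<^bsub>S\<^esub> h r, m)#} {#(s, r \<odot>\<^bsub>M\<^esub> m)#}"

definition tensor_class ::
  "('r, 'x) ring_scheme \<Rightarrow> ('s, 'z) ring_scheme \<Rightarrow> ('r \<Rightarrow> 's) \<Rightarrow> ('r, 'm, 'y) module_scheme
     \<Rightarrow> ('s \<times> 'm) multiset \<Rightarrow> ('s \<times> 'm) multiset set" where
  "tensor_class R S h M A = {B. tensor_eq R S h M A B}"

text \<open>The record fields \<open>mult\<close> and \<open>one\<close> of a module are not used.\<close>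
definition base_ext ::
  "('r, 'x) ring_scheme \<Rightarrow> ('s, 'z) ring_scheme \<Rightarrow> ('r \<Rightarrow> 's) \<Rightarrow> ('r, 'm, 'y) module_scheme
     \<Rightarrow> ('s, ('s \<times> 'm) multiset set) module" where
  "base_ext R S h M =
     \<lparr>carrier = tensor_class R S h M ` {A. set_mset A \<subseteq> carrier S \<times> carrier M},
      monoid.mult = undefined,
      one = undefined,
      ring.zero = tensor_class R S h M {#},
      add = (\<lambda>U V. \<Union>A\<in>U. \<Union>B\<in>V. tensor_class R S h M (A + B)),
      module.smult = (\<lambda>a U. \<Union>A\<in>U. tensor_class R S h M (image_mset (\<lambda>(s, m). (a \<otimes>\<^bsub>S\<^esub> s, m)) A))\<rparr>"

text \<open>The extension \<open>s \<otimes> m \<mapsto> s\<^sup>\<sigma> \<otimes> F m\<close> of \<open>F\<close>, where \<open>\<tau>\<close> is the action of \<open>\<sigma>\<close> on \<open>S\<close>.\<close>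
definition base_ext_F ::
  "('r, 'x) ring_scheme \<Rightarrow> ('s, 'z) ring_scheme \<Rightarrow> ('r \<Rightarrow> 's) \<Rightarrow> ('r, 'm, 'y) module_scheme
     \<Rightarrow> ('s \<Rightarrow> 's) \<Rightarrow> ('m \<Rightarrow> 'm) \<Rightarrow> ('s \<times> 'm) multiset set \<Rightarrow> ('s \<times> 'm) multiset set" where
  "base_ext_F R S h M \<tau> F U =
     (\<Union>A\<in>U. tensor_class R S h M (image_mset (\<lambda>(s, m). (\<tau> s, F m)) A))"

text \<open>\<open>M / tM\<close>, as the base extension of \<open>M\<close> along \<open>\<Omega> \<rightarrow> \<Omega> / t\<Omega> = \<O>\<close>.\<close>
definition reduction ::
  "('a::field \<Rightarrow> real) \<Rightarrow> 'a set \<Rightarrow> ('a fps, 'm, 'y) module_scheme \<Rightarrow> ('a, ('a \<times> 'm) multiset set) module" where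
  "reduction v K M =
     base_ext (Omega v K) (subring_of_type (integers_of v K)) (\<lambda>f. fps_nth f 0) M"

definition reduction_F ::
  "('a::field \<Rightarrow> real) \<Rightarrow> 'a set \<Rightarrow> ('a \<Rightarrow> 'a) \<Rightarrow> ('a fps, 'm, 'y) module_scheme \<Rightarrow> ('m \<Rightarrow> 'm)
     \<Rightarrow> ('a \<times> 'm) multiset set \<Rightarrow> ('a \<times> 'm) multiset set" where
  "reduction_F v K \<sigma> M F =
     base_ext_F (Omega v K) (subring_of_type (integers_of v K)) (\<lambda>f. fps_nth f 0) M \<sigma> F"


section \<open>Newton polygons\<close>

text \<open>
  \<open>S\<close> is the multiset of valuations of the eigenvalues, in \<open>L - {0}\<close>, of some basis of eigenvectors of
  \<open>F\<close>; the map \<open>c\<close> sends an element of \<open>L\<close> to the corresponding scalar in \<open>R\<close>.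
\<close>
definition eigenbasis_slopes ::
  "('a::field \<Rightarrow> real) \<Rightarrow> 'a set \<Rightarrow> ('a \<Rightarrow> 'r) \<Rightarrow> ('r, 'x) ring_scheme \<Rightarrow> ('r, 'm, 'y) module_scheme
     \<Rightarrow> ('m \<Rightarrow> 'm) \<Rightarrow> real multiset \<Rightarrow> bool" where
  "eigenbasis_slopes v L c R M F S \<longleftrightarrow>
     (\<exists>n b l. is_basis R M n b \<and>
        (\<forall>i<n. l i \<in> L \<and> l i \<noteq> 0 \<and> F (b i) = c (l i) \<odot>\<^bsub>M\<^esub> b i) \<and>
        S = image_mset (\<lambda>i. v (l i)) (mset_set {..<n}))"

text \<open>Below, \<open>K'\<close> is \<open>\<O>'[1/p]\<close>.\<close>
definition special_slopes ::
  "nat \<Rightarrow> ('a::field \<Rightarrow> real) \<Rightarrow> 'a set \<Rightarrow> ('a \<Rightarrow> 'a) \<Rightarrow> ('a fps \<Rightarrow> 'a series)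
     \<Rightarrow> ('a fps, 'm, 'y) module_scheme \<Rightarrow> ('m \<Rightarrow> 'm) \<Rightarrow> real multiset \<Rightarrow> bool" where
  "special_slopes p v K \<sigma> \<psi> M F S \<longleftrightarrow>
     (\<exists>K' \<sigma>'. finite_extension v K \<sigma> K' \<sigma>' \<and>
        eigenbasis_slopes v K' series_const (Gamma_ext p v K K')
          (base_ext (Omega v K) (Gamma_ext p v K K') \<psi> M)
          (base_ext_F (Omega v K) (Gamma_ext p v K K') \<psi> M (series_frob p \<sigma>') F) S)"

definition crystal_slopes ::
  "('a::field \<Rightarrow> real) \<Rightarrow> 'a set \<Rightarrow> ('a \<Rightarrow> 'a) \<Rightarrow> ('a, 'm, 'y) module_scheme \<Rightarrow> ('m \<Rightarrow> 'm)
     \<Rightarrow> real multiset \<Rightarrow> bool" where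
  "crystal_slopes v K \<sigma> N F S \<longleftrightarrow>
     (\<exists>K' \<sigma>'. finite_extension v K \<sigma> K' \<sigma>' \<and>
        eigenbasis_slopes v K' (\<lambda>x. x) (subring_of_type K')
          (base_ext (subring_of_type (integers_of v K)) (subring_of_type K') (\<lambda>x. x) N)
          (base_ext_F (subring_of_type (integers_of v K)) (subring_of_type K') (\<lambda>x. x) N \<sigma>' F) S)"

definition polygon_vertex :: "real multiset \<Rightarrow> nat \<Rightarrow> real \<times> real" where
  "polygon_vertex S i = (real i, sum_list (take i (sorted_list_of_multiset S)))"

definition polygon_of_slopes :: "real multiset \<Rightarrow> (real \<times> real) set" where
  "polygon_of_slopes S =
     {(0, 0)} \<union> (\<Union>i<size S. closed_segment (polygon_vertex S i) (polygon_vertex S (Suc i)))"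

text \<open>The multiset of slopes does not depend on the choice of \<open>\<O>'\<close>, \<open>\<sigma>'\<close> and the eigenbasis.\<close>
definition special_newton_polygon ::
  "nat \<Rightarrow> ('a::field \<Rightarrow> real) \<Rightarrow> 'a set \<Rightarrow> ('a \<Rightarrow> 'a) \<Rightarrow> ('a fps \<Rightarrow> 'a series)
     \<Rightarrow> ('a fps, 'm, 'y) module_scheme \<Rightarrow> ('m \<Rightarrow> 'm) \<Rightarrow> (real \<times> real) set" where
  "special_newton_polygon p v K \<sigma> \<psi> M F =
     polygon_of_slopes (THE S. special_slopes p v K \<sigma> \<psi> M F S)"

definition newton_polygon ::
  "('a::field \<Rightarrow> real) \<Rightarrow> 'a set \<Rightarrow> ('a \<Rightarrow> 'a) \<Rightarrow> ('a, 'm, 'y) module_scheme \<Rightarrow> ('m \<Rightarrow> 'm)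
     \<Rightarrow> (real \<times> real) set" where
  "newton_polygon v K \<sigma> N F = polygon_of_slopes (THE S. crystal_slopes v K \<sigma> N F S)"

end

theory Submission
  imports Defs
begin

text \<open>Fix a finite extension \<open>K'\<close> of \<open>K\<close> and let \<open>A\<close> be the matrix of \<open>F\<close> on a basis of \<open>M\<close>, a matrix over \<open>\<Omega>\<close> such that
  \<open>A B = B A = p\<^sup>e\<close> for some \<open>B\<close> over \<open>\<Omega>\<close>. After base extension, an eigenbasis with eigenvalues \<open>l\<^sub>1, \<dots>, l\<^sub>m\<close> is the
  same as an invertible matrix \<open>U\<close> with \<open>A U\<^sup>\<sigma> = U \<Lambda>\<close>, where \<open>\<Lambda>\<close> is the diagonal matrix of the \<open>l\<^sub>j\<close>: for the special slopes
  \<open>U\<close> has entries in the series ring over \<open>K'\<close> and \<open>A\<close> stands for \<open>\<psi>(A)\<close>, for the slopes of the reduction \<open>U\<close> has entries in \<open>K'\<close>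
  and \<open>A\<close> stands for its value at \<open>t = 0\<close>. The proof shows that, for each list of eigenvalues, the first problem is solvable
  if and only if the second one is. Hence the same multisets occur as special slopes and as slopes of the reduction, and the
  polygons agree.

  The two problems are related by the fact that \<open>\<psi> f\<close> has no coefficients with negative exponents and that its coefficient
  at \<open>0\<close> is \<open>f(0)\<close> (\<open>\<psi>_vanish\<close>, \<open>\<psi>_nth_0\<close>). Indeed \<open>\<phi> f = f\<^sup>p + w h\<close> for a uniformizer \<open>w\<close>, and a bound for the coefficients at
  exponents \<open>i < 0\<close>, valid for all \<open>f\<close>, improves by the factor \<open>|w|\<close> on passing from the exponent \<open>i\<close> to \<open>p i\<close>.

  From series to constants (\<open>frobenius_solution_support\<close>): comparing coefficients in \<open>p\<^sup>e U\<^sup>\<sigma> = B U \<Lambda>\<close> bounds the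
  coefficients of \<open>U\<close> at \<open>i\<close> by those at exponents at most \<open>p i\<close>. For \<open>i < 0\<close> the exponents run off to \<open>-\<infinity>\<close>, where the
  growth condition lets the coefficients decay doubly exponentially in the number of steps, so they vanish. The same holds
  for the inverse of \<open>U\<close>, and the coefficients at \<open>0\<close> solve the problem over \<open>K'\<close>.

  From constants to series (\<open>dwork_trick\<close>): after a constant change of basis the value of \<open>A\<close> at \<open>t = 0\<close> is \<open>\<Lambda>\<close>. At a large
  radius \<open>A\<close> is then close to \<open>\<Lambda>\<close>, and the equation is solved by successive approximation, whose single step is a twisted
  linear equation \<open>\<kappa> \<sigma>(x) - \<mu> x = a\<close> for a series with positive exponents (\<open>solve_twisted\<close>, \<open>perturbed_system\<close>). The equation for
  \<open>U\<close> carries finiteness of the norm from a radius \<open>s\<close> to \<open>s / p\<close>, so the solution lies in the series ring.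

  All of this takes place over \<open>K'\<close>, which is complete with a discrete valuation, and the series ring tensored with \<open>\<O>'\<close> is
  the series ring over \<open>K'\<close> (\<open>Gamma_ext_eq\<close>); both follow from an expansion of the elements of \<open>K'\<close> with respect to finitely
  many elements and coefficients in \<open>W[1/p]\<close> (\<open>expansion\<close>).\<close>

section \<open>The absolute value\<close>

locale p_adic_norm =
  fixes p :: nat and v :: "'a::field \<Rightarrow> real"
  assumes p_gt_1: "p > 1" and valuation: "is_valuation p v"
begin

abbreviation N :: "'a \<Rightarrow> real" where "N \<equiv> pabs p v"

lemma v_mult: "x \<noteq> 0 \<Longrightarrow> y \<noteq> 0 \<Longrightarrow> v (x * y) = v x + v y"
  using valuation by (auto simp: is_valuation_def)

lemma v_add: "x \<noteq> 0 \<Longrightarrow> y \<noteq> 0 \<Longrightarrow> x + y \<noteq> 0 \<Longrightarrow> min (v x) (v y) \<le> v (x + y)"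
  using valuation by (auto simp: is_valuation_def)

lemma p_nonzero: "(of_nat p :: 'a) \<noteq> 0" and v_p: "v (of_nat p) = 1"
  using valuation by (auto simp: is_valuation_def)

lemma v_1: "v 1 = 0"
  using v_mult[of 1 1] by simp

lemma v_inverse: "x \<noteq> 0 \<Longrightarrow> v (inverse x) = - v x"
  using v_mult[of x "inverse x"] v_1 by simp

lemma v_power: "x \<noteq> 0 \<Longrightarrow> v (x ^ n) = real n * v x"
  by (induction n) (auto simp: v_1 v_mult algebra_simps)

lemma v_p_power: "v (of_nat p ^ n) = real n"
  by (simp add: v_power p_nonzero v_p)

lemma N_0 [simp]: "N 0 = 0"
  by (simp add: pabs_def)

lemma N_nonneg [simp]: "N x \<ge> 0"
  by (simp add: pabs_def)

lemma N_eq_0 [simp]: "N x = 0 \<longleftrightarrow> x = 0"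
  using p_gt_1 by (simp add: pabs_def)

lemma N_pos: "x \<noteq> 0 \<Longrightarrow> N x > 0"
  using N_nonneg[of x] N_eq_0[of x] by linarith

lemma N_mult: "N (x * y) = N x * N y"
  by (auto simp: pabs_def v_mult powr_add[symmetric] algebra_simps)

lemma N_1 [simp]: "N 1 = 1"
  using p_gt_1 by (simp add: pabs_def v_1)

lemma N_minus [simp]: "N (- x) = N x"
proof -
  have "N (-1) * N (-1) = 1" using N_mult[of "-1" "-1"] by simp
  hence "N (-1) = 1" using N_nonneg[of "-1"] by (auto simp only: square_eq_1_iff)
  thus ?thesis using N_mult[of "-1" x] by simp
qed

lemma N_minus_commute: "N (x - y) = N (y - x)"
  using N_minus[of "x - y"] by simp

lemma N_inverse: "N (inverse x) = inverse (N x)"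
  by (cases "x = 0") (auto simp: pabs_def v_inverse powr_minus)

lemma N_divide: "N (x / y) = N x / N y"
  by (simp add: divide_inverse N_mult N_inverse)

lemma N_power: "N (x ^ n) = N x ^ n"
  by (induction n) (auto simp: N_mult)

lemma N_p: "N (of_nat p) = 1 / p"
  using p_gt_1 by (simp add: pabs_def p_nonzero v_p powr_minus divide_inverse)

lemma N_le_iff: "x \<noteq> 0 \<Longrightarrow> N x \<le> real p powr r \<longleftrightarrow> - r \<le> v x"
  using p_gt_1 by (simp add: pabs_def) linarith

lemma N_le_1_iff: "N x \<le> 1 \<longleftrightarrow> x = 0 \<or> v x \<ge> 0"
  using N_le_iff[of x 0] p_gt_1 by (cases "x = 0") auto

lemma N_less_1_iff: "N x < 1 \<longleftrightarrow> x = 0 \<or> v x > 0"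
  using p_gt_1 powr_less_cancel_iff[of "real p" "- v x" 0] by (auto simp: pabs_def)

lemma N_le_N_iff: "x \<noteq> 0 \<Longrightarrow> y \<noteq> 0 \<Longrightarrow> N x \<le> N y \<longleftrightarrow> v y \<le> v x"
  using p_gt_1 by (simp add: pabs_def)

lemma N_add: "N (x + y) \<le> max (N x) (N y)"
proof (cases "x = 0 \<or> y = 0 \<or> x + y = 0")
  case False
  then have "min (v x) (v y) \<le> v (x + y)" by (intro v_add) auto
  thus ?thesis using False N_le_N_iff[of "x+y" x] N_le_N_iff[of "x+y" y]
    by (auto simp: min_def max_def split: if_splits)
qed (auto simp: max_def)

lemma N_add_le: "N x \<le> C \<Longrightarrow> N y \<le> C \<Longrightarrow> N (x + y) \<le> C"
  using N_add[of x y] by simp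

lemma N_diff_le: "N x \<le> C \<Longrightarrow> N y \<le> C \<Longrightarrow> N (x - y) \<le> C"
  using N_add_le[of x C "-y"] by simp

lemma N_add_less: "N x < C \<Longrightarrow> N y < C \<Longrightarrow> N (x + y) < C"
  using N_add[of x y] by simp

lemma N_diff_less: "N x < C \<Longrightarrow> N y < C \<Longrightarrow> N (x - y) < C"
  using N_add_less[of x C "-y"] by simp

lemma N_sum_le: "(\<And>i. i \<in> A \<Longrightarrow> N (f i) \<le> C) \<Longrightarrow> 0 \<le> C \<Longrightarrow> N (sum f A) \<le> C"
  by (induction A rule: infinite_finite_induct) (auto intro!: N_add_le)

lemma N_sum_less: "(\<And>i. i \<in> A \<Longrightarrow> N (f i) < C) \<Longrightarrow> 0 < C \<Longrightarrow> N (sum f A) < C"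
  by (induction A rule: infinite_finite_induct) (auto intro!: N_add_less)

lemma N_add_eq: "N y < N x \<Longrightarrow> N (x + y) = N x"
  using N_add[of x y] N_diff_less[of "x+y" "N x" y] by (cases "N (x + y) < N x") auto

lemma N_of_nat: "N (of_nat n) \<le> 1"
  by (induction n) (auto intro!: N_add_le)

text \<open>A nonzero term of strictly largest norm dominates a finite sum.\<close>
lemma N_sum_distinct_nonzero:
  assumes "finite A" "i0 \<in> A" "f i0 \<noteq> 0"
    and "\<And>i j. i \<in> A \<Longrightarrow> j \<in> A \<Longrightarrow> i \<noteq> j \<Longrightarrow> f i \<noteq> 0 \<Longrightarrow> N (f i) \<noteq> N (f j)"
  shows "sum f A \<noteq> 0"
proof -
  obtain m where m: "m \<in> A" "N (f m) = Max ((\<lambda>i. N (f i)) ` A)"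
    using Max_in[of "(\<lambda>i. N (f i)) ` A"] assms(1,2) by fastforce
  have le: "N (f i) \<le> N (f m)" if "i \<in> A" for i using m that assms(1) by simp
  have pos: "N (f m) > 0" using le[OF assms(2)] N_pos[OF assms(3)] by linarith
  then have fm: "f m \<noteq> 0" by auto
  have "N (sum f (A - {m})) < N (f m)"
  proof (rule N_sum_less)
    fix i assume i: "i \<in> A - {m}"
    then have "N (f m) \<noteq> N (f i)" using assms(4)[of m i] m(1) fm by blast
    thus "N (f i) < N (f m)" using le[of i] i by simp
  qed (rule pos)
  then have "N (sum f A) = N (f m)"
    using N_add_eq sum.remove[OF assms(1) m(1), of f] by simp
  thus ?thesis using pos by auto
qed

end

section \<open>Subrings and subfields of a field\<close>

lemma (in comm_ring_1) ring_of_type_simps: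
  "carrier (ring_of_type_algebra::'a ring) = UNIV"
  "monoid.mult (ring_of_type_algebra::'a ring) = (*)"
  "monoid.one (ring_of_type_algebra::'a ring) = 1"
  "ring.zero (ring_of_type_algebra::'a ring) = 0"
  "add (ring_of_type_algebra::'a ring) = (+)"
  by (auto simp: ring_of_type_algebra_def)

lemma subring_of_type_simps:
  "carrier (subring_of_type A) = A"
  "monoid.mult (subring_of_type A) = (*)"
  "monoid.one (subring_of_type A) = 1"
  "ring.zero (subring_of_type A) = 0"
  "add (subring_of_type A) = (+)"
  by (auto simp: subring_of_type_def ring_of_type_algebra_def)

lemma ring_of_type_a_inv: "a_inv (ring_of_type_algebra :: 'a::comm_ring_1 ring) x = - x"
proof -
  interpret cring "ring_of_type_algebra :: 'a ring" by (rule cring_from_type_algebra)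
  show ?thesis by (rule minus_equality) (auto simp: ring_of_type_simps)
qed

lemma subring_of_type_iff:
  "subring A (ring_of_type_algebra :: 'a::comm_ring_1 ring) \<longleftrightarrow>
     1 \<in> A \<and> (\<forall>x\<in>A. - x \<in> A) \<and> (\<forall>x\<in>A. \<forall>y\<in>A. x + y \<in> A) \<and> (\<forall>x\<in>A. \<forall>y\<in>A. x * y \<in> A)"
proof -
  interpret cring "ring_of_type_algebra :: 'a ring" by (rule cring_from_type_algebra)
  show ?thesis
  proof
    assume "subring A (ring_of_type_algebra :: 'a ring)"
    from subringE[OF this] show "1 \<in> A \<and> (\<forall>x\<in>A. - x \<in> A) \<and> (\<forall>x\<in>A. \<forall>y\<in>A. x + y \<in> A) \<and> (\<forall>x\<in>A. \<forall>y\<in>A. x * y \<in> A)"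
      by (auto simp: ring_of_type_simps ring_of_type_a_inv)
  next
    assume "1 \<in> A \<and> (\<forall>x\<in>A. - x \<in> A) \<and> (\<forall>x\<in>A. \<forall>y\<in>A. x + y \<in> A) \<and> (\<forall>x\<in>A. \<forall>y\<in>A. x * y \<in> A)"
    then show "subring A (ring_of_type_algebra :: 'a ring)"
      by (intro subringI) (auto simp: ring_of_type_simps ring_of_type_a_inv)
  qed
qed

definition is_subfield :: "'a::field set \<Rightarrow> bool" where
  "is_subfield A \<longleftrightarrow> 1 \<in> A \<and> (\<forall>x\<in>A. - x \<in> A) \<and> (\<forall>x\<in>A. \<forall>y\<in>A. x + y \<in> A) \<and> (\<forall>x\<in>A. \<forall>y\<in>A. x * y \<in> A)
     \<and> (\<forall>x\<in>A. inverse x \<in> A)"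

lemma subfield_of_type_iff:
  "subfield A (ring_of_type_algebra :: 'a::field ring) \<longleftrightarrow> is_subfield A"
proof -
  interpret R: Ring.field "ring_of_type_algebra :: 'a ring" by (rule field_from_type_algebra)
  show ?thesis
  proof
    assume s: "subfield A (ring_of_type_algebra :: 'a ring)"
    have inv: "inverse x \<in> A" if x: "x \<in> A" for x
    proof (cases "x = 0")
      case False
      have "m_inv ring_of_type_algebra x \<in> A" "x * m_inv ring_of_type_algebra x = 1"
        using R.subfield_m_inv[OF s, of x] x False by (auto simp: ring_of_type_simps)
      thus ?thesis using inverse_unique by metis
    qed (use subfieldE(2)[OF s] subringE(2)[OF subfieldE(1)[OF s]] x in \<open>auto simp: ring_of_type_simps\<close>)
    show "is_subfield A" using inv subfieldE(1)[OF s] unfolding subring_of_type_iff is_subfield_def by blast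
  next
    assume s: "is_subfield A"
    then have "subring A (ring_of_type_algebra :: 'a ring)" unfolding subring_of_type_iff is_subfield_def by blast
    moreover have "m_inv ring_of_type_algebra x \<in> A" if "x \<in> A - {0}" for x :: 'a
    proof -
      have "x * m_inv ring_of_type_algebra x = 1"
        using R.field_Units R.Units_r_inv[of x] that by (auto simp: ring_of_type_simps)
      then have "m_inv ring_of_type_algebra x = inverse x" using inverse_unique by metis
      thus ?thesis using s that by (auto simp: is_subfield_def)
    qed
    ultimately show "subfield A (ring_of_type_algebra :: 'a ring)"
      by (intro R.subfieldI' ) (auto simp: ring_of_type_simps)
  qed
qed

lemma is_subfieldD:
  assumes "is_subfield A"
  shows "0 \<in> A" "1 \<in> A" "x \<in> A \<Longrightarrow> - x \<in> A" "x \<in> A \<Longrightarrow> inverse x \<in> A"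
    "x \<in> A \<Longrightarrow> y \<in> A \<Longrightarrow> x + y \<in> A" "x \<in> A \<Longrightarrow> y \<in> A \<Longrightarrow> x * y \<in> A"
    "x \<in> A \<Longrightarrow> y \<in> A \<Longrightarrow> x - y \<in> A" "x \<in> A \<Longrightarrow> y \<in> A \<Longrightarrow> x / y \<in> A"
    "x \<in> A \<Longrightarrow> x ^ n \<in> A" "of_nat n \<in> A"
    "(\<And>i. i \<in> I \<Longrightarrow> f i \<in> A) \<Longrightarrow> sum f I \<in> A"
proof -
  have *: "1 \<in> A" "\<And>x. x \<in> A \<Longrightarrow> - x \<in> A" "\<And>x. x \<in> A \<Longrightarrow> inverse x \<in> A"
    "\<And>x y. x \<in> A \<Longrightarrow> y \<in> A \<Longrightarrow> x + y \<in> A" "\<And>x y. x \<in> A \<Longrightarrow> y \<in> A \<Longrightarrow> x * y \<in> A"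
    using assms by (auto simp: is_subfield_def)
  show **: "0 \<in> A" using *(4)[OF *(1) *(2)[OF *(1)]] by simp
  show "1 \<in> A" "x \<in> A \<Longrightarrow> - x \<in> A" "x \<in> A \<Longrightarrow> inverse x \<in> A"
    "x \<in> A \<Longrightarrow> y \<in> A \<Longrightarrow> x + y \<in> A" "x \<in> A \<Longrightarrow> y \<in> A \<Longrightarrow> x * y \<in> A" using * by auto
  show "x \<in> A \<Longrightarrow> y \<in> A \<Longrightarrow> x - y \<in> A" using *(4)[OF _ *(2)] by force
  show "x \<in> A \<Longrightarrow> y \<in> A \<Longrightarrow> x / y \<in> A" using *(5)[OF _ *(3)] by (simp add: divide_inverse)
  show "x \<in> A \<Longrightarrow> x ^ n \<in> A" by (induction n) (use * in auto)
  show "of_nat n \<in> A" by (induction n) (use * ** in auto)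
  show "(\<And>i. i \<in> I \<Longrightarrow> f i \<in> A) \<Longrightarrow> sum f I \<in> A"
    by (induction I rule: infinite_finite_induct) (use * ** in auto)
qed

section \<open>The Witt ring\<close>

locale witt_subring = p_adic_norm p v for p :: nat and v :: "'a::field \<Rightarrow> real" +
  fixes res :: "'a \<Rightarrow> 'k::alg_closed_field" and W :: "'a set"
  assumes witt: "is_witt_ring p res W"
    and W_integral: "w \<in> W \<Longrightarrow> N w \<le> 1"
    and res_eq_0_iff: "w \<in> W \<Longrightarrow> res w = 0 \<longleftrightarrow> N w < 1"
begin

lemma W_1: "1 \<in> W" and W_minus: "x \<in> W \<Longrightarrow> - x \<in> W"
  and W_add: "x \<in> W \<Longrightarrow> y \<in> W \<Longrightarrow> x + y \<in> W" and W_mult: "x \<in> W \<Longrightarrow> y \<in> W \<Longrightarrow> x * y \<in> W"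
  using witt unfolding is_witt_ring_def subring_of_type_iff by auto

lemma W_0: "0 \<in> W" using W_add[OF W_1 W_minus[OF W_1]] by simp
lemma W_of_nat: "of_nat n \<in> W" by (induction n) (auto simp: W_0 W_1 W_add)
lemma W_power: "x \<in> W \<Longrightarrow> x ^ n \<in> W" by (induction n) (auto simp: W_1 W_mult)
lemma W_sum: "(\<And>i. i \<in> A \<Longrightarrow> f i \<in> W) \<Longrightarrow> sum f A \<in> W"
  by (induction A rule: infinite_finite_induct) (auto simp: W_0 W_add)
lemma W_prod: "(\<And>i. i \<in> A \<Longrightarrow> f i \<in> W) \<Longrightarrow> prod f A \<in> W"
  by (induction A rule: infinite_finite_induct) (auto simp: W_1 W_mult)

lemma res_add: "x \<in> W \<Longrightarrow> y \<in> W \<Longrightarrow> res (x + y) = res x + res y"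
  and res_mult: "x \<in> W \<Longrightarrow> y \<in> W \<Longrightarrow> res (x * y) = res x * res y"
  using witt unfolding is_witt_ring_def
  by (auto simp: ring_hom_def ring_of_type_simps subring_of_type_simps)

lemma res_surj: "\<exists>w\<in>W. res w = c"
proof -
  have "c \<in> res ` W" using witt unfolding is_witt_ring_def by auto
  thus ?thesis by auto
qed

lemma res_0: "res 0 = 0" by (simp add: res_eq_0_iff[OF W_0])

lemma W_p_multiple: "w \<in> W \<Longrightarrow> N w < 1 \<Longrightarrow> \<exists>u\<in>W. w = of_nat p * u"
proof -
  assume w: "w \<in> W" "N w < 1"
  then have "w \<in> {x \<in> W. res x = 0}" by (simp add: res_eq_0_iff)
  also have "\<dots> = (\<lambda>w. of_nat p * w) ` W" using witt unfolding is_witt_ring_def by auto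
  finally show ?thesis by auto
qed

lemma W_complete:
  assumes "\<And>n. x n \<in> W" "\<And>n. x (Suc n) - x n \<in> (\<lambda>w. of_nat p ^ n * w) ` W"
  shows "\<exists>!y. y \<in> W \<and> (\<forall>n. y - x n \<in> (\<lambda>w. of_nat p ^ n * w) ` W)"
  using witt assms unfolding is_witt_ring_def by blast

text \<open>Divide by \<open>p\<close> as long as the residue class vanishes; each division multiplies the norm by \<open>p\<close>, and the norm
  stays at most \<open>1\<close>.\<close>
lemma W_decomp:
  assumes w: "w \<in> W" "w \<noteq> 0"
  shows "\<exists>n u. u \<in> W \<and> N u = 1 \<and> w = of_nat p ^ n * u"
proof -
  define D where "D n \<longleftrightarrow> w \<in> (\<lambda>w. of_nat p ^ n * w) ` W" for n
  have "\<exists>n. \<not> D n"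
  proof (rule ccontr)
    assume "\<nexists>n. \<not> D n"
    then have D: "D n" for n by auto
    have "\<exists>!y. y \<in> W \<and> (\<forall>n. y - 0 \<in> (\<lambda>w. of_nat p ^ n * w) ` W)"
      by (rule W_complete[of "\<lambda>_. 0"]) (auto simp: W_0 intro: image_eqI[of _ _ 0])
    moreover have "w \<in> W \<and> (\<forall>n. w - 0 \<in> (\<lambda>w. of_nat p ^ n * w) ` W)" using D w by (auto simp: D_def)
    moreover have "0 \<in> W \<and> (\<forall>n. 0 - 0 \<in> (\<lambda>w. of_nat p ^ n * w) ` W)"
      by (auto simp: W_0 intro: image_eqI[of _ _ 0])
    ultimately show False using w by blast
  qed
  moreover have "D 0" using w by (auto simp: D_def)
  ultimately obtain n where n: "D n" "\<not> D (Suc n)" by (metis not0_implies_Suc old.nat.exhaust nat_induct)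
  then obtain u where u: "u \<in> W" "w = of_nat p ^ n * u" by (auto simp: D_def)
  have "\<not> N u < 1"
  proof
    assume "N u < 1"
    then obtain z where "z \<in> W" "u = of_nat p * z" using W_p_multiple u by blast
    then have "D (Suc n)" using u by (auto simp: D_def mult_ac intro!: image_eqI[of _ _ z])
    thus False using n by simp
  qed
  thus ?thesis using u W_integral[OF u(1)] by force
qed

lemma W_v: assumes "w \<in> W" "w \<noteq> 0" shows "\<exists>n::nat. v w = n"
proof -
  obtain n u where u: "u \<in> W" "N u = 1" "w = of_nat p ^ n * u" using W_decomp assms by blast
  have "v u = 0" using u(2) p_gt_1 by (auto simp: pabs_def powr_eq_one_iff split: if_splits)
  moreover have "u \<noteq> 0" using u(2) by auto
  ultimately show ?thesis using u(3) p_nonzero by (auto simp: v_mult v_p_power)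
qed

definition Q :: "'a set" where "Q = {w / of_nat p ^ k | w k. w \<in> W}"

lemma Q_I: "w \<in> W \<Longrightarrow> w \<in> Q"
  unfolding Q_def by (intro CollectI exI[of _ w] exI[of _ 0]) auto

lemma Q_add: assumes "x \<in> Q" "y \<in> Q" shows "x + y \<in> Q"
proof -
  obtain a k b l where *: "x = a / of_nat p ^ k" "y = b / of_nat p ^ l" "a \<in> W" "b \<in> W"
    using assms by (auto simp: Q_def)
  have "x + y = (a * of_nat p ^ l + b * of_nat p ^ k) / of_nat p ^ (k + l)"
    using p_nonzero by (simp add: * field_simps power_add)
  moreover have "a * of_nat p ^ l + b * of_nat p ^ k \<in> W" by (intro W_add W_mult W_power W_of_nat *)
  ultimately show ?thesis unfolding Q_def by blast
qed

lemma Q_minus: assumes "x \<in> Q" shows "- x \<in> Q"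
proof -
  obtain a k where *: "x = a / of_nat p ^ k" "a \<in> W" using assms by (auto simp: Q_def)
  then have "- x = (- a) / of_nat p ^ k" by simp
  thus ?thesis unfolding Q_def using W_minus[OF *(2)] by blast
qed

lemma Q_diff: "x \<in> Q \<Longrightarrow> y \<in> Q \<Longrightarrow> x - y \<in> Q"
  using Q_add[OF _ Q_minus] by force

lemma Q_mult: assumes "x \<in> Q" "y \<in> Q" shows "x * y \<in> Q"
proof -
  obtain a k b l where *: "x = a / of_nat p ^ k" "y = b / of_nat p ^ l" "a \<in> W" "b \<in> W"
    using assms by (auto simp: Q_def)
  have "x * y = (a * b) / of_nat p ^ (k + l)" by (simp add: * power_add)
  thus ?thesis unfolding Q_def using W_mult *(3,4) by blast
qed

lemma Q_sum: "(\<And>i. i \<in> A \<Longrightarrow> f i \<in> Q) \<Longrightarrow> sum f A \<in> Q"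
  by (induction A rule: infinite_finite_induct) (auto simp: Q_add Q_I W_0)

lemma Q_p_inverse: "inverse (of_nat p) \<in> Q"
  unfolding Q_def by (rule CollectI, rule exI[of _ 1], rule exI[of _ 1]) (simp add: W_1 divide_inverse)

lemma Q_p_powi: "of_nat p powi n \<in> Q"
proof (cases "n \<ge> 0")
  case True thus ?thesis by (simp add: power_int_def Q_I W_power W_of_nat)
next
  case False
  have "inverse (of_nat p) ^ k \<in> Q" for k by (induction k) (auto simp: Q_mult Q_p_inverse Q_I W_1)
  thus ?thesis using False by (simp add: power_int_def power_inverse)
qed

lemma Q_multiple:
  assumes x: "x \<in> Q" "N x \<le> 1 / real p ^ m" shows "\<exists>w\<in>W. x = of_nat p ^ m * w"
proof (cases "x = 0")
  case False
  obtain a k where a: "a \<in> W" "x = a / of_nat p ^ k" using x by (auto simp: Q_def)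
  with False obtain n u where u: "u \<in> W" "N u = 1" "a = of_nat p ^ n * u" using W_decomp by force
  have "N x = (1/p) ^ n / (1/p) ^ k" using u a by (simp add: N_divide N_mult N_power N_p)
  then have "(1/p) ^ n / (1/p) ^ k \<le> 1 / real p ^ m" using x by simp
  then have "real p ^ (m + k) \<le> real p ^ n" using p_gt_1 by (simp add: field_simps power_add)
  then have "m + k \<le> n" using p_gt_1 by simp
  then obtain d where "n = m + k + d" using le_Suc_ex by blast
  then have "x = of_nat p ^ m * (of_nat p ^ d * u)"
    using a(2) u(3) p_nonzero by (simp add: field_simps power_add)
  thus ?thesis using u W_mult W_power W_of_nat by blast
qed (auto intro!: bexI[of _ 0] W_0)

end

text \<open>A subset of \<open>'a\<close> is complete if every series whose terms tend to zero converges in it.\<close>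
context p_adic_norm begin
definition complete_set :: "'a set \<Rightarrow> bool" where
  "complete_set A \<longleftrightarrow> (\<forall>f::nat \<Rightarrow> 'a. (\<forall>n. f n \<in> A) \<longrightarrow> (\<lambda>n. N (f n)) \<longlonglongrightarrow> 0 \<longrightarrow>
     (\<exists>s\<in>A. (\<lambda>n. N (sum f {..<n} - s)) \<longlonglongrightarrow> 0))"

lemma inverse_p_power_tendsto: "(\<lambda>k. C / real p ^ k) \<longlonglongrightarrow> 0"
  using p_gt_1 by (intro LIMSEQ_divide_realpow_zero) simp

lemma small_p_power: assumes "e > 0" shows "\<exists>k. C / real p ^ k < e"
proof -
  have "\<forall>\<^sub>F k in sequentially. C / real p ^ k < e"
    using inverse_p_power_tendsto[of C] assms by (intro order_tendstoD(2))
  thus ?thesis by (auto simp: eventually_sequentially)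
qed
end

context witt_subring begin

text \<open>Up to a power of \<open>p\<close> the terms of a series that tend to \<open>0\<close> lie in \<open>W\<close>, which is \<open>p\<close>-adically complete.\<close>
lemma Q_complete: "complete_set Q"
  unfolding complete_set_def
proof (intro allI impI)
  fix f :: "nat \<Rightarrow> 'a" assume fQ: "\<forall>n. f n \<in> Q" and f0: "(\<lambda>n. N (f n)) \<longlonglongrightarrow> 0"
  have "\<exists>m. \<forall>n\<ge>m. N (f n) \<le> 1 / real p ^ k" for k
  proof -
    have "\<forall>\<^sub>F n in sequentially. N (f n) < 1 / real p ^ k"
      using p_gt_1 by (intro order_tendstoD(2)[OF f0]) simp
    thus ?thesis by (auto simp: eventually_sequentially intro: less_imp_le)
  qed
  then obtain M' where M': "\<And>k n. n \<ge> M' k \<Longrightarrow> N (f n) \<le> 1 / real p ^ k" by metis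
  define M where "M k = Max (M' ` {..k})" for k
  have M'M: "M' k \<le> M k" for k by (auto simp: M_def intro: Max_ge)
  have M: "N (f n) \<le> 1 / real p ^ k" if "n \<ge> M k" for k n using M'[of k n] M'M[of k] that by simp
  have mono: "M k \<le> M (Suc k)" for k by (auto simp: M_def intro!: Max_mono)
  have mono': "M 0 \<le> M k" for k by (induction k) (use mono le_trans in blast)+
  define S where "S n = sum f {..<n}" for n
  have S_diff: "S n - S m = sum f {m..<n}" if "m \<le> n" for m n
    using sum_diff_nat_ivl[of 0 m n f] that by (simp add: S_def atLeast0LessThan)
  have SN: "N (S n - S (M k)) \<le> 1 / real p ^ k" if "M k \<le> n" for n k
    unfolding S_diff[OF that] by (rule N_sum_le) (use M in auto)
  have SQ: "S n - S m \<in> Q" for m n unfolding S_def by (intro Q_diff Q_sum) (use fQ in auto)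
  define y where "y k = S (M k) - S (M 0)" for k
  have "y k \<in> W" for k
    using Q_multiple[OF SQ, of "M k" "M 0" 0] SN[OF mono'[of k]] by (auto simp: y_def)
  moreover have "y (Suc k) - y k \<in> (\<lambda>w. of_nat p ^ k * w) ` W" for k
    using Q_multiple[OF SQ SN[OF mono]] by (auto simp: y_def)
  ultimately obtain z where z: "z \<in> W" "\<And>n. z - y n \<in> (\<lambda>w. of_nat p ^ n * w) ` W"
    using W_complete[of y] by blast
  have zN: "N (z - y n) \<le> 1 / real p ^ n" for n
    using z(2)[of n] W_integral p_gt_1 by (auto simp: N_mult N_power N_p power_divide divide_right_mono)
  define s where "s = z + S (M 0)"
  have "s \<in> Q" unfolding s_def S_def by (intro Q_add[OF Q_I[OF z(1)] Q_sum]) (use fQ in auto)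
  moreover have "(\<lambda>n. N (S n - s)) \<longlonglongrightarrow> 0"
  proof (rule LIMSEQ_I)
    fix r :: real assume "0 < r"
    then obtain k where k: "1 / real p ^ k < r" using small_p_power by blast
    have "N (S n - s) < r" if n: "n \<ge> M k" for n
    proof -
      have "S n - s = (S n - S (M k)) - (z - y k)" by (simp add: s_def y_def)
      then have "N (S n - s) \<le> 1 / real p ^ k" using SN[OF n] zN[of k] N_diff_le by metis
      thus ?thesis using k by simp
    qed
    thus "\<exists>no. \<forall>n\<ge>no. norm (N (S n - s) - 0) < r" by auto
  qed
  ultimately show "\<exists>s\<in>Q. (\<lambda>n. N (sum f {..<n} - s)) \<longlonglongrightarrow> 0" unfolding S_def by blast
qed

lemma poly_in_W: "(\<And>i. coeff f i \<in> W) \<Longrightarrow> w \<in> W \<Longrightarrow> poly f w \<in> W"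
  by (simp add: poly_altdef W_sum W_mult W_power)

lemma res_poly:
  assumes "\<And>i. coeff f i \<in> W" "w \<in> W"
  shows "res (poly f w) = poly (map_poly res f) (res w)"
  using assms(1)
proof (induction f)
  case (pCons a f)
  have f: "coeff f i \<in> W" for i using pCons.prems[of "Suc i"] by simp
  have a: "a \<in> W" using pCons.prems[of 0] by simp
  show ?case using pCons.hyps pCons.IH[OF f] a
    by (cases "a = 0 \<and> f = 0")
       (auto simp: map_poly_pCons res_0 res_add res_mult W_mult poly_in_W[OF f] assms(2) res_eq_0_iff)
qed (simp add: res_0)

lemma synthetic_div_in_W:
  assumes "\<And>i. coeff f i \<in> W" "w \<in> W"
  shows "coeff (synthetic_div f w) i \<in> W"
  using assms(1)
proof (induction f arbitrary: i)
  case (pCons a f)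
  have f: "coeff f i \<in> W" for i using pCons.prems[of "Suc i"] by simp
  show ?case using pCons.IH[OF f] poly_in_W[OF f assms(2)] by (cases i) auto
qed (simp add: W_0)

text \<open>The residue field of \<open>W\<close> is algebraically closed, so an integral element whose residue class
  is not hit by \<open>W\<close> has transcendental residue class.\<close>
lemma poly_unit_value:
  assumes x: "\<And>w. w \<in> W \<Longrightarrow> N (x - w) = 1"
    and f: "\<And>i. coeff f i \<in> W" "\<exists>i. res (coeff f i) \<noteq> 0"
  shows "N (poly f x) = 1"
  using f
proof (induction "degree f" arbitrary: f rule: less_induct)
  case less
  note f = less.prems
  have xN: "N x = 1" using x[OF W_0] by simp
  define F where "F = map_poly res f"
  have F: "coeff F i = res (coeff f i)" for i by (simp add: F_def coeff_map_poly res_0)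
  have "F \<noteq> 0" using f(2) F by (metis coeff_0)
  show ?case
  proof (cases "degree F = 0")
    case True
    have r0: "res (coeff f i) = 0" if "i > 0" for i using F[of i] coeff_eq_0[of F i] that True by simp
    then have "res (coeff f 0) \<noteq> 0" using f(2) by (metis neq0_conv)
    then have a: "N (coeff f 0) = 1"
      using W_integral[OF f(1)[of 0]] res_eq_0_iff[OF f(1)[of 0]] by simp
    have "poly f x = (\<Sum>i\<le>degree f. coeff f i * x ^ i)" by (simp add: poly_altdef)
    also have "\<dots> = coeff f 0 + (\<Sum>i\<in>{..degree f} - {0}. coeff f i * x ^ i)"
      by (subst sum.remove[of _ 0]) auto
    also have "N \<dots> = N (coeff f 0)"
    proof (rule N_add_eq)
      have "N (\<Sum>i\<in>{..degree f} - {0}. coeff f i * x ^ i) < 1"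
        using r0 res_eq_0_iff[OF f(1)] by (intro N_sum_less) (auto simp: N_mult N_power xN)
      thus "N (\<Sum>i\<in>{..degree f} - {0}. coeff f i * x ^ i) < N (coeff f 0)" using a by simp
    qed
    finally show ?thesis using a by simp
  next
    case False
    then obtain c where c: "poly F c = 0" using alg_closed_imp_poly_has_root[of F] by auto
    obtain w where w: "w \<in> W" "res w = c" using res_surj by blast
    define q where "q = synthetic_div f w"
    have fq: "f = [:-w, 1:] * q + [:poly f w:]"
      unfolding q_def by (rule synthetic_div_correct'[symmetric])
    have degF: "degree F \<le> degree f" by (rule degree_le) (auto simp: F res_0 coeff_eq_0)
    then have "degree q < degree f" using False by (simp add: q_def degree_synthetic_div)
    moreover have qW: "coeff q i \<in> W" for i unfolding q_def by (rule synthetic_div_in_W[OF f(1) w(1)])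
    moreover have "\<exists>i. res (coeff q i) \<noteq> 0"
    proof (rule ccontr)
      assume "\<nexists>i. res (coeff q i) \<noteq> 0"
      then have q0: "res (coeff q i) = 0" for i by auto
      have "coeff F i = 0" if "i > 0" for i
      proof -
        obtain j where j: "i = Suc j" using gr0_implies_Suc[OF \<open>i > 0\<close>] by blast
        have eq: "coeff f i = coeff q j + (- w) * coeff q i" by (subst fq) (simp add: j)
        have "res (coeff f i) = res (coeff q j) + res (- w) * res (coeff q i)"
          by (simp only: eq res_add[OF qW W_mult[OF W_minus[OF w(1)] qW]] res_mult[OF W_minus[OF w(1)] qW])
        thus ?thesis using q0 F by simp
      qed
      then have "degree F = 0" using leading_coeff_0_iff[of F] \<open>F \<noteq> 0\<close> by (metis neq0_conv)
      thus False using False by simp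
    qed
    ultimately have "N (poly q x) = 1" using less.hyps by blast
    then have "N ((x - w) * poly q x) = 1" using x[OF w(1)] by (simp add: N_mult)
    moreover have "N (poly f w) < 1"
      using res_poly[OF f(1) w(1)] c w res_eq_0_iff[OF poly_in_W[OF f(1) w(1)]] by (simp add: F_def)
    moreover have "poly f x = (x - w) * poly q x + poly f w"
      by (subst fq) (simp add: algebra_simps)
    ultimately show ?thesis using N_add_eq by simp
  qed
qed

lemma fractions_is_subfield: "is_subfield (fractions W)"
  unfolding is_subfield_def
proof (intro conjI ballI)
  show "1 \<in> fractions W" unfolding fractions_def using W_1 by (intro CollectI exI[of _ 1]) auto
  fix x assume "x \<in> fractions W"
  then obtain a b where x: "x = a / b" "a \<in> W" "b \<in> W" "b \<noteq> 0" by (auto simp: fractions_def)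
  show "- x \<in> fractions W" unfolding fractions_def
    using x W_minus by (intro CollectI exI[of _ "-a"] exI[of _ b]) auto
  show "inverse x \<in> fractions W"
  proof (cases "a = 0")
    case True thus ?thesis unfolding fractions_def x using W_0 W_1 by (intro CollectI exI[of _ 0] exI[of _ 1]) auto
  next
    case False thus ?thesis unfolding fractions_def using x by (intro CollectI exI[of _ b] exI[of _ a]) auto
  qed
  fix y assume "y \<in> fractions W"
  then obtain c d where y: "y = c / d" "c \<in> W" "d \<in> W" "d \<noteq> 0" by (auto simp: fractions_def)
  show "x + y \<in> fractions W" unfolding fractions_def
    using x y by (intro CollectI exI[of _ "a * d + c * b"] exI[of _ "b * d"]) (auto simp: W_add W_mult add_frac_eq)
  show "x * y \<in> fractions W" unfolding fractions_def
    using x y by (intro CollectI exI[of _ "a * c"] exI[of _ "b * d"]) (auto simp: W_mult)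
qed

end

section \<open>Finite extensions of the Witt ring\<close>

lemma (in p_adic_norm) complete_setD:
  "complete_set A \<Longrightarrow> (\<And>n. f n \<in> A) \<Longrightarrow> (\<lambda>n. N (f n)) \<longlonglongrightarrow> 0 \<Longrightarrow>
    \<exists>s\<in>A. (\<lambda>n. N (sum f {..<n} - s)) \<longlonglongrightarrow> 0"
  unfolding complete_set_def by blast

locale witt_extension = witt_subring p v res W
  for p :: nat and v :: "'a::field \<Rightarrow> real" and res :: "'a \<Rightarrow> 'k::alg_closed_field" and W +
  fixes L :: "'a set"
  assumes L_subfield: "is_subfield L" and W_subset: "W \<subseteq> L"
    and finite_dim: "ring.finite_dimension ring_of_type_algebra (fractions W) L"
begin

lemmas L_closed = is_subfieldD[OF L_subfield]

lemma Q_subset: "Q \<subseteq> L"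
  using W_subset L_closed(8,9,10) by (auto simp: Q_def)

lemma p_powi_in_L: "of_nat p powi n \<in> L"
  using Q_p_powi Q_subset by blast

text \<open>The elements of any sequence with more members than the dimension of \<open>L\<close> are linearly dependent.\<close>
lemma fractions_relation:
  "\<exists>d. \<forall>x::nat \<Rightarrow> 'a. (\<forall>i. x i \<in> L) \<longrightarrow>
     (\<exists>a. (\<forall>i. a i \<in> fractions W) \<and> (\<exists>i\<le>d. a i \<noteq> 0) \<and> (\<Sum>i\<le>d. a i * x i) = 0)"
proof -
  interpret R: Ring.field "ring_of_type_algebra :: 'a ring" by (rule field_from_type_algebra)
  have F: "subfield (fractions W) (ring_of_type_algebra :: 'a ring)"
    using fractions_is_subfield subfield_of_type_iff by blast
  obtain d where d: "R.dimension d (fractions W) L" using finite_dim by (elim R.finite_dimensionE')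
  have comb: "R.combine Ks Us = (\<Sum>i<length Us. (if i < length Ks then Ks ! i else 0) * Us ! i)" for Ks Us
  proof (induction Ks Us rule: R.combine.induct)
    case (1 k Ks u Us)
    show ?case using 1 by (simp add: ring_of_type_simps sum.lessThan_Suc_shift del: sum.lessThan_Suc cong: if_cong)
  qed (auto simp: ring_of_type_simps)
  show ?thesis
  proof (intro exI[of _ d] allI impI)
    fix x :: "nat \<Rightarrow> 'a" assume x: "\<forall>i. x i \<in> L"
    define Us where "Us = map x [0..<Suc d]"
    have Us: "length Us = Suc d" "set Us \<subseteq> L" "\<And>i. i < Suc d \<Longrightarrow> Us ! i = x i"
      using x by (auto simp: Us_def simp del: upt_Suc)
    have "\<not> R.independent (fractions W) Us"
      using R.independent_length_le_dimension[OF F d _ Us(2)] Us(1) by auto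
    then obtain Ks where Ks: "set Ks \<subseteq> fractions W" "R.combine Ks Us = 0"
        "\<not> set (take (length Us) Ks) \<subseteq> {0}"
      using R.trivial_combine_imp_independent[OF F, of Us] by (auto simp: ring_of_type_simps)
    define a where "a i = (if i < length Ks then Ks ! i else 0)" for i
    have "a i \<in> fractions W" for i
      using Ks(1) is_subfieldD(1)[OF fractions_is_subfield] by (auto simp: a_def)
    moreover have "\<exists>i\<le>d. a i \<noteq> 0"
    proof -
      obtain k where "k \<in> set (take (length Us) Ks)" "k \<noteq> 0" using Ks(3) by blast
      then obtain i where "i < length Ks" "i < Suc d" "Ks ! i \<noteq> 0"
        unfolding in_set_conv_nth using Us(1) by auto
      thus ?thesis by (intro exI[of _ i]) (auto simp: a_def)
    qed
    moreover have "(\<Sum>i\<le>d. a i * x i) = 0"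
    proof -
      have "(\<Sum>i\<le>d. a i * x i) = (\<Sum>i<Suc d. a i * Us ! i)"
        unfolding lessThan_Suc_atMost by (intro sum.cong) (auto simp: Us(3))
      also have "\<dots> = R.combine Ks Us" unfolding comb Us(1) a_def by simp
      finally show ?thesis using Ks(2) by simp
    qed
    ultimately show "\<exists>a. (\<forall>i. a i \<in> fractions W) \<and> (\<exists>i\<le>d. a i \<noteq> 0) \<and> (\<Sum>i\<le>d. a i * x i) = 0"
      by blast
  qed
qed

text \<open>Clear denominators in a linear relation and divide by the largest common power of \<open>p\<close>, so that one of the
  coefficients becomes a unit.\<close>
lemma W_relation:
  "\<exists>d. \<forall>x::nat \<Rightarrow> 'a. (\<forall>i. x i \<in> L) \<longrightarrow>
     (\<exists>a. (\<forall>i. a i \<in> W) \<and> (\<exists>i\<le>d. a i \<noteq> 0) \<and> (\<Sum>i\<le>d. a i * x i) = 0)"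
proof -
  obtain d where d: "\<And>x::nat \<Rightarrow> 'a. (\<forall>i. x i \<in> L) \<Longrightarrow>
     (\<exists>a. (\<forall>i. a i \<in> fractions W) \<and> (\<exists>i\<le>d. a i \<noteq> 0) \<and> (\<Sum>i\<le>d. a i * x i) = 0)"
    using fractions_relation by metis
  show ?thesis
  proof (intro exI[of _ d] allI impI)
    fix x :: "nat \<Rightarrow> 'a" assume "\<forall>i. x i \<in> L"
    from d[OF this] obtain a where a: "\<And>i. a i \<in> fractions W" "\<exists>i\<le>d. a i \<noteq> 0" "(\<Sum>i\<le>d. a i * x i) = 0"
      by blast
    have "\<forall>i. \<exists>c b. a i = c / b \<and> c \<in> W \<and> b \<in> W \<and> b \<noteq> 0" using a(1) by (auto simp: fractions_def)
    then obtain c b where cb: "\<And>i. a i = c i / b i" "\<And>i. c i \<in> W" "\<And>i. b i \<in> W" "\<And>i. b i \<noteq> 0"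
      by metis
    define B where "B = (\<Prod>i\<le>d. b i)"
    have B: "B \<noteq> 0" by (simp add: B_def cb)
    define a' where "a' i = (if i \<le> d then a i * B else 0)" for i
    have "a' i \<in> W" for i
    proof (cases "i \<le> d")
      case True
      then have "a' i = c i * (\<Prod>j\<in>{..d} - {i}. b j)"
        unfolding a'_def B_def using cb(4)[of i] by (subst prod.remove[of _ i]) (auto simp: cb(1))
      thus ?thesis by (auto intro!: W_mult W_prod cb)
    qed (simp add: a'_def W_0)
    moreover have "\<exists>i\<le>d. a' i \<noteq> 0" using a(2) B by (auto simp: a'_def)
    moreover have "(\<Sum>i\<le>d. a' i * x i) = B * (\<Sum>i\<le>d. a i * x i)"
      by (simp add: a'_def sum_distrib_left mult_ac)
    ultimately show "\<exists>a. (\<forall>i. a i \<in> W) \<and> (\<exists>i\<le>d. a i \<noteq> 0) \<and> (\<Sum>i\<le>d. a i * x i) = 0"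
      using a(3) by (intro exI[of _ a']) simp
  qed
qed

text \<open>Elements of \<open>L\<close> whose valuations are distinct modulo \<open>\<int>\<close> are linearly independent over \<open>W\<close>,
  because \<open>v\<close> is integral on \<open>W\<close>; this bounds the ramification index.\<close>
lemma finite_frac_values: "finite ((\<lambda>x. frac (v x)) ` (L - {0}))"
proof (rule ccontr)
  assume inf: "infinite ((\<lambda>x. frac (v x)) ` (L - {0}))"
  obtain d where d: "\<And>x::nat \<Rightarrow> 'a. (\<forall>i. x i \<in> L) \<Longrightarrow>
     (\<exists>a. (\<forall>i. a i \<in> W) \<and> (\<exists>i\<le>d. a i \<noteq> 0) \<and> (\<Sum>i\<le>d. a i * x i) = 0)"
    using W_relation by metis
  obtain s :: "nat \<Rightarrow> real" where s: "inj s" "range s \<subseteq> (\<lambda>x. frac (v x)) ` (L - {0})"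
    using infinite_countable_subset[OF inf] by blast
  have "\<forall>i. \<exists>x. x \<in> L - {0} \<and> frac (v x) = s i"
  proof
    fix i
    have "s i \<in> (\<lambda>x. frac (v x)) ` (L - {0})" using s(2) rangeI by (rule subsetD)
    thus "\<exists>x. x \<in> L - {0} \<and> frac (v x) = s i" by (elim imageE) auto
  qed
  then obtain x where x: "\<And>i. x i \<in> L - {0}" "\<And>i. frac (v (x i)) = s i" by metis
  obtain a where a: "\<And>i. a i \<in> W" "\<exists>i\<le>d. a i \<noteq> 0" "(\<Sum>i\<le>d. a i * x i) = 0"
    using d[of x] x(1) by blast
  obtain i0 where i0: "i0 \<le> d" "a i0 \<noteq> 0" using a(2) by blast
  have fr: "frac (v (a i * x i)) = s i" if ai: "a i \<noteq> 0" for i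
  proof -
    obtain n :: nat where "v (a i) = n" using W_v[OF a(1) ai] by blast
    then have "v (a i * x i) = v (x i) + of_int (int n)" using v_mult[OF ai, of "x i"] x(1)[of i] by simp
    thus ?thesis using x(2)[of i] by (simp add: frac_def)
  qed
  have "(\<Sum>i\<le>d. a i * x i) \<noteq> 0"
  proof (rule N_sum_distinct_nonzero)
    show "a i0 * x i0 \<noteq> 0" using i0 x(1)[of i0] by simp
    fix i j assume "i \<noteq> j" and nz: "a i * x i \<noteq> 0"
    show "N (a i * x i) \<noteq> N (a j * x j)"
    proof
      assume eq: "N (a i * x i) = N (a j * x j)"
      then have nz': "a j * x j \<noteq> 0" using nz by (metis N_eq_0)
      have "v (a i * x i) = v (a j * x j)"
        using N_le_N_iff[OF nz nz'] N_le_N_iff[OF nz' nz] eq by simp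
      then have "s i = s j" using fr[of i] fr[of j] nz nz' by simp
      thus False using s(1) \<open>i \<noteq> j\<close> by (auto dest: injD)
    qed
  qed (use i0 in auto)
  thus False using a(3) by simp
qed

lemma v_p_powi: "v (of_nat p powi n) = of_int n"
  by (cases "n \<ge> 0") (simp_all add: power_int_def v_p_power v_power v_inverse p_nonzero v_p)

lemma frac_representatives:
  "\<exists>G. finite G \<and> G \<subseteq> L - {0} \<and> (\<forall>g\<in>G. 0 \<le> v g \<and> v g < 1) \<and>
     (\<forall>x\<in>L - {0}. \<exists>g\<in>G. v g = frac (v x))"
proof -
  define S where "S = (\<lambda>x. frac (v x)) ` (L - {0})"
  have "\<forall>s\<in>S. \<exists>g. g \<in> L - {0} \<and> v g = s"
  proof
    fix s assume "s \<in> S"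
    then obtain x where x: "x \<in> L" "x \<noteq> 0" "s = frac (v x)" by (auto simp: S_def)
    define g where "g = x * (of_nat p powi (- \<lfloor>v x\<rfloor>))"
    have "v g = v x - \<lfloor>v x\<rfloor>" unfolding g_def
      using v_mult[OF x(2), of "of_nat p powi (- \<lfloor>v x\<rfloor>)"] p_nonzero by (simp add: v_p_powi del: power_int_minus)
    moreover have "g \<in> L - {0}" unfolding g_def using x p_powi_in_L L_closed(6) p_nonzero by auto
    ultimately show "\<exists>g. g \<in> L - {0} \<and> v g = s" using x by (auto simp: frac_def)
  qed
  then obtain h where h: "\<And>s. s \<in> S \<Longrightarrow> h s \<in> L - {0} \<and> v (h s) = s" by metis
  have "finite (h ` S)" using finite_frac_values by (simp add: S_def)
  moreover have "h ` S \<subseteq> L - {0}" by (rule image_subsetI) (rule conjunct1[OF h])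
  moreover have "\<forall>g\<in>h ` S. 0 \<le> v g \<and> v g < 1"
  proof
    fix g assume "g \<in> h ` S"
    then obtain s where s: "s \<in> S" "g = h s" by (elim imageE)
    then have "v g = s" using h by simp
    moreover have "0 \<le> s \<and> s < 1" using s(1) unfolding S_def by (elim imageE) (simp add: frac_lt_1)
    ultimately show "0 \<le> v g \<and> v g < 1" by simp
  qed
  moreover have "\<forall>x\<in>L - {0}. \<exists>g\<in>h ` S. v g = frac (v x)"
  proof
    fix x assume "x \<in> L - {0}"
    then have S: "frac (v x) \<in> S" unfolding S_def by (rule imageI)
    show "\<exists>g\<in>h ` S. v g = frac (v x)" using h[OF S] imageI[OF S, of h] by (intro bexI[of _ "h (frac (v x))"]) simp_all
  qed
  ultimately show ?thesis by blast
qed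

text \<open>One element of \<open>L\<close> for each class of valuations modulo \<open>\<int>\<close>, in the fundamental domain \<open>[0, 1)\<close>.\<close>
definition G :: "'a set" where
  "G = (SOME G. finite G \<and> G \<subseteq> L - {0} \<and> (\<forall>g\<in>G. 0 \<le> v g \<and> v g < 1) \<and>
     (\<forall>x\<in>L - {0}. \<exists>g\<in>G. v g = frac (v x)))"

lemma G: "finite G" "G \<subseteq> L - {0}" "g \<in> G \<Longrightarrow> 0 \<le> v g \<and> v g < 1"
  "x \<in> L \<Longrightarrow> x \<noteq> 0 \<Longrightarrow> \<exists>g\<in>G. v g = frac (v x)"
  using someI_ex[OF frac_representatives, folded G_def] by auto

lemma G_integral: "g \<in> G \<Longrightarrow> g \<in> L \<and> g \<noteq> 0 \<and> N g \<le> 1"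
  using G(2) G(3)[of g] by (auto simp: N_le_1_iff)

lemma uniformizer: "\<exists>w\<in>L. w \<noteq> 0 \<and> N w < 1 \<and> (\<forall>x\<in>L. N x < 1 \<longrightarrow> N x \<le> N w)"
proof -
  define P where "P = insert (of_nat p) {g\<in>G. v g > 0}"
  have fin: "finite P" and ne: "P \<noteq> {}" using G(1) by (auto simp: P_def)
  obtain w where w: "w \<in> P" "v w = Min (v ` P)" using Min_in[of "v ` P"] fin ne by fastforce
  have wP: "v w \<le> v g" if "g \<in> P" for g using w(2) fin that by simp
  have w': "w \<in> L" "w \<noteq> 0" "v w > 0"
    using w(1) G(2) L_closed(10) p_nonzero v_p by (auto simp: P_def)
  moreover have "N x \<le> N w" if x: "x \<in> L" "N x < 1" for x
  proof (cases "x = 0")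
    case False
    then have vx: "v x > 0" using x(2) by (simp add: N_less_1_iff)
    have "v w \<le> v x"
    proof (cases "v x < 1")
      case True
      then have "frac (v x) = v x" using vx by (intro frac_eq[THEN iffD2]) auto
      then obtain g where "g \<in> G" "v g = v x" using G(4)[OF x(1) False] by auto
      thus ?thesis using wP[of g] vx by (simp add: P_def)
    next
      case False thus ?thesis using wP[of "of_nat p"] by (simp add: P_def v_p)
    qed
    thus ?thesis using N_le_N_iff[OF False w'(2)] by simp
  qed simp
  ultimately show ?thesis by (auto simp: N_less_1_iff)
qed

text \<open>If no element of \<open>W\<close> were congruent to \<open>x\<close>, then a polynomial over \<open>W\<close> with a unit coefficient would take a
  value of norm \<open>1\<close> at \<open>x\<close>. The linear dependence of the powers of \<open>x\<close> contradicts this: \<open>L\<close> is totally ramified.\<close>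
lemma residue_representative:
  assumes x: "x \<in> L" "N x = 1"
  shows "\<exists>w\<in>W. N (x - w) < 1"
proof (rule ccontr)
  assume contr: "\<not> (\<exists>w\<in>W. N (x - w) < 1)"
  have x1: "N (x - w) = 1" if "w \<in> W" for w
    using contr that N_diff_le[of x 1 w] x(2) W_integral[OF that] by (auto simp: not_less intro: antisym)
  obtain d where d: "\<And>x::nat \<Rightarrow> 'a. (\<forall>i. x i \<in> L) \<Longrightarrow>
     (\<exists>a. (\<forall>i. a i \<in> W) \<and> (\<exists>i\<le>d. a i \<noteq> 0) \<and> (\<Sum>i\<le>d. a i * x i) = 0)"
    using W_relation by metis
  obtain a where a: "\<And>i. a i \<in> W" "\<exists>i\<le>d. a i \<noteq> 0" "(\<Sum>i\<le>d. a i * x ^ i) = 0"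
    using d[of "\<lambda>i. x ^ i"] L_closed(9)[OF x(1)] by blast
  define A where "A = {i. i \<le> d \<and> a i \<noteq> 0}"
  have A: "finite A" "A \<noteq> {}" using a(2) by (auto simp: A_def)
  obtain m where m: "m \<in> A" "v (a m) = Min ((\<lambda>i. v (a i)) ` A)"
    using Min_in[of "(\<lambda>i. v (a i)) ` A"] A by fastforce
  have vm: "v (a m) \<le> v (a i)" if "i \<in> A" for i using m(2) that A by simp
  obtain k :: nat where k: "v (a m) = k" using W_v[OF a(1)] m(1) by (auto simp: A_def)
  have "\<exists>b\<in>W. a i = of_nat p ^ k * b" if "i \<le> d" for i
  proof (cases "a i = 0")
    case True thus ?thesis using W_0 by auto
  next
    case False
    then have "v (of_nat p ^ k) \<le> v (a i)" using vm[of i] k that by (simp add: A_def v_p_power)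
    then have "N (a i) \<le> N (of_nat p ^ k)" using N_le_N_iff[OF False] p_nonzero by simp
    thus ?thesis using Q_multiple[OF Q_I[OF a(1)], of i k] by (simp add: N_power N_p power_divide)
  qed
  then obtain b where b: "\<And>i. i \<le> d \<Longrightarrow> b i \<in> W \<and> a i = of_nat p ^ k * b i" by metis
  define f where "f = Poly (map b [0..<Suc d])"
  have cf: "coeff f i = (if i \<le> d then b i else 0)" for i
    by (auto simp: f_def nth_default_def simp del: upt_Suc)
  have "v (b m) = 0" "b m \<noteq> 0"
    using b[of m] m(1) k p_nonzero v_mult[of "of_nat p ^ k" "b m"] by (auto simp: A_def v_p_power)
  then have "res (b m) \<noteq> 0" using res_eq_0_iff[of "b m"] b[of m] m(1) by (auto simp: A_def N_less_1_iff)
  then have "\<exists>i. res (coeff f i) \<noteq> 0" using m(1) by (intro exI[of _ m]) (simp add: cf A_def)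
  moreover have "coeff f i \<in> W" for i using b by (simp add: cf W_0)
  ultimately have "N (poly f x) = 1" by (intro poly_unit_value) (use x1 in auto)
  moreover have "poly f x = 0"
  proof -
    have "degree f \<le> d" by (rule degree_le) (simp add: cf)
    then have "poly f x = (\<Sum>i\<le>d. coeff f i * x ^ i)"
      by (simp add: poly_altdef) (rule sum.mono_neutral_left, auto simp: coeff_eq_0)
    then have "of_nat p ^ k * poly f x = (\<Sum>i\<le>d. a i * x ^ i)"
      by (simp add: sum_distrib_left cf b mult_ac)
    thus ?thesis using a(3) p_nonzero by simp
  qed
  ultimately show False by simp
qed

text \<open>Subtracting a suitable \<open>w g\<close> makes the norm strictly smaller; by discreteness it is at most \<open>1 / p\<close> after
  finitely many such steps.\<close>
lemma approximate_expansion: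
  assumes "x \<in> L" "N x \<le> 1"
  shows "\<exists>w. (\<forall>g. w g \<in> W) \<and> N (x - (\<Sum>g\<in>G. w g * g)) \<le> 1 / p"
  using assms
proof (induction "card {g\<in>G. v x \<le> v g}" arbitrary: x rule: less_induct)
  case less
  show ?case
  proof (cases "N x \<le> 1 / p")
    case True thus ?thesis by (intro exI[of _ "\<lambda>_. 0"]) (simp add: W_0)
  next
    case False
    then have x0: "x \<noteq> 0" using p_gt_1 by auto
    have vx: "0 \<le> v x" "v x < 1"
      using less.prems(2) x0 False N_le_iff[OF x0, of "-1"] p_gt_1
      by (auto simp: N_le_1_iff powr_minus divide_inverse)
    then have "frac (v x) = v x" by (intro frac_eq[THEN iffD2]) auto
    then obtain g where g: "g \<in> G" "v g = v x" using G(4)[OF less.prems(1) x0] by auto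
    have g': "g \<in> L" "g \<noteq> 0" using G(2) g by auto
    have Ng: "N g = N x" using g(2) g'(2) x0 by (simp add: pabs_def)
    have "x / g \<in> L" "N (x / g) = 1" using less.prems(1) g' L_closed(8) Ng x0 by (auto simp: N_divide)
    then obtain w where w: "w \<in> W" "N (x / g - w) < 1" using residue_representative by blast
    define y where "y = x - w * g"
    have "y = (x / g - w) * g" using g' by (simp add: y_def field_simps)
    then have Ny: "N y < N x" using w(2) Ng N_pos[OF x0] by (simp add: N_mult)
    have yL: "y \<in> L" unfolding y_def using less.prems(1) w W_subset g' by (intro L_closed) auto
    have "\<exists>w'. (\<forall>g. w' g \<in> W) \<and> N (y - (\<Sum>g\<in>G. w' g * g)) \<le> 1 / p"
    proof (cases "y = 0")
      case True thus ?thesis by (intro exI[of _ "\<lambda>_. 0"]) (simp add: W_0)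
    next
      case y0: False
      have "v x < v y" using Ny N_le_N_iff[OF x0 y0] by simp
      then have "{g\<in>G. v y \<le> v g} \<subseteq> {g\<in>G. v x \<le> v g}" "g \<notin> {g\<in>G. v y \<le> v g}" "g \<in> {g\<in>G. v x \<le> v g}"
        using g by auto
      then have "{g\<in>G. v y \<le> v g} \<subset> {g\<in>G. v x \<le> v g}" by blast
      then have "card {g\<in>G. v y \<le> v g} < card {g\<in>G. v x \<le> v g}" using G(1) by (intro psubset_card_mono) auto
      thus ?thesis using less.hyps yL Ny less.prems(2) by simp
    qed
    then obtain w' where w': "\<And>g. w' g \<in> W" "N (y - (\<Sum>g\<in>G. w' g * g)) \<le> 1 / p" by blast
    have "(\<Sum>h\<in>G. (if h = g then w' g + w else w' h) * h)
        = (\<Sum>h\<in>G. w' h * h) + (\<Sum>h\<in>G. if h = g then w * g else 0)"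
      by (subst sum.distrib[symmetric], intro sum.cong) (auto simp: algebra_simps)
    also have "\<dots> = (\<Sum>h\<in>G. w' h * h) + w * g" using g G(1) by simp
    finally have "x - (\<Sum>h\<in>G. (if h = g then w' g + w else w' h) * h) = y - (\<Sum>h\<in>G. w' h * h)"
      by (simp add: y_def)
    thus ?thesis using w' w W_add by (intro exI[of _ "\<lambda>h. if h = g then w' g + w else w' h"]) auto
  qed
qed

lemma N_tendsto_0I:
  assumes "\<And>n. N (f n) \<le> g n" "g \<longlonglongrightarrow> 0" shows "(\<lambda>n. N (f n)) \<longlonglongrightarrow> 0"
  by (rule tendsto_sandwich[of "\<lambda>_. 0"]) (use assms in auto)

text \<open>Iterate the approximation modulo \<open>p\<close>. The coordinates are series over \<open>W\<close> that converge \<open>p\<close>-adically.\<close>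
lemma integral_expansion:
  assumes "x \<in> L" "N x \<le> 1"
  shows "\<exists>c. (\<forall>g\<in>G. c g \<in> Q \<and> N (c g) \<le> 1) \<and> x = (\<Sum>g\<in>G. c g * g)"
proof -
  have "\<forall>x. \<exists>w. x \<in> L \<and> N x \<le> 1 \<longrightarrow> (\<forall>g. w g \<in> W) \<and> N (x - (\<Sum>g\<in>G. w g * g)) \<le> 1 / p"
    using approximate_expansion by blast
  then obtain \<omega> where \<omega>: "\<And>x g. x \<in> L \<Longrightarrow> N x \<le> 1 \<Longrightarrow> \<omega> x g \<in> W"
      "\<And>x. x \<in> L \<Longrightarrow> N x \<le> 1 \<Longrightarrow> N (x - (\<Sum>g\<in>G. \<omega> x g * g)) \<le> 1 / p" by metis
  define y where "y = rec_nat x (\<lambda>_ z. (z - (\<Sum>g\<in>G. \<omega> z g * g)) / of_nat p)"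
  have y0: "y 0 = x" and yS: "y (Suc n) = (y n - (\<Sum>g\<in>G. \<omega> (y n) g * g)) / of_nat p" for n
    by (simp_all add: y_def)
  have yL: "y n \<in> L \<and> N (y n) \<le> 1" for n
  proof (induction n)
    case (Suc n)
    then have "\<omega> (y n) g \<in> L" for g using \<omega>(1) W_subset by blast
    then have "y (Suc n) \<in> L" unfolding yS using Suc G_integral
      by (intro L_closed(8,7,11) L_closed(6) L_closed(10)) auto
    moreover have "N (y (Suc n)) \<le> 1" unfolding yS using \<omega>(2)[of "y n"] Suc p_gt_1
      by (simp add: N_divide N_p mult_imp_le_div_pos field_simps)
    ultimately show ?case by simp
  qed (use assms y0 in simp)
  define f where "f g n = of_nat p ^ n * \<omega> (y n) g" for g n
  have fQ: "f g n \<in> Q" for g n unfolding f_def using yL \<omega>(1) by (intro Q_I W_mult W_power W_of_nat) auto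
  have fN: "N (f g n) \<le> 1 / real p ^ n" for g n
    unfolding f_def using W_integral[OF \<omega>(1)[of "y n" g]] yL[of n]
    by (simp add: N_mult N_power N_p power_divide divide_right_mono)
  have f0: "(\<lambda>n. N (f g n)) \<longlonglongrightarrow> 0" for g by (rule N_tendsto_0I[OF fN inverse_p_power_tendsto])
  have "\<forall>g. \<exists>s\<in>Q. (\<lambda>n. N (sum (f g) {..<n} - s)) \<longlonglongrightarrow> 0"
    using complete_setD[OF Q_complete fQ f0] by blast
  then obtain c where c: "\<And>g. c g \<in> Q" "\<And>g. (\<lambda>n. N (sum (f g) {..<n} - c g)) \<longlonglongrightarrow> 0" by metis
  have cN: "N (c g) \<le> 1" for g
  proof -
    have "\<forall>\<^sub>F n in sequentially. N (sum (f g) {..<n} - c g) < 1" by (rule order_tendstoD(2)[OF c(2)]) simp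
    then obtain n where n: "N (sum (f g) {..<n} - c g) < 1" by (auto simp: eventually_sequentially)
    have "N (f g i) \<le> 1" for i
      using order.trans[OF fN[of g i], of 1] p_gt_1 by (simp add: one_le_power)
    then have "N (sum (f g) {..<n}) \<le> 1" by (intro N_sum_le) auto
    then have "N (sum (f g) {..<n} - (sum (f g) {..<n} - c g)) \<le> 1" using n by (rule N_diff_le[OF _ less_imp_le])
    thus ?thesis by simp
  qed
  have partial: "x - (\<Sum>g\<in>G. sum (f g) {..<n} * g) = of_nat p ^ n * y n" for n
  proof (induction n)
    case (Suc n)
    have "(\<Sum>g\<in>G. sum (f g) {..<Suc n} * g) = (\<Sum>g\<in>G. sum (f g) {..<n} * g) + (\<Sum>g\<in>G. f g n * g)"
      by (simp add: sum.distrib[symmetric] algebra_simps)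
    then have "x - (\<Sum>g\<in>G. sum (f g) {..<Suc n} * g) = of_nat p ^ n * (y n - (\<Sum>g\<in>G. \<omega> (y n) g * g))"
      using Suc by (simp add: f_def sum_distrib_left algebra_simps)
    thus ?case using p_nonzero by (simp add: yS)
  qed (simp add: y0)
  have "N (x - (\<Sum>g\<in>G. c g * g)) < e" if "e > 0" for e
  proof -
    have "\<forall>\<^sub>F n in sequentially. \<forall>g\<in>G. N (sum (f g) {..<n} - c g) < e"
      using G(1) by (intro eventually_ball_finite ballI order_tendstoD(2)[OF c(2)]) (use that in auto)
    moreover have "\<forall>\<^sub>F n in sequentially. 1 / real p ^ n < e"
      using inverse_p_power_tendsto that by (intro order_tendstoD(2))
    ultimately have "\<forall>\<^sub>F n in sequentially. (\<forall>g\<in>G. N (sum (f g) {..<n} - c g) < e) \<and> 1 / real p ^ n < e"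
      by eventually_elim auto
    then obtain n where n: "\<And>g. g \<in> G \<Longrightarrow> N (sum (f g) {..<n} - c g) < e" "1 / real p ^ n < e"
      by (auto simp: eventually_sequentially)
    have "N (of_nat p ^ n * y n) < e"
      using n(2) yL[of n] order.strict_trans1[OF _ n(2)] by (simp add: N_mult N_power N_p power_divide divide_right_mono)
    moreover have "N (\<Sum>g\<in>G. (sum (f g) {..<n} - c g) * g) < e"
    proof (rule N_sum_less[OF _ that])
      fix g assume g: "g \<in> G"
      have "N ((sum (f g) {..<n} - c g) * g) \<le> N (sum (f g) {..<n} - c g)"
        using G_integral[OF g] by (simp add: N_mult mult_left_le)
      thus "N ((sum (f g) {..<n} - c g) * g) < e" using n(1)[OF g] by simp
    qed
    moreover have "x - (\<Sum>g\<in>G. c g * g) = of_nat p ^ n * y n + (\<Sum>g\<in>G. (sum (f g) {..<n} - c g) * g)"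
      by (simp add: partial[symmetric] left_diff_distrib sum_subtractf)
    ultimately show ?thesis using N_add_less by simp
  qed
  then have "N (x - (\<Sum>g\<in>G. c g * g)) \<le> 0" by (meson less_irrefl not_le)
  then have "x - (\<Sum>g\<in>G. c g * g) = 0" by (metis N_eq_0 N_nonneg antisym)
  thus ?thesis using c cN by (intro exI[of _ c]) simp
qed

text \<open>Up to the factor \<open>p\<close>, the norm of \<open>L\<close> is the maximum norm with respect to the coordinates.\<close>
lemma expansion:
  assumes "x \<in> L"
  shows "\<exists>c. (\<forall>g\<in>G. c g \<in> Q \<and> N (c g) \<le> p * N x) \<and> x = (\<Sum>g\<in>G. c g * g)"
proof (cases "x = 0")
  case True thus ?thesis by (intro exI[of _ "\<lambda>_. 0"]) (simp add: Q_I W_0)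
next
  case False
  define m where "m = \<lfloor>v x\<rfloor>"
  define y where "y = x * of_nat p powi (-m)"
  have pp: "(of_nat p :: 'a) powi m \<noteq> 0" using p_nonzero by simp
  have "v y = v x - m" unfolding y_def
    using v_mult[OF False, of "of_nat p powi (-m)"] p_nonzero by (simp add: v_p_powi del: power_int_minus)
  then have "v y \<ge> 0" by (simp add: m_def)
  then have "N y \<le> 1" by (simp add: N_le_1_iff)
  moreover have "y \<in> L" unfolding y_def using assms p_powi_in_L L_closed(6) by blast
  ultimately obtain c where c: "\<And>g. g \<in> G \<Longrightarrow> c g \<in> Q \<and> N (c g) \<le> 1" "y = (\<Sum>g\<in>G. c g * g)"
    using integral_expansion by blast
  have "x = of_nat p powi m * y" unfolding y_def using pp by (simp add: power_int_minus)
  then have "x = (\<Sum>g\<in>G. (of_nat p powi m * c g) * g)" by (simp add: c(2) sum_distrib_left mult_ac)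
  moreover have "N (of_nat p powi m * c g) \<le> p * N x" if "g \<in> G" for g
  proof -
    have "N (of_nat p powi m * c g) \<le> N (of_nat p powi m)"
      using c(1)[OF that] by (simp add: N_mult mult_left_le)
    also have "\<dots> = real p powr (- m)" using p_nonzero by (simp add: pabs_def v_p_powi)
    also have "\<dots> \<le> real p powr (1 - v x)" using p_gt_1 by (simp add: m_def) linarith
    also have "\<dots> = p * N x" using False p_gt_1 by (simp add: pabs_def powr_diff powr_minus divide_inverse)
    finally show ?thesis .
  qed
  ultimately show ?thesis using c(1) Q_mult Q_p_powi by (intro exI[of _ "\<lambda>g. of_nat p powi m * c g"]) auto
qed

text \<open>If the terms of a series tend to \<open>0\<close>, then so do their coordinates, and \<open>Q\<close> is complete.\<close>
lemma L_complete: "complete_set L"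
  unfolding complete_set_def
proof (intro allI impI)
  fix f :: "nat \<Rightarrow> 'a" assume f: "\<forall>n. f n \<in> L" and f0: "(\<lambda>n. N (f n)) \<longlonglongrightarrow> 0"
  have "\<forall>n. \<exists>c. (\<forall>g\<in>G. c g \<in> Q \<and> N (c g) \<le> p * N (f n)) \<and> f n = (\<Sum>g\<in>G. c g * g)"
    using expansion f by blast
  then obtain c where c: "\<And>n g. g \<in> G \<Longrightarrow> c n g \<in> Q \<and> N (c n g) \<le> p * N (f n)"
      "\<And>n. f n = (\<Sum>g\<in>G. c n g * g)" by metis
  have lim: "(\<lambda>n. p * N (f n)) \<longlonglongrightarrow> 0" using tendsto_mult_right_zero[OF f0] by simp
  have "\<exists>s\<in>Q. (\<lambda>n. N (sum (\<lambda>n. c n g) {..<n} - s)) \<longlonglongrightarrow> 0" if g: "g \<in> G" for g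
  proof -
    have "(\<lambda>n. N (c n g)) \<longlonglongrightarrow> 0" by (rule N_tendsto_0I[OF _ lim]) (use c(1) g in auto)
    thus ?thesis using complete_setD[OF Q_complete, of "\<lambda>n. c n g"] c(1)[OF g] by blast
  qed
  then obtain s where s: "\<And>g. g \<in> G \<Longrightarrow> s g \<in> Q \<and> (\<lambda>n. N (sum (\<lambda>n. c n g) {..<n} - s g)) \<longlonglongrightarrow> 0"
    by metis
  have "(\<Sum>g\<in>G. s g * g) \<in> L" using s Q_subset G_integral by (intro L_closed(11) L_closed(6)) auto
  moreover have "(\<lambda>n. N (sum f {..<n} - (\<Sum>g\<in>G. s g * g))) \<longlonglongrightarrow> 0"
  proof (rule N_tendsto_0I)
    fix n
    have "sum f {..<n} = (\<Sum>g\<in>G. sum (\<lambda>n. c n g) {..<n} * g)"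
      unfolding c(2) by (subst sum.swap) (simp add: sum_distrib_right)
    then have "sum f {..<n} - (\<Sum>g\<in>G. s g * g) = (\<Sum>g\<in>G. (sum (\<lambda>n. c n g) {..<n} - s g) * g)"
      by (simp add: left_diff_distrib sum_subtractf)
    also have "N \<dots> \<le> (\<Sum>g\<in>G. N (sum (\<lambda>n. c n g) {..<n} - s g))"
    proof (rule N_sum_le)
      fix g assume g: "g \<in> G"
      have "N ((sum (\<lambda>n. c n g) {..<n} - s g) * g) \<le> N (sum (\<lambda>n. c n g) {..<n} - s g)"
        using G_integral[OF g] by (simp add: N_mult mult_left_le)
      also have "\<dots> \<le> (\<Sum>g\<in>G. N (sum (\<lambda>n. c n g) {..<n} - s g))"
        using G(1) g member_le_sum[of g G "\<lambda>g. N (sum (\<lambda>n. c n g) {..<n} - s g)"] by simp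
      finally show "N ((sum (\<lambda>n. c n g) {..<n} - s g) * g) \<le> (\<Sum>g\<in>G. N (sum (\<lambda>n. c n g) {..<n} - s g))" .
    qed (simp add: sum_nonneg)
    finally show "N (sum f {..<n} - (\<Sum>g\<in>G. s g * g)) \<le> (\<Sum>g\<in>G. N (sum (\<lambda>n. c n g) {..<n} - s g))" .
  next
    show "(\<lambda>n. \<Sum>g\<in>G. N (sum (\<lambda>n. c n g) {..<n} - s g)) \<longlonglongrightarrow> 0"
      by (rule tendsto_null_sum) (use s in blast)
  qed
  ultimately show "\<exists>s\<in>L. (\<lambda>n. N (sum f {..<n} - s)) \<longlonglongrightarrow> 0" by blast
qed

end

section \<open>Well-ordered sets of rational numbers\<close>

lemma well_ordered_iff:
  "well_ordered A \<longleftrightarrow> \<not> (\<exists>f::nat \<Rightarrow> rat. \<forall>n. f n \<in> A \<and> f (Suc n) < f n)"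
proof -
  define r where "r = {(i, j). i \<in> A \<and> j \<in> A \<and> i \<le> j}"
  have "linear_order_on A r"
    by (auto simp: r_def linear_order_on_def partial_order_on_def preorder_on_def refl_on_def
        trans_def antisym_def total_on_def)
  moreover have "wf (r - Id) \<longleftrightarrow> \<not> (\<exists>f::nat \<Rightarrow> rat. \<forall>n. f n \<in> A \<and> f (Suc n) < f n)"
  proof -
    have "(\<forall>n. (f (Suc n), f n) \<in> r - Id) \<longleftrightarrow> (\<forall>n. f n \<in> A \<and> f (Suc n) < f n)" for f
      by (auto simp: r_def less_le)
    thus ?thesis unfolding wf_iff_no_infinite_down_chain by simp
  qed
  ultimately show ?thesis by (simp add: well_ordered_def well_order_on_def r_def)
qed

lemma well_orderedI:
  "(\<And>f::nat \<Rightarrow> rat. (\<And>n. f n \<in> A) \<Longrightarrow> (\<And>n. f (Suc n) < f n) \<Longrightarrow> False) \<Longrightarrow> well_ordered A"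
  unfolding well_ordered_iff by blast

lemma well_orderedD:
  "well_ordered A \<Longrightarrow> (\<And>n::nat. f n \<in> A) \<Longrightarrow> (\<And>n. f (Suc n) < f n) \<Longrightarrow> False"
  unfolding well_ordered_iff by blast

lemma well_ordered_subset: "well_ordered A \<Longrightarrow> B \<subseteq> A \<Longrightarrow> well_ordered B"
  unfolding well_ordered_iff by blast

lemma well_ordered_min:
  assumes "well_ordered A" "B \<subseteq> A" "B \<noteq> {}" shows "\<exists>m\<in>B. \<forall>b\<in>B. m \<le> b"
proof (rule ccontr)
  assume "\<not> ?thesis"
  then have step: "\<forall>m\<in>B. \<exists>b\<in>B. b < m" by (auto simp: not_le)
  obtain b0 where "b0 \<in> B" using assms(3) by blast
  then have "\<exists>f. \<forall>n::nat. f n \<in> B \<and> f (Suc n) < f n"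
    using step by (intro dependent_nat_choice) auto
  thus False using assms(1,2) unfolding well_ordered_iff by blast
qed

lemma well_ordered_empty: "well_ordered {}"
  unfolding well_ordered_iff by simp

lemma decreasing_seq_less: "(\<And>n::nat. f (Suc n) < (f n :: rat)) \<Longrightarrow> m < n \<Longrightarrow> f n < f m"
  by (rule lift_Suc_mono_less[of "\<lambda>n. - f n", simplified])

lemma well_ordered_Un:
  assumes "well_ordered A" "well_ordered B" shows "well_ordered (A \<union> B)"
proof (rule well_orderedI)
  fix f :: "nat \<Rightarrow> rat" assume f: "\<And>n. f n \<in> A \<union> B" "\<And>n. f (Suc n) < f n"
  have *: "\<exists>n. \<forall>m\<ge>n. f m \<notin> C" if wo: "well_ordered C" for C
  proof (cases "\<exists>n. f n \<in> C")
    case True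
    then obtain m where m: "m \<in> range f \<inter> C" "\<forall>b\<in>range f \<inter> C. m \<le> b"
      using well_ordered_min[OF wo, of "range f \<inter> C"] by blast
    then obtain n where n: "m = f n" by blast
    have "f k \<notin> C" if "k \<ge> Suc n" for k
    proof
      assume "f k \<in> C"
      then have "m \<le> f k" using m(2) by blast
      moreover have "f k < f n" using decreasing_seq_less[of f n k] f(2) that by simp
      ultimately show False using n by simp
    qed
    thus ?thesis by blast
  qed auto
  obtain n1 n2 where "\<forall>m\<ge>n1. f m \<notin> A" "\<forall>m\<ge>n2. f m \<notin> B" using *[OF assms(1)] *[OF assms(2)] by blast
  then have "f (max n1 n2) \<notin> A \<union> B" by auto
  thus False using f(1) by blast
qed

lemma well_ordered_UN:
  "finite I \<Longrightarrow> (\<And>i. i \<in> I \<Longrightarrow> well_ordered (A i)) \<Longrightarrow> well_ordered (\<Union>i\<in>I. A i)"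
  by (induction I rule: finite_induct) (auto intro: well_ordered_empty well_ordered_Un)

lemma well_ordered_scale:
  assumes "well_ordered A" "0 < c" shows "well_ordered {i. i / c \<in> A}"
proof (rule well_orderedI)
  fix f :: "nat \<Rightarrow> rat" assume "\<And>n. f n \<in> {i. i / c \<in> A}" "\<And>n. f (Suc n) < f n"
  thus False using well_orderedD[OF assms(1), of "\<lambda>n. f n / c"] assms(2) by (auto simp: divide_strict_right_mono)
qed

lemma well_ordered_sum:
  assumes A: "well_ordered A" and B: "well_ordered B"
  shows "well_ordered {i + j | i j. i \<in> A \<and> j \<in> B}"
proof (rule well_orderedI)
  fix f :: "nat \<Rightarrow> rat" assume "\<And>n. f n \<in> {i + j | i j. i \<in> A \<and> j \<in> B}" and dec: "\<And>n. f (Suc n) < f n"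
  have "\<forall>n. \<exists>i. i \<in> A \<and> f n - i \<in> B"
  proof
    fix n
    have "f n \<in> {i + j | i j. i \<in> A \<and> j \<in> B}" by fact
    then obtain i j where "f n = i + j" "i \<in> A" "j \<in> B" by blast
    thus "\<exists>i. i \<in> A \<and> f n - i \<in> B" by (intro exI[of _ i]) simp
  qed
  then obtain a where a: "\<And>n. a n \<in> A" "\<And>n. f n - a n \<in> B" by metis
  obtain r :: "nat \<Rightarrow> nat" where r: "strict_mono r" "monoseq (\<lambda>n. a (r n))" using seq_monosub by blast
  have fr: "f (r (Suc n)) < f (r n)" for n
    using decreasing_seq_less[of f "r n" "r (Suc n)"] dec r(1) by (simp add: strict_mono_Suc_iff)
  from r(2) consider "\<And>m n. m \<le> n \<Longrightarrow> a (r m) \<le> a (r n)" | "\<And>m n. m \<le> n \<Longrightarrow> a (r n) \<le> a (r m)"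
    unfolding monoseq_def by blast
  then show False
  proof cases
    case 1
    have "f (r (Suc n)) - a (r (Suc n)) < f (r n) - a (r n)" for n using fr[of n] 1[of n "Suc n"] by simp
    thus False using well_orderedD[OF B, of "\<lambda>n. f (r n) - a (r n)"] a(2) by blast
  next
    case 2
    have "range (\<lambda>n. a (r n)) \<subseteq> A" using a(1) by blast
    then obtain n where n: "\<And>m. a (r n) \<le> a (r m)"
      using well_ordered_min[OF A, of "range (\<lambda>n. a (r n))"] by blast
    have "a (r (n + m)) = a (r n)" for m using n[of "n + m"] 2[of n "n + m"] by simp
    then have "f (r (n + Suc m)) - a (r (n + Suc m)) < f (r (n + m)) - a (r (n + m))" for m
      using fr[of "n + m"] by (metis add_Suc_right diff_strict_right_mono)
    thus False using well_orderedD[OF B, of "\<lambda>m. f (r (n + m)) - a (r (n + m))"] a(2) by blast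
  qed
qed

lemma well_ordered_antidiagonal_finite:
  assumes A: "well_ordered A" and B: "well_ordered B"
  shows "finite {i \<in> A. k - i \<in> B}"
proof (rule ccontr)
  assume "infinite {i \<in> A. k - i \<in> B}"
  then obtain f :: "nat \<Rightarrow> rat" where f: "inj f" "range f \<subseteq> {i \<in> A. k - i \<in> B}"
    using infinite_countable_subset by blast
  obtain r :: "nat \<Rightarrow> nat" where r: "strict_mono r" "monoseq (\<lambda>n. f (r n))" using seq_monosub by blast
  have ne: "f (r n) \<noteq> f (r (Suc n))" for n
    using f(1) r(1) by (metis injD n_not_Suc_n strict_mono_eq)
  have fr: "f (r n) \<in> A" "k - f (r n) \<in> B" for n using f(2) by auto
  from r(2) consider "\<And>m n. m \<le> n \<Longrightarrow> f (r m) \<le> f (r n)" | "\<And>m n. m \<le> n \<Longrightarrow> f (r n) \<le> f (r m)"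
    unfolding monoseq_def by blast
  then show False
  proof cases
    case 1
    have "k - f (r (Suc n)) < k - f (r n)" for n using 1[of n "Suc n"] ne[of n] by simp
    thus False using well_orderedD[OF B, of "\<lambda>n. k - f (r n)"] fr by blast
  next
    case 2
    have "f (r (Suc n)) < f (r n)" for n using 2[of n "Suc n"] ne[of n] by simp
    thus False using well_orderedD[OF A, of "\<lambda>n. f (r n)"] fr by blast
  qed
qed

section \<open>Unconditional summation\<close>

context p_adic_norm begin

definition psums :: "('i \<Rightarrow> 'a) \<Rightarrow> 'a \<Rightarrow> bool" where
  "psums f s \<longleftrightarrow> (\<forall>\<epsilon>>0. \<exists>A. finite A \<and> (\<forall>B. finite B \<longrightarrow> A \<subseteq> B \<longrightarrow> N (sum f B - s) < \<epsilon>))"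

lemma le_if_less_all: "(\<And>e. e > 0 \<Longrightarrow> x < C + e) \<Longrightarrow> x \<le> (C::real)"
  by (meson le_less_linear field_le_epsilon less_imp_le)

lemma N_le_limit:
  assumes "\<And>e. e > 0 \<Longrightarrow> \<exists>y. N y \<le> C \<and> N (y - x) < e" "0 \<le> C" shows "N x \<le> C"
proof (rule le_if_less_all)
  fix e :: real assume "e > 0"
  then obtain y where y: "N y \<le> C" "N (y - x) < C + e" using assms(1)[of "C + e"] assms(2) by auto
  have "N (y - (y - x)) < C + e" by (rule N_diff_less) (use y \<open>e > 0\<close> in auto)
  thus "N x < C + e" by simp
qed

lemma psums_approx:
  assumes "psums f s" "finite J" "\<And>j. j \<notin> J \<Longrightarrow> N (f j) \<le> C" "0 \<le> C"
  shows "N (s - sum f J) \<le> C"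
proof (rule N_le_limit[OF _ assms(4)])
  fix e :: real assume "e > 0"
  then obtain A where A: "finite A" "\<And>B. finite B \<Longrightarrow> A \<subseteq> B \<Longrightarrow> N (sum f B - s) < e"
    using assms(1) unfolding psums_def by blast
  have "N (sum f (A - J)) \<le> C" by (rule N_sum_le) (use assms in auto)
  moreover have "sum f (A \<union> J) = sum f J + sum f (A - J)"
    using sum.union_disjoint[of J "A - J" f] A(1) assms(2) by (simp add: Un_commute)
  ultimately show "\<exists>y. N y \<le> C \<and> N (y - (s - sum f J)) < e"
    using A(2)[of "A \<union> J"] A(1) assms(2) by (intro exI[of _ "sum f (A - J)"]) (auto simp: algebra_simps)
qed

lemma psumsI:
  assumes "\<And>e. e > 0 \<Longrightarrow> \<exists>J. finite J \<and> (\<forall>j. j \<notin> J \<longrightarrow> N (f j) \<le> e) \<and> N (s - sum f J) \<le> e"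
  shows "psums f s"
  unfolding psums_def
proof (intro allI impI)
  fix \<epsilon> :: real assume e: "0 < \<epsilon>"
  then obtain J where J: "finite J" "\<And>j. j \<notin> J \<Longrightarrow> N (f j) \<le> \<epsilon> / 2" "N (s - sum f J) \<le> \<epsilon> / 2"
    using assms[of "\<epsilon> / 2"] by auto
  have "N (sum f B - s) < \<epsilon>" if B: "finite B" "J \<subseteq> B" for B
  proof -
    have "sum f B - s = sum f (B - J) - (s - sum f J)"
      using sum.subset_diff[OF B(2,1), of f] by (simp add: algebra_simps)
    moreover have "N (sum f (B - J)) \<le> \<epsilon> / 2" by (rule N_sum_le) (use J e in auto)
    ultimately have "N (sum f B - s) \<le> \<epsilon> / 2" using N_diff_le J(3) by metis
    thus ?thesis using e by simp
  qed
  thus "\<exists>A. finite A \<and> (\<forall>B. finite B \<longrightarrow> A \<subseteq> B \<longrightarrow> N (sum f B - s) < \<epsilon>)" using J(1) by blast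
qed

lemma psums_tail:
  assumes "psums f s" "0 < e" shows "\<exists>J. finite J \<and> (\<forall>j. j \<notin> J \<longrightarrow> N (f j) \<le> e)"
proof -
  obtain A where A: "finite A" "\<And>B. finite B \<Longrightarrow> A \<subseteq> B \<Longrightarrow> N (sum f B - s) < e"
    using assms unfolding psums_def by blast
  have "N (f j) \<le> e" if "j \<notin> A" for j
  proof -
    have "N ((sum f (insert j A) - s) - (sum f A - s)) < e" by (rule N_diff_less) (use A in auto)
    thus ?thesis using A(1) that by simp
  qed
  thus ?thesis using A(1) by blast
qed

lemma psums_unique: assumes "psums f s" "psums f t" shows "s = t"
proof -
  have "N (s - t) \<le> e" if e: "e > 0" for e
  proof -
    obtain J where J: "finite J" "\<And>j. j \<notin> J \<Longrightarrow> N (f j) \<le> e" using psums_tail[OF assms(1) e] by blast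
    have "N ((s - sum f J) - (t - sum f J)) \<le> e"
      by (intro N_diff_le psums_approx J assms) (use J(2) e in auto)
    thus ?thesis by simp
  qed
  then have "N (s - t) \<le> 0" by (meson dense_ge)
  thus ?thesis using N_nonneg[of "s - t"] by (metis N_eq_0 antisym eq_iff_diff_eq_0)
qed

lemma psum_eqI: "psums f s \<Longrightarrow> psum p v f = s"
  unfolding psum_def psums_def[symmetric] using psums_unique by blast

lemma psums_N_le: "psums f s \<Longrightarrow> (\<And>i. N (f i) \<le> C) \<Longrightarrow> 0 \<le> C \<Longrightarrow> N s \<le> C"
  using psums_approx[of f s "{}" C] by simp

lemma psums_finite: "finite A \<Longrightarrow> (\<And>i. i \<notin> A \<Longrightarrow> f i = 0) \<Longrightarrow> psums f (sum f A)"
  by (rule psumsI) (auto intro!: exI[of _ A])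

lemma psums_add: assumes "psums f s" "psums g t" shows "psums (\<lambda>i. f i + g i) (s + t)"
proof (rule psumsI)
  fix e :: real assume e: "e > 0"
  obtain J K where J: "finite J" "\<And>j. j \<notin> J \<Longrightarrow> N (f j) \<le> e" and K: "finite K" "\<And>j. j \<notin> K \<Longrightarrow> N (g j) \<le> e"
    using psums_tail[OF assms(1) e] psums_tail[OF assms(2) e] by blast
  have "N ((s - sum f (J \<union> K)) + (t - sum g (J \<union> K))) \<le> e"
    using J K e by (intro N_add_le psums_approx[OF assms(1)] psums_approx[OF assms(2)]) auto
  thus "\<exists>J. finite J \<and> (\<forall>j. j \<notin> J \<longrightarrow> N (f j + g j) \<le> e) \<and> N (s + t - (\<Sum>i\<in>J. f i + g i)) \<le> e"
    using J K by (intro exI[of _ "J \<union> K"]) (auto simp: sum.distrib algebra_simps intro!: N_add_le)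
qed

lemma psums_image:
  assumes "psums f s" and A: "s \<in> A" "\<And>i. f i \<in> A" "0 \<in> A" "\<And>x y. x \<in> A \<Longrightarrow> y \<in> A \<Longrightarrow> x - y \<in> A"
    and h: "\<And>x y. x \<in> A \<Longrightarrow> y \<in> A \<Longrightarrow> h (x + y) = h x + h y" "\<And>x. x \<in> A \<Longrightarrow> N (h x) \<le> C * N x" "C > 0"
  shows "psums (\<lambda>i. h (f i)) (h s)"
proof (rule psumsI)
  fix e :: real assume e: "e > 0"
  then have e': "e / C > 0" using h(3) by simp
  have h0: "h 0 = 0" using h(1)[OF A(3) A(3)] by (metis add_0_right add_left_cancel)
  have hm: "h (x - y) = h x - h y" if "x \<in> A" "y \<in> A" for x y
    using h(1)[OF A(4)[OF that] that(2)] by (simp add: algebra_simps)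
  have A_add: "x + y \<in> A" if "x \<in> A" "y \<in> A" for x y
    using A(4)[OF that(1) A(4)[OF A(3) that(2)]] by simp
  have A_sum: "sum f J \<in> A" for J
    by (induction J rule: infinite_finite_induct) (auto simp: A A_add)
  have hs: "h (sum f J) = (\<Sum>i\<in>J. h (f i))" for J
    by (induction J rule: infinite_finite_induct) (auto simp: h0 h(1) A A_sum)
  obtain J where J: "finite J" "\<And>j. j \<notin> J \<Longrightarrow> N (f j) \<le> e / C" using psums_tail[OF assms(1) e'] by blast
  have *: "N (h x) \<le> e" if "x \<in> A" "N x \<le> e / C" for x
    using order.trans[OF h(2)[of x], of e] that h(3) by (simp add: field_simps)
  have "N (h (s - sum f J)) \<le> e"
    using J e' by (intro * psums_approx[OF assms(1)] A A_sum) auto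
  thus "\<exists>J. finite J \<and> (\<forall>j. j \<notin> J \<longrightarrow> N (h (f j)) \<le> e) \<and> N (h s - (\<Sum>i\<in>J. h (f i))) \<le> e"
    using J * A A_sum by (intro exI[of _ J]) (auto simp: hm hs[symmetric])
qed

lemma psums_cmult: "psums f s \<Longrightarrow> psums (\<lambda>i. c * f i) (c * s)"
  by (rule psums_image[of _ _ UNIV "\<lambda>x. c * x" "max 1 (N c)"])
     (auto simp: distrib_left N_mult intro: mult_right_mono)

lemma psums_reindex:
  assumes "psums f s" "bij h" shows "psums (\<lambda>i. f (h i)) s"
  unfolding psums_def
proof (intro allI impI)
  fix \<epsilon> :: real assume "0 < \<epsilon>"
  then obtain A where A: "finite A" "\<And>B. finite B \<Longrightarrow> A \<subseteq> B \<Longrightarrow> N (sum f B - s) < \<epsilon>"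
    using assms(1) unfolding psums_def by blast
  have inj: "inj h" and surj: "surj h" using assms(2) by (auto simp: bij_def)
  show "\<exists>A. finite A \<and> (\<forall>B. finite B \<longrightarrow> A \<subseteq> B \<longrightarrow> N (sum (\<lambda>i. f (h i)) B - s) < \<epsilon>)"
  proof (intro exI[of _ "h -` A"] conjI allI impI)
    show "finite (h -` A)" using A(1) inj by (rule finite_vimageI)
    fix B assume B: "finite B" "h -` A \<subseteq> B"
    have "A \<subseteq> h ` B"
    proof
      fix a assume "a \<in> A"
      moreover obtain i where "a = h i" using surj by blast
      ultimately show "a \<in> h ` B" using B(2) by blast
    qed
    then have "N (sum f (h ` B) - s) < \<epsilon>" using A(2) B(1) by blast
    thus "N (sum (\<lambda>i. f (h i)) B - s) < \<epsilon>"
      using sum.reindex[of h B f, OF inj_on_subset[OF inj subset_UNIV]] by (simp add: o_def)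
  qed
qed

lemma psum_reindex: fixes h :: "rat \<Rightarrow> rat" assumes "bij h" shows "psum p v (\<lambda>i. f (h i)) = psum p v f"
proof -
  have "psums (\<lambda>i. f (h i)) s \<longleftrightarrow> psums f s" for s
    using psums_reindex[OF _ assms, of f s] psums_reindex[OF _ bij_imp_bij_inv[OF assms], of "\<lambda>i. f (h i)" s]
      surj_f_inv_f[OF bij_is_surj[OF assms]] by auto
  thus ?thesis unfolding psum_def psums_def[symmetric] by simp
qed

definition null_family :: "('i \<Rightarrow> 'a) \<Rightarrow> bool" where
  "null_family f \<longleftrightarrow> (\<forall>e>0. finite {i. N (f i) > e})"

text \<open>All but finitely many terms of a null family are small, so that the sum can be taken in blocks.\<close>
lemma psums_iterated:
  assumes "null_family f" "psums f S" "\<And>i. psums (\<lambda>j. f (i, j)) (g i)"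
  shows "psums g S"
proof (rule psumsI)
  fix e :: real assume e: "e > 0"
  define E where "E = {x. N (f x) > e}"
  have E: "finite E" using assms(1) e by (simp add: null_family_def E_def)
  define J where "J = fst ` E"
  define K where "K = snd ` E"
  have JK: "E \<subseteq> J \<times> K" "finite J" "finite K" using E by (auto simp: J_def K_def image_iff) force+
  have E0: "N (f (i, j)) \<le> e" if "i \<notin> J \<or> j \<notin> K" for i j
  proof (rule ccontr)
    assume "\<not> N (f (i, j)) \<le> e"
    then have "(i, j) \<in> E" by (simp add: E_def)
    thus False using that JK(1) by blast
  qed
  have "N (g i - (\<Sum>j\<in>K. f (i, j))) \<le> e" for i
    by (rule psums_approx[OF assms(3) JK(3)]) (use e E0 in auto)
  note g = this
  have "N (g i) \<le> e" if "i \<notin> J" for i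
    by (rule psums_N_le[OF assms(3)]) (use e that E0 in auto)
  moreover have "N (S - sum g J) \<le> e"
  proof -
    have *: "N (S - sum f (J \<times> K)) \<le> e"
      by (rule psums_approx[OF assms(2)]) (use e E0 JK(2,3) in auto)
    have **: "N (\<Sum>i\<in>J. g i - (\<Sum>j\<in>K. f (i, j))) \<le> e" by (rule N_sum_le) (use g e in auto)
    have "S - sum g J = (S - sum f (J \<times> K)) - (\<Sum>i\<in>J. g i - (\<Sum>j\<in>K. f (i, j)))"
      by (simp add: sum_subtractf sum.cartesian_product)
    thus ?thesis using N_diff_le[OF * **] by (simp only:)
  qed
  ultimately show "\<exists>J. finite J \<and> (\<forall>j. j \<notin> J \<longrightarrow> N (g j) \<le> e) \<and> N (S - sum g J) \<le> e"
    using JK by blast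
qed

end

locale complete_subfield = p_adic_norm p v for p :: nat and v :: "'a::field \<Rightarrow> real" +
  fixes L :: "'a set"
  assumes L_is_subfield: "is_subfield L" and L_is_complete: "complete_set L"
begin

lemmas in_L = is_subfieldD[OF L_is_subfield]

lemma null_family_summable:
  assumes null: "null_family f" and fL: "\<And>i. f i \<in> L" shows "\<exists>s\<in>L. psums f s"
proof -
  define A where "A k = {i. N (f i) > 1 / real p ^ k}" for k
  have finA: "finite (A k)" for k using null p_gt_1 by (simp add: A_def null_family_def)
  have sub: "A k \<subseteq> A (Suc k)" for k
  proof -
    have "1 / real p ^ Suc k \<le> 1 / real p ^ k" using p_gt_1 by (intro divide_left_mono power_increasing) auto
    thus ?thesis unfolding A_def by force
  qed
  define f' where "f' k = sum f (A (Suc k) - A k)" for k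
  have "f' k \<in> L" for k unfolding f'_def using fL by (rule in_L(11))
  moreover have "(\<lambda>k. N (f' k)) \<longlonglongrightarrow> 0"
  proof (rule tendsto_sandwich[of "\<lambda>_. 0" _ _ "\<lambda>k. 1 / real p ^ k"])
    have "N (f' k) \<le> 1 / real p ^ k" for k unfolding f'_def by (rule N_sum_le) (auto simp: A_def)
    thus "\<forall>\<^sub>F k in sequentially. N (f' k) \<le> 1 / real p ^ k" by simp
  qed (auto intro: inverse_p_power_tendsto)
  ultimately obtain s' where s': "s' \<in> L" "(\<lambda>n. N (sum f' {..<n} - s')) \<longlonglongrightarrow> 0"
    using complete_setD[OF L_is_complete, of f'] by blast
  have partial: "sum f (A k) = sum f (A 0) + sum f' {..<k}" for k
  proof (induction k)
    case (Suc k)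
    have "sum f (A (Suc k)) = f' k + sum f (A k)" unfolding f'_def by (rule sum.subset_diff[OF sub finA])
    thus ?case using Suc by simp
  qed simp
  have "psums f (sum f (A 0) + s')"
  proof (rule psumsI)
    fix e :: real assume e: "e > 0"
    have "\<forall>\<^sub>F k in sequentially. N (sum f' {..<k} - s') < e" using s'(2) e by (rule order_tendstoD(2))
    moreover have "\<forall>\<^sub>F k in sequentially. 1 / real p ^ k < e"
      using inverse_p_power_tendsto e by (rule order_tendstoD(2))
    ultimately have "\<forall>\<^sub>F k in sequentially. N (sum f' {..<k} - s') < e \<and> 1 / real p ^ k < e"
      by (rule eventually_conj)
    then obtain k where k: "N (sum f' {..<k} - s') < e" "1 / real p ^ k < e"
      by (auto simp: eventually_sequentially)
    show "\<exists>J. finite J \<and> (\<forall>j. j \<notin> J \<longrightarrow> N (f j) \<le> e) \<and> N (sum f (A 0) + s' - sum f J) \<le> e"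
    proof (intro exI[of _ "A k"] conjI allI impI)
      show "N (sum f (A 0) + s' - sum f (A k)) \<le> e"
        unfolding partial[of k] using k(1) N_minus_commute[of s' "sum f' {..<k}"] by simp
      show "finite (A k)" by (rule finA)
      fix j assume "j \<notin> A k"
      then have "N (f j) \<le> 1 / real p ^ k" by (simp add: A_def not_less)
      thus "N (f j) \<le> e" using k(2) by linarith
    qed
  qed
  moreover have "sum f (A 0) + s' \<in> L" by (intro in_L(5) in_L(11) fL s')
  ultimately show ?thesis by blast
qed

end

section \<open>Convolution of generalized power series\<close>

lemma half_less: "0 < (x::real) \<Longrightarrow> x / 2 < x" by simp

lemma well_ordered_finite: "finite A \<Longrightarrow> well_ordered A"
proof (rule well_orderedI)
  fix f :: "nat \<Rightarrow> rat" assume A: "finite A" and f: "\<And>n. f n \<in> A" "\<And>n. f (Suc n) < f n"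
  have "inj f"
  proof (rule injI)
    fix m n assume "f m = f n"
    thus "m = n" using decreasing_seq_less[of f m n] decreasing_seq_less[of f n m] f(2)
      by (cases m n rule: linorder_cases) auto
  qed
  then have "infinite (range f)" by (simp add: finite_image_iff)
  thus False using A f(1) finite_subset[of "range f" A] by blast
qed

context p_adic_norm begin

abbreviation wt :: "real \<Rightarrow> rat \<Rightarrow> real" where
  "wt s i \<equiv> real p powr (s * of_rat i)"

lemma wt_pos: "wt s i > 0" using p_gt_1 by simp
lemma wt_add: "wt s (i + j) = wt s i * wt s j" by (simp add: of_rat_add distrib_left powr_add)
lemma wt_mono: "0 \<le> s \<Longrightarrow> i \<le> j \<Longrightarrow> wt s i \<le> wt s j"
  using p_gt_1 by (simp add: mult_left_mono of_rat_less_eq)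
lemma wt_le: "s \<le> t \<Longrightarrow> 0 \<le> i \<Longrightarrow> wt s i \<le> wt t i"
  using p_gt_1 by (simp add: mult_right_mono)

text \<open>Finiteness of the norm at radius \<open>s\<close>, which weights the exponent \<open>i\<close> by \<open>p\<^sup>-\<^sup>s\<^sup>i\<close>.\<close>
definition bnd :: "real \<Rightarrow> 'a series \<Rightarrow> bool" where
  "bnd s x \<longleftrightarrow> (\<exists>C. \<forall>i. N (x i) \<le> C * wt s i)"

lemma bndE: assumes "bnd s x" obtains C where "C \<ge> 0" "\<And>i. N (x i) \<le> C * wt s i"
proof -
  obtain C where C: "\<And>i. N (x i) \<le> C * wt s i" using assms unfolding bnd_def by blast
  have "N (x i) \<le> max 0 C * wt s i" for i
    using order.trans[OF C[of i] mult_right_mono[of C "max 0 C"]] wt_pos[of s i] by simp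
  thus ?thesis using that[of "max 0 C"] by simp
qed

lemma bnd_add: assumes "bnd s x" "bnd s y" shows "bnd s (\<lambda>i. x i + y i)"
proof -
  obtain C D where C: "\<And>i. N (x i) \<le> C * wt s i" and D: "\<And>i. N (y i) \<le> D * wt s i"
    using assms unfolding bnd_def by blast
  have "N (x i) \<le> max C D * wt s i" "N (y i) \<le> max C D * wt s i" for i
    using order.trans[OF C[of i] mult_right_mono[of C "max C D"]]
      order.trans[OF D[of i] mult_right_mono[of D "max C D"]] wt_pos[of s i] by simp_all
  thus ?thesis unfolding bnd_def by (intro exI[of _ "max C D"] allI N_add_le)
qed

lemma bnd_const_mult: "bnd s x \<Longrightarrow> bnd s (\<lambda>i. c * x i)"
  unfolding bnd_def
proof (elim exE)
  fix C assume "\<forall>i. N (x i) \<le> C * wt s i"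
  then have "N (c * x i) \<le> (N c * C) * wt s i" for i by (simp add: N_mult mult_left_mono mult.assoc)
  thus "\<exists>C. \<forall>i. N (c * x i) \<le> C * wt s i" by blast
qed

definition conv :: "'a series \<Rightarrow> 'a series \<Rightarrow> 'a series" (infixl "\<star>" 70) where
  "x \<star> y = (\<lambda>k. psum p v (\<lambda>i. x i * y (k - i)))"

lemma bij_reflect: "bij (\<lambda>i. k - i :: rat)"
  by (rule bij_betw_byWitness[of _ "\<lambda>i. k - i"]) auto

lemma bij_shift: "bij (\<lambda>i. i - k :: rat)"
  by (rule bij_betw_byWitness[of _ "\<lambda>i. i + k"]) auto

lemma conv_commute: "x \<star> y = y \<star> x"
proof
  fix k
  have "psum p v (\<lambda>i. (\<lambda>i. x i * y (k - i)) (k - i)) = psum p v (\<lambda>i. x i * y (k - i))"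
    by (rule psum_reindex[OF bij_reflect])
  thus "(x \<star> y) k = (y \<star> x) k" by (simp add: conv_def mult.commute)
qed

lemma conv_finite_support:
  assumes "finite A" "\<And>i. i \<notin> A \<Longrightarrow> x i * y (k - i) = 0"
  shows "(x \<star> y) k = (\<Sum>i\<in>A. x i * y (k - i))"
  unfolding conv_def using psum_eqI[OF psums_finite[OF assms]] by simp

lemma conv_const_left: "series_const c \<star> y = (\<lambda>i. c * y i)"
proof
  fix k
  have "(series_const c \<star> y) k = (\<Sum>i\<in>{0}. series_const c i * y (k - i))"
    by (rule conv_finite_support) (auto simp: series_const_def)
  thus "(series_const c \<star> y) k = c * y k" by (simp add: series_const_def)
qed

lemma conv_const_right: "y \<star> series_const c = (\<lambda>i. c * y i)"
  by (simp add: conv_commute[of y] conv_const_left)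

lemma conv_zero [simp]: "(\<lambda>_. 0) \<star> y = (\<lambda>_. 0)" "y \<star> (\<lambda>_. 0) = (\<lambda>_. 0)"
  using conv_const_left[of 0 y] conv_const_right[of y 0] by (simp_all add: series_const_def)

end

lemma series_const_0: "series_const 0 = (\<lambda>_. 0)"
  by (auto simp: series_const_def)

context complete_subfield begin

text \<open>Finite norm at two radii, hence at all radii between them. With one radius alone the terms of a coefficient
  of a product need not tend to \<open>0\<close>.\<close>
definition SR :: "real \<Rightarrow> real \<Rightarrow> 'a series set" where
  "SR a b = {x. (\<forall>i. x i \<in> L) \<and> (\<forall>e>0. well_ordered {i. N (x i) > e}) \<and> bnd a x \<and> bnd b x}"

lemma SR_in_L: "x \<in> SR a b \<Longrightarrow> x i \<in> L" by (simp add: SR_def)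
lemma SR_well_ordered: "x \<in> SR a b \<Longrightarrow> e > 0 \<Longrightarrow> well_ordered {i. N (x i) > e}" by (simp add: SR_def)

lemma SR_const: "c \<in> L \<Longrightarrow> series_const c \<in> SR a b"
proof -
  assume c: "c \<in> L"
  have "well_ordered {i. N (series_const c i) > e}" if "e > 0" for e
    by (rule well_ordered_finite, rule finite_subset[of _ "{0}"]) (use that in \<open>auto simp: series_const_def split: if_splits\<close>)
  moreover have "bnd s (series_const c)" for s
    unfolding bnd_def by (rule exI[of _ "N c"]) (use p_gt_1 in \<open>auto simp: series_const_def\<close>)
  ultimately show ?thesis using c in_L(1) by (auto simp: SR_def series_const_def)
qed

lemma well_ordered_add:
  assumes "\<And>e. e > 0 \<Longrightarrow> well_ordered {i. N (x i) > e}" "\<And>e. e > 0 \<Longrightarrow> well_ordered {i. N (y i) > e}" "e > 0"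
  shows "well_ordered {i. N (x i + y i) > e}"
  by (rule well_ordered_subset[OF well_ordered_Un[OF assms(1,2)[OF assms(3)]]])
     (use N_add_le[of _ e] in \<open>auto simp: not_less[symmetric]\<close>)

lemma well_ordered_cmult:
  assumes "\<And>e. e > 0 \<Longrightarrow> well_ordered {i. N (x i) > e}" "e > 0"
  shows "well_ordered {i. N (c * x i) > e}"
proof (cases "c = 0")
  case True thus ?thesis using assms(2) by (simp add: not_less well_ordered_empty)
next
  case False
  have "{i. N (c * x i) > e} = {i. N (x i) > e / N c}"
    using N_pos[OF False] by (auto simp: N_mult field_simps)
  thus ?thesis using assms(1)[of "e / N c"] assms(2) N_pos[OF False] by simp
qed

lemma SR_add: "x \<in> SR a b \<Longrightarrow> y \<in> SR a b \<Longrightarrow> (\<lambda>i. x i + y i) \<in> SR a b"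
  unfolding SR_def by (auto intro!: bnd_add well_ordered_add in_L(5))

lemma SR_cmult: "x \<in> SR a b \<Longrightarrow> c \<in> L \<Longrightarrow> (\<lambda>i. c * x i) \<in> SR a b"
  unfolding SR_def by (auto intro!: bnd_const_mult well_ordered_cmult in_L(6))

lemma SR_zero: "(\<lambda>_. 0) \<in> SR a b"
  using SR_const[OF in_L(1)] by (simp add: series_const_0)

lemma SR_sum: "(\<And>l. l \<in> I \<Longrightarrow> x l \<in> SR a b) \<Longrightarrow> (\<lambda>i. \<Sum>l\<in>I. x l i) \<in> SR a b"
  by (induction I rule: infinite_finite_induct) (auto simp: SR_zero SR_add)

text \<open>If the exponents sum to at most \<open>k\<close> and the product of the coefficients is not small, then no
  exponent can be very negative: being bounded at the smaller radius limits the other factors, being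
  bounded at the larger one then bounds this factor. So no coefficient can be small.\<close>
lemma SR_window:
  assumes ab: "0 < a" "a < b" and x: "x \<in> SR a b" and y: "y \<in> SR a b" and z: "z \<in> SR a b" and e: "0 < e"
  shows "\<exists>d>0. \<forall>i j l. i + j + l \<le> k \<longrightarrow> N (x i) * N (y j) * N (z l) > e \<longrightarrow>
           N (x i) > d \<and> N (y j) > d \<and> N (z l) > d"
proof -
  have "\<exists>C>0. \<forall>f\<in>{x, y, z}. \<forall>i. N (f i) \<le> C * wt a i \<and> N (f i) \<le> C * wt b i"
  proof -
    have "\<exists>C. \<forall>i. N (f i) \<le> C * wt a i \<and> N (f i) \<le> C * wt b i" if f: "f \<in> SR a b" for f
    proof -
      have fb: "bnd a f" "bnd b f" using f by (simp_all add: SR_def)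
      obtain C where C: "C \<ge> 0" "\<And>i. N (f i) \<le> C * wt a i" using bndE[OF fb(1)] by blast
      obtain D where D: "D \<ge> 0" "\<And>i. N (f i) \<le> D * wt b i" using bndE[OF fb(2)] by blast
      have "C * wt a i \<le> (C + D) * wt a i" "D * wt b i \<le> (C + D) * wt b i" for i
        using C(1) D(1) by (simp_all add: mult_right_mono)
      then have "N (f i) \<le> (C + D) * wt a i" "N (f i) \<le> (C + D) * wt b i" for i
        using C(2)[of i] D(2)[of i] order.trans by blast+
      thus ?thesis by blast
    qed
    then obtain C where C: "\<And>f i. f \<in> SR a b \<Longrightarrow> N (f i) \<le> C f * wt a i \<and> N (f i) \<le> C f * wt b i" by metis
    define D where "D = 1 + \<bar>C x\<bar> + \<bar>C y\<bar> + \<bar>C z\<bar>"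
    have "N (f i) \<le> D * wt a i \<and> N (f i) \<le> D * wt b i" if f: "f \<in> {x, y, z}" for f i
    proof -
      have fS: "f \<in> SR a b" using f x y z by auto
      have "C f \<le> D" using f by (auto simp: D_def)
      then have "C f * wt a i \<le> D * wt a i" "C f * wt b i \<le> D * wt b i"
        by (intro mult_right_mono less_imp_le[OF wt_pos], assumption)+
      thus ?thesis using C[OF fS, of i] by linarith
    qed
    moreover have "D > 0" by (simp add: D_def add_pos_nonneg)
    ultimately show ?thesis by blast
  qed
  then obtain C where C: "C > 0" "\<And>f i. f \<in> {x, y, z} \<Longrightarrow> N (f i) \<le> C * wt a i \<and> N (f i) \<le> C * wt b i" by blast
  define m where "m = (log p (e / C ^ 3) - a * of_rat k) / (b - a)"
  have low: "m < of_rat i" if fs: "f \<in> {x, y, z}" "g \<in> {x, y, z}" "h \<in> {x, y, z}" "i + j + l \<le> k"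
      and gt: "N (f i) * N (g j) * N (h l) > e" for f g h i j l
  proof -
    have "e < N (f i) * N (g j) * N (h l)" by (rule gt)
    also have "\<dots> \<le> (C * wt b i) * (C * wt a j) * (C * wt a l)"
      using C fs by (intro mult_mono) (auto intro!: mult_nonneg_nonneg less_imp_le[OF wt_pos])
    also have "\<dots> = C ^ 3 * (wt b i * wt a (j + l))" by (simp add: power3_eq_cube wt_add)
    also have "\<dots> \<le> C ^ 3 * (wt b i * wt a (k - i))"
      using C(1) fs(4) ab by (intro mult_left_mono wt_mono) auto
    also have "wt b i * wt a (k - i) = real p powr ((b - a) * of_rat i + a * of_rat k)"
      by (simp add: powr_add[symmetric] of_rat_diff algebra_simps)
    finally have "e / C ^ 3 < real p powr ((b - a) * of_rat i + a * of_rat k)"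
      using C(1) by (simp add: field_simps)
    then have "log p (e / C ^ 3) < (b - a) * of_rat i + a * of_rat k"
      using p_gt_1 e C(1) by (subst log_less_iff) auto
    thus "m < of_rat i" using ab by (simp add: m_def field_simps)
  qed
  define D where "D = C * real p powr (b * (of_rat k - 2 * m))"
  have D: "D > 0" using C(1) p_gt_1 by (simp add: D_def)
  have up: "N (f i) \<le> D" if fs: "f \<in> {x, y, z}" "g \<in> {x, y, z}" "h \<in> {x, y, z}" "i + j + l \<le> k"
      and gt: "N (f i) * N (g j) * N (h l) > e" for f g h i j l
  proof -
    have "m < of_rat j" by (rule low[of g f h j i l]) (use fs gt in \<open>auto simp: mult_ac add_ac\<close>)
    moreover have "m < of_rat l" by (rule low[of h f g l i j]) (use fs gt in \<open>auto simp: mult_ac add_ac\<close>)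
    moreover have "of_rat i + of_rat j + of_rat l \<le> (of_rat k :: real)"
      using fs(4) by (simp add: of_rat_add[symmetric] of_rat_less_eq)
    ultimately have "of_rat i \<le> of_rat k - 2 * m" by linarith
    then have "wt b i \<le> real p powr (b * (of_rat k - 2 * m))" using p_gt_1 ab by (simp add: mult_left_mono)
    then have "C * wt b i \<le> D" using C(1) by (simp add: D_def)
    thus ?thesis using C(2)[OF fs(1), of i] by linarith
  qed
  have main: "N (f i) > e / (D * D) / 2" if fs: "f \<in> {x, y, z}" "g \<in> {x, y, z}" "h \<in> {x, y, z}" "i + j + l \<le> k"
      and gt: "N (f i) * N (g j) * N (h l) > e" for f g h i j l
  proof -
    have "N (g j) \<le> D" by (rule up[of g f h j i l]) (use fs gt in \<open>auto simp: mult_ac add_ac\<close>)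
    moreover have "N (h l) \<le> D" by (rule up[of h f g l i j]) (use fs gt in \<open>auto simp: mult_ac add_ac\<close>)
    ultimately have "N (g j) * N (h l) \<le> D * D" using D by (intro mult_mono) auto
    then have "N (f i) * (N (g j) * N (h l)) \<le> N (f i) * (D * D)" by (intro mult_left_mono) auto
    then have "e < N (f i) * (D * D)" using gt by (simp add: mult.assoc)
    then have "e / (D * D) < N (f i)" using D by (simp add: field_simps)
    moreover have "0 < e / (D * D)" using e D by simp
    then have "e / (D * D) / 2 < e / (D * D)" by (rule half_less)
    ultimately show ?thesis by linarith
  qed
  show ?thesis
  proof (intro exI[of _ "e / (D * D) / 2"] conjI allI impI)
    show "0 < e / (D * D) / 2" using e D by simp
    fix i j l assume s: "i + j + l \<le> k" and gt: "N (x i) * N (y j) * N (z l) > e"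
    show "e / (D * D) / 2 < N (x i)" by (rule main[of x y z i j l]) (use s gt in auto)
    show "e / (D * D) / 2 < N (y j)" by (rule main[of y x z j i l]) (use s gt in \<open>auto simp: mult_ac add_ac\<close>)
    show "e / (D * D) / 2 < N (z l)" by (rule main[of z x y l i j]) (use s gt in \<open>auto simp: mult_ac add_ac\<close>)
  qed
qed

lemma SR_window2:
  assumes ab: "0 < a" "a < b" and x: "x \<in> SR a b" and y: "y \<in> SR a b" and e: "0 < e"
  shows "\<exists>d>0. \<forall>i j. i + j \<le> k \<longrightarrow> N (x i) * N (y j) > e \<longrightarrow> N (x i) > d \<and> N (y j) > d"
proof -
  obtain d where d: "d > 0" "\<And>i j l. i + j + l \<le> k \<Longrightarrow> N (x i) * N (y j) * N (series_const 1 l) > e \<Longrightarrow>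
           N (x i) > d \<and> N (y j) > d"
    using SR_window[OF ab x y SR_const[OF in_L(2)] e, of k] by blast
  show ?thesis using d(1) d(2)[of _ _ 0] by (auto simp: series_const_def)
qed

lemma null_conv:
  assumes ab: "0 < a" "a < b" and x: "x \<in> SR a b" and y: "y \<in> SR a b"
  shows "null_family (\<lambda>i. x i * y (k - i))"
  unfolding null_family_def
proof (intro allI impI)
  fix e :: real assume "e > 0"
  then obtain d where d: "d > 0" "\<And>i j. i + j \<le> k \<Longrightarrow> N (x i) * N (y j) > e \<Longrightarrow> N (x i) > d \<and> N (y j) > d"
    using SR_window2[OF ab x y] by blast
  have "finite {i \<in> {i. N (x i) > d}. k - i \<in> {i. N (y i) > d}}"
    using d(1) x y by (intro well_ordered_antidiagonal_finite SR_well_ordered)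
  thus "finite {i. e < N (x i * y (k - i))}"
  proof (rule rev_finite_subset, intro subsetI)
    fix i assume "i \<in> {i. e < N (x i * y (k - i))}"
    thus "i \<in> {i \<in> {i. N (x i) > d}. k - i \<in> {i. N (y i) > d}}"
      using d(2)[of i "k - i"] by (simp add: N_mult)
  qed
qed

lemma conv_psums:
  assumes ab: "0 < a" "a < b" and x: "x \<in> SR a b" and y: "y \<in> SR a b"
  shows "psums (\<lambda>i. x i * y (k - i)) ((x \<star> y) k)" "(x \<star> y) k \<in> L"
proof -
  obtain s where "s \<in> L" "psums (\<lambda>i. x i * y (k - i)) s"
    using null_family_summable[OF null_conv[OF assms]] SR_in_L[OF x] SR_in_L[OF y] in_L(6) by blast
  moreover from this have "(x \<star> y) k = s" unfolding conv_def by (intro psum_eqI)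
  ultimately show "psums (\<lambda>i. x i * y (k - i)) ((x \<star> y) k)" "(x \<star> y) k \<in> L" by auto
qed

lemma conv_bound:
  assumes "0 < a" "a < b" "x \<in> SR a b" "y \<in> SR a b" "0 \<le> C"
    and "\<And>i. N (x i) * N (y (k - i)) \<le> C"
  shows "N ((x \<star> y) k) \<le> C"
  by (rule psums_N_le[OF conv_psums(1)[OF assms(1-4)]]) (use assms in \<open>auto simp: N_mult\<close>)

lemma conv_weighted_bound:
  assumes "0 < a" "a < b" "x \<in> SR a b" "y \<in> SR a b" "0 \<le> C" "0 \<le> D"
    and "\<And>i. N (x i) \<le> C * wt s i" "\<And>i. N (y i) \<le> D * wt s i"
  shows "N ((x \<star> y) k) \<le> C * D * wt s k"
proof (rule conv_bound[OF assms(1-4)])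
  show "0 \<le> C * D * wt s k" using assms(5,6) by simp
  fix i
  have "N (x i) * N (y (k - i)) \<le> (C * wt s i) * (D * wt s (k - i))"
    using assms by (intro mult_mono) auto
  also have "\<dots> = C * D * wt s k" using wt_add[of s i "k - i"] by simp
  finally show "N (x i) * N (y (k - i)) \<le> C * D * wt s k" .
qed

lemma SR_conv:
  assumes ab: "0 < a" "a < b" and x: "x \<in> SR a b" and y: "y \<in> SR a b"
  shows "x \<star> y \<in> SR a b"
proof -
  have "well_ordered {k. N ((x \<star> y) k) > e}" if e: "e > 0" for e
  proof (rule well_orderedI)
    fix f :: "nat \<Rightarrow> rat" assume f: "\<And>n. f n \<in> {k. N ((x \<star> y) k) > e}" and dec: "\<And>n. f (Suc n) < f n"
    obtain d where d: "d > 0" "\<And>i j. i + j \<le> f 0 \<Longrightarrow> N (x i) * N (y j) > e \<Longrightarrow> N (x i) > d \<and> N (y j) > d"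
      using SR_window2[OF ab x y e] by blast
    have "f n \<in> {i + j | i j. i \<in> {i. N (x i) > d} \<and> j \<in> {i. N (y i) > d}}" for n
    proof -
      have le: "f n \<le> f 0" using decreasing_seq_less[of f 0 n] dec by (cases "n = 0") auto
      have "\<exists>i. N (x i) * N (y (f n - i)) > e"
      proof (rule ccontr)
        assume "\<nexists>i. N (x i) * N (y (f n - i)) > e"
        then have "N ((x \<star> y) (f n)) \<le> e"
          using e by (intro conv_bound[OF ab x y]) (auto simp: not_less)
        thus False using f[of n] by simp
      qed
      then obtain i where i: "N (x i) * N (y (f n - i)) > e" by blast
      then have "N (x i) > d \<and> N (y (f n - i)) > d" using le by (intro d(2)) auto
      thus ?thesis by (intro CollectI exI[of _ i] exI[of _ "f n - i"]) simp
    qed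
    thus False using well_orderedD[OF well_ordered_sum, of _ _ f] d(1) dec
        SR_well_ordered[OF x, of d] SR_well_ordered[OF y, of d] by blast
  qed
  moreover have "bnd s (x \<star> y)" if s: "bnd s x" "bnd s y" for s
  proof -
    obtain C D where C: "C \<ge> 0" "\<And>i. N (x i) \<le> C * wt s i" and D: "D \<ge> 0" "\<And>i. N (y i) \<le> D * wt s i"
      using s bndE by metis
    have "N ((x \<star> y) k) \<le> C * D * wt s k" for k by (rule conv_weighted_bound[OF ab x y C(1) D(1) C(2) D(2)])
    thus ?thesis unfolding bnd_def by blast
  qed
  ultimately show ?thesis using conv_psums(2)[OF assms] x y unfolding SR_def by blast
qed

lemma conv_add_left:
  assumes "0 < a" "a < b" "x \<in> SR a b" "y \<in> SR a b" "z \<in> SR a b"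
  shows "(\<lambda>i. x i + y i) \<star> z = (\<lambda>i. (x \<star> z) i + (y \<star> z) i)"
proof
  fix k
  have "psums (\<lambda>i. x i * z (k - i) + y i * z (k - i)) ((x \<star> z) k + (y \<star> z) k)"
    using assms by (intro psums_add conv_psums)
  thus "((\<lambda>i. x i + y i) \<star> z) k = (x \<star> z) k + (y \<star> z) k"
    unfolding conv_def[of "\<lambda>i. x i + y i"] by (intro psum_eqI) (simp add: distrib_right)
qed

lemma conv_add_right:
  assumes "0 < a" "a < b" "x \<in> SR a b" "y \<in> SR a b" "z \<in> SR a b"
  shows "z \<star> (\<lambda>i. x i + y i) = (\<lambda>i. (z \<star> x) i + (z \<star> y) i)"
  using conv_add_left[OF assms] by (simp add: conv_commute)

lemma conv_cmult_left:
  assumes "0 < a" "a < b" "x \<in> SR a b" "y \<in> SR a b"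
  shows "(\<lambda>i. c * x i) \<star> y = (\<lambda>i. c * (x \<star> y) i)"
proof
  fix k
  have "psums (\<lambda>i. c * (x i * y (k - i))) (c * (x \<star> y) k)"
    using assms by (intro psums_cmult conv_psums)
  thus "((\<lambda>i. c * x i) \<star> y) k = c * (x \<star> y) k"
    unfolding conv_def[of "\<lambda>i. c * x i"] by (intro psum_eqI) (simp add: mult.assoc)
qed

lemma conv_sum_left:
  assumes "0 < a" "a < b" "\<And>l. l \<in> I \<Longrightarrow> x l \<in> SR a b" "y \<in> SR a b"
  shows "(\<lambda>i. \<Sum>l\<in>I. x l i) \<star> y = (\<lambda>i. \<Sum>l\<in>I. (x l \<star> y) i)"
  using assms(3)
proof (induction I rule: infinite_finite_induct)
  case (insert l I)
  have "(\<lambda>i. x l i + (\<Sum>l\<in>I. x l i)) \<star> y = (\<lambda>i. (x l \<star> y) i + ((\<lambda>i. \<Sum>l\<in>I. x l i) \<star> y) i)"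
    by (rule conv_add_left[OF assms(1,2)]) (use insert assms(4) SR_sum[of I x a b] in auto)
  thus ?case using insert by simp
qed simp_all

lemma conv_sum_right:
  assumes "0 < a" "a < b" "\<And>l. l \<in> I \<Longrightarrow> x l \<in> SR a b" "y \<in> SR a b"
  shows "y \<star> (\<lambda>i. \<Sum>l\<in>I. x l i) = (\<lambda>i. \<Sum>l\<in>I. (y \<star> x l) i)"
  using conv_sum_left[OF assms] by (simp add: conv_commute[of y])

text \<open>Both bracketings sum the same null family over the pairs of exponents, in the two possible orders.\<close>
lemma conv_assoc:
  assumes ab: "0 < a" "a < b" and x: "x \<in> SR a b" and y: "y \<in> SR a b" and z: "z \<in> SR a b"
  shows "(x \<star> y) \<star> z = x \<star> (y \<star> z)"
proof
  fix k
  define f where "f = (\<lambda>(m, i). x i * y (m - i) * z (k - m))"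
  have fL: "f q \<in> L" for q unfolding f_def
    by (cases q) (auto intro!: in_L(6) SR_in_L[OF x] SR_in_L[OF y] SR_in_L[OF z])
  have null: "null_family f"
    unfolding null_family_def
  proof (intro allI impI)
    fix e :: real assume "e > 0"
    then obtain d where d: "d > 0" "\<And>i j l. i + j + l \<le> k \<Longrightarrow> N (x i) * N (y j) * N (z l) > e \<Longrightarrow>
           N (x i) > d \<and> N (y j) > d \<and> N (z l) > d"
      using SR_window[OF ab x y z] by blast
    define A where "A = {i. N (x i) > d}"
    define B where "B = {i. N (y i) > d}"
    define C where "C = {i. N (z i) > d}"
    have wo: "well_ordered A" "well_ordered B" "well_ordered C"
      using d(1) x y z by (auto simp: A_def B_def C_def intro: SR_well_ordered)
    have "finite {i \<in> A. k - i \<in> {j + l | j l. j \<in> B \<and> l \<in> C}}"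
      by (intro well_ordered_antidiagonal_finite well_ordered_sum wo)
    moreover have "finite {j \<in> B. k - i - j \<in> C}" for i by (intro well_ordered_antidiagonal_finite wo)
    ultimately have "finite (SIGMA i:{i \<in> A. k - i \<in> {j + l | j l. j \<in> B \<and> l \<in> C}}. {j \<in> B. k - i - j \<in> C})"
      by (intro finite_SigmaI)
    then have "finite ((\<lambda>(i, j). (i + j, i)) ` (SIGMA i:{i \<in> A. k - i \<in> {j + l | j l. j \<in> B \<and> l \<in> C}}. {j \<in> B. k - i - j \<in> C}))"
      by (rule finite_imageI)
    thus "finite {q. e < N (f q)}"
    proof (rule rev_finite_subset, intro subsetI)
      fix q assume "q \<in> {q. e < N (f q)}"
      moreover obtain m i where q: "q = (m, i)" by (cases q)
      ultimately have "N (x i) > d \<and> N (y (m - i)) > d \<and> N (z (k - m)) > d"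
        by (intro d(2)) (auto simp: f_def N_mult)
      then have *: "i \<in> A" "m - i \<in> B" "k - m \<in> C" by (auto simp: A_def B_def C_def)
      have "k - i \<in> {j + l | j l. j \<in> B \<and> l \<in> C}"
        using * by (intro CollectI exI[of _ "m - i"] exI[of _ "k - m"]) simp
      then have "(i, m - i) \<in> (SIGMA i:{i \<in> A. k - i \<in> {j + l | j l. j \<in> B \<and> l \<in> C}}. {j \<in> B. k - i - j \<in> C})"
        using * by auto
      thus "q \<in> (\<lambda>(i, j). (i + j, i)) ` (SIGMA i:{i \<in> A. k - i \<in> {j + l | j l. j \<in> B \<and> l \<in> C}}. {j \<in> B. k - i - j \<in> C})"
        by (rule rev_image_eqI) (simp add: q)
    qed
  qed
  obtain S where S: "psums f S" using null_family_summable[OF null fL] by blast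
  have "psums (\<lambda>m. (x \<star> y) m * z (k - m)) S"
  proof (rule psums_iterated[OF null S])
    fix m
    show "psums (\<lambda>i. f (m, i)) ((x \<star> y) m * z (k - m))"
      using psums_cmult[OF conv_psums(1)[OF ab x y, of m], of "z (k - m)"] by (simp add: f_def mult_ac)
  qed
  then have 1: "((x \<star> y) \<star> z) k = S" unfolding conv_def[of "x \<star> y"] by (rule psum_eqI)
  define g where "g q = f (snd q, fst q)" for q
  have bij: "bij (\<lambda>q::rat \<times> rat. (snd q, fst q))"
    by (rule bij_betw_byWitness[of _ "\<lambda>q. (snd q, fst q)"]) auto
  have S': "psums g S" unfolding g_def by (rule psums_reindex[OF S bij])
  have null': "null_family g"
    unfolding null_family_def
  proof (intro allI impI)
    fix e :: real assume "e > 0"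
    then have "finite ((\<lambda>q. (snd q, fst q)) ` {q. e < N (f q)})" using null by (simp add: null_family_def)
    thus "finite {q. e < N (g q)}" by (rule rev_finite_subset) (force simp: g_def)
  qed
  have "psums (\<lambda>i. x i * (y \<star> z) (k - i)) S"
  proof (rule psums_iterated[OF null' S'])
    fix i
    have "psums (\<lambda>j. x i * (y j * z (k - i - j))) (x i * (y \<star> z) (k - i))"
      by (rule psums_cmult[OF conv_psums(1)[OF ab y z]])
    from psums_reindex[OF this bij_shift[of i]]
    show "psums (\<lambda>j. g (i, j)) (x i * (y \<star> z) (k - i))"
      by (simp add: g_def f_def mult.assoc)
  qed
  then have 2: "(x \<star> (y \<star> z)) k = S" unfolding conv_def[of x] by (rule psum_eqI)
  show "((x \<star> y) \<star> z) k = (x \<star> (y \<star> z)) k" using 1 2 by simp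
qed

end

section \<open>Eigenbases as matrices\<close>

lemma (in abelian_monoid) finsum_swap:
  assumes "finite I" "finite J" "\<And>i j. i \<in> I \<Longrightarrow> j \<in> J \<Longrightarrow> f i j \<in> carrier G"
  shows "(\<Oplus>i\<in>I. \<Oplus>j\<in>J. f i j) = (\<Oplus>j\<in>J. \<Oplus>i\<in>I. f i j)"
  using assms(1,3)
proof (induction I rule: finite_induct)
  case (insert i I)
  have "(\<Oplus>j\<in>J. \<Oplus>i\<in>insert i I. f i j) = (\<Oplus>j\<in>J. f i j \<oplus> (\<Oplus>i\<in>I. f i j))"
    using insert by (intro finsum_cong') (auto intro!: finsum_closed)
  also have "\<dots> = (\<Oplus>j\<in>J. f i j) \<oplus> (\<Oplus>j\<in>J. \<Oplus>i\<in>I. f i j)"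
    using insert by (intro finsum_addf) (auto intro!: finsum_closed)
  finally show ?case using insert by (subst finsum_insert) (auto intro!: finsum_closed)
qed (simp add: finsum_zero)

lemma (in semiring) finsum_delta:
  assumes "finite I" "i \<in> I" "c \<in> I \<rightarrow> carrier R"
  shows "(\<Oplus>j\<in>I. c j \<otimes> (if j = i then \<one> else \<zero>)) = c i"
    "(\<Oplus>j\<in>I. c j \<otimes> (if i = j then \<one> else \<zero>)) = c i"
proof -
  have "(\<Oplus>j\<in>I. c j \<otimes> (if j = i then \<one> else \<zero>)) = (\<Oplus>j\<in>I. if i = j then c j else \<zero>)"
    using assms by (intro finsum_cong') (auto simp: Pi_iff)
  also have "\<dots> = c i" using assms by (intro finsum_singleton) auto
  finally show "(\<Oplus>j\<in>I. c j \<otimes> (if j = i then \<one> else \<zero>)) = c i" .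
  moreover have "(\<Oplus>j\<in>I. c j \<otimes> (if i = j then \<one> else \<zero>)) = (\<Oplus>j\<in>I. c j \<otimes> (if j = i then \<one> else \<zero>))"
    using assms by (intro finsum_cong') (auto simp: Pi_iff)
  ultimately show "(\<Oplus>j\<in>I. c j \<otimes> (if i = j then \<one> else \<zero>)) = c i" by simp
qed

lemma (in semiring) finsum_mult_assoc:
  assumes "finite I" "finite J" "\<And>j. j \<in> J \<Longrightarrow> a j \<in> carrier R"
    "\<And>i j. i \<in> I \<Longrightarrow> j \<in> J \<Longrightarrow> b j i \<in> carrier R" "\<And>i. i \<in> I \<Longrightarrow> c i \<in> carrier R"
  shows "(\<Oplus>j\<in>J. a j \<otimes> (\<Oplus>i\<in>I. b j i \<otimes> c i)) = (\<Oplus>i\<in>I. (\<Oplus>j\<in>J. a j \<otimes> b j i) \<otimes> c i)"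
proof -
  have "(\<Oplus>j\<in>J. a j \<otimes> (\<Oplus>i\<in>I. b j i \<otimes> c i)) = (\<Oplus>j\<in>J. \<Oplus>i\<in>I. a j \<otimes> b j i \<otimes> c i)"
    using assms by (intro finsum_cong') (auto simp: finsum_rdistr m_assoc intro!: finsum_cong' finsum_closed)
  also have "\<dots> = (\<Oplus>i\<in>I. \<Oplus>j\<in>J. a j \<otimes> b j i \<otimes> c i)"
    using assms by (intro finsum_swap) auto
  also have "\<dots> = (\<Oplus>i\<in>I. (\<Oplus>j\<in>J. a j \<otimes> b j i) \<otimes> c i)"
    using assms by (intro finsum_cong') (auto simp: finsum_ldistr intro!: finsum_closed)
  finally show ?thesis .
qed

definition lin :: "('r, 'm, 'y) module_scheme \<Rightarrow> nat \<Rightarrow> (nat \<Rightarrow> 'm) \<Rightarrow> (nat \<Rightarrow> 'r) \<Rightarrow> 'm" where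
  "lin M n b c = (\<Oplus>\<^bsub>M\<^esub>i\<in>{..<n}. c i \<odot>\<^bsub>M\<^esub> b i)"

context module begin

lemma lin_closed: "(\<And>i. i < n \<Longrightarrow> b i \<in> carrier M) \<Longrightarrow> (\<And>i. i < n \<Longrightarrow> c i \<in> carrier R) \<Longrightarrow> lin M n b c \<in> carrier M"
  unfolding lin_def by (rule M.finsum_closed) auto

lemma lin_cong: "(\<And>i. i < n \<Longrightarrow> b i \<in> carrier M) \<Longrightarrow> (\<And>i. i < n \<Longrightarrow> d i \<in> carrier R) \<Longrightarrow>
    (\<And>i. i < n \<Longrightarrow> c i = d i) \<Longrightarrow> lin M n b c = lin M n b d"
  unfolding lin_def by (rule M.finsum_cong') auto

lemma lin_add:
  assumes "\<And>i. i < n \<Longrightarrow> b i \<in> carrier M" "\<And>i. i < n \<Longrightarrow> c i \<in> carrier R" "\<And>i. i < n \<Longrightarrow> d i \<in> carrier R"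
  shows "lin M n b (\<lambda>i. c i \<oplus> d i) = lin M n b c \<oplus>\<^bsub>M\<^esub> lin M n b d"
proof -
  have "lin M n b (\<lambda>i. c i \<oplus> d i) = (\<Oplus>\<^bsub>M\<^esub>i\<in>{..<n}. c i \<odot>\<^bsub>M\<^esub> b i \<oplus>\<^bsub>M\<^esub> d i \<odot>\<^bsub>M\<^esub> b i)"
    unfolding lin_def using assms by (intro M.finsum_cong') (auto simp: smult_l_distr)
  thus ?thesis unfolding lin_def using assms by (subst (asm) M.finsum_addf) auto
qed

lemma lin_smult:
  assumes "\<And>i. i < n \<Longrightarrow> b i \<in> carrier M" "\<And>i. i < n \<Longrightarrow> c i \<in> carrier R" "a \<in> carrier R"
  shows "lin M n b (\<lambda>i. a \<otimes> c i) = a \<odot>\<^bsub>M\<^esub> lin M n b c"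
proof -
  have "lin M n b (\<lambda>i. a \<otimes> c i) = (\<Oplus>\<^bsub>M\<^esub>i\<in>{..<n}. a \<odot>\<^bsub>M\<^esub> (c i \<odot>\<^bsub>M\<^esub> b i))"
    unfolding lin_def using assms by (intro M.finsum_cong') (auto simp: smult_assoc1)
  thus ?thesis unfolding lin_def using assms finsum_smult_ldistr[of "{..<n}" a "\<lambda>i. c i \<odot>\<^bsub>M\<^esub> b i"] by auto
qed

lemma lin_zero: "(\<And>i. i < n \<Longrightarrow> b i \<in> carrier M) \<Longrightarrow> lin M n b (\<lambda>_. \<zero>) = \<zero>\<^bsub>M\<^esub>"
  unfolding lin_def by (subst M.finsum_cong'[of _ _ "\<lambda>_. \<zero>\<^bsub>M\<^esub>"]) (auto simp: M.finsum_zero)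

lemma lin_finsum:
  fixes m :: nat
  assumes "\<And>i. i < n \<Longrightarrow> b i \<in> carrier M" "\<And>j. j < m \<Longrightarrow> a j \<in> carrier R"
    "\<And>i j. i < n \<Longrightarrow> j < m \<Longrightarrow> c j i \<in> carrier R"
  shows "(\<Oplus>\<^bsub>M\<^esub>j\<in>{..<m}. a j \<odot>\<^bsub>M\<^esub> lin M n b (c j)) = lin M n b (\<lambda>i. \<Oplus>j\<in>{..<m}. a j \<otimes> c j i)"
  using assms(2,3)
proof (induction m)
  case (Suc m)
  have IH: "(\<Oplus>\<^bsub>M\<^esub>j\<in>{..<m}. a j \<odot>\<^bsub>M\<^esub> lin M n b (c j)) = lin M n b (\<lambda>i. \<Oplus>j\<in>{..<m}. a j \<otimes> c j i)"
    using Suc by auto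
  have cl: "lin M n b (c j) \<in> carrier M" if "j < Suc m" for j using Suc that assms(1) by (intro lin_closed) auto
  have "(\<Oplus>\<^bsub>M\<^esub>j\<in>{..<Suc m}. a j \<odot>\<^bsub>M\<^esub> lin M n b (c j))
      = a m \<odot>\<^bsub>M\<^esub> lin M n b (c m) \<oplus>\<^bsub>M\<^esub> lin M n b (\<lambda>i. \<Oplus>j\<in>{..<m}. a j \<otimes> c j i)"
    unfolding lessThan_Suc IH[symmetric] using Suc cl by (subst M.finsum_insert) auto
  also have "a m \<odot>\<^bsub>M\<^esub> lin M n b (c m) = lin M n b (\<lambda>i. a m \<otimes> c m i)"
    using Suc assms(1) by (intro lin_smult[symmetric]) auto
  also have "lin M n b (\<lambda>i. a m \<otimes> c m i) \<oplus>\<^bsub>M\<^esub> lin M n b (\<lambda>i. \<Oplus>j\<in>{..<m}. a j \<otimes> c j i)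
      = lin M n b (\<lambda>i. a m \<otimes> c m i \<oplus> (\<Oplus>j\<in>{..<m}. a j \<otimes> c j i))"
    using Suc assms(1) by (intro lin_add[symmetric]) (auto intro!: R.finsum_closed)
  also have "\<dots> = lin M n b (\<lambda>i. \<Oplus>j\<in>{..<Suc m}. a j \<otimes> c j i)"
    using Suc assms(1) by (intro lin_cong) (auto simp: lessThan_Suc intro!: R.finsum_closed)
  finally show ?case .
qed (use assms(1) in \<open>simp add: lin_zero\<close>)

lemma lin_delta:
  assumes "\<And>i. i < n \<Longrightarrow> b i \<in> carrier M" "j < n"
  shows "lin M n b (\<lambda>i. if i = j then \<one> else \<zero>) = b j"
proof -
  have "lin M n b (\<lambda>i. if i = j then \<one> else \<zero>) = (\<Oplus>\<^bsub>M\<^esub>i\<in>{..<n}. if j = i then b i else \<zero>\<^bsub>M\<^esub>)"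
    unfolding lin_def using assms by (intro M.finsum_cong') auto
  also have "\<dots> = b j" using assms by (intro M.finsum_singleton) auto
  finally show ?thesis .
qed

lemma is_basis_iff:
  "is_basis R M n b \<longleftrightarrow> (\<forall>i<n. b i \<in> carrier M) \<and>
     (\<forall>m\<in>carrier M. \<exists>c. (\<forall>i<n. c i \<in> carrier R) \<and> m = lin M n b c) \<and>
     (\<forall>c d. (\<forall>i<n. c i \<in> carrier R) \<longrightarrow> (\<forall>i<n. d i \<in> carrier R) \<longrightarrow> lin M n b c = lin M n b d \<longrightarrow> (\<forall>i<n. c i = d i))"
    (is "_ = (?B \<and> ?S \<and> ?I)")
proof
  assume bas: "is_basis R M n b"
  then have B: ?B by (auto simp: is_basis_def)
  have ex1: "\<exists>!c. c \<in> {..<n} \<rightarrow>\<^sub>E carrier R \<and> m = lin M n b c" if "m \<in> carrier M" for m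
    using bas that unfolding is_basis_def lin_def by blast
  have ?S
  proof
    fix m assume "m \<in> carrier M"
    then obtain c where "c \<in> {..<n} \<rightarrow>\<^sub>E carrier R" "m = lin M n b c" using ex1 by blast
    thus "\<exists>c. (\<forall>i<n. c i \<in> carrier R) \<and> m = lin M n b c" by (intro exI[of _ c]) auto
  qed
  moreover have ?I
  proof (intro allI impI)
    fix c d i assume c: "\<forall>i<n. c i \<in> carrier R" and d: "\<forall>i<n. d i \<in> carrier R" and eq: "lin M n b c = lin M n b d" and i: "i < n"
    have "lin M n b (restrict c {..<n}) = lin M n b c" "lin M n b (restrict d {..<n}) = lin M n b d"
      using B c d by (auto intro!: lin_cong)
    moreover have "restrict c {..<n} \<in> {..<n} \<rightarrow>\<^sub>E carrier R" "restrict d {..<n} \<in> {..<n} \<rightarrow>\<^sub>E carrier R"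
      using c d by auto
    moreover have "lin M n b c \<in> carrier M" using B c by (intro lin_closed) auto
    ultimately have "restrict c {..<n} = restrict d {..<n}" using ex1[of "lin M n b c"] eq by metis
    thus "c i = d i" using i by (metis lessThan_iff restrict_apply')
  qed
  ultimately show "?B \<and> ?S \<and> ?I" using B by blast
next
  assume *: "?B \<and> ?S \<and> ?I"
  then have B: ?B and S: ?S and I: ?I by blast+
  show "is_basis R M n b"
    unfolding is_basis_def
  proof (intro conjI ballI)
    show "b \<in> {..<n} \<rightarrow> carrier M" using B by auto
    fix m assume m: "m \<in> carrier M"
    obtain c where c: "\<forall>i<n. c i \<in> carrier R" "m = lin M n b c" using S m by blast
    show "\<exists>!c. c \<in> {..<n} \<rightarrow>\<^sub>E carrier R \<and> m = (\<Oplus>\<^bsub>M\<^esub>i\<in>{..<n}. c i \<odot>\<^bsub>M\<^esub> b i)"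
    proof (rule ex1I[of _ "restrict c {..<n}"])
      have "lin M n b (restrict c {..<n}) = lin M n b c" using B c by (intro lin_cong) auto
      thus "restrict c {..<n} \<in> {..<n} \<rightarrow>\<^sub>E carrier R \<and> m = (\<Oplus>\<^bsub>M\<^esub>i\<in>{..<n}. restrict c {..<n} i \<odot>\<^bsub>M\<^esub> b i)"
        using c unfolding lin_def by auto
      fix d assume d: "d \<in> {..<n} \<rightarrow>\<^sub>E carrier R \<and> m = (\<Oplus>\<^bsub>M\<^esub>i\<in>{..<n}. d i \<odot>\<^bsub>M\<^esub> b i)"
      then have "\<forall>i<n. d i \<in> carrier R" "lin M n b c = lin M n b d" using c(2) unfolding lin_def by auto
      then have eq: "\<forall>i<n. c i = d i" using I c(1) by blast
      show "d = restrict c {..<n}"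
      proof
        fix i show "d i = restrict c {..<n} i"
          using d eq by (cases "i < n") (auto simp: PiE_def extensional_def)
      qed
    qed
  qed
qed

end

text \<open>\<open>U\<close> and \<open>V\<close> are the mutually inverse matrices of a change of basis from a basis on which \<open>F\<close> has
  matrix \<open>B\<close> to a basis of eigenvectors with eigenvalues \<open>l\<close>.\<close>
definition eigenmatrix ::
  "('r, 'x) ring_scheme \<Rightarrow> ('r \<Rightarrow> 'r) \<Rightarrow> nat \<Rightarrow> (nat \<Rightarrow> nat \<Rightarrow> 'r) \<Rightarrow> nat \<Rightarrow>
     (nat \<Rightarrow> nat \<Rightarrow> 'r) \<Rightarrow> (nat \<Rightarrow> nat \<Rightarrow> 'r) \<Rightarrow> (nat \<Rightarrow> 'r) \<Rightarrow> bool" where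
  "eigenmatrix S \<tau> n B m U V l \<longleftrightarrow>
     (\<forall>i<n. \<forall>j<m. U i j \<in> carrier S) \<and> (\<forall>i<m. \<forall>j<n. V i j \<in> carrier S) \<and>
     (\<forall>i<n. \<forall>j<n. (\<Oplus>\<^bsub>S\<^esub>k\<in>{..<m}. U i k \<otimes>\<^bsub>S\<^esub> V k j) = (if i = j then \<one>\<^bsub>S\<^esub> else \<zero>\<^bsub>S\<^esub>)) \<and>
     (\<forall>i<m. \<forall>j<m. (\<Oplus>\<^bsub>S\<^esub>k\<in>{..<n}. V i k \<otimes>\<^bsub>S\<^esub> U k j) = (if i = j then \<one>\<^bsub>S\<^esub> else \<zero>\<^bsub>S\<^esub>)) \<and>
     (\<forall>i<n. \<forall>j<m. (\<Oplus>\<^bsub>S\<^esub>k\<in>{..<n}. B i k \<otimes>\<^bsub>S\<^esub> \<tau> (U k j)) = l j \<otimes>\<^bsub>S\<^esub> U i j)"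

lemma (in module) eigenbasis_slopes_iff:
  assumes bas: "is_basis R M n e" and B: "\<And>i j. i < n \<Longrightarrow> j < n \<Longrightarrow> B i j \<in> carrier R"
    and \<tau>: "\<And>a. a \<in> carrier R \<Longrightarrow> \<tau> a \<in> carrier R"
    and F: "\<And>x. x \<in> carrier M \<Longrightarrow> F x \<in> carrier M"
    and F_add: "\<And>x y. x \<in> carrier M \<Longrightarrow> y \<in> carrier M \<Longrightarrow> F (x \<oplus>\<^bsub>M\<^esub> y) = F x \<oplus>\<^bsub>M\<^esub> F y"
    and F_smult: "\<And>a x. a \<in> carrier R \<Longrightarrow> x \<in> carrier M \<Longrightarrow> F (a \<odot>\<^bsub>M\<^esub> x) = \<tau> a \<odot>\<^bsub>M\<^esub> F x"
    and F_e: "\<And>j. j < n \<Longrightarrow> F (e j) = lin M n e (\<lambda>i. B i j)"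
    and c: "\<And>x. x \<in> L \<Longrightarrow> c x \<in> carrier R"
  shows "eigenbasis_slopes v L c R M F Sl \<longleftrightarrow>
    (\<exists>m U V l. (\<forall>i<m. l i \<in> L \<and> l i \<noteq> 0) \<and> eigenmatrix R \<tau> n B m U V (\<lambda>i. c (l i)) \<and>
       Sl = image_mset (\<lambda>i. v (l i)) (mset_set {..<m}))"
proof -
  have e: "\<And>i. i < n \<Longrightarrow> e i \<in> carrier M"
    and e_span: "\<And>m. m \<in> carrier M \<Longrightarrow> \<exists>c. (\<forall>i<n. c i \<in> carrier R) \<and> m = lin M n e c"
    and e_inj: "\<And>c d i. \<forall>i<n. c i \<in> carrier R \<Longrightarrow> \<forall>i<n. d i \<in> carrier R \<Longrightarrow> lin M n e c = lin M n e d \<Longrightarrow> i < n \<Longrightarrow> c i = d i"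
    using bas unfolding is_basis_iff by blast+
  have F_zero: "F \<zero>\<^bsub>M\<^esub> = \<zero>\<^bsub>M\<^esub>"
    using F_add[of "\<zero>\<^bsub>M\<^esub>" "\<zero>\<^bsub>M\<^esub>"] F[of "\<zero>\<^bsub>M\<^esub>"] by (metis M.add.l_cancel_one M.zero_closed M.l_zero)
  have F_sum: "F (\<Oplus>\<^bsub>M\<^esub>i\<in>{..<k}. x i) = (\<Oplus>\<^bsub>M\<^esub>i\<in>{..<k}. F (x i))" if "\<forall>i<k. x i \<in> carrier M" for k :: nat and x
    using that
  proof (induction k)
    case (Suc k)
    have "(\<Oplus>\<^bsub>M\<^esub>i\<in>{..<Suc k}. x i) = x k \<oplus>\<^bsub>M\<^esub> (\<Oplus>\<^bsub>M\<^esub>i\<in>{..<k}. x i)"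
      "(\<Oplus>\<^bsub>M\<^esub>i\<in>{..<Suc k}. F (x i)) = F (x k) \<oplus>\<^bsub>M\<^esub> (\<Oplus>\<^bsub>M\<^esub>i\<in>{..<k}. F (x i))"
      using Suc F by (auto simp: lessThan_Suc M.finsum_insert)
    thus ?case using Suc F_add[of "x k" "\<Oplus>\<^bsub>M\<^esub>i\<in>{..<k}. x i"] by (auto intro!: M.finsum_closed)
  qed (simp add: F_zero)
  have F_lin: "F (lin M n e u) = lin M n e (\<lambda>i. \<Oplus>k\<in>{..<n}. B i k \<otimes> \<tau> (u k))" if u: "\<forall>i<n. u i \<in> carrier R" for u
  proof -
    have "F (lin M n e u) = (\<Oplus>\<^bsub>M\<^esub>k\<in>{..<n}. F (u k \<odot>\<^bsub>M\<^esub> e k))"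
      unfolding lin_def using u e by (intro F_sum) auto
    also have "\<dots> = (\<Oplus>\<^bsub>M\<^esub>k\<in>{..<n}. \<tau> (u k) \<odot>\<^bsub>M\<^esub> lin M n e (\<lambda>i. B i k))"
      using u e \<tau> B by (intro M.finsum_cong') (auto simp: F_smult F_e intro!: lin_closed)
    also have "\<dots> = lin M n e (\<lambda>i. \<Oplus>k\<in>{..<n}. \<tau> (u k) \<otimes> B i k)"
      using u e \<tau> B by (intro lin_finsum) auto
    also have "\<dots> = lin M n e (\<lambda>i. \<Oplus>k\<in>{..<n}. B i k \<otimes> \<tau> (u k))"
      using u e \<tau> B by (intro lin_cong) (auto intro!: R.finsum_closed R.finsum_cong' simp: R.m_comm)
    finally show ?thesis .
  qed
  show ?thesis
  proof
    assume "eigenbasis_slopes v L c R M F Sl"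
    then obtain m b l where b: "is_basis R M m b" "\<And>i. i < m \<Longrightarrow> l i \<in> L \<and> l i \<noteq> 0 \<and> F (b i) = c (l i) \<odot>\<^bsub>M\<^esub> b i"
        "Sl = image_mset (\<lambda>i. v (l i)) (mset_set {..<m})"
      unfolding eigenbasis_slopes_def by blast
    have bM: "\<And>i. i < m \<Longrightarrow> b i \<in> carrier M"
      and b_span: "\<And>x. x \<in> carrier M \<Longrightarrow> \<exists>c. (\<forall>i<m. c i \<in> carrier R) \<and> x = lin M m b c"
      and b_inj: "\<And>c d i. \<forall>i<m. c i \<in> carrier R \<Longrightarrow> \<forall>i<m. d i \<in> carrier R \<Longrightarrow> lin M m b c = lin M m b d \<Longrightarrow> i < m \<Longrightarrow> c i = d i"
      using b(1) unfolding is_basis_iff by blast+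
    have "\<forall>j. \<exists>u. j < m \<longrightarrow> (\<forall>i<n. u i \<in> carrier R) \<and> b j = lin M n e u" using e_span bM by blast
    then obtain U' where U': "\<And>j i. j < m \<Longrightarrow> i < n \<Longrightarrow> U' j i \<in> carrier R" "\<And>j. j < m \<Longrightarrow> b j = lin M n e (U' j)" by metis
    have "\<forall>j. \<exists>u. j < n \<longrightarrow> (\<forall>i<m. u i \<in> carrier R) \<and> e j = lin M m b u" using b_span e by blast
    then obtain V' where V': "\<And>j i. j < n \<Longrightarrow> i < m \<Longrightarrow> V' j i \<in> carrier R" "\<And>j. j < n \<Longrightarrow> e j = lin M m b (V' j)" by metis
    define U where "U i j = U' j i" for i j
    define V where "V i j = V' j i" for i j
    have UV: "(\<Oplus>k\<in>{..<m}. U i k \<otimes> V k j) = (if i = j then \<one> else \<zero>)" if ij: "i < n" "j < n" for i j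
    proof -
      have "lin M n e (\<lambda>i. if i = j then \<one> else \<zero>) = e j" using e ij by (intro lin_delta) auto
      also have "e j = (\<Oplus>\<^bsub>M\<^esub>k\<in>{..<m}. V' j k \<odot>\<^bsub>M\<^esub> b k)" using V'(2)[OF ij(2)] by (simp add: lin_def)
      also have "\<dots> = (\<Oplus>\<^bsub>M\<^esub>k\<in>{..<m}. V' j k \<odot>\<^bsub>M\<^esub> lin M n e (U' k))"
        using V'(1) U' bM ij e by (intro M.finsum_cong') (auto intro!: lin_closed)
      also have "\<dots> = lin M n e (\<lambda>i. \<Oplus>k\<in>{..<m}. V' j k \<otimes> U' k i)"
        using V'(1) U' e ij by (intro lin_finsum) auto
      finally have "(if i = j then \<one> else \<zero>) = (\<Oplus>k\<in>{..<m}. V' j k \<otimes> U' k i)"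
        using V'(1) U'(1) ij by (intro e_inj[of "\<lambda>i. if i = j then \<one> else \<zero>"]) (auto intro!: R.finsum_closed)
      also have "\<dots> = (\<Oplus>k\<in>{..<m}. U i k \<otimes> V k j)"
        unfolding U_def V_def using V'(1) U'(1) ij by (intro R.finsum_cong') (auto simp: R.m_comm)
      finally show ?thesis by simp
    qed
    have VU: "(\<Oplus>k\<in>{..<n}. V i k \<otimes> U k j) = (if i = j then \<one> else \<zero>)" if ij: "i < m" "j < m" for i j
    proof -
      have "lin M m b (\<lambda>i. if i = j then \<one> else \<zero>) = b j" using bM ij by (intro lin_delta) auto
      also have "b j = (\<Oplus>\<^bsub>M\<^esub>k\<in>{..<n}. U' j k \<odot>\<^bsub>M\<^esub> e k)" using U'(2)[OF ij(2)] by (simp add: lin_def)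
      also have "\<dots> = (\<Oplus>\<^bsub>M\<^esub>k\<in>{..<n}. U' j k \<odot>\<^bsub>M\<^esub> lin M m b (V' k))"
        using U'(1) V' bM ij e by (intro M.finsum_cong') (auto intro!: lin_closed)
      also have "\<dots> = lin M m b (\<lambda>i. \<Oplus>k\<in>{..<n}. U' j k \<otimes> V' k i)"
        using U'(1) V' bM ij by (intro lin_finsum) auto
      finally have "(if i = j then \<one> else \<zero>) = (\<Oplus>k\<in>{..<n}. U' j k \<otimes> V' k i)"
        using V'(1) U'(1) ij by (intro b_inj[of "\<lambda>i. if i = j then \<one> else \<zero>"]) (auto intro!: R.finsum_closed)
      also have "\<dots> = (\<Oplus>k\<in>{..<n}. V i k \<otimes> U k j)"
        unfolding U_def V_def using V'(1) U'(1) ij by (intro R.finsum_cong') (auto simp: R.m_comm)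
      finally show ?thesis by simp
    qed
    have eig: "(\<Oplus>k\<in>{..<n}. B i k \<otimes> \<tau> (U k j)) = c (l j) \<otimes> U i j" if ij: "i < n" "j < m" for i j
    proof -
      have "lin M n e (\<lambda>i. \<Oplus>k\<in>{..<n}. B i k \<otimes> \<tau> (U' j k)) = F (b j)"
        using U'(1) ij unfolding U'(2)[OF ij(2)] by (intro F_lin[symmetric]) auto
      also have "\<dots> = c (l j) \<odot>\<^bsub>M\<^esub> lin M n e (U' j)" using b(2)[OF ij(2)] U'(2)[OF ij(2)] by simp
      also have "\<dots> = lin M n e (\<lambda>i. c (l j) \<otimes> U' j i)"
        using e U'(1) ij c b(2) by (intro lin_smult[symmetric]) auto
      finally show ?thesis unfolding U_def
        using U'(1) ij c b(2) B \<tau> by (intro e_inj) (auto intro!: R.finsum_closed)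
    qed
    show "\<exists>m U V l. (\<forall>i<m. l i \<in> L \<and> l i \<noteq> 0) \<and> eigenmatrix R \<tau> n B m U V (\<lambda>i. c (l i)) \<and>
       Sl = image_mset (\<lambda>i. v (l i)) (mset_set {..<m})"
    proof (intro exI conjI)
      show "\<forall>i<m. l i \<in> L \<and> l i \<noteq> 0" using b(2) by blast
      show "eigenmatrix R \<tau> n B m U V (\<lambda>i. c (l i))"
        unfolding eigenmatrix_def using UV VU eig U'(1) V'(1) by (auto simp: U_def V_def)
    qed (rule b(3))
  next
    assume "\<exists>m U V l. (\<forall>i<m. l i \<in> L \<and> l i \<noteq> 0) \<and> eigenmatrix R \<tau> n B m U V (\<lambda>i. c (l i)) \<and>
       Sl = image_mset (\<lambda>i. v (l i)) (mset_set {..<m})"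
    then obtain m U V l where l: "\<And>i. i < m \<Longrightarrow> l i \<in> L \<and> l i \<noteq> 0" and em: "eigenmatrix R \<tau> n B m U V (\<lambda>i. c (l i))"
      and Sl: "Sl = image_mset (\<lambda>i. v (l i)) (mset_set {..<m})" by blast
    have U: "\<And>i j. i < n \<Longrightarrow> j < m \<Longrightarrow> U i j \<in> carrier R" and V: "\<And>i j. i < m \<Longrightarrow> j < n \<Longrightarrow> V i j \<in> carrier R"
      and UV: "\<And>i j. i < n \<Longrightarrow> j < n \<Longrightarrow> (\<Oplus>k\<in>{..<m}. U i k \<otimes> V k j) = (if i = j then \<one> else \<zero>)"
      and VU: "\<And>i j. i < m \<Longrightarrow> j < m \<Longrightarrow> (\<Oplus>k\<in>{..<n}. V i k \<otimes> U k j) = (if i = j then \<one> else \<zero>)"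
      and eig: "\<And>i j. i < n \<Longrightarrow> j < m \<Longrightarrow> (\<Oplus>k\<in>{..<n}. B i k \<otimes> \<tau> (U k j)) = c (l j) \<otimes> U i j"
      using em unfolding eigenmatrix_def by blast+
    define b where "b j = lin M n e (\<lambda>i. U i j)" for j
    have bM: "b j \<in> carrier M" if "j < m" for j unfolding b_def using that U e by (intro lin_closed) auto
    have lin_b: "lin M m b d = lin M n e (\<lambda>i. \<Oplus>j\<in>{..<m}. U i j \<otimes> d j)" if d: "\<forall>j<m. d j \<in> carrier R" for d
    proof -
      have "lin M m b d = lin M n e (\<lambda>i. \<Oplus>j\<in>{..<m}. d j \<otimes> U i j)"
        unfolding lin_def[of M m] b_def using d U e by (intro lin_finsum) auto
      also have "\<dots> = lin M n e (\<lambda>i. \<Oplus>j\<in>{..<m}. U i j \<otimes> d j)"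
        using d U e by (intro lin_cong) (auto intro!: R.finsum_closed R.finsum_cong' simp: R.m_comm)
      finally show ?thesis .
    qed
    have "is_basis R M m b"
      unfolding is_basis_iff
    proof (intro conjI ballI allI impI)
      fix x assume "x \<in> carrier M"
      then obtain u where u: "\<forall>i<n. u i \<in> carrier R" "x = lin M n e u" using e_span by blast
      define d where "d j = (\<Oplus>k\<in>{..<n}. V j k \<otimes> u k)" for j
      have d: "\<forall>j<m. d j \<in> carrier R" unfolding d_def using V u by (auto intro!: R.finsum_closed)
      have "(\<Oplus>j\<in>{..<m}. U i j \<otimes> d j) = u i" if i: "i < n" for i
      proof -
        have "(\<Oplus>j\<in>{..<m}. U i j \<otimes> d j) = (\<Oplus>k\<in>{..<n}. (\<Oplus>j\<in>{..<m}. U i j \<otimes> V j k) \<otimes> u k)"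
          unfolding d_def using U V u i by (intro R.finsum_mult_assoc) auto
        also have "\<dots> = (\<Oplus>k\<in>{..<n}. u k \<otimes> (if i = k then \<one> else \<zero>))"
          using UV u i by (intro R.finsum_cong') auto
        also have "\<dots> = u i" using i u by (intro R.finsum_delta) auto
        finally show ?thesis .
      qed
      then have "lin M m b d = x" unfolding lin_b[OF d] u(2) using u e by (intro lin_cong) auto
      thus "\<exists>c. (\<forall>i<m. c i \<in> carrier R) \<and> x = lin M m b c" using d by blast
    next
      fix d d' i assume d: "\<forall>i<m. d i \<in> carrier R" and d': "\<forall>i<m. d' i \<in> carrier R"
        and eq: "lin M m b d = lin M m b d'" and i: "i < m"
      have *: "(\<Oplus>k\<in>{..<n}. V i k \<otimes> (\<Oplus>j\<in>{..<m}. U k j \<otimes> d j)) = d i" if d: "\<forall>i<m. d i \<in> carrier R" for d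
      proof -
        have "(\<Oplus>k\<in>{..<n}. V i k \<otimes> (\<Oplus>j\<in>{..<m}. U k j \<otimes> d j)) = (\<Oplus>j\<in>{..<m}. (\<Oplus>k\<in>{..<n}. V i k \<otimes> U k j) \<otimes> d j)"
          using U V d i by (intro R.finsum_mult_assoc) auto
        also have "\<dots> = (\<Oplus>j\<in>{..<m}. d j \<otimes> (if i = j then \<one> else \<zero>))"
          using VU d i by (intro R.finsum_cong') auto
        also have "\<dots> = d i" using i d by (intro R.finsum_delta) auto
        finally show ?thesis .
      qed
      have "(\<Oplus>j\<in>{..<m}. U k j \<otimes> d j) = (\<Oplus>j\<in>{..<m}. U k j \<otimes> d' j)" if "k < n" for k
        using eq d d' U that unfolding lin_b[OF d] lin_b[OF d'] by (intro e_inj[OF _ _ eq[unfolded lin_b[OF d] lin_b[OF d']]]) (auto intro!: R.finsum_closed)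
      then have "(\<Oplus>k\<in>{..<n}. V i k \<otimes> (\<Oplus>j\<in>{..<m}. U k j \<otimes> d j)) = (\<Oplus>k\<in>{..<n}. V i k \<otimes> (\<Oplus>j\<in>{..<m}. U k j \<otimes> d' j))"
        using U V d' i by (intro R.finsum_cong') (auto intro!: R.finsum_closed)
      thus "d i = d' i" using *[OF d] *[OF d'] by simp
    qed (use bM in auto)
    moreover have "F (b j) = c (l j) \<odot>\<^bsub>M\<^esub> b j" if j: "j < m" for j
    proof -
      have "F (b j) = lin M n e (\<lambda>i. \<Oplus>k\<in>{..<n}. B i k \<otimes> \<tau> (U k j))"
        unfolding b_def using U j by (intro F_lin) auto
      also have "\<dots> = lin M n e (\<lambda>i. c (l j) \<otimes> U i j)"
        using eig U j e c l by (intro lin_cong) auto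
      also have "\<dots> = c (l j) \<odot>\<^bsub>M\<^esub> b j" unfolding b_def using e U j c l by (intro lin_smult) auto
      finally show ?thesis .
    qed
    ultimately show "eigenbasis_slopes v L c R M F Sl"
      unfolding eigenbasis_slopes_def using l Sl by blast
  qed
qed

section \<open>Base extension of free modules\<close>

locale base_extension =
  R: cring R + S: cring S + M: module R M
  for R :: "('r, 'x) ring_scheme" and S :: "('s, 'z) ring_scheme" and M :: "('r, 'm, 'y) module_scheme" +
  fixes h :: "'r \<Rightarrow> 's" and n :: nat and b :: "nat \<Rightarrow> 'm"
  assumes h: "h \<in> ring_hom R S" and basis: "is_basis R M n b"
begin

lemma b_closed: "i < n \<Longrightarrow> b i \<in> carrier M"
  and b_span: "m \<in> carrier M \<Longrightarrow> \<exists>c. (\<forall>i<n. c i \<in> carrier R) \<and> m = lin M n b c"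
  and b_inj: "\<forall>i<n. c i \<in> carrier R \<Longrightarrow> \<forall>i<n. d i \<in> carrier R \<Longrightarrow> lin M n b c = lin M n b d \<Longrightarrow> i < n \<Longrightarrow> c i = d i"
  using basis unfolding M.is_basis_iff by blast+

lemmas h_simps = ring_hom_closed[OF h] ring_hom_add[OF h] ring_hom_mult[OF h] ring_hom_one[OF h]

lemma h_zero: "h \<zero>\<^bsub>R\<^esub> = \<zero>\<^bsub>S\<^esub>"
  using h_simps(2)[of "\<zero>\<^bsub>R\<^esub>" "\<zero>\<^bsub>R\<^esub>"] h_simps(1)[of "\<zero>\<^bsub>R\<^esub>"] S.add.l_cancel_one[of "h \<zero>\<^bsub>R\<^esub>" "h \<zero>\<^bsub>R\<^esub>"] by simp

definition crd :: "'m \<Rightarrow> nat \<Rightarrow> 'r" where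
  "crd m = (SOME c. (\<forall>i<n. c i \<in> carrier R) \<and> m = lin M n b c)"

lemma crd: assumes "m \<in> carrier M" shows "i < n \<Longrightarrow> crd m i \<in> carrier R" "lin M n b (crd m) = m"
  using someI_ex[OF b_span[OF assms], folded crd_def] by auto

lemma crd_lin: "\<forall>i<n. c i \<in> carrier R \<Longrightarrow> i < n \<Longrightarrow> crd (lin M n b c) i = c i"
  using crd[of "lin M n b c"] M.lin_closed[OF b_closed] by (intro b_inj) auto

lemma crd_add: "x \<in> carrier M \<Longrightarrow> y \<in> carrier M \<Longrightarrow> i < n \<Longrightarrow> crd (x \<oplus>\<^bsub>M\<^esub> y) i = crd x i \<oplus>\<^bsub>R\<^esub> crd y i"
  using crd_lin[of "\<lambda>i. crd x i \<oplus>\<^bsub>R\<^esub> crd y i" i] M.lin_add[of n b "crd x" "crd y"] crd b_closed by auto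

lemma crd_smult: "a \<in> carrier R \<Longrightarrow> x \<in> carrier M \<Longrightarrow> i < n \<Longrightarrow> crd (a \<odot>\<^bsub>M\<^esub> x) i = a \<otimes>\<^bsub>R\<^esub> crd x i"
  using crd_lin[of "\<lambda>i. a \<otimes>\<^bsub>R\<^esub> crd x i" i] M.lin_smult[of n b "crd x" a] crd b_closed by auto

lemma crd_basis: "i < n \<Longrightarrow> j < n \<Longrightarrow> crd (b j) i = (if i = j then \<one>\<^bsub>R\<^esub> else \<zero>\<^bsub>R\<^esub>)"
  using crd_lin[of "\<lambda>i. if i = j then \<one>\<^bsub>R\<^esub> else \<zero>\<^bsub>R\<^esub>" i] M.lin_delta[of n b j] b_closed by auto

abbreviation good :: "('s \<times> 'm) multiset \<Rightarrow> bool" where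
  "good A \<equiv> set_mset A \<subseteq> carrier S \<times> carrier M"

text \<open>The coordinates of a formal sum; the guard makes the folded operation commutative everywhere.\<close>
definition ev_step :: "nat \<Rightarrow> 's \<times> 'm \<Rightarrow> 's \<Rightarrow> 's" where
  "ev_step i q acc = (if fst q \<in> carrier S \<and> snd q \<in> carrier M \<and> acc \<in> carrier S
     then fst q \<otimes>\<^bsub>S\<^esub> h (crd (snd q) i) \<oplus>\<^bsub>S\<^esub> acc else acc)"

definition ev :: "('s \<times> 'm) multiset \<Rightarrow> nat \<Rightarrow> 's" where
  "ev A i = fold_mset (ev_step i) \<zero>\<^bsub>S\<^esub> A"

lemma ev_empty: "ev {#} i = \<zero>\<^bsub>S\<^esub>" by (simp add: ev_def)

lemma term_closed: "s \<in> carrier S \<Longrightarrow> m \<in> carrier M \<Longrightarrow> i < n \<Longrightarrow> s \<otimes>\<^bsub>S\<^esub> h (crd m i) \<in> carrier S"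
  by (simp add: crd h_simps)

lemma ev_step_commute: assumes "i < n" shows "comp_fun_commute (ev_step i)"
proof
  fix x y
  have "ev_step i y (ev_step i x z) = ev_step i x (ev_step i y z)" for z
    using term_closed[of "fst x" "snd x" i] term_closed[of "fst y" "snd y" i] assms
    by (auto simp: ev_step_def S.a_lcomm)
  thus "ev_step i y \<circ> ev_step i x = ev_step i x \<circ> ev_step i y" by (auto simp: fun_eq_iff)
qed

lemma ev_closed: "good A \<Longrightarrow> i < n \<Longrightarrow> ev A i \<in> carrier S"
proof (induction A)
  case (add q A)
  interpret comp_fun_commute "ev_step i" by (rule ev_step_commute) fact
  show ?case using add term_closed[of "fst q" "snd q" i] unfolding ev_def
    by (auto simp: ev_step_def)
qed (simp add: ev_empty)

lemma ev_add_mset: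
  assumes "good A" "s \<in> carrier S" "m \<in> carrier M" "i < n"
  shows "ev (add_mset (s, m) A) i = s \<otimes>\<^bsub>S\<^esub> h (crd m i) \<oplus>\<^bsub>S\<^esub> ev A i"
proof -
  interpret comp_fun_commute "ev_step i" by (rule ev_step_commute) fact
  show ?thesis using assms ev_closed[of A i] unfolding ev_def by (auto simp: ev_step_def)
qed

lemma ev_single: "s \<in> carrier S \<Longrightarrow> m \<in> carrier M \<Longrightarrow> i < n \<Longrightarrow> ev {#(s, m)#} i = s \<otimes>\<^bsub>S\<^esub> h (crd m i)"
  using ev_add_mset[of "{#}" s m i] term_closed[of s m i] by (simp add: ev_empty)

lemma ev_add: "good A \<Longrightarrow> good B \<Longrightarrow> i < n \<Longrightarrow> ev (A + B) i = ev A i \<oplus>\<^bsub>S\<^esub> ev B i"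
proof (induction A)
  case (add q A)
  obtain s m where q: "q = (s, m)" by (cases q)
  have "ev (add_mset q A + B) i = s \<otimes>\<^bsub>S\<^esub> h (crd m i) \<oplus>\<^bsub>S\<^esub> ev (A + B) i"
    using add by (simp add: q ev_add_mset)
  also have "\<dots> = ev (add_mset q A) i \<oplus>\<^bsub>S\<^esub> ev B i"
    using add term_closed[of s m i] ev_closed[of A i] ev_closed[of B i] by (simp add: q ev_add_mset S.a_assoc)
  finally show ?case .
qed (simp add: ev_empty ev_closed)

definition scale :: "'s \<Rightarrow> ('s \<times> 'm) multiset \<Rightarrow> ('s \<times> 'm) multiset" where
  "scale a A = image_mset (\<lambda>(s, m). (a \<otimes>\<^bsub>S\<^esub> s, m)) A"

lemma good_scale: "good A \<Longrightarrow> a \<in> carrier S \<Longrightarrow> good (scale a A)"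
  by (induction A) (auto simp: scale_def)

lemma scale_add_mset: "scale a (add_mset (s, m) A) = add_mset (a \<otimes>\<^bsub>S\<^esub> s, m) (scale a A)"
  and scale_empty: "scale a {#} = {#}"
  by (simp_all add: scale_def)

lemma ev_scale: "good A \<Longrightarrow> a \<in> carrier S \<Longrightarrow> i < n \<Longrightarrow> ev (scale a A) i = a \<otimes>\<^bsub>S\<^esub> ev A i"
proof (induction A)
  case (add q A)
  obtain s m where q: "q = (s, m)" by (cases q)
  have "good (scale a A)" using add by (intro good_scale) auto
  thus ?case using add term_closed[of s m i] ev_closed[of A i] crd(1)[of m i]
    by (simp add: q scale_add_mset ev_add_mset S.r_distr S.m_assoc h_simps)
qed (simp add: ev_empty scale_empty)

abbreviation teq where "teq \<equiv> tensor_eq R S h M"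

lemma teq_ev: "teq A B \<Longrightarrow> good A \<and> good B \<and> (\<forall>i<n. ev A i = ev B i)"
proof (induction rule: tensor_eq.induct)
  case (plus A A' B B') thus ?case by (auto simp: ev_add)
next
  case (zero m) thus ?case by (auto simp: ev_single ev_empty crd h_simps)
next
  case (add_left s s' m)
  thus ?case by (auto simp: ev_add_mset ev_empty crd h_simps S.l_distr term_closed)
next
  case (add_right s m m')
  thus ?case by (auto simp: ev_add_mset ev_empty crd crd_add h_simps S.r_distr term_closed)
next
  case (balanced r s m)
  thus ?case by (auto simp: ev_add_mset ev_empty crd crd_smult h_simps S.m_assoc)
qed auto

text \<open>The normal form with given coordinates.\<close>
definition nf :: "nat \<Rightarrow> (nat \<Rightarrow> 's) \<Rightarrow> ('s \<times> 'm) multiset" where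
  "nf k c = image_mset (\<lambda>i. (c i, b i)) (mset_set {..<k})"

lemma nf_0: "nf 0 c = {#}" and nf_Suc: "nf (Suc k) c = add_mset (c k, b k) (nf k c)"
  by (simp_all add: nf_def lessThan_Suc)

lemma good_nf: "k \<le> n \<Longrightarrow> (\<And>i. i < k \<Longrightarrow> c i \<in> carrier S) \<Longrightarrow> good (nf k c)"
  using b_closed by (induction k) (auto simp: nf_0 nf_Suc)

lemma nf_cong: "(\<And>i. i < k \<Longrightarrow> c i = d i) \<Longrightarrow> nf k c = nf k d"
  unfolding nf_def by (intro image_mset_cong) auto

lemma ev_nf:
  assumes "\<And>i. i < n \<Longrightarrow> c i \<in> carrier S" "i < n" shows "ev (nf n c) i = c i"
proof -
  have "k \<le> n \<Longrightarrow> ev (nf k c) i = (if i < k then c i else \<zero>\<^bsub>S\<^esub>)" for k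
  proof (induction k)
    case (Suc k)
    then show ?case using assms
      by (auto simp: nf_Suc ev_add_mset good_nf b_closed crd_basis h_simps h_zero less_Suc_eq)
  qed (simp add: nf_0 ev_empty)
  thus ?thesis using assms(2) by simp
qed

lemma teq_cons: "teq {#(s, m)#} C \<Longrightarrow> teq A B \<Longrightarrow> teq (add_mset (s, m) A) (C + B)"
  using tensor_eq.plus[of R S h M "{#(s, m)#}" C A B] by simp

lemma nf_add:
  "k \<le> n \<Longrightarrow> (\<And>i. i < k \<Longrightarrow> c i \<in> carrier S) \<Longrightarrow> (\<And>i. i < k \<Longrightarrow> d i \<in> carrier S) \<Longrightarrow>
     teq (nf k (\<lambda>i. c i \<oplus>\<^bsub>S\<^esub> d i)) (nf k c + nf k d)"
proof (induction k)
  case (Suc k)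
  have "teq (add_mset (c k \<oplus>\<^bsub>S\<^esub> d k, b k) (nf k (\<lambda>i. c i \<oplus>\<^bsub>S\<^esub> d i)))
      ({#(c k, b k), (d k, b k)#} + (nf k c + nf k d))"
    using Suc b_closed[of k] by (intro teq_cons tensor_eq.add_left) auto
  thus ?case by (simp add: nf_Suc add_mset_commute)
qed (simp add: nf_0 tensor_eq.refl)

lemma teq_nf_single:
  assumes s: "s \<in> carrier S" and m: "m \<in> carrier M"
  shows "teq {#(s, m)#} (nf n (\<lambda>i. s \<otimes>\<^bsub>S\<^esub> h (crd m i)))"
proof -
  let ?x = "\<lambda>i. crd m i \<odot>\<^bsub>M\<^esub> b i"
  have "k \<le> n \<Longrightarrow> teq {#(s, \<Oplus>\<^bsub>M\<^esub>i\<in>{..<k}. ?x i)#} (nf k (\<lambda>i. s \<otimes>\<^bsub>S\<^esub> h (crd m i)))" for k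
  proof (induction k)
    case 0
    have "teq {#(s \<otimes>\<^bsub>S\<^esub> h \<zero>\<^bsub>R\<^esub>, \<zero>\<^bsub>M\<^esub>)#} {#(s, \<zero>\<^bsub>R\<^esub> \<odot>\<^bsub>M\<^esub> \<zero>\<^bsub>M\<^esub>)#}"
      using s by (intro tensor_eq.balanced) auto
    then have "teq {#(s, \<zero>\<^bsub>M\<^esub>)#} {#(\<zero>\<^bsub>S\<^esub>, \<zero>\<^bsub>M\<^esub>)#}" using s by (simp add: h_zero tensor_eq.sym)
    from tensor_eq.trans[OF this tensor_eq.zero] show ?case by (simp add: nf_0)
  next
    case (Suc k)
    have x: "?x i \<in> carrier M" if "i < Suc k" for i using that Suc crd(1)[OF m] b_closed by auto
    have sum: "(\<Oplus>\<^bsub>M\<^esub>i\<in>{..<Suc k}. ?x i) = ?x k \<oplus>\<^bsub>M\<^esub> (\<Oplus>\<^bsub>M\<^esub>i\<in>{..<k}. ?x i)"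
      unfolding lessThan_Suc using x by (subst M.finsum_insert) auto
    have sk: "(\<Oplus>\<^bsub>M\<^esub>i\<in>{..<k}. ?x i) \<in> carrier M" using x by (intro M.finsum_closed) auto
    have "teq {#(s, ?x k \<oplus>\<^bsub>M\<^esub> (\<Oplus>\<^bsub>M\<^esub>i\<in>{..<k}. ?x i))#} {#(s, ?x k), (s, \<Oplus>\<^bsub>M\<^esub>i\<in>{..<k}. ?x i)#}"
      using s x sk by (intro tensor_eq.add_right) auto
    also have "{#(s, ?x k), (s, \<Oplus>\<^bsub>M\<^esub>i\<in>{..<k}. ?x i)#} = {#(s, ?x k)#} + {#(s, \<Oplus>\<^bsub>M\<^esub>i\<in>{..<k}. ?x i)#}" by simp
    finally have 1: "teq {#(s, ?x k \<oplus>\<^bsub>M\<^esub> (\<Oplus>\<^bsub>M\<^esub>i\<in>{..<k}. ?x i))#} ({#(s, ?x k)#} + {#(s, \<Oplus>\<^bsub>M\<^esub>i\<in>{..<k}. ?x i)#})" .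
    have "teq {#(s, ?x k)#} {#(s \<otimes>\<^bsub>S\<^esub> h (crd m k), b k)#}"
      using s Suc crd(1)[OF m] b_closed by (intro tensor_eq.sym[OF tensor_eq.balanced]) auto
    then have "teq ({#(s, ?x k)#} + {#(s, \<Oplus>\<^bsub>M\<^esub>i\<in>{..<k}. ?x i)#})
        ({#(s \<otimes>\<^bsub>S\<^esub> h (crd m k), b k)#} + nf k (\<lambda>i. s \<otimes>\<^bsub>S\<^esub> h (crd m i)))"
      using Suc by (intro tensor_eq.plus) auto
    from tensor_eq.trans[OF 1 this] show ?case unfolding sum by (simp add: nf_Suc)
  qed
  from this[of n] show ?thesis using crd(2)[OF m] by (simp add: lin_def)
qed

lemma teq_nf: "good A \<Longrightarrow> teq A (nf n (ev A))"
proof (induction A)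
  case empty
  have "k \<le> n \<Longrightarrow> teq (nf k (\<lambda>_. \<zero>\<^bsub>S\<^esub>)) {#}" for k
  proof (induction k)
    case (Suc k)
    have "teq (add_mset (\<zero>\<^bsub>S\<^esub>, b k) (nf k (\<lambda>_. \<zero>\<^bsub>S\<^esub>))) ({#} + {#})"
      using Suc b_closed[of k] by (intro teq_cons tensor_eq.zero) auto
    thus ?case by (simp add: nf_Suc)
  qed (simp add: nf_0 tensor_eq.refl)
  then have *: "teq (nf n (\<lambda>_. \<zero>\<^bsub>S\<^esub>)) {#}" by simp
  have "nf n (ev {#}) = nf n (\<lambda>_. \<zero>\<^bsub>S\<^esub>)" by (intro nf_cong) (simp add: ev_empty)
  then show ?case using tensor_eq.sym[OF *] by (simp only:)
next
  case (add q A)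
  obtain s m where q: "q = (s, m)" by (cases q)
  have sm: "s \<in> carrier S" "m \<in> carrier M" "good A" using add by (auto simp: q)
  have 1: "teq (add_mset q A) (nf n (\<lambda>i. s \<otimes>\<^bsub>S\<^esub> h (crd m i)) + nf n (ev A))"
    unfolding q using sm add.IH by (intro teq_cons teq_nf_single) auto
  have 2: "teq (nf n (\<lambda>i. s \<otimes>\<^bsub>S\<^esub> h (crd m i) \<oplus>\<^bsub>S\<^esub> ev A i)) (nf n (\<lambda>i. s \<otimes>\<^bsub>S\<^esub> h (crd m i)) + nf n (ev A))"
    using sm term_closed ev_closed by (intro nf_add) auto
  have "teq (add_mset q A) (nf n (\<lambda>i. s \<otimes>\<^bsub>S\<^esub> h (crd m i) \<oplus>\<^bsub>S\<^esub> ev A i))"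
    by (rule tensor_eq.trans[OF 1 tensor_eq.sym[OF 2]])
  moreover have "nf n (\<lambda>i. s \<otimes>\<^bsub>S\<^esub> h (crd m i) \<oplus>\<^bsub>S\<^esub> ev A i) = nf n (ev (add_mset q A))"
    using sm by (intro nf_cong) (simp add: q ev_add_mset)
  ultimately show ?case by (simp only:)
qed

text \<open>The coordinates are a complete invariant of a formal sum, because every formal sum is equivalent to the normal
  form with its coordinates. This makes the tensor product free on the extended basis.\<close>
lemma teq_iff: "teq A B \<longleftrightarrow> good A \<and> good B \<and> (\<forall>i<n. ev A i = ev B i)"
proof
  assume *: "good A \<and> good B \<and> (\<forall>i<n. ev A i = ev B i)"
  have eq: "nf n (ev A) = nf n (ev B)" using * by (intro nf_cong) auto
  have 1: "teq A (nf n (ev A))" and 2: "teq B (nf n (ev B))" using * teq_nf by blast+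
  show "teq A B" by (rule tensor_eq.trans[OF 1[unfolded eq] tensor_eq.sym[OF 2]])
qed (rule teq_ev)

abbreviation T :: "('s, ('s \<times> 'm) multiset set) module" where "T \<equiv> base_ext R S h M"
abbreviation cls where "cls \<equiv> tensor_class R S h M"

lemma cls_eq_iff: "good A \<Longrightarrow> good B \<Longrightarrow> cls A = cls B \<longleftrightarrow> (\<forall>i<n. ev A i = ev B i)"
proof -
  assume AB: "good A" "good B"
  show ?thesis
  proof
    assume "cls A = cls B"
    moreover have "B \<in> cls B" using AB by (simp add: tensor_class_def tensor_eq.refl)
    ultimately have "B \<in> cls A" by simp
    thus "\<forall>i<n. ev A i = ev B i" by (simp add: tensor_class_def teq_iff)
  next
    assume "\<forall>i<n. ev A i = ev B i"
    thus "cls A = cls B" unfolding tensor_class_def using AB by (auto simp: teq_iff)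
  qed
qed

lemma cls_UN:
  assumes "good A" "\<And>B. teq A B \<Longrightarrow> f B = Y" shows "(\<Union>B\<in>cls A. f B) = Y"
proof -
  have "A \<in> cls A" using assms(1) by (simp add: tensor_class_def tensor_eq.refl)
  moreover have "\<And>B. B \<in> cls A \<Longrightarrow> f B = Y" using assms(2) by (simp add: tensor_class_def)
  ultimately show ?thesis by blast
qed

lemma carrier_T: "carrier T = cls ` {A. good A}" by (simp add: base_ext_def)
lemma zero_T: "\<zero>\<^bsub>T\<^esub> = cls {#}" by (simp add: base_ext_def)

lemma add_T: assumes "good A" "good B" shows "cls A \<oplus>\<^bsub>T\<^esub> cls B = cls (A + B)"
  unfolding base_ext_def using assms
  by (simp, intro cls_UN) (auto simp: teq_iff ev_add cls_eq_iff intro!: cls_UN)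

lemma smult_T: assumes "good A" "a \<in> carrier S" shows "a \<odot>\<^bsub>T\<^esub> cls A = cls (scale a A)"
  unfolding base_ext_def using assms
  by (simp add: scale_def[symmetric], intro cls_UN) (auto simp: teq_iff ev_scale cls_eq_iff good_scale)

lemma module_T: "module S T"
proof (rule moduleI)
  show "cring S" by (rule S.cring_axioms)
  show "abelian_group T"
  proof (rule abelian_groupI)
    fix x assume "x \<in> carrier T"
    then obtain A where A: "good A" "x = cls A" by (auto simp: carrier_T)
    have g: "good (scale (\<ominus>\<^bsub>S\<^esub> \<one>\<^bsub>S\<^esub>) A)" using A by (intro good_scale) auto
    have "cls (scale (\<ominus>\<^bsub>S\<^esub> \<one>\<^bsub>S\<^esub>) A) \<oplus>\<^bsub>T\<^esub> x = \<zero>\<^bsub>T\<^esub>"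
      unfolding A(2) add_T[OF g A(1)] zero_T using A(1) g
      by (subst cls_eq_iff) (auto simp: ev_add ev_scale ev_empty ev_closed S.l_minus S.l_neg)
    thus "\<exists>y\<in>carrier T. y \<oplus>\<^bsub>T\<^esub> x = \<zero>\<^bsub>T\<^esub>" using g unfolding carrier_T by blast
  next
    fix x y z assume "x \<in> carrier T" "y \<in> carrier T" "z \<in> carrier T"
    then obtain A B C where "good A" "x = cls A" "good B" "y = cls B" "good C" "z = cls C"
      by (auto simp: carrier_T)
    thus "x \<oplus>\<^bsub>T\<^esub> y \<oplus>\<^bsub>T\<^esub> z = x \<oplus>\<^bsub>T\<^esub> (y \<oplus>\<^bsub>T\<^esub> z)" by (simp add: add_T add.assoc)
  next
    fix x y assume "x \<in> carrier T" "y \<in> carrier T"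
    then obtain A B where *: "good A" "x = cls A" "good B" "y = cls B" by (auto simp: carrier_T)
    show "x \<oplus>\<^bsub>T\<^esub> y = y \<oplus>\<^bsub>T\<^esub> x" using * by (simp add: add_T add.commute)
    show "x \<oplus>\<^bsub>T\<^esub> y \<in> carrier T" using * by (simp add: add_T carrier_T)
  next
    show "\<zero>\<^bsub>T\<^esub> \<in> carrier T" by (simp add: carrier_T zero_T)
    fix x assume "x \<in> carrier T"
    then obtain A where "good A" "x = cls A" by (auto simp: carrier_T)
    thus "\<zero>\<^bsub>T\<^esub> \<oplus>\<^bsub>T\<^esub> x = x" by (simp add: add_T zero_T)
  qed
next
  fix a x assume a: "a \<in> carrier S" and "x \<in> carrier T"
  then obtain A where A: "good A" "x = cls A" by (auto simp: carrier_T)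
  show "a \<odot>\<^bsub>T\<^esub> x \<in> carrier T" using A a good_scale[OF A(1) a] by (simp add: smult_T carrier_T)
next
  fix a b x assume a: "a \<in> carrier S" and b: "b \<in> carrier S" and "x \<in> carrier T"
  then obtain A where A: "good A" "x = cls A" by (auto simp: carrier_T)
  note g = good_scale[OF A(1) a] good_scale[OF A(1) b]
  show "(a \<oplus>\<^bsub>S\<^esub> b) \<odot>\<^bsub>T\<^esub> x = a \<odot>\<^bsub>T\<^esub> x \<oplus>\<^bsub>T\<^esub> b \<odot>\<^bsub>T\<^esub> x"
    using A a b g good_scale[OF A(1) S.a_closed[OF a b]]
    by (simp add: smult_T add_T cls_eq_iff ev_add ev_scale ev_closed S.l_distr)
  show "(a \<otimes>\<^bsub>S\<^esub> b) \<odot>\<^bsub>T\<^esub> x = a \<odot>\<^bsub>T\<^esub> (b \<odot>\<^bsub>T\<^esub> x)"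
    using A a b g good_scale[OF A(1) S.m_closed[OF a b]] good_scale[OF g(2) a]
    by (simp add: smult_T cls_eq_iff ev_scale ev_closed S.m_assoc)
next
  fix a x y assume a: "a \<in> carrier S" and "x \<in> carrier T" "y \<in> carrier T"
  then obtain A B where A: "good A" "x = cls A" and B: "good B" "y = cls B" by (auto simp: carrier_T)
  show "a \<odot>\<^bsub>T\<^esub> (x \<oplus>\<^bsub>T\<^esub> y) = a \<odot>\<^bsub>T\<^esub> x \<oplus>\<^bsub>T\<^esub> a \<odot>\<^bsub>T\<^esub> y"
    using A B a good_scale[OF A(1) a] good_scale[OF B(1) a] good_scale[of "A + B" a]
    by (simp add: smult_T add_T cls_eq_iff ev_add ev_scale ev_closed S.r_distr)
next
  fix x assume "x \<in> carrier T"
  then obtain A where A: "good A" "x = cls A" by (auto simp: carrier_T)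
  show "\<one>\<^bsub>S\<^esub> \<odot>\<^bsub>T\<^esub> x = x"
    using A good_scale[OF A(1) S.one_closed] by (simp add: smult_T cls_eq_iff ev_scale ev_closed)
qed

definition e :: "nat \<Rightarrow> ('s \<times> 'm) multiset set" where "e i = cls {#(\<one>\<^bsub>S\<^esub>, b i)#}"

sublocale T: module S T by (rule module_T)

lemma e_closed: "i < n \<Longrightarrow> e i \<in> carrier T"
  unfolding e_def carrier_T by (rule imageI) (simp add: b_closed)

lemma lin_e: assumes "\<And>i. i < n \<Longrightarrow> c i \<in> carrier S" shows "lin T n e c = cls (nf n c)"
proof -
  have "k \<le> n \<Longrightarrow> (\<Oplus>\<^bsub>T\<^esub>i\<in>{..<k}. c i \<odot>\<^bsub>T\<^esub> e i) = cls (nf k c)" for k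
  proof (induction k)
    case (Suc k)
    have "(\<Oplus>\<^bsub>T\<^esub>i\<in>{..<Suc k}. c i \<odot>\<^bsub>T\<^esub> e i) = c k \<odot>\<^bsub>T\<^esub> e k \<oplus>\<^bsub>T\<^esub> (\<Oplus>\<^bsub>T\<^esub>i\<in>{..<k}. c i \<odot>\<^bsub>T\<^esub> e i)"
      unfolding lessThan_Suc using assms Suc e_closed by (subst T.finsum_insert) auto
    also have "c k \<odot>\<^bsub>T\<^esub> e k = cls {#(c k, b k)#}"
      unfolding e_def using Suc assms[of k] b_closed[of k] by (subst smult_T) (auto simp: scale_add_mset scale_empty)
    also have "(\<Oplus>\<^bsub>T\<^esub>i\<in>{..<k}. c i \<odot>\<^bsub>T\<^esub> e i) = cls (nf k c)" using Suc by simp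
    also have "cls {#(c k, b k)#} \<oplus>\<^bsub>T\<^esub> cls (nf k c) = cls (nf (Suc k) c)"
      using Suc assms b_closed[of k] good_nf[of k c] by (subst add_T) (auto simp: nf_Suc)
    finally show ?case .
  qed (simp add: nf_0 T.finsum_empty zero_T)
  from this[of n] show ?thesis by (simp add: lin_def)
qed

lemma basis_T: "is_basis S T n e"
  unfolding T.is_basis_iff
proof (intro conjI ballI allI impI)
  fix x assume "x \<in> carrier T"
  then obtain A where A: "good A" "x = cls A" by (auto simp: carrier_T)
  have "x = lin T n e (ev A)"
    using A by (subst lin_e) (auto simp: ev_closed cls_eq_iff good_nf ev_nf)
  thus "\<exists>c. (\<forall>i<n. c i \<in> carrier S) \<and> x = lin T n e c" using ev_closed[OF A(1)] by blast
next
  fix c d i assume "\<forall>i<n. c i \<in> carrier S" "\<forall>i<n. d i \<in> carrier S" "lin T n e c = lin T n e d" "i < n"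
  thus "c i = d i" by (auto simp: lin_e cls_eq_iff good_nf ev_nf)
qed (simp add: e_closed)

end

locale base_extension_F = base_extension +
  fixes \<phi> F \<tau> B
  assumes F_closed: "x \<in> carrier M \<Longrightarrow> F x \<in> carrier M"
    and F_add: "x \<in> carrier M \<Longrightarrow> y \<in> carrier M \<Longrightarrow> F (x \<oplus>\<^bsub>M\<^esub> y) = F x \<oplus>\<^bsub>M\<^esub> F y"
    and F_smult: "r \<in> carrier R \<Longrightarrow> x \<in> carrier M \<Longrightarrow> F (r \<odot>\<^bsub>M\<^esub> x) = \<phi> r \<odot>\<^bsub>M\<^esub> F x"
    and \<phi>_closed: "r \<in> carrier R \<Longrightarrow> \<phi> r \<in> carrier R"
    and \<tau>_hom: "\<tau> \<in> ring_hom S S"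
    and \<tau>_h: "r \<in> carrier R \<Longrightarrow> \<tau> (h r) = h (\<phi> r)"
    and B_closed: "i < n \<Longrightarrow> j < n \<Longrightarrow> B i j \<in> carrier R"
    and F_b: "j < n \<Longrightarrow> F (b j) = lin M n b (\<lambda>i. B i j)"
begin

lemmas \<tau>_simps = ring_hom_closed[OF \<tau>_hom] ring_hom_add[OF \<tau>_hom] ring_hom_mult[OF \<tau>_hom] ring_hom_one[OF \<tau>_hom]

lemma \<tau>_zero: "\<tau> \<zero>\<^bsub>S\<^esub> = \<zero>\<^bsub>S\<^esub>"
  using \<tau>_simps(2)[of "\<zero>\<^bsub>S\<^esub>" "\<zero>\<^bsub>S\<^esub>"] \<tau>_simps(1)[of "\<zero>\<^bsub>S\<^esub>"] S.add.l_cancel_one[of "\<tau> \<zero>\<^bsub>S\<^esub>" "\<tau> \<zero>\<^bsub>S\<^esub>"] by simp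

definition img where "img A = image_mset (\<lambda>(s, m). (\<tau> s, F m)) A"

lemma img_simps: "img {#} = {#}" "img (add_mset (s, m) A) = add_mset (\<tau> s, F m) (img A)"
    "img (A + A') = img A + img A'"
  by (simp_all add: img_def)

lemma good_img: "good A \<Longrightarrow> good (img A)"
  by (induction A) (auto simp: img_simps F_closed \<tau>_simps(1))

lemma teq_img: "teq A A' \<Longrightarrow> teq (img A) (img A')"
proof (induction rule: tensor_eq.induct)
  case (refl A) thus ?case using good_img by (auto intro!: tensor_eq.refl)
next
  case (sym A B) show ?case by (rule tensor_eq.sym[OF sym.IH])
next
  case (trans A B C) thus ?case using tensor_eq.trans by blast
next
  case (plus A A' B B') thus ?case by (simp add: img_simps tensor_eq.plus)
next
  case (zero m) thus ?case using F_closed by (simp add: img_simps \<tau>_zero tensor_eq.zero)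
next
  case (add_left s s' m) thus ?case using F_closed by (simp add: img_simps \<tau>_simps tensor_eq.add_left)
next
  case (add_right s m m') thus ?case using F_closed by (simp add: img_simps F_add \<tau>_simps tensor_eq.add_right)
next
  case (balanced r s m) thus ?case using F_closed
    by (simp add: img_simps F_smult \<tau>_simps \<tau>_h \<phi>_closed h_simps tensor_eq.balanced)
qed

abbreviation FT where "FT \<equiv> base_ext_F R S h M \<tau> F"

lemma FT_cls: "good A \<Longrightarrow> FT (cls A) = cls (img A)"
  unfolding base_ext_F_def img_def[symmetric]
proof (rule cls_UN)
  fix B' assume "teq A B'"
  then have "teq (img A) (img B')" by (rule teq_img)
  thus "cls (img B') = cls (img A)" by (simp add: teq_iff cls_eq_iff)
qed

lemma FT_closed: "x \<in> carrier T \<Longrightarrow> FT x \<in> carrier T"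
  by (auto simp: carrier_T FT_cls good_img)

lemma FT_add: "x \<in> carrier T \<Longrightarrow> y \<in> carrier T \<Longrightarrow> FT (x \<oplus>\<^bsub>T\<^esub> y) = FT x \<oplus>\<^bsub>T\<^esub> FT y"
  by (auto simp: carrier_T add_T FT_cls good_img img_simps)

lemma FT_smult: "a \<in> carrier S \<Longrightarrow> x \<in> carrier T \<Longrightarrow> FT (a \<odot>\<^bsub>T\<^esub> x) = \<tau> a \<odot>\<^bsub>T\<^esub> FT x"
proof -
  assume a: "a \<in> carrier S" and "x \<in> carrier T"
  then obtain A where A: "good A" "x = cls A" by (auto simp: carrier_T)
  have "img (scale a A) = scale (\<tau> a) (img A)"
    using A(1) a by (induction A) (auto simp: \<tau>_simps img_simps scale_add_mset scale_empty)
  thus ?thesis using A a by (simp add: smult_T FT_cls good_img good_scale \<tau>_simps)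
qed

lemma FT_e: assumes "j < n" shows "FT (e j) = lin T n e (\<lambda>i. h (B i j))"
proof -
  have "FT (e j) = cls {#(\<one>\<^bsub>S\<^esub>, F (b j))#}"
    unfolding e_def using assms b_closed by (subst FT_cls) (auto simp: \<tau>_simps img_simps)
  also have "\<dots> = cls (nf n (\<lambda>i. h (B i j)))"
    using assms b_closed F_closed B_closed
    by (subst cls_eq_iff) (auto simp: good_nf h_simps ev_nf ev_single F_b crd_lin M.lin_closed)
  also have "\<dots> = lin T n e (\<lambda>i. h (B i j))"
    using assms B_closed by (intro lin_e[symmetric]) (auto simp: h_simps)
  finally show ?thesis .
qed

lemma base_ext_eigenbasis_slopes_iff:
  assumes "\<And>x. x \<in> L \<Longrightarrow> c x \<in> carrier S"
  shows "eigenbasis_slopes v L c S T FT Sl \<longleftrightarrow>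
    (\<exists>m U V l. (\<forall>i<m. l i \<in> L \<and> l i \<noteq> 0) \<and> eigenmatrix S \<tau> n (\<lambda>i j. h (B i j)) m U V (\<lambda>i. c (l i)) \<and>
       Sl = image_mset (\<lambda>i. v (l i)) (mset_set {..<m}))"
  by (rule T.eigenbasis_slopes_iff[OF basis_T])
     (use assms B_closed FT_closed FT_add FT_smult FT_e \<tau>_simps(1) h_simps(1) in auto)

end

section \<open>The rings of generalized power series\<close>

context p_adic_norm begin

lemma ex_wt_gt: assumes "s > 0" shows "\<exists>q::rat. 0 \<le> q \<and> C < wt s q"
proof -
  obtain n :: nat where n: "log p (max C 1) / s < n" using reals_Archimedean2 by blast
  have "log p (max C 1) < s * n" using n assms by (simp add: field_simps)
  then have "max C 1 < real p powr (s * n)" using p_gt_1 by (subst (asm) log_less_iff) auto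
  thus ?thesis by (intro exI[of _ "of_nat n"]) auto
qed

end

context complete_subfield begin

abbreviation \<Gamma> :: "'a series set" where "\<Gamma> \<equiv> Gamma_imm_an_con p v L"

lemma Gamma_well_ordered_iff:
  "(\<forall>r. well_ordered {i. N (x i) > real p powr r}) \<longleftrightarrow> (\<forall>e>0. well_ordered {i. N (x i) > e})"
proof
  assume *: "\<forall>r. well_ordered {i. N (x i) > real p powr r}"
  show "\<forall>e>0. well_ordered {i. N (x i) > e}"
  proof (intro allI impI)
    fix e :: real assume "e > 0"
    then have "real p powr (log p e) = e" using p_gt_1 by simp
    thus "well_ordered {i. N (x i) > e}" using * by metis
  qed
qed (use p_gt_1 in auto)

lemma bnd_if_growth:
  assumes bd: "\<forall>j. bounded {N (x i) | i. i < j}" and c: "c > 0"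
    and neg: "\<forall>\<^sub>F i in at_bot. N (x i) < wt c i" and pos: "\<forall>d>0. \<forall>\<^sub>F i in at_top. N (x i) < wt d i"
    and s: "0 < s" "s \<le> c"
  shows "bnd s x"
proof -
  obtain i0 where i0: "\<And>i. i \<le> i0 \<Longrightarrow> N (x i) < wt c i" using neg unfolding eventually_at_bot_linorder by blast
  obtain i1 where i1: "\<And>i. i \<ge> i1 \<Longrightarrow> N (x i) < wt s i" using pos s(1) unfolding eventually_at_top_linorder by blast
  define a where "a = min i0 0"
  obtain B where B: "\<And>i. i < i1 \<Longrightarrow> N (x i) \<le> B" using bd unfolding bounded_iff by fastforce
  define C where "C = max 1 (\<bar>B\<bar> / wt s a)"
  have "N (x i) \<le> C * wt s i" for i
  proof -
    consider "i \<le> a" | "i \<ge> i1" | "a < i" "i < i1" by linarith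
    then show ?thesis
    proof cases
      case 1
      then have "N (x i) < wt c i" using i0 by (simp add: a_def)
      also have "\<dots> \<le> wt s i" using 1 s(2) p_gt_1 by (simp add: a_def mult_right_mono_neg)
      also have "\<dots> \<le> C * wt s i" using mult_right_mono[of 1 C "wt s i"] by (simp add: C_def)
      finally show ?thesis by simp
    next
      case 2
      then have "N (x i) < wt s i" using i1 by simp
      also have "\<dots> \<le> C * wt s i" using mult_right_mono[of 1 C "wt s i"] by (simp add: C_def)
      finally show ?thesis by simp
    next
      case 3
      have "N (x i) \<le> \<bar>B\<bar> / wt s a * wt s a" using B[OF 3(2)] wt_pos[of s a] by simp
      also have "\<dots> \<le> C * wt s i" using 3 s by (intro mult_mono wt_mono) (auto simp: C_def)
      finally show ?thesis .
    qed
  qed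
  thus ?thesis unfolding bnd_def by blast
qed

text \<open>The growth conditions at both ends amount to a finite norm at every sufficiently small positive radius.\<close>
lemma Gamma_iff:
  "x \<in> \<Gamma> \<longleftrightarrow> (\<forall>i. x i \<in> L) \<and> (\<forall>e>0. well_ordered {i. N (x i) > e}) \<and>
     (\<exists>s0>0. \<forall>s. 0 < s \<longrightarrow> s \<le> s0 \<longrightarrow> bnd s x)" (is "_ \<longleftrightarrow> ?L \<and> ?W \<and> ?B")
proof
  assume x: "x \<in> \<Gamma>"
  then obtain c where "c > 0" "\<forall>\<^sub>F i in at_bot. N (x i) < wt c i" unfolding Gamma_imm_an_con_def by blast
  then have ?B using bnd_if_growth x unfolding Gamma_imm_an_con_def by blast
  thus "?L \<and> ?W \<and> ?B" using x unfolding Gamma_imm_an_con_def Gamma_well_ordered_iff by blast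
next
  assume *: "?L \<and> ?W \<and> ?B"
  then obtain s0 where s0: "s0 > 0" "\<And>s. 0 < s \<Longrightarrow> s \<le> s0 \<Longrightarrow> bnd s x" by blast
  obtain C where C: "C \<ge> 0" "\<And>i. N (x i) \<le> C * wt s0 i" using bndE[OF s0(2)[of s0]] s0(1) by blast
  have 1: "bounded {N (x i) | i. i < j}" for j
    unfolding bounded_iff
  proof (intro exI[of _ "C * wt s0 j"] ballI)
    fix y assume "y \<in> {N (x i) | i. i < j}"
    then obtain i where i: "i < j" "y = N (x i)" by blast
    have "N (x i) \<le> C * wt s0 i" by (rule C)
    also have "\<dots> \<le> C * wt s0 j" using C(1) s0(1) i(1) by (intro mult_left_mono wt_mono) auto
    finally show "norm y \<le> C * wt s0 j" using i(2) by simp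
  qed
  have 2: "\<forall>\<^sub>F i in at_bot. N (x i) < wt (s0 / 2) i"
  proof -
    obtain q :: rat where q: "0 \<le> q" "C < wt (s0 / 2) q" using ex_wt_gt[of "s0 / 2" C] s0(1) by auto
    have "N (x i) < wt (s0 / 2) i" if "i \<le> - q" for i
    proof -
      have "N (x i) \<le> C * wt s0 i" by (rule C)
      also have "\<dots> < wt (s0 / 2) q * wt s0 i" using q(2) by (intro mult_strict_right_mono wt_pos)
      also have "\<dots> \<le> wt (s0 / 2) (- i) * wt s0 i" using that s0(1) by (intro mult_right_mono wt_mono) auto
      also have "\<dots> = wt (s0 / 2) i" by (simp add: powr_add[symmetric] of_rat_minus)
      finally show ?thesis .
    qed
    thus ?thesis unfolding eventually_at_bot_linorder by blast
  qed
  have 3: "\<forall>\<^sub>F i in at_top. N (x i) < wt d i" if d: "d > 0" for d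
  proof -
    define s where "s = min (d / 2) s0"
    have s: "0 < s" "s \<le> s0" "s \<le> d / 2" using d s0(1) by (auto simp: s_def)
    obtain C where C: "C \<ge> 0" "\<And>i. N (x i) \<le> C * wt s i" using bndE[OF s0(2)[OF s(1,2)]] by blast
    obtain q :: rat where q: "0 \<le> q" "C < wt (d / 2) q" using ex_wt_gt[of "d / 2" C] d by auto
    have "N (x i) < wt d i" if "q \<le> i" for i
    proof -
      have "N (x i) \<le> C * wt s i" by (rule C)
      also have "\<dots> < wt (d / 2) q * wt s i" using q(2) by (intro mult_strict_right_mono wt_pos)
      also have "\<dots> \<le> wt (d / 2) i * wt (d / 2) i" using that q(1) s d by (intro mult_mono wt_mono wt_le) auto
      also have "\<dots> = wt d i" by (simp add: powr_add[symmetric])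
      finally show ?thesis .
    qed
    thus ?thesis unfolding eventually_at_top_linorder by blast
  qed
  show "x \<in> \<Gamma>" unfolding Gamma_imm_an_con_def Gamma_well_ordered_iff
    using * 1 2 3 s0(1) by (auto intro!: exI[of _ "s0 / 2"])
qed

lemma Gamma_in_L: "x \<in> \<Gamma> \<Longrightarrow> x i \<in> L" by (simp add: Gamma_iff)

lemma Gamma_SR: "x \<in> \<Gamma> \<Longrightarrow> \<exists>s0>0. \<forall>a b. 0 < a \<longrightarrow> a \<le> s0 \<longrightarrow> 0 < b \<longrightarrow> b \<le> s0 \<longrightarrow> x \<in> SR a b"
  unfolding Gamma_iff SR_def by blast

lemma Gamma_SR_family:
  assumes "finite Xs" "Xs \<subseteq> \<Gamma>"
  shows "\<exists>s0>0. \<forall>a b. 0 < a \<longrightarrow> a \<le> s0 \<longrightarrow> 0 < b \<longrightarrow> b \<le> s0 \<longrightarrow> Xs \<subseteq> SR a b"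
  using assms
proof (induction Xs rule: finite_induct)
  case (insert x Xs)
  then obtain s t where "s > 0" "\<forall>a b. 0 < a \<longrightarrow> a \<le> s \<longrightarrow> 0 < b \<longrightarrow> b \<le> s \<longrightarrow> Xs \<subseteq> SR a b"
      "t > 0" "\<forall>a b. 0 < a \<longrightarrow> a \<le> t \<longrightarrow> 0 < b \<longrightarrow> b \<le> t \<longrightarrow> x \<in> SR a b"
    using Gamma_SR[of x] by auto
  thus ?case by (intro exI[of _ "min s t"]) auto
qed (auto intro: exI[of _ 1])

lemma Gamma_SR3:
  assumes "x \<in> \<Gamma>" "y \<in> \<Gamma>" "z \<in> \<Gamma>" shows "\<exists>a b. 0 < a \<and> a < b \<and> x \<in> SR a b \<and> y \<in> SR a b \<and> z \<in> SR a b"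
proof -
  obtain s where "s > 0" "\<forall>a b. 0 < a \<longrightarrow> a \<le> s \<longrightarrow> 0 < b \<longrightarrow> b \<le> s \<longrightarrow> {x, y, z} \<subseteq> SR a b"
    using Gamma_SR_family[of "{x, y, z}"] assms by auto
  thus ?thesis by (intro exI[of _ "s / 2"] exI[of _ s]) auto
qed

lemma GammaI: "s0 > 0 \<Longrightarrow> (\<And>s. 0 < s \<Longrightarrow> s \<le> s0 \<Longrightarrow> x \<in> SR (s / 2) s) \<Longrightarrow> x \<in> \<Gamma>"
  unfolding Gamma_iff SR_def by blast

lemma Gamma_const: "c \<in> L \<Longrightarrow> series_const c \<in> \<Gamma>"
  by (rule GammaI[of 1]) (auto intro: SR_const)

lemma Gamma_zero: "(\<lambda>_. 0) \<in> \<Gamma>"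
  using Gamma_const[OF in_L(1)] by (simp add: series_const_0)

lemma Gamma_SR2:
  assumes "x \<in> \<Gamma>" "y \<in> \<Gamma>" shows "\<exists>s0>0. \<forall>s. 0 < s \<longrightarrow> s \<le> s0 \<longrightarrow> x \<in> SR (s / 2) s \<and> y \<in> SR (s / 2) s"
proof -
  obtain s0 where s0: "s0 > 0" "\<forall>a b. 0 < a \<longrightarrow> a \<le> s0 \<longrightarrow> 0 < b \<longrightarrow> b \<le> s0 \<longrightarrow> {x, y} \<subseteq> SR a b"
    using Gamma_SR_family[of "{x, y}"] assms by auto
  have "x \<in> SR (s / 2) s \<and> y \<in> SR (s / 2) s" if "0 < s" "s \<le> s0" for s
    using s0(2)[rule_format, of "s / 2" s] that by auto
  thus ?thesis using s0(1) by blast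
qed

lemma Gamma_add: "x \<in> \<Gamma> \<Longrightarrow> y \<in> \<Gamma> \<Longrightarrow> (\<lambda>i. x i + y i) \<in> \<Gamma>"
  using Gamma_SR2[of x y] by (auto intro!: GammaI SR_add)

lemma Gamma_conv: "x \<in> \<Gamma> \<Longrightarrow> y \<in> \<Gamma> \<Longrightarrow> x \<star> y \<in> \<Gamma>"
  using Gamma_SR2[of x y] by (auto intro!: GammaI SR_conv)

lemma Gamma_cmult: "x \<in> \<Gamma> \<Longrightarrow> c \<in> L \<Longrightarrow> (\<lambda>i. c * x i) \<in> \<Gamma>"
  using Gamma_conv[OF Gamma_const] by (simp add: conv_const_left)

lemma Gamma_minus: "x \<in> \<Gamma> \<Longrightarrow> (\<lambda>i. - x i) \<in> \<Gamma>"
  using Gamma_cmult[of x "-1"] in_L(3)[OF in_L(2)] by simp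

lemma Gamma_sum: "(\<And>l. l \<in> I \<Longrightarrow> x l \<in> \<Gamma>) \<Longrightarrow> (\<lambda>i. \<Sum>l\<in>I. x l i) \<in> \<Gamma>"
  by (induction I rule: infinite_finite_induct) (auto simp: Gamma_zero Gamma_add)

lemma Gamma_conv_assoc: "x \<in> \<Gamma> \<Longrightarrow> y \<in> \<Gamma> \<Longrightarrow> z \<in> \<Gamma> \<Longrightarrow> (x \<star> y) \<star> z = x \<star> (y \<star> z)"
  using Gamma_SR3[of x y z] conv_assoc by blast

lemma Gamma_conv_add_left:
  "x \<in> \<Gamma> \<Longrightarrow> y \<in> \<Gamma> \<Longrightarrow> z \<in> \<Gamma> \<Longrightarrow> (\<lambda>i. x i + y i) \<star> z = (\<lambda>i. (x \<star> z) i + (y \<star> z) i)"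
  using Gamma_SR3[of x y z] conv_add_left by blast

lemma series_ring_simps:
  "carrier (series_ring p v A) = A" "monoid.mult (series_ring p v A) = (\<star>)"
  "monoid.one (series_ring p v A) = series_const 1" "ring.zero (series_ring p v A) = (\<lambda>_. 0)"
  "add (series_ring p v A) = (\<lambda>x y i. x i + y i)"
  by (auto simp: series_ring_def conv_def[abs_def] series_const_0)

abbreviation GR :: "'a series ring" where "GR \<equiv> series_ring p v \<Gamma>"

lemma cring_GR: "cring GR"
proof (rule cringI)
  show "abelian_group GR"
  proof (rule abelian_groupI)
    fix x assume "x \<in> carrier GR"
    then show "\<exists>y\<in>carrier GR. y \<oplus>\<^bsub>GR\<^esub> x = \<zero>\<^bsub>GR\<^esub>"
      using Gamma_minus[of x] by (intro bexI[of _ "\<lambda>i. - x i"]) (auto simp: series_ring_simps)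
  qed (auto simp: series_ring_simps Gamma_add Gamma_zero add_ac)
  show "comm_monoid GR"
    by (rule comm_monoidI)
       (auto simp: series_ring_simps Gamma_conv Gamma_const in_L(2) Gamma_conv_assoc conv_const_left intro: conv_commute)
qed (auto simp: series_ring_simps Gamma_conv_add_left)

lemma finsum_GR:
  assumes "finite I" "\<And>l. l \<in> I \<Longrightarrow> x l \<in> \<Gamma>"
  shows "(\<Oplus>\<^bsub>GR\<^esub>l\<in>I. x l) = (\<lambda>i. \<Sum>l\<in>I. x l i)"
proof -
  interpret cring GR by (rule cring_GR)
  show ?thesis using assms
  proof (induction I rule: finite_induct)
    case (insert l I)
    have "(\<Oplus>\<^bsub>GR\<^esub>l\<in>insert l I. x l) = x l \<oplus>\<^bsub>GR\<^esub> (\<Oplus>\<^bsub>GR\<^esub>l\<in>I. x l)"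
      using insert by (intro finsum_insert) (auto simp: series_ring_simps)
    thus ?case using insert by (simp add: series_ring_simps)
  qed (simp add: series_ring_simps)
qed

end

locale isometric_automorphism = complete_subfield p v L for p :: nat and v :: "'a::field \<Rightarrow> real" and L +
  fixes \<sigma> :: "'a \<Rightarrow> 'a"
  assumes \<sigma>_in_L: "x \<in> L \<Longrightarrow> \<sigma> x \<in> L" and \<sigma>_add: "x \<in> L \<Longrightarrow> y \<in> L \<Longrightarrow> \<sigma> (x + y) = \<sigma> x + \<sigma> y"
    and \<sigma>_mult: "x \<in> L \<Longrightarrow> y \<in> L \<Longrightarrow> \<sigma> (x * y) = \<sigma> x * \<sigma> y" and \<sigma>_1: "\<sigma> 1 = 1"
    and N_\<sigma>: "x \<in> L \<Longrightarrow> N (\<sigma> x) = N x" and \<sigma>_surj: "y \<in> L \<Longrightarrow> \<exists>x\<in>L. \<sigma> x = y"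
begin

lemma \<sigma>_0: "\<sigma> 0 = 0"
  using \<sigma>_add[OF in_L(1) in_L(1)] by (metis add_0_right add_left_cancel)

lemma \<sigma>_diff: "x \<in> L \<Longrightarrow> y \<in> L \<Longrightarrow> \<sigma> (x - y) = \<sigma> x - \<sigma> y"
  using \<sigma>_add[OF in_L(7), of x y y] by (simp add: algebra_simps)

lemma \<sigma>_sum: "(\<And>i. i \<in> I \<Longrightarrow> f i \<in> L) \<Longrightarrow> \<sigma> (sum f I) = (\<Sum>i\<in>I. \<sigma> (f i))"
  by (induction I rule: infinite_finite_induct) (auto simp: \<sigma>_0 \<sigma>_add in_L(11))

abbreviation frob :: "'a series \<Rightarrow> 'a series" where "frob \<equiv> series_frob p \<sigma>"

lemma frob_apply: "frob x i = \<sigma> (x (i / of_nat p))"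
  by (simp add: series_frob_def)

lemma of_nat_p_pos: "(of_nat p :: rat) > 0" using p_gt_1 by simp

lemma bnd_frob: assumes "\<And>i. x i \<in> L" "bnd s x" shows "bnd (s / p) (frob x)"
proof -
  obtain C where C: "\<And>i. N (x i) \<le> C * wt s i" using assms(2) unfolding bnd_def by blast
  have "N (frob x i) \<le> C * wt (s / p) i" for i
    using C[of "i / of_nat p"] assms(1) by (simp add: frob_apply N_\<sigma> of_rat_divide mult.commute)
  thus ?thesis unfolding bnd_def by blast
qed

lemma well_ordered_frob:
  assumes "\<And>i. x i \<in> L" "well_ordered {i. N (x i) > e}" shows "well_ordered {i. N (frob x i) > e}"
  using well_ordered_scale[OF assms(2) of_nat_p_pos] assms(1) by (simp add: frob_apply N_\<sigma>)

lemma SR_frob: "x \<in> SR a b \<Longrightarrow> frob x \<in> SR (a / p) (b / p)"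
  unfolding SR_def using well_ordered_frob[of x] bnd_frob[of x] \<sigma>_in_L by (auto simp: frob_apply)

lemma Gamma_frob: assumes "x \<in> \<Gamma>" shows "frob x \<in> \<Gamma>"
proof -
  obtain s0 where s0: "s0 > 0" "\<And>s. 0 < s \<Longrightarrow> s \<le> s0 \<Longrightarrow> bnd s x" using assms unfolding Gamma_iff by blast
  have "bnd s (frob x)" if "0 < s" "s \<le> s0 / p" for s
    using bnd_frob[of x "s * p"] s0(2)[of "s * p"] that p_gt_1 Gamma_in_L[OF assms] by (simp add: field_simps)
  moreover have "s0 / p > 0" using s0(1) p_gt_1 by simp
  ultimately show ?thesis using assms well_ordered_frob[of x] \<sigma>_in_L unfolding Gamma_iff
    by (auto simp: frob_apply)
qed

lemma frob_add: "(\<And>i. x i \<in> L) \<Longrightarrow> (\<And>i. y i \<in> L) \<Longrightarrow> frob (\<lambda>i. x i + y i) = (\<lambda>i. frob x i + frob y i)"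
  by (auto simp: frob_apply \<sigma>_add)

lemma frob_const: "frob (series_const c) = series_const (\<sigma> c)"
  using of_nat_p_pos by (auto simp: frob_apply series_const_def \<sigma>_0)

lemma frob_conv:
  assumes ab: "0 < a" "a < b" and x: "x \<in> SR a b" and y: "y \<in> SR a b"
  shows "frob (x \<star> y) = frob x \<star> frob y"
proof
  fix k :: rat
  let ?q = "of_nat p :: rat"
  have "psums (\<lambda>i. \<sigma> (x i * y (k / ?q - i))) (\<sigma> ((x \<star> y) (k / ?q)))"
    by (rule psums_image[OF conv_psums(1)[OF assms], where A = L and h = \<sigma> and C = 1])
       (use conv_psums(2)[OF assms] SR_in_L[OF x] SR_in_L[OF y] in_L \<sigma>_add N_\<sigma> in auto)
  moreover have "bij (\<lambda>i. i / ?q)"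
    using of_nat_p_pos by (intro bij_betw_byWitness[of _ "\<lambda>i. i * ?q"]) auto
  ultimately have "psums (\<lambda>i. \<sigma> (x (i / ?q) * y (k / ?q - i / ?q))) (\<sigma> ((x \<star> y) (k / ?q)))"
    by (rule psums_reindex)
  then have "psums (\<lambda>i. frob x i * frob y (k - i)) (frob (x \<star> y) k)"
    using SR_in_L[OF x] SR_in_L[OF y] by (simp add: frob_apply \<sigma>_mult diff_divide_distrib)
  thus "frob (x \<star> y) k = (frob x \<star> frob y) k"
    unfolding conv_def[of "frob x"] by (intro psum_eqI[symmetric])
qed

lemma Gamma_frob_conv: "x \<in> \<Gamma> \<Longrightarrow> y \<in> \<Gamma> \<Longrightarrow> frob (x \<star> y) = frob x \<star> frob y"
  using Gamma_SR3[of x y y] frob_conv by blast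

lemma frob_hom: "frob \<in> ring_hom GR GR"
  by (rule ring_hom_memI)
     (auto simp: series_ring_simps Gamma_frob Gamma_frob_conv frob_add Gamma_in_L frob_const \<sigma>_1)

end

context isometric_automorphism begin

lemma wt_ge_1: "0 \<le> s \<Longrightarrow> 0 \<le> i \<Longrightarrow> 1 \<le> wt s i"
  using wt_mono[of s 0 i] p_gt_1 by simp

lemma limit_0_iff_small: "(\<And>e. e > 0 \<Longrightarrow> N x < e) \<Longrightarrow> x = 0"
  using N_pos[of x] by (metis less_irrefl)

section \<open>The twisted linear equation\<close>

primrec twisted_term :: "'a \<Rightarrow> rat \<Rightarrow> 'a series \<Rightarrow> nat \<Rightarrow> 'a series" where
  "twisted_term \<alpha> q b 0 = b"
| "twisted_term \<alpha> q b (Suc k) = (\<lambda>j. \<alpha> * \<sigma> (twisted_term \<alpha> q b k (j / q)))"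

lemma twisted_term_in_L: "\<alpha> \<in> L \<Longrightarrow> (\<And>i. b i \<in> L) \<Longrightarrow> twisted_term \<alpha> q b k j \<in> L"
  by (induction k arbitrary: j) (auto intro: in_L(6) \<sigma>_in_L)

lemma N_twisted_term:
  "\<alpha> \<in> L \<Longrightarrow> (\<And>i. b i \<in> L) \<Longrightarrow> N (twisted_term \<alpha> q b k j) = N \<alpha> ^ k * N (b (j / q ^ k))"
proof (induction k arbitrary: j)
  case (Suc k)
  have "j / q / q ^ k = j / q ^ Suc k" by (simp add: mult.commute)
  thus ?case using Suc twisted_term_in_L[of \<alpha> b q k "j / q"] by (simp add: N_mult N_\<sigma>)
qed simp

text \<open>The solution is the sum of the iterates of the right-hand side; uniform decay of these iterates
  below every given exponent makes the sum converge and its support well-ordered.\<close>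
lemma twisted_sum:
  assumes \<alpha>: "\<alpha> \<in> L" and q: "0 < q" and bL: "\<And>i. b i \<in> L" and b0: "\<And>i. i \<le> 0 \<Longrightarrow> b i = 0"
    and wo: "\<And>e. e > 0 \<Longrightarrow> well_ordered {i. N (b i) > e}"
    and decay: "\<And>e j1. e > 0 \<Longrightarrow> \<exists>k0. \<forall>k\<ge>k0. \<forall>j\<le>j1. N \<alpha> ^ k * N (b (j / q ^ k)) \<le> e"
  shows "\<exists>x. (\<forall>i. x i \<in> L) \<and> (\<forall>i\<le>0. x i = 0) \<and> (\<forall>e>0. well_ordered {i. N (x i) > e}) \<and>
    (\<forall>i. x i = \<alpha> * \<sigma> (x (i / q)) + b i) \<and>
    (\<forall>j C. 0 \<le> C \<longrightarrow> (\<forall>k. N \<alpha> ^ k * N (b (j / q ^ k)) \<le> C) \<longrightarrow> N (x j) \<le> C)"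
proof -
  define T where "T = twisted_term \<alpha> q b"
  have TL: "T k j \<in> L" for k j unfolding T_def by (rule twisted_term_in_L[OF \<alpha> bL])
  have NT: "N (T k j) = N \<alpha> ^ k * N (b (j / q ^ k))" for k j unfolding T_def by (rule N_twisted_term[OF \<alpha> bL])
  have T0: "T 0 j = b j" and TS: "T (Suc k) j = \<alpha> * \<sigma> (T k (j / q))" for k j by (simp_all add: T_def)
  have lim0: "(\<lambda>k. N (T k j)) \<longlonglongrightarrow> 0" for j
  proof (rule LIMSEQ_I)
    fix r :: real assume "0 < r"
    then obtain k0 where "\<forall>k\<ge>k0. \<forall>i\<le>j. N \<alpha> ^ k * N (b (i / q ^ k)) \<le> r / 2" using decay[of "r / 2" j] by auto
    then have "\<forall>k\<ge>k0. N (T k j) \<le> r / 2" by (simp add: NT)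
    then have "\<forall>k\<ge>k0. norm (N (T k j) - 0) < r" using \<open>0 < r\<close> by force
    thus "\<exists>no. \<forall>n\<ge>no. norm (N (T n j) - 0) < r" by blast
  qed
  have "\<forall>j. \<exists>s\<in>L. (\<lambda>n. N (sum (\<lambda>k. T k j) {..<n} - s)) \<longlonglongrightarrow> 0"
  proof
    fix j
    show "\<exists>s\<in>L. (\<lambda>n. N (sum (\<lambda>k. T k j) {..<n} - s)) \<longlonglongrightarrow> 0"
      by (rule complete_setD[OF L_is_complete TL lim0])
  qed
  then obtain x where x: "\<And>j. x j \<in> L" "\<And>j. (\<lambda>n. N (sum (\<lambda>k. T k j) {..<n} - x j)) \<longlonglongrightarrow> 0" by metis
  have close: "\<exists>n0. \<forall>n\<ge>n0. N (sum (\<lambda>k. T k j) {..<n} - x j) < e" if "e > 0" for e j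
    using order_tendstoD(2)[OF x(2)[of j] that] by (simp add: eventually_sequentially)
  have bound: "N (x j) \<le> C" if "0 \<le> C" "\<And>k. N \<alpha> ^ k * N (b (j / q ^ k)) \<le> C" for j C
  proof (rule N_le_limit[OF _ that(1)])
    fix e :: real assume "e > 0"
    then obtain n where "N (sum (\<lambda>k. T k j) {..<n} - x j) < e" using close by blast
    moreover have "N (sum (\<lambda>k. T k j) {..<n}) \<le> C" by (rule N_sum_le) (use that in \<open>simp_all add: NT\<close>)
    ultimately show "\<exists>y. N y \<le> C \<and> N (y - x j) < e" by blast
  qed
  have x0: "x i = 0" if "i \<le> 0" for i
  proof -
    have "i / q ^ k \<le> 0" for k using that q by (simp add: divide_nonpos_pos)
    then have "N (x i) \<le> 0" by (intro bound) (simp_all add: b0)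
    thus ?thesis by (metis N_eq_0 N_nonneg antisym)
  qed
  have eq: "x j = \<alpha> * \<sigma> (x (j / q)) + b j" for j
  proof -
    have "N (x j - (\<alpha> * \<sigma> (x (j / q)) + b j)) < e" if e: "e > 0" for e
    proof -
      define e' where "e' = e / max 1 (N \<alpha>)"
      have e': "e' > 0" using e by (simp add: e'_def)
      obtain n1 n2 where n: "\<forall>n\<ge>n1. N (sum (\<lambda>k. T k j) {..<n} - x j) < e"
          "\<forall>n\<ge>n2. N (sum (\<lambda>k. T k (j / q)) {..<n} - x (j / q)) < e'"
        using close[OF e] close[OF e'] by blast
      define m where "m = max n1 n2"
      have S: "sum (\<lambda>k. T k j) {..<Suc m} = b j + \<alpha> * \<sigma> (sum (\<lambda>k. T k (j / q)) {..<m})"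
        unfolding sum.lessThan_Suc_shift T0 TS by (subst \<sigma>_sum) (auto simp: TL sum_distrib_left)
      have 1: "N (sum (\<lambda>k. T k j) {..<Suc m} - x j) < e"
        using n(1)[rule_format, of "Suc m"] by (simp add: m_def del: sum.lessThan_Suc)
      have "N (\<sigma> (sum (\<lambda>k. T k (j / q)) {..<m} - x (j / q))) < e'"
        using n(2) by (subst N_\<sigma>) (auto simp: m_def intro!: in_L(7,11) TL x(1))
      then have "N \<alpha> * N (\<sigma> (sum (\<lambda>k. T k (j / q)) {..<m} - x (j / q))) \<le> max 1 (N \<alpha>) * N (\<sigma> (sum (\<lambda>k. T k (j / q)) {..<m} - x (j / q)))"
        "max 1 (N \<alpha>) * N (\<sigma> (sum (\<lambda>k. T k (j / q)) {..<m} - x (j / q))) < max 1 (N \<alpha>) * e'"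
        by (intro mult_right_mono mult_strict_left_mono; simp)+
      then have 2: "N (\<alpha> * \<sigma> (sum (\<lambda>k. T k (j / q)) {..<m} - x (j / q))) < e"
        by (simp add: N_mult e'_def)
      have "x j - (\<alpha> * \<sigma> (x (j / q)) + b j)
          = \<alpha> * \<sigma> (sum (\<lambda>k. T k (j / q)) {..<m} - x (j / q)) - (sum (\<lambda>k. T k j) {..<Suc m} - x j)"
        unfolding S by (subst \<sigma>_diff) (auto simp: algebra_simps intro!: in_L(11) TL x(1))
      thus ?thesis using N_diff_less[OF 2 1] by (simp only:)
    qed
    then have "x j - (\<alpha> * \<sigma> (x (j / q)) + b j) = 0" by (rule limit_0_iff_small)
    thus ?thesis by simp
  qed
  have wox: "well_ordered {i. N (x i) > e}" if e: "e > 0" for e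
  proof (rule well_orderedI)
    fix f :: "nat \<Rightarrow> rat" assume f: "\<And>n. f n \<in> {i. N (x i) > e}" and dec: "\<And>n. f (Suc n) < f n"
    obtain k0 where k0: "\<And>k j. k \<ge> k0 \<Longrightarrow> j \<le> f 0 \<Longrightarrow> N \<alpha> ^ k * N (b (j / q ^ k)) \<le> e" using decay[OF e, of "f 0"] by blast
    define A where "A k = {j. N \<alpha> ^ k * N (b (j / q ^ k)) > e}" for k
    have inA: "f n \<in> (\<Union>k\<in>{..<k0}. A k)" for n
    proof (rule ccontr)
      assume nA: "f n \<notin> (\<Union>k\<in>{..<k0}. A k)"
      have le: "f n \<le> f 0" using decreasing_seq_less[of f 0 n] dec by (cases "n = 0") auto
      have "N \<alpha> ^ k * N (b (f n / q ^ k)) \<le> e" for k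
      proof (cases "k < k0")
        case True
        then have "f n \<notin> A k" using nA by blast
        thus ?thesis by (simp add: A_def)
      qed (use k0[OF _ le, of k] in simp)
      then have "N (x (f n)) \<le> e" using e by (intro bound) auto
      thus False using f[of n] by simp
    qed
    have woA: "well_ordered (A k)" for k
    proof (cases "N \<alpha> ^ k = 0")
      case True
      have "A k = {}" unfolding A_def True using e by simp
      thus ?thesis by (simp only: well_ordered_empty)
    next
      case False
      then have pos: "N \<alpha> ^ k > 0" using zero_le_power[OF N_nonneg[of \<alpha>], of k] by linarith
      have "A k = {j. j / q ^ k \<in> {i. N (b i) > e / N \<alpha> ^ k}}"
        unfolding A_def using pos by (simp add: divide_less_eq mult.commute)
      moreover have "well_ordered {j. j / q ^ k \<in> {i. N (b i) > e / N \<alpha> ^ k}}"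
        using pos e q by (intro well_ordered_scale wo) simp_all
      ultimately show ?thesis by (simp only:)
    qed
    have "well_ordered (\<Union>k\<in>{..<k0}. A k)" by (rule well_ordered_UN[OF finite_lessThan woA])
    from well_orderedD[of _ f, OF this inA dec] show False .
  qed
  show ?thesis using x(1) x0 wox eq bound by blast
qed

definition \<sigma>_inv :: "'a \<Rightarrow> 'a" where "\<sigma>_inv y = (SOME x. x \<in> L \<and> \<sigma> x = y)"

lemma \<sigma>_inv: "y \<in> L \<Longrightarrow> \<sigma>_inv y \<in> L" "y \<in> L \<Longrightarrow> \<sigma> (\<sigma>_inv y) = y"
  using someI_ex[of "\<lambda>x. x \<in> L \<and> \<sigma> x = y"] \<sigma>_surj[of y] unfolding \<sigma>_inv_def by blast+

lemma \<sigma>_inj: "x \<in> L \<Longrightarrow> y \<in> L \<Longrightarrow> \<sigma> x = \<sigma> y \<Longrightarrow> x = y"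
  using N_\<sigma>[of "x - y"] \<sigma>_diff[of x y] in_L(7)[of x y] by simp

lemma \<sigma>_inv_\<sigma>: "x \<in> L \<Longrightarrow> \<sigma>_inv (\<sigma> x) = x"
  by (rule \<sigma>_inj[OF \<sigma>_inv(1)[OF \<sigma>_in_L] _ \<sigma>_inv(2)[OF \<sigma>_in_L]])

lemma isometric_automorphism_inv: "isometric_automorphism p v L \<sigma>_inv"
proof (rule isometric_automorphism.intro[OF complete_subfield_axioms isometric_automorphism_axioms.intro])
  fix x y assume xy: "x \<in> L" "y \<in> L"
  note inv = \<sigma>_inv(1)[OF xy(1)] \<sigma>_inv(1)[OF xy(2)]
  have "\<sigma> (\<sigma>_inv x + \<sigma>_inv y) = x + y"
    using \<sigma>_add[OF inv] \<sigma>_inv(2)[OF xy(1)] \<sigma>_inv(2)[OF xy(2)] by simp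
  then show "\<sigma>_inv (x + y) = \<sigma>_inv x + \<sigma>_inv y" using \<sigma>_inv_\<sigma>[OF in_L(5)[OF inv]] by simp
  have "\<sigma> (\<sigma>_inv x * \<sigma>_inv y) = x * y"
    using \<sigma>_mult[OF inv] \<sigma>_inv(2)[OF xy(1)] \<sigma>_inv(2)[OF xy(2)] by simp
  then show "\<sigma>_inv (x * y) = \<sigma>_inv x * \<sigma>_inv y" using \<sigma>_inv_\<sigma>[OF in_L(6)[OF inv]] by simp
next
  show "\<sigma>_inv 1 = 1" using \<sigma>_inv_\<sigma>[OF in_L(2)] by (simp add: \<sigma>_1)
next
  fix x assume x: "x \<in> L"
  show "\<sigma>_inv x \<in> L" by (rule \<sigma>_inv(1)[OF x])
  show "N (\<sigma>_inv x) = N x" using N_\<sigma>[OF \<sigma>_inv(1)[OF x]] \<sigma>_inv(2)[OF x] by simp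
  show "\<exists>y\<in>L. \<sigma>_inv y = x" by (rule bexI[of _ "\<sigma> x"]) (rule \<sigma>_inv_\<sigma>[OF x], rule \<sigma>_in_L[OF x])
qed

text \<open>Series with exponents \<open>> 0\<close> of finite norm at radius \<open>s\<close>; \<open>C\<close> bounds this norm.\<close>
definition PosSeries :: "real \<Rightarrow> real \<Rightarrow> 'a series set" where
  "PosSeries s C = {x. (\<forall>i. x i \<in> L) \<and> (\<forall>i\<le>0. x i = 0) \<and> (\<forall>e>0. well_ordered {i. N (x i) > e}) \<and>
     (\<forall>i. N (x i) \<le> C * wt s i)}"

lemma PosSeriesD:
  "x \<in> PosSeries s C \<Longrightarrow> x i \<in> L" "x \<in> PosSeries s C \<Longrightarrow> i \<le> 0 \<Longrightarrow> x i = 0"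
  "x \<in> PosSeries s C \<Longrightarrow> e > 0 \<Longrightarrow> well_ordered {i. N (x i) > e}"
  "x \<in> PosSeries s C \<Longrightarrow> N (x i) \<le> C * wt s i"
  by (auto simp: PosSeries_def)

lemma ex_power_gt: "\<exists>k0. \<forall>k\<ge>k0. C < (real p) ^ k"
proof -
  obtain k0 where k0: "C < real p ^ k0" using real_arch_pow[of "real p" C] p_gt_1 by auto
  have "real p ^ k0 \<le> real p ^ k" if "k \<ge> k0" for k using that p_gt_1 by (simp add: power_increasing)
  thus ?thesis using k0 by (meson less_le_trans)
qed

lemma ex_scaled_less:
  assumes "0 < r" shows "\<exists>k0. \<forall>k\<ge>k0. \<forall>j\<le>j1. (of_rat (j / of_nat p ^ k) :: real) < r"
proof -
  obtain k0 where k0: "\<forall>k\<ge>k0. of_rat j1 / r < real p ^ k" using ex_power_gt by blast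
  have "(of_rat (j / of_nat p ^ k) :: real) < r" if "k \<ge> k0" "j \<le> j1" for k j
  proof -
    have "of_rat j / r \<le> of_rat j1 / r" using that(2) assms by (simp add: divide_right_mono of_rat_less_eq)
    also have "\<dots> < real p ^ k" using k0 that(1) by blast
    finally have "of_rat j < r * real p ^ k" using assms by (simp add: field_simps)
    thus ?thesis using p_gt_1 by (simp add: of_rat_divide of_rat_power divide_less_eq mult.commute)
  qed
  thus ?thesis by blast
qed

text \<open>The case of non-expanding coefficient: \<open>x = - \<mu>\<inverse> (a + (\<kappa>/\<mu>) \<sigma>(a) + \<dots>)\<close> converges since
  the coefficients of \<open>a\<close> tend to \<open>0\<close> as the exponent decreases to \<open>0\<close>.\<close>
lemma solve_nonexpanding:
  assumes \<kappa>: "\<kappa> \<in> L" and \<mu>: "\<mu> \<in> L" "\<mu> \<noteq> 0" and le: "N \<kappa> \<le> N \<mu>" and s: "0 < s" and a: "a \<in> PosSeries s C" and C: "0 \<le> C"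
  shows "\<exists>x\<in>PosSeries s (C / N \<mu>). \<forall>i. \<kappa> * \<sigma> (x (i / of_nat p)) - \<mu> * x i = a i"
proof -
  define \<alpha> where "\<alpha> = \<kappa> / \<mu>"
  define b where "b i = - (inverse \<mu>) * a i" for i
  note aD = PosSeriesD[OF a]
  have \<alpha>: "\<alpha> \<in> L" "N \<alpha> \<le> 1" using \<kappa> \<mu> le in_L(8) N_pos[OF \<mu>(2)] by (auto simp: \<alpha>_def N_divide)
  have \<alpha>k: "N \<alpha> ^ k \<le> 1" for k using \<alpha>(2) by (simp add: power_le_one)
  have bL: "b i \<in> L" for i unfolding b_def using aD(1) \<mu> by (intro in_L(6) in_L(3) in_L(4))
  have b0: "b i = 0" if "i \<le> 0" for i using aD(2)[OF that] by (simp add: b_def)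
  have wo: "well_ordered {i. N (b i) > e}" if "e > 0" for e
    unfolding b_def by (rule well_ordered_cmult[OF aD(3) that])
  have Nb: "N (b i) \<le> C / N \<mu> * wt s i" for i
  proof -
    have "N (b i) = N (a i) / N \<mu>" by (simp add: b_def N_mult N_inverse divide_inverse)
    thus ?thesis using divide_right_mono[OF aD(4)[of i], of "N \<mu>"] by simp
  qed
  have decay: "\<exists>k0. \<forall>k\<ge>k0. \<forall>j\<le>j1. N \<alpha> ^ k * N (b (j / of_nat p ^ k)) \<le> e" if e: "e > 0" for e j1
  proof (cases "{i. N (b i) > e} = {}")
    case True
    then have be: "N (b i) \<le> e" for i by (simp add: Collect_empty_eq not_less)
    have "N \<alpha> ^ k * N (b i) \<le> e" for k i
      using mult_left_le_one_le[of "N (b i)" "N \<alpha> ^ k"] \<alpha>k[of k] be[of i] by simp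
    thus ?thesis by blast
  next
    case False
    then obtain m where m: "m \<in> {i. N (b i) > e}" "\<And>i. i \<in> {i. N (b i) > e} \<Longrightarrow> m \<le> i"
      using well_ordered_min[OF wo[OF e], of "{i. N (b i) > e}"] by blast
    have "m > 0" using m(1) b0[of m] e by (cases "m \<le> 0") auto
    then obtain k0 where k0: "\<forall>k\<ge>k0. \<forall>j\<le>j1. (of_rat (j / of_nat p ^ k) :: real) < of_rat m"
      using ex_scaled_less[of "of_rat m" j1] by auto
    have "N \<alpha> ^ k * N (b (j / of_nat p ^ k)) \<le> e" if "k \<ge> k0" "j \<le> j1" for k j
    proof -
      have "j / of_nat p ^ k < m" using k0 that of_rat_less by blast
      then have "N (b (j / of_nat p ^ k)) \<le> e" using m(2)[of "j / of_nat p ^ k"] by force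
      thus ?thesis using mult_left_le_one_le[of "N (b (j / of_nat p ^ k))" "N \<alpha> ^ k"] \<alpha>k[of k] by simp
    qed
    thus ?thesis by blast
  qed
  obtain x where x: "\<forall>i. x i \<in> L" "\<forall>i\<le>0. x i = 0" "\<forall>e>0. well_ordered {i. N (x i) > e}"
      "\<forall>i. x i = \<alpha> * \<sigma> (x (i / of_nat p)) + b i"
      "\<forall>j C. 0 \<le> C \<longrightarrow> (\<forall>k. N \<alpha> ^ k * N (b (j / of_nat p ^ k)) \<le> C) \<longrightarrow> N (x j) \<le> C"
    using twisted_sum[OF \<alpha>(1) of_nat_p_pos bL b0 wo decay] by blast
  have CN: "0 \<le> C / N \<mu>" using C by simp
  have CW: "0 \<le> C / N \<mu> * wt s j" for j using C by simp
  have "N (x j) \<le> C / N \<mu> * wt s j" for j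
  proof (cases "j \<le> 0")
    case True thus ?thesis using x(2) C by simp
  next
    case False
    have "N \<alpha> ^ k * N (b (j / of_nat p ^ k)) \<le> C / N \<mu> * wt s j" for k
    proof -
      have "N \<alpha> ^ k * N (b (j / of_nat p ^ k)) \<le> N (b (j / of_nat p ^ k))"
        using mult_left_le_one_le[of "N (b (j / of_nat p ^ k))" "N \<alpha> ^ k"] \<alpha>k[of k] by simp
      also have "\<dots> \<le> C / N \<mu> * wt s (j / of_nat p ^ k)" by (rule Nb)
      also have "\<dots> \<le> C / N \<mu> * wt s j"
      proof (intro mult_left_mono wt_mono CN)
        have "(1::rat) \<le> of_nat p ^ k" using p_gt_1 by (simp add: one_le_power)
        thus "j / of_nat p ^ k \<le> j" using False by (simp add: divide_le_eq mult_le_cancel_left1)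
      qed (use s in auto)
      finally show ?thesis .
    qed
    from x(5)[rule_format, OF CW this] show ?thesis .
  qed
  moreover have "\<kappa> * \<sigma> (x (i / of_nat p)) - \<mu> * x i = a i" for i
    using \<mu>(2) x(4)[rule_format, of i] by (simp add: \<alpha>_def b_def field_simps)
  ultimately show ?thesis using x(1-3) by (intro bexI[of _ x]) (auto simp: PosSeries_def)
qed

text \<open>The case of expanding coefficient. Where \<open>wt s i\<close> exceeds the expansion factor, the growth of the
  weight under \<open>i \<mapsto> p i\<close> absorbs the expansion and the same series converges. The remaining exponents
  are bounded, so there the inverse Frobenius contracts.\<close>
lemma solve_expanding:
  assumes \<kappa>: "\<kappa> \<in> L" and \<mu>: "\<mu> \<in> L" "\<mu> \<noteq> 0" and gt: "N \<mu> < N \<kappa>" and s: "0 < s" and a: "a \<in> PosSeries s C" and C: "0 \<le> C"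
  shows "\<exists>x\<in>PosSeries s (C / N \<mu>). \<forall>i. \<kappa> * \<sigma> (x (i / of_nat p)) - \<mu> * x i = a i"
proof -
  define \<rho> where "\<rho> = N \<kappa> / N \<mu>"
  have \<rho>: "\<rho> > 1" using gt N_pos[OF \<mu>(2)] by (simp add: \<rho>_def)
  have \<kappa>0: "\<kappa> \<noteq> 0" using gt by (metis N_0 N_nonneg not_less)
  note aD = PosSeriesD[OF a]
  have CN: "0 \<le> C / N \<mu>" using C by simp
  have CW: "0 \<le> C / N \<mu> * wt s j" for j using C by simp
  have restrict_wo: "well_ordered {i. N (if P i then a i else 0) > e}" if "e > 0" for e P
    by (rule well_ordered_subset[OF aD(3)[OF that]]) (use that in auto)
  have "\<exists>x\<in>PosSeries s (C / N \<mu>). \<forall>i. \<kappa> * \<sigma> (x (i / of_nat p)) - \<mu> * x i = (if wt s i \<ge> \<rho> then a i else 0)"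
  proof -
    define a' where "a' i = (if wt s i \<ge> \<rho> then a i else 0)" for i
    define \<alpha> where "\<alpha> = \<kappa> / \<mu>"
    define b where "b i = - (inverse \<mu>) * a' i" for i
    have \<alpha>: "\<alpha> \<in> L" "N \<alpha> = \<rho>" using \<kappa> \<mu> in_L(8) by (auto simp: \<alpha>_def \<rho>_def N_divide)
    have bL: "b i \<in> L" for i unfolding b_def a'_def using aD(1) \<mu> in_L(1) by (intro in_L(6) in_L(3) in_L(4)) auto
    have b0: "b i = 0" if "i \<le> 0" for i using aD(2)[OF that] by (simp add: b_def a'_def)
    have wo: "well_ordered {i. N (b i) > e}" if "e > 0" for e
      unfolding b_def a'_def by (rule well_ordered_cmult[OF restrict_wo that])
    have Nb: "N (b i) \<le> C / N \<mu> * wt s i" for i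
    proof -
      have "N (b i) = N (a' i) / N \<mu>" by (simp add: b_def N_mult N_inverse divide_inverse)
      moreover have "N (a' i) \<le> C * wt s i" using aD(4)[of i] C by (simp add: a'_def)
      ultimately show ?thesis using divide_right_mono[of "N (a' i)" "C * wt s i" "N \<mu>"] by simp
    qed
    have decay: "\<exists>k0. \<forall>k\<ge>k0. \<forall>j\<le>j1. N \<alpha> ^ k * N (b (j / of_nat p ^ k)) \<le> e" if e: "e > 0" for e j1
    proof -
      have "log p \<rho> / s > 0" using \<rho> s p_gt_1 by simp
      then obtain k0 where k0: "\<forall>k\<ge>k0. \<forall>j\<le>j1. (of_rat (j / of_nat p ^ k) :: real) < log p \<rho> / s"
        using ex_scaled_less by blast
      have "b (j / of_nat p ^ k) = 0" if "k \<ge> k0" "j \<le> j1" for k j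
      proof -
        have "s * of_rat (j / of_nat p ^ k) < log p \<rho>" using k0[rule_format, OF that] s by (simp add: field_simps)
        then have "wt s (j / of_nat p ^ k) < \<rho>" using p_gt_1 \<rho> by (subst (asm) less_log_iff) auto
        thus ?thesis by (simp add: b_def a'_def)
      qed
      thus ?thesis using e by (intro exI[of _ k0]) auto
    qed
    obtain x where x: "\<forall>i. x i \<in> L" "\<forall>i\<le>0. x i = 0" "\<forall>e>0. well_ordered {i. N (x i) > e}"
        "\<forall>i. x i = \<alpha> * \<sigma> (x (i / of_nat p)) + b i"
        "\<forall>j C. 0 \<le> C \<longrightarrow> (\<forall>k. N \<alpha> ^ k * N (b (j / of_nat p ^ k)) \<le> C) \<longrightarrow> N (x j) \<le> C"
      using twisted_sum[OF \<alpha>(1) of_nat_p_pos bL b0 wo decay] by blast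
    have grow: "\<rho> ^ k * wt s i \<le> wt s (i * of_nat p ^ k)" if i: "i > 0" "wt s i \<ge> \<rho>" for k i
    proof (induction k)
      case (Suc k)
      let ?j = "i * of_nat p ^ k"
      have "(1::rat) \<le> of_nat p ^ k" using p_gt_1 by (simp add: one_le_power)
      then have "i \<le> ?j" using i(1) by (simp add: mult_le_cancel_left1)
      then have "\<rho> \<le> wt s ?j" using i(2) wt_mono[of s i ?j] s by linarith
      then have "\<rho> * (\<rho> ^ k * wt s i) \<le> wt s ?j * wt s ?j" using Suc \<rho> by (intro mult_mono) auto
      also have "\<dots> = wt s (?j + ?j)" by (simp only: wt_add)
      also have "\<dots> \<le> wt s (?j * of_nat p)"
      proof (rule wt_mono)
        have "(of_nat 2::rat) \<le> of_nat p" using p_gt_1 by (intro of_nat_mono) simp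
        then have "?j * 2 \<le> ?j * of_nat p" using i(1) of_nat_p_pos by (intro mult_left_mono) auto
        thus "?j + ?j \<le> ?j * of_nat p" by simp
      qed (use s in simp)
      finally show ?case by (simp add: mult_ac)
    qed simp
    have "N (x j) \<le> C / N \<mu> * wt s j" for j
    proof (cases "j \<le> 0")
      case True thus ?thesis using x(2) C by simp
    next
      case False
      have "N \<alpha> ^ k * N (b (j / of_nat p ^ k)) \<le> C / N \<mu> * wt s j" for k
      proof (cases "wt s (j / of_nat p ^ k) \<ge> \<rho>")
        case True
        have "N \<alpha> ^ k * N (b (j / of_nat p ^ k)) \<le> \<rho> ^ k * (C / N \<mu> * wt s (j / of_nat p ^ k))"
          unfolding \<alpha>(2) using Nb \<rho> by (intro mult_left_mono) auto
        also have "\<dots> = C / N \<mu> * (\<rho> ^ k * wt s (j / of_nat p ^ k))" by simp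
        also have "\<dots> \<le> C / N \<mu> * wt s (j / of_nat p ^ k * of_nat p ^ k)"
          using CN True False of_nat_p_pos by (intro mult_left_mono grow) auto
        also have "j / of_nat p ^ k * of_nat p ^ k = j" using p_gt_1 by simp
        finally show ?thesis .
      qed (use C in \<open>simp add: b_def a'_def\<close>)
      from x(5)[rule_format, OF CW this] show ?thesis .
    qed
    moreover have "\<kappa> * \<sigma> (x (i / of_nat p)) - \<mu> * x i = a' i" for i
      using \<mu>(2) x(4)[rule_format, of i] by (simp add: \<alpha>_def b_def field_simps)
    ultimately show ?thesis using x(1-3) unfolding a'_def by (intro bexI[of _ x]) (auto simp: PosSeries_def)
  qed
  then obtain x where x: "x \<in> PosSeries s (C / N \<mu>)"
      "\<And>i. \<kappa> * \<sigma> (x (i / of_nat p)) - \<mu> * x i = (if wt s i \<ge> \<rho> then a i else 0)" by blast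
  have "\<exists>y\<in>PosSeries s (C / N \<mu>). \<forall>i. \<kappa> * \<sigma> (y (i / of_nat p)) - \<mu> * y i = (if wt s i < \<rho> then a i else 0)"
  proof -
    interpret inv: isometric_automorphism p v L \<sigma>_inv by (rule isometric_automorphism_inv)
    define a' where "a' i = (if wt s i < \<rho> then a i else 0)" for i
    define \<alpha> where "\<alpha> = \<sigma>_inv (\<mu> / \<kappa>)"
    define b where "b i = \<sigma>_inv (inverse \<kappa> * a' (of_nat p * i))" for i
    have \<mu>\<kappa>: "\<mu> / \<kappa> \<in> L" using \<mu> \<kappa> in_L(8) by blast
    have \<alpha>: "\<alpha> \<in> L" "N \<alpha> = 1 / \<rho>" using \<sigma>_inv(1)[OF \<mu>\<kappa>] inv.N_\<sigma>[OF \<mu>\<kappa>] by (auto simp: \<alpha>_def \<rho>_def N_divide)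
    have a'L: "inverse \<kappa> * a' i \<in> L" for i unfolding a'_def using aD(1) in_L(1) \<kappa> by (intro in_L(6) in_L(4)) auto
    have bL: "b i \<in> L" for i unfolding b_def by (rule \<sigma>_inv(1)[OF a'L])
    have Nb_eq: "N (b i) = N (inverse \<kappa> * a' (of_nat p * i))" for i unfolding b_def by (rule inv.N_\<sigma>[OF a'L])
    have b0: "b i = 0" if i: "i \<le> 0" for i
    proof -
      have "of_nat p * i \<le> 0" using i of_nat_p_pos by (simp add: mult_le_0_iff)
      then have "a' (of_nat p * i) = 0" using aD(2) by (simp add: a'_def)
      thus ?thesis using Nb_eq[of i] by simp
    qed
    have wo: "well_ordered {i. N (b i) > e}" if e: "e > 0" for e
    proof -
      have "well_ordered {i. N (inverse \<kappa> * a' i) > e}"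
      proof (rule well_ordered_cmult[OF _ e])
        fix e :: real assume "e > 0"
        thus "well_ordered {i. N (a' i) > e}"
          unfolding a'_def by (rule restrict_wo)
      qed
      from well_ordered_scale[OF this, of "1 / of_nat p"] show ?thesis
        using of_nat_p_pos by (simp add: Nb_eq mult.commute)
    qed
    have Nb: "N (b i) \<le> C / N \<mu>" for i
    proof (cases "wt s (of_nat p * i) \<ge> \<rho>")
      case False
      have "N (a (of_nat p * i)) \<le> C * wt s (of_nat p * i)" by (rule aD(4))
      also have "\<dots> \<le> C * \<rho>" using False C by (intro mult_left_mono) auto
      finally have "N (inverse \<kappa> * a (of_nat p * i)) \<le> inverse (N \<kappa>) * (C * \<rho>)"
        by (simp add: N_mult N_inverse mult_left_mono)
      also have "\<dots> = C / N \<mu>" using N_pos[OF \<kappa>0] \<kappa>0 by (simp add: \<rho>_def field_simps)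
      finally show ?thesis using False by (simp add: Nb_eq a'_def)
    qed (use CN in \<open>simp add: Nb_eq a'_def\<close>)
    have decay: "\<exists>k0. \<forall>k\<ge>k0. \<forall>j\<le>j1. N \<alpha> ^ k * N (b (j / (1 / of_nat p) ^ k)) \<le> e" if e: "e > 0" for e j1
    proof -
      have "(\<lambda>k. (C / N \<mu>) / \<rho> ^ k) \<longlonglongrightarrow> 0" using \<rho> by (intro LIMSEQ_divide_realpow_zero)
      then have "\<forall>\<^sub>F k in sequentially. (C / N \<mu>) / \<rho> ^ k < e" using e by (rule order_tendstoD(2))
      then obtain k0 where k0: "\<And>k. k \<ge> k0 \<Longrightarrow> (C / N \<mu>) / \<rho> ^ k < e" by (auto simp: eventually_sequentially)
      have "N \<alpha> ^ k * N (b i) \<le> e" if "k \<ge> k0" for k i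
      proof -
        have "N \<alpha> ^ k * N (b i) \<le> (1 / \<rho>) ^ k * (C / N \<mu>)" unfolding \<alpha>(2) using Nb \<rho> by (intro mult_left_mono) auto
        also have "\<dots> = (C / N \<mu>) / \<rho> ^ k" by (simp add: power_divide)
        finally show ?thesis using k0[OF that] by linarith
      qed
      thus ?thesis by blast
    qed
    have q: "(0::rat) < 1 / of_nat p" using of_nat_p_pos by simp
    obtain y where y: "\<forall>i. y i \<in> L" "\<forall>i\<le>0. y i = 0" "\<forall>e>0. well_ordered {i. N (y i) > e}"
        "\<forall>i. y i = \<alpha> * \<sigma>_inv (y (i / (1 / of_nat p))) + b i"
        "\<forall>j C. 0 \<le> C \<longrightarrow> (\<forall>k. N \<alpha> ^ k * N (b (j / (1 / of_nat p) ^ k)) \<le> C) \<longrightarrow> N (y j) \<le> C"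
      using inv.twisted_sum[OF \<alpha>(1) q bL b0 wo decay] by blast
    have "N (y j) \<le> C / N \<mu> * wt s j" for j
    proof (cases "j \<le> 0")
      case True thus ?thesis using y(2) C by simp
    next
      case False
      have "N \<alpha> ^ k * N (b i) \<le> C / N \<mu>" for k i
      proof -
        have "N \<alpha> ^ k \<le> 1" using \<rho> by (simp add: \<alpha>(2) power_le_one)
        then have "N \<alpha> ^ k * N (b i) \<le> N (b i)" using mult_left_le_one_le[of "N (b i)" "N \<alpha> ^ k"] by simp
        thus ?thesis using Nb[of i] by linarith
      qed
      from y(5)[rule_format, OF CN this] have "N (y j) \<le> C / N \<mu>" .
      also have "\<dots> \<le> C / N \<mu> * wt s j" using mult_left_mono[OF wt_ge_1[of s j] CN] s False by simp
      finally show ?thesis .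
    qed
    moreover have "\<kappa> * \<sigma> (y (i / of_nat p)) - \<mu> * y i = a' i" for i
    proof -
      have "y (i / of_nat p) = \<sigma>_inv (\<mu> / \<kappa>) * \<sigma>_inv (y i) + \<sigma>_inv (inverse \<kappa> * a' i)"
        using y(4)[rule_format, of "i / of_nat p"] of_nat_p_pos by (simp add: \<alpha>_def b_def)
      then have "\<sigma> (y (i / of_nat p)) = \<mu> / \<kappa> * y i + inverse \<kappa> * a' i"
        using \<sigma>_inv \<mu>\<kappa> a'L y(1) by (simp add: \<sigma>_add \<sigma>_mult in_L(6))
      thus ?thesis using \<kappa>0 by (simp add: field_simps)
    qed
    ultimately show ?thesis using y(1-3) unfolding a'_def by (intro bexI[of _ y]) (auto simp: PosSeries_def)
  qed
  then obtain y where y: "y \<in> PosSeries s (C / N \<mu>)"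
      "\<And>i. \<kappa> * \<sigma> (y (i / of_nat p)) - \<mu> * y i = (if wt s i < \<rho> then a i else 0)" by blast
  note xD = PosSeriesD[OF x(1)] and yD = PosSeriesD[OF y(1)]
  show ?thesis
  proof (intro bexI[of _ "\<lambda>i. x i + y i"] allI)
    fix i
    have "\<kappa> * \<sigma> (x (i / of_nat p) + y (i / of_nat p)) - \<mu> * (x i + y i)
        = (\<kappa> * \<sigma> (x (i / of_nat p)) - \<mu> * x i) + (\<kappa> * \<sigma> (y (i / of_nat p)) - \<mu> * y i)"
      using xD(1) yD(1) by (simp add: \<sigma>_add algebra_simps)
    thus "\<kappa> * \<sigma> (x (i / of_nat p) + y (i / of_nat p)) - \<mu> * (x i + y i) = a i" by (auto simp: x(2) y(2))
  next
    show "(\<lambda>i. x i + y i) \<in> PosSeries s (C / N \<mu>)"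
      unfolding PosSeries_def using xD yD
      by (auto intro!: in_L(5) well_ordered_add N_add_le)
  qed
qed

text \<open>Both cases together: the equation is solvable with a bounded loss of norm whatever the ratio of the two
  coefficients is.\<close>
lemma solve_twisted:
  assumes "\<kappa> \<in> L" "\<mu> \<in> L" "\<mu> \<noteq> 0" "0 < s" "a \<in> PosSeries s C" "0 \<le> C"
  shows "\<exists>x\<in>PosSeries s (C / N \<mu>). \<forall>i. \<kappa> * \<sigma> (x (i / of_nat p)) - \<mu> * x i = a i"
  using solve_nonexpanding[of \<kappa> \<mu> s a C] solve_expanding[of \<kappa> \<mu> s a C] assms by (cases "N \<kappa> \<le> N \<mu>") auto

end

lemma choice2: "(\<And>i j. \<exists>r. Q i j r) \<Longrightarrow> \<exists>R. \<forall>i j. Q i j (R i j)"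
  by metis

context isometric_automorphism begin

section \<open>Successive approximation\<close>

lemma PosSeries_mono: "x \<in> PosSeries s C \<Longrightarrow> C \<le> D \<Longrightarrow> x \<in> PosSeries s D"
  unfolding PosSeries_def using order.trans[OF _ mult_right_mono[of C D]] by fastforce

lemma PosSeries_add: "x \<in> PosSeries s C \<Longrightarrow> y \<in> PosSeries s C \<Longrightarrow> (\<lambda>i. x i + y i) \<in> PosSeries s C"
  unfolding PosSeries_def by (auto intro!: in_L(5) well_ordered_add N_add_le)

lemma PosSeries_minus: "x \<in> PosSeries s C \<Longrightarrow> (\<lambda>i. - x i) \<in> PosSeries s C"
  unfolding PosSeries_def by (auto intro!: in_L(3))

lemma PosSeries_zero: "0 \<le> C \<Longrightarrow> (\<lambda>_. 0) \<in> PosSeries s C"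
  unfolding PosSeries_def by (auto simp: in_L(1) not_less well_ordered_empty)

lemma PosSeries_sum:
  "0 \<le> C \<Longrightarrow> (\<And>l. l \<in> I \<Longrightarrow> x l \<in> PosSeries s C) \<Longrightarrow> (\<lambda>i. \<Sum>l\<in>I. x l i) \<in> PosSeries s C"
  by (induction I rule: infinite_finite_induct) (auto simp: PosSeries_zero PosSeries_add)

lemma bnd_supp_mono: assumes "bnd s x" "\<And>i. i < 0 \<Longrightarrow> x i = 0" "s \<le> t" shows "bnd t x"
proof -
  obtain C where C: "C \<ge> 0" "\<And>i. N (x i) \<le> C * wt s i" using bndE[OF assms(1)] by blast
  have "N (x i) \<le> C * wt t i" for i
  proof (cases "i < 0")
    case False
    have "N (x i) \<le> C * wt s i" by (rule C)
    also have "\<dots> \<le> C * wt t i" using False assms(3) C(1) by (intro mult_left_mono wt_le) auto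
    finally show ?thesis .
  qed (use assms(2) C(1) in simp)
  thus ?thesis unfolding bnd_def by blast
qed

text \<open>Series with exponents \<open>\<ge> 0\<close> of finite norm at radius \<open>s\<close>.\<close>
definition PS :: "real \<Rightarrow> 'a series set" where
  "PS s = {x. (\<forall>i. x i \<in> L) \<and> (\<forall>i<0. x i = 0) \<and> (\<forall>e>0. well_ordered {i. N (x i) > e}) \<and> bnd s x}"

lemma PS_SR: "x \<in> PS s \<Longrightarrow> s \<le> a \<Longrightarrow> s \<le> b \<Longrightarrow> x \<in> SR a b"
  unfolding PS_def SR_def using bnd_supp_mono by auto

lemma SR_PS: "x \<in> SR a b \<Longrightarrow> (\<And>i. i < 0 \<Longrightarrow> x i = 0) \<Longrightarrow> x \<in> PS a"
  unfolding PS_def SR_def by auto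

lemma PosSeries_PS: "x \<in> PosSeries s C \<Longrightarrow> x \<in> PS s"
  unfolding PS_def PosSeries_def bnd_def by auto

lemma PS_mono: "x \<in> PS s \<Longrightarrow> s \<le> t \<Longrightarrow> x \<in> PS t"
  unfolding PS_def using bnd_supp_mono by auto

lemma PS_frob: assumes x: "x \<in> PS s" and s: "0 < s" shows "frob x \<in> PS (s / p)" "frob x \<in> PS s"
proof -
  have neg: "frob x i = 0" if "i < 0" for i
  proof -
    have "i / of_nat p < 0" using that of_nat_p_pos by (simp add: divide_neg_pos)
    thus ?thesis using x by (simp add: frob_apply PS_def \<sigma>_0)
  qed
  have "frob x \<in> SR (s / p) (s / p)" using x by (intro SR_frob PS_SR[of x s]) auto
  then show *: "frob x \<in> PS (s / p)" by (rule SR_PS) (rule neg)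
  have "s / p \<le> s" using p_gt_1 s by (simp add: field_simps)
  thus "frob x \<in> PS s" by (rule PS_mono[OF *])
qed

lemma conv_neg:
  assumes "\<And>i. i < 0 \<Longrightarrow> x i = 0" "\<And>i. i < 0 \<Longrightarrow> y i = 0" "k < 0" shows "(x \<star> y) k = 0"
proof -
  have "x i * y (k - i) = 0" for i using assms(1)[of i] assms(2)[of "k - i"] assms(3) by (cases "i < 0") auto
  thus ?thesis using conv_finite_support[of "{}" x y k] by simp
qed

lemma conv_at_0:
  assumes "\<And>i. i < 0 \<Longrightarrow> x i = 0" "\<And>i. i < 0 \<Longrightarrow> y i = 0" shows "(x \<star> y) 0 = x 0 * y 0"
proof -
  have "x i * y (0 - i) = 0" if "i \<notin> {0}" for i using assms(1)[of i] assms(2)[of "- i"] that by (cases "i < 0") auto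
  thus ?thesis using conv_finite_support[of "{0}" x y 0] by simp
qed

lemma PS_conv: assumes "x \<in> PS s" "y \<in> PS s" "0 < s" shows "x \<star> y \<in> PS s"
proof -
  have x: "x \<in> SR s (2 * s)" and y: "y \<in> SR s (2 * s)" using assms by (auto intro!: PS_SR)
  show ?thesis
    by (rule SR_PS[OF SR_conv[OF _ _ x y]]) (use assms in \<open>auto simp: PS_def intro!: conv_neg\<close>)
qed

lemma PosSeries_conv:
  assumes x: "x \<in> PosSeries s C" and y: "y \<in> PosSeries s D" and s: "0 < s" and CD: "0 \<le> C" "0 \<le> D"
  shows "x \<star> y \<in> PosSeries s (C * D)"
proof -
  have sr: "x \<in> SR s (2 * s)" "y \<in> SR s (2 * s)" using x y s by (auto intro!: PS_SR PosSeries_PS)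
  note xD = PosSeriesD[OF x] and yD = PosSeriesD[OF y]
  have c: "x \<star> y \<in> SR s (2 * s)" using s sr by (intro SR_conv) auto
  have "(x \<star> y) k = 0" if "k \<le> 0" for k
  proof -
    have "x i * y (k - i) = 0" for i using xD(2)[of i] yD(2)[of "k - i"] that by (cases "i \<le> 0") auto
    thus ?thesis using conv_finite_support[of "{}" x y k] by simp
  qed
  moreover have "N ((x \<star> y) k) \<le> C * D * wt s k" for k
    using s by (intro conv_weighted_bound[OF _ _ sr CD]) (auto intro: xD(4) yD(4))
  ultimately show ?thesis using c unfolding PosSeries_def SR_def by auto
qed

lemma PosSeries_frob: assumes x: "x \<in> PosSeries s C" and s: "0 < s" "0 \<le> C" shows "frob x \<in> PosSeries s C"
proof -
  note xD = PosSeriesD[OF x]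
  have 0: "frob x i = 0" if "i \<le> 0" for i
  proof -
    have "i / of_nat p \<le> 0" using that of_nat_p_pos by (simp add: divide_nonpos_pos)
    thus ?thesis using xD(2) by (simp add: frob_apply \<sigma>_0)
  qed
  moreover have "N (frob x i) \<le> C * wt s i" for i
  proof (cases "i \<le> 0")
    case False
    have "N (frob x i) \<le> C * wt s (i / of_nat p)" using xD(1,4) by (simp add: frob_apply N_\<sigma>)
    also have "\<dots> \<le> C * wt s i"
    proof (intro mult_left_mono wt_mono)
      have "(1::rat) \<le> of_nat p" using p_gt_1 by simp
      thus "i / of_nat p \<le> i" using False by (simp add: divide_le_eq mult_le_cancel_left1)
    qed (use s in auto)
    finally show ?thesis .
  qed (use 0 s(2) in simp)
  ultimately show ?thesis using xD well_ordered_frob[of x] \<sigma>_in_L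
    by (auto simp: PosSeries_def frob_apply)
qed

lemma PosSeries_limit:
  assumes R: "\<And>m. R m \<in> PosSeries s (C / real p ^ m)" and s: "0 < s" and C: "0 \<le> C"
  shows "\<exists>x\<in>PosSeries s C. \<forall>n. (\<lambda>i. x i - (\<Sum>m<n. R m i)) \<in> PosSeries s (C / real p ^ n)"
proof -
  have Cp: "0 \<le> C / real p ^ n" "C / real p ^ n \<le> C" for n
    using C p_gt_1 by (simp_all add: divide_le_eq one_le_power mult_le_cancel_left1)
  have Cm: "C / real p ^ m \<le> C / real p ^ n" if "n \<le> m" for m n
    using that C p_gt_1 by (intro divide_left_mono power_increasing) auto
  note RD = PosSeriesD[OF R]
  have lim0: "(\<lambda>m. N (R m i)) \<longlonglongrightarrow> 0" for i
  proof (rule tendsto_sandwich[of "\<lambda>_. 0" _ _ "\<lambda>m. (C * wt s i) / real p ^ m"])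
    show "\<forall>\<^sub>F m in sequentially. N (R m i) \<le> C * wt s i / real p ^ m" using RD(4)[of _ i] by simp
  qed (auto intro: inverse_p_power_tendsto)
  have "\<forall>i. \<exists>x\<in>L. (\<lambda>n. N (sum (\<lambda>m. R m i) {..<n} - x)) \<longlonglongrightarrow> 0"
    by (intro allI complete_setD[OF L_is_complete] RD(1) lim0)
  then obtain x where x: "\<And>i. x i \<in> L" "\<And>i. (\<lambda>n. N (sum (\<lambda>m. R m i) {..<n} - x i)) \<longlonglongrightarrow> 0" by metis
  have approx: "N (x i - (\<Sum>m<n. R m i)) \<le> C / real p ^ n * wt s i" for n i
  proof (rule N_le_limit)
    show "0 \<le> C / real p ^ n * wt s i" using C by simp
    fix e :: real assume "e > 0"
    then have "\<forall>\<^sub>F k in sequentially. N (sum (\<lambda>m. R m i) {..<k} - x i) < e" using x(2) by (intro order_tendstoD(2))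
    then obtain k0 where k0: "\<And>k. k \<ge> k0 \<Longrightarrow> N (sum (\<lambda>m. R m i) {..<k} - x i) < e" by (auto simp: eventually_sequentially)
    define k where "k = max k0 n"
    have S: "sum (\<lambda>m. R m i) {..<k} - sum (\<lambda>m. R m i) {..<n} = sum (\<lambda>m. R m i) {n..<k}"
      using sum_diff_nat_ivl[of 0 n k "\<lambda>m. R m i"] by (simp add: k_def atLeast0LessThan)
    have "N (sum (\<lambda>m. R m i) {n..<k}) \<le> C / real p ^ n * wt s i"
    proof (rule N_sum_le)
      fix m assume "m \<in> {n..<k}"
      then have "C / real p ^ m * wt s i \<le> C / real p ^ n * wt s i" by (intro mult_right_mono Cm) auto
      thus "N (R m i) \<le> C / real p ^ n * wt s i" using RD(4)[of m i] by linarith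
    qed (use C in simp)
    moreover have eq: "sum (\<lambda>m. R m i) {n..<k} - (x i - sum (\<lambda>m. R m i) {..<n}) = sum (\<lambda>m. R m i) {..<k} - x i"
      unfolding S[symmetric] by simp
    ultimately show "\<exists>y. N y \<le> C / real p ^ n * wt s i \<and> N (y - (x i - sum (\<lambda>m. R m i) {..<n})) < e"
      using k0[of k] unfolding k_def[symmetric] eq[symmetric]
      by (intro exI[of _ "sum (\<lambda>m. R m i) {n..<k}"]) (simp add: k_def)
  qed
  have S: "(\<lambda>i. \<Sum>m<n. R m i) \<in> PosSeries s C" for n
    by (rule PosSeries_sum[OF C]) (rule PosSeries_mono[OF R Cp(2)])
  have "x \<in> PosSeries s C"
    unfolding PosSeries_def
  proof (intro CollectI conjI allI impI)
    fix i show "x i \<in> L" by (rule x(1))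
    show "N (x i) \<le> C * wt s i" using approx[of i 0] by simp
  next
    fix i :: rat assume "i \<le> 0"
    then have Sx: "N (x i) \<le> C * wt s i / real p ^ n" for n using approx[of i n] RD(2) by simp
    have "N (x i) < e" if "e > 0" for e
    proof -
      obtain n where "C * wt s i / real p ^ n < e" using small_p_power[OF \<open>e > 0\<close>] by blast
      thus ?thesis using Sx[of n] by linarith
    qed
    thus "x i = 0" by (rule limit_0_iff_small)
  next
    fix e :: real assume e: "e > 0"
    show "well_ordered {i. N (x i) > e}"
    proof (rule well_orderedI)
      fix f :: "nat \<Rightarrow> rat" assume f: "\<And>n. f n \<in> {i. N (x i) > e}" and dec: "\<And>n. f (Suc n) < f n"
      obtain n where n: "C * wt s (f 0) / real p ^ n < e" using small_p_power[OF e] by blast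
      have "f m \<in> {i. N (\<Sum>k<n. R k i) > e}" for m
      proof (rule ccontr)
        assume "f m \<notin> {i. N (\<Sum>k<n. R k i) > e}"
        then have a: "N (\<Sum>k<n. R k (f m)) \<le> e" by simp
        have "f m \<le> f 0" using decreasing_seq_less[of f 0 m] dec by (cases "m = 0") auto
        then have "C / real p ^ n * wt s (f m) \<le> C / real p ^ n * wt s (f 0)"
          using s by (intro mult_left_mono Cp(1) wt_mono) auto
        then have "N (x (f m) - (\<Sum>k<n. R k (f m))) \<le> e" using approx[of "f m" n] n by simp
        from N_add_le[OF this a] have "N (x (f m)) \<le> e" by simp
        thus False using f[of m] by simp
      qed
      thus False using well_orderedD[OF PosSeriesD(3)[OF S e], of f] dec by blast
    qed
  qed
  moreover have "(\<lambda>i. x i - (\<Sum>m<n. R m i)) \<in> PosSeries s (C / real p ^ n)" for n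
  proof -
    have "(\<lambda>i. x i + - (\<Sum>m<n. R m i)) \<in> PosSeries s C"
      by (intro PosSeries_add PosSeries_minus S calculation)
    thus ?thesis using approx[of _ n] unfolding PosSeries_def by simp
  qed
  ultimately show ?thesis by blast
qed

text \<open>A linear system solved up to a contracting perturbation. The operator \<open>\<theta>\<close> is the identity
  when a matrix close to \<open>1\<close> is inverted, and the Frobenius in the twisted equation.\<close>
lemma perturbed_system:
  fixes n :: nat and P :: "nat \<Rightarrow> nat \<Rightarrow> 'a series"
  assumes \<kappa>: "\<And>i. i < n \<Longrightarrow> \<kappa> i \<in> L" and \<mu>: "\<And>j. j < n \<Longrightarrow> \<mu> j \<in> L \<and> \<mu> j \<noteq> 0"
    and s: "0 < s" and \<eta>: "0 \<le> \<eta>" "\<And>j. j < n \<Longrightarrow> \<eta> / N (\<mu> j) \<le> 1 / p"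
    and P: "\<And>i j. i < n \<Longrightarrow> j < n \<Longrightarrow> P i j \<in> PosSeries s \<eta>"
    and \<theta>_Pos: "\<And>x C. 0 \<le> C \<Longrightarrow> x \<in> PosSeries s C \<Longrightarrow> \<theta> x \<in> PosSeries s C"
    and \<theta>_add: "\<And>x y. (\<And>i. x i \<in> L) \<Longrightarrow> (\<And>i. y i \<in> L) \<Longrightarrow> \<theta> (\<lambda>i. x i + y i) = (\<lambda>i. \<theta> x i + \<theta> y i)"
  shows "\<exists>Xs. (\<forall>i<n. \<forall>j<n. Xs i j \<in> PosSeries s (1 / p)) \<and>
    (\<forall>i<n. \<forall>j<n. \<forall>k. \<kappa> i * \<sigma> (Xs i j (k / of_nat p)) - \<mu> j * Xs i j k = P i j k + (\<Sum>h<n. (P i h \<star> \<theta> (Xs h j)) k))"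
proof -
  define C where "C = 1 / real p"
  have C: "0 \<le> C" "0 \<le> C / real p ^ m" for m by (simp_all add: C_def)
  have \<eta>C: "\<eta> * D / N (\<mu> j) \<le> D / p" if "j < n" "0 \<le> D" for j D
    using mult_right_mono[OF \<eta>(2)[OF that(1)] that(2)] by simp
  define Good where "Good m R \<longleftrightarrow> (\<forall>i<n. \<forall>j<n. R i j \<in> PosSeries s (C / real p ^ m))" for m and R :: "nat \<Rightarrow> nat \<Rightarrow> 'a series"
  define solves where "solves R rhs \<longleftrightarrow> (\<forall>i<n. \<forall>j<n. \<forall>k. \<kappa> i * \<sigma> (R i j (k / of_nat p)) - \<mu> j * R i j k = rhs i j k)"
    for R rhs :: "nat \<Rightarrow> nat \<Rightarrow> 'a series"
  have solve: "\<exists>R. (\<forall>i<n. \<forall>j<n. R i j \<in> PosSeries s (D / p)) \<and> solves R rhs"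
    if D: "0 \<le> D" and rhs: "\<And>i j. i < n \<Longrightarrow> j < n \<Longrightarrow> rhs i j \<in> PosSeries s (\<eta> * D)" for D rhs
  proof -
    have ex: "\<exists>r. i < n \<longrightarrow> j < n \<longrightarrow> r \<in> PosSeries s (D / p) \<and>
        (\<forall>k. \<kappa> i * \<sigma> (r (k / of_nat p)) - \<mu> j * r k = rhs i j k)" for i j
    proof -
      show "\<exists>r. i < n \<longrightarrow> j < n \<longrightarrow> r \<in> PosSeries s (D / p) \<and>
        (\<forall>k. \<kappa> i * \<sigma> (r (k / of_nat p)) - \<mu> j * r k = rhs i j k)"
      proof (cases "i < n \<and> j < n")
        case True
        then have ij: "i < n" "j < n" by auto
        have "\<exists>r\<in>PosSeries s (\<eta> * D / N (\<mu> j)). \<forall>k. \<kappa> i * \<sigma> (r (k / of_nat p)) - \<mu> j * r k = rhs i j k"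
          by (rule solve_twisted[OF \<kappa>[OF ij(1)] conjunct1[OF \<mu>[OF ij(2)]] conjunct2[OF \<mu>[OF ij(2)]] s rhs[OF ij]
            mult_nonneg_nonneg[OF \<eta>(1) D]])
        then obtain r where r: "r \<in> PosSeries s (\<eta> * D / N (\<mu> j))" "\<forall>k. \<kappa> i * \<sigma> (r (k / of_nat p)) - \<mu> j * r k = rhs i j k"
          by (elim bexE)
        have "r \<in> PosSeries s (D / p)" by (rule PosSeries_mono[OF r(1) \<eta>C[OF ij(2) D]])
        thus ?thesis using r(2) by (intro exI[of _ r]) simp
      qed auto
    qed
    have "\<exists>R. \<forall>i j. i < n \<longrightarrow> j < n \<longrightarrow> R i j \<in> PosSeries s (D / p) \<and>
        (\<forall>k. \<kappa> i * \<sigma> (R i j (k / of_nat p)) - \<mu> j * R i j k = rhs i j k)" by (rule choice2) (rule ex)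
    then obtain R where R: "\<forall>i j. i < n \<longrightarrow> j < n \<longrightarrow> R i j \<in> PosSeries s (D / p) \<and>
        (\<forall>k. \<kappa> i * \<sigma> (R i j (k / of_nat p)) - \<mu> j * R i j k = rhs i j k)" by (elim exE)
    show ?thesis unfolding solves_def by (intro exI[of _ R] conjI allI impI) (use R in blast)+
  qed
  define next_rhs where "next_rhs R = (\<lambda>i j k. \<Sum>h<n. (P i h \<star> \<theta> (R h j)) k)" for R :: "nat \<Rightarrow> nat \<Rightarrow> 'a series"
  have "\<exists>R. \<forall>m. (Good m (R m) \<and> (m = 0 \<longrightarrow> solves (R m) P)) \<and> solves (R (Suc m)) (next_rhs (R m))"
  proof (rule dependent_nat_choice)
    have "\<exists>R. (\<forall>i<n. \<forall>j<n. R i j \<in> PosSeries s (1 / p)) \<and> solves R P"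
      by (rule solve) (use P in simp_all)
    then obtain R where "\<forall>i<n. \<forall>j<n. R i j \<in> PosSeries s (1 / p)" "solves R P" by blast
    thus "\<exists>R. Good 0 R \<and> (0 = (0::nat) \<longrightarrow> solves R P)" by (intro exI[of _ R]) (simp add: Good_def C_def)
  next
    fix R and m :: nat assume "Good m R \<and> (m = 0 \<longrightarrow> solves R P)"
    then have R: "R i j \<in> PosSeries s (C / real p ^ m)" if "i < n" "j < n" for i j using that by (simp add: Good_def)
    have nr: "next_rhs R i j \<in> PosSeries s (\<eta> * (C / real p ^ m))" if "i < n" "j < n" for i j
      unfolding next_rhs_def using that C \<eta>(1)
      by (intro PosSeries_sum mult_nonneg_nonneg PosSeries_conv P \<theta>_Pos R s) auto
    have "\<exists>R'. (\<forall>i<n. \<forall>j<n. R' i j \<in> PosSeries s (C / real p ^ m / p)) \<and> solves R' (next_rhs R)"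
      by (rule solve[OF C(2)]) (rule nr)
    then obtain R' where "\<forall>i<n. \<forall>j<n. R' i j \<in> PosSeries s (C / real p ^ m / p)" "solves R' (next_rhs R)"
      by blast
    thus "\<exists>R'. (Good (Suc m) R' \<and> (Suc m = 0 \<longrightarrow> solves R' P)) \<and> solves R' (next_rhs R)"
      by (intro exI[of _ R']) (simp add: Good_def mult.commute)
  qed
  then obtain R where R: "\<And>m. Good m (R m)" "solves (R 0) P" "\<And>m. solves (R (Suc m)) (next_rhs (R m))" by metis
  have RP: "R m i j \<in> PosSeries s (C / real p ^ m)" if "i < n" "j < n" for m i j using R(1) that by (simp add: Good_def)
  have ex: "\<exists>x. i < n \<longrightarrow> j < n \<longrightarrow> x \<in> PosSeries s C \<and> (\<forall>q. (\<lambda>k. x k - (\<Sum>m<q. R m i j k)) \<in> PosSeries s (C / real p ^ q))" for i j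
  proof -
    show "\<exists>x. i < n \<longrightarrow> j < n \<longrightarrow> x \<in> PosSeries s C \<and> (\<forall>q. (\<lambda>k. x k - (\<Sum>m<q. R m i j k)) \<in> PosSeries s (C / real p ^ q))"
    proof (cases "i < n \<and> j < n")
      case True
      then show ?thesis using PosSeries_limit[of "\<lambda>m. R m i j" s C, OF RP s C(1)] by blast
    qed auto
  qed
  have "\<exists>x. \<forall>i j. i < n \<longrightarrow> j < n \<longrightarrow> x i j \<in> PosSeries s C \<and> (\<forall>q. (\<lambda>k. x i j k - (\<Sum>m<q. R m i j k)) \<in> PosSeries s (C / real p ^ q))"
    by (rule choice2) (rule ex)
  then obtain x where x': "\<forall>i j. i < n \<longrightarrow> j < n \<longrightarrow> x i j \<in> PosSeries s C \<and> (\<forall>q. (\<lambda>k. x i j k - (\<Sum>m<q. R m i j k)) \<in> PosSeries s (C / real p ^ q))"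
    by (elim exE)
  have x: "\<And>i j. i < n \<Longrightarrow> j < n \<Longrightarrow> x i j \<in> PosSeries s C"
    "\<And>i j q. i < n \<Longrightarrow> j < n \<Longrightarrow> (\<lambda>k. x i j k - (\<Sum>m<q. R m i j k)) \<in> PosSeries s (C / real p ^ q)"
    using x' by blast+
  have "\<kappa> i * \<sigma> (x i j (k / of_nat p)) - \<mu> j * x i j k = P i j k + (\<Sum>h<n. (P i h \<star> \<theta> (x h j)) k)"
    if ij: "i < n" "j < n" for i j k
  proof -
    define S where "S q i j k = (\<Sum>m<q. R m i j k)" for q i j k
    have SL: "S q i j k \<in> L" if "i < n" "j < n" for q i j k
      unfolding S_def using PosSeriesD(1)[OF RP[OF that]] by (intro in_L(11))
    have S_Pos: "S q i j \<in> PosSeries s C" if "i < n" "j < n" for q i j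
    proof -
      have "C / real p ^ m \<le> C" for m using C(1) p_gt_1 by (simp add: divide_le_eq one_le_power mult_le_cancel_left1)
      thus ?thesis unfolding S_def[abs_def] using RP[OF that] by (intro PosSeries_sum C) (rule PosSeries_mono)
    qed
    have SR: "y \<in> SR s (2 * s)" if "y \<in> PosSeries s D" for y D using that s by (auto intro!: PS_SR PosSeries_PS)
    have \<theta>_sum: "\<theta> (S q h j) = (\<lambda>k. \<Sum>m<q. \<theta> (R m h j) k)" if h: "h < n" for q h
    proof (induction q)
      case 0
      have "\<theta> (\<lambda>i. 0 + 0) = (\<lambda>i. \<theta> (\<lambda>_. 0) i + \<theta> (\<lambda>_. 0) i)" by (rule \<theta>_add) (auto simp: in_L(1))
      then have z: "\<theta> (\<lambda>_. 0) i = \<theta> (\<lambda>_. 0) i + \<theta> (\<lambda>_. 0) i" for i by (metis add_0_right)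
      have "\<theta> (\<lambda>_. 0) i = 0" for i using z[of i] by (metis add_cancel_right_right)
      thus ?case unfolding S_def[abs_def] by (simp add: fun_eq_iff)
    next
      case (Suc q)
      have "S (Suc q) h j = (\<lambda>k. S q h j k + R q h j k)" by (simp add: S_def[abs_def])
      then have "\<theta> (S (Suc q) h j) = (\<lambda>k. \<theta> (S q h j) k + \<theta> (R q h j) k)"
        using SL[OF h ij(2)] PosSeriesD(1)[OF RP[OF h ij(2)]] by (simp add: \<theta>_add)
      thus ?case using Suc by simp
    qed
    have rec: "\<kappa> i * \<sigma> (S (Suc q) i j (k / of_nat p)) - \<mu> j * S (Suc q) i j k = P i j k + (\<Sum>h<n. (P i h \<star> \<theta> (S q h j)) k)" for q
    proof -
      have "\<kappa> i * \<sigma> (S (Suc q) i j (k / of_nat p)) - \<mu> j * S (Suc q) i j k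
          = (\<Sum>m<Suc q. \<kappa> i * \<sigma> (R m i j (k / of_nat p)) - \<mu> j * R m i j k)"
        unfolding S_def using PosSeriesD(1)[OF RP[OF ij]]
        by (subst \<sigma>_sum) (auto simp: sum_distrib_left sum_subtractf simp del: sum.lessThan_Suc)
      also have "\<dots> = P i j k + (\<Sum>m<q. next_rhs (R m) i j k)"
        unfolding sum.lessThan_Suc_shift using R(2,3) ij unfolding solves_def by simp
      also have "(\<Sum>m<q. next_rhs (R m) i j k) = (\<Sum>h<n. \<Sum>m<q. (P i h \<star> \<theta> (R m h j)) k)"
        unfolding next_rhs_def by (rule sum.swap)
      also have "\<dots> = (\<Sum>h<n. (P i h \<star> \<theta> (S q h j)) k)"
      proof (rule sum.cong[OF HOL.refl])
        fix h assume "h \<in> {..<n}"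
        then have h: "h < n" by simp
        have "P i h \<star> (\<lambda>k. \<Sum>m<q. \<theta> (R m h j) k) = (\<lambda>k. \<Sum>m<q. (P i h \<star> \<theta> (R m h j)) k)"
          using s h ij by (intro conv_sum_right[of s "2 * s"] SR[OF \<theta>_Pos[OF C(2) RP]] SR[OF P]) auto
        thus "(\<Sum>m<q. (P i h \<star> \<theta> (R m h j)) k) = (P i h \<star> \<theta> (S q h j)) k" by (simp add: \<theta>_sum[OF h])
      qed
      finally show ?thesis .
    qed
    define err where "err = (\<kappa> i * \<sigma> (x i j (k / of_nat p)) - \<mu> j * x i j k) - (P i j k + (\<Sum>h<n. (P i h \<star> \<theta> (x h j)) k))"
    define B where "B = N (\<kappa> i) * wt s (k / of_nat p) + N (\<mu> j) * wt s k + \<eta> * wt s k"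
    have B: "0 \<le> B" using \<eta>(1) by (simp add: B_def)
    have bound: "N err \<le> C * B / real p ^ q" for q
    proof -
      let ?D = "C / real p ^ q"
      define d where "d h k = x h j k - S q h j k" for h k
      have d: "d h \<in> PosSeries s ?D" if "h < n" for h
        using x(2)[OF that ij(2), of q] by (simp add: d_def[abs_def] S_def)
      define d' where "d' k = x i j k - S (Suc q) i j k" for k
      have d': "d' \<in> PosSeries s ?D"
      proof -
        have "d' \<in> PosSeries s (C / real p ^ Suc q)" using x(2)[OF ij, of "Suc q"] unfolding d'_def[abs_def] S_def .
        moreover have "C / real p ^ Suc q \<le> ?D" using C(1) p_gt_1 by (intro divide_left_mono power_increasing) auto
        ultimately show ?thesis by (rule PosSeries_mono)
      qed
      have \<theta>x: "\<theta> (x h j) = (\<lambda>k. \<theta> (S q h j) k + \<theta> (d h) k)" if h: "h < n" for h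
      proof -
        have "x h j = (\<lambda>k. S q h j k + d h k)" by (simp add: d_def)
        thus ?thesis using \<theta>_add[of "S q h j" "d h"] SL[OF h ij(2)] PosSeriesD(1)[OF d[OF h]] by simp
      qed
      have Px: "(P i h \<star> \<theta> (x h j)) k = (P i h \<star> \<theta> (S q h j)) k + (P i h \<star> \<theta> (d h)) k" if h: "h < n" for h
      proof -
        have "P i h \<star> (\<lambda>k. \<theta> (S q h j) k + \<theta> (d h) k) = (\<lambda>k. (P i h \<star> \<theta> (S q h j)) k + (P i h \<star> \<theta> (d h)) k)"
          using s by (intro conv_add_right[of s "2 * s"] SR[OF \<theta>_Pos[OF C(1) S_Pos[OF h ij(2)]]] SR[OF \<theta>_Pos[OF C(2) d[OF h]]] SR[OF P[OF ij(1) h]]) auto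
        thus ?thesis by (simp add: \<theta>x[OF h])
      qed
      have "x i j (k / of_nat p) = S (Suc q) i j (k / of_nat p) + d' (k / of_nat p)" by (simp add: d'_def)
      then have sx: "\<sigma> (x i j (k / of_nat p)) = \<sigma> (S (Suc q) i j (k / of_nat p)) + \<sigma> (d' (k / of_nat p))"
        using \<sigma>_add[OF SL[OF ij] PosSeriesD(1)[OF d']] by simp
      have "err = (\<kappa> i * \<sigma> (d' (k / of_nat p)) - \<mu> j * d' k) - (\<Sum>h<n. (P i h \<star> \<theta> (d h)) k)"
      proof -
        have "(\<Sum>h<n. (P i h \<star> \<theta> (x h j)) k) = (\<Sum>h<n. (P i h \<star> \<theta> (S q h j)) k) + (\<Sum>h<n. (P i h \<star> \<theta> (d h)) k)"
          by (simp add: Px sum.distrib)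
        moreover have "x i j k = S (Suc q) i j k + d' k" by (simp add: d'_def)
        ultimately show ?thesis using rec[of q] unfolding err_def sx by (simp add: algebra_simps)
      qed
      moreover have "N (\<kappa> i * \<sigma> (d' (k / of_nat p))) \<le> C * B / real p ^ q"
      proof -
        have "N (\<kappa> i * \<sigma> (d' (k / of_nat p))) \<le> N (\<kappa> i) * (?D * wt s (k / of_nat p))"
          unfolding N_mult N_\<sigma>[OF PosSeriesD(1)[OF d']] by (rule mult_left_mono[OF PosSeriesD(4)[OF d'] N_nonneg])
        also have "\<dots> = ?D * (N (\<kappa> i) * wt s (k / of_nat p))" by simp
        also have "\<dots> \<le> ?D * B" using \<eta>(1) by (intro mult_left_mono C) (simp add: B_def)
        finally show ?thesis by simp
      qed
      moreover have "N (\<mu> j * d' k) \<le> C * B / real p ^ q"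
      proof -
        have "N (\<mu> j * d' k) \<le> N (\<mu> j) * (?D * wt s k)"
          unfolding N_mult by (rule mult_left_mono[OF PosSeriesD(4)[OF d'] N_nonneg])
        also have "\<dots> = ?D * (N (\<mu> j) * wt s k)" by simp
        also have "\<dots> \<le> ?D * B" using \<eta>(1) by (intro mult_left_mono C) (simp add: B_def)
        finally show ?thesis by simp
      qed
      moreover have "N (\<Sum>h<n. (P i h \<star> \<theta> (d h)) k) \<le> C * B / real p ^ q"
      proof (rule N_sum_le)
        fix h assume "h \<in> {..<n}"
        then have h: "h < n" by simp
        have "P i h \<star> \<theta> (d h) \<in> PosSeries s (\<eta> * ?D)"
          by (rule PosSeries_conv[OF P[OF ij(1) h] \<theta>_Pos[OF C(2) d[OF h]] s \<eta>(1) C(2)])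
        from PosSeriesD(4)[OF this, of k] have "N ((P i h \<star> \<theta> (d h)) k) \<le> ?D * (\<eta> * wt s k)" by (simp add: mult_ac)
        also have "\<dots> \<le> ?D * B" by (intro mult_left_mono C) (simp add: B_def)
        finally show "N ((P i h \<star> \<theta> (d h)) k) \<le> C * B / real p ^ q" by simp
      qed (use C(1) B in simp)
      ultimately show ?thesis by (metis N_diff_le)
    qed
    have "N err < e" if "e > 0" for e
    proof -
      obtain q where "C * B / real p ^ q < e" using small_p_power[OF \<open>e > 0\<close>] by blast
      thus ?thesis using bound[of q] by linarith
    qed
    then have "err = 0" by (rule limit_0_iff_small)
    thus ?thesis by (simp add: err_def)
  qed
  thus ?thesis using x(1) unfolding C_def by (intro exI[of _ x]) blast
qed

end

context isometric_automorphism begin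

section \<open>Matrices of series\<close>

definition mm :: "nat \<Rightarrow> (nat \<Rightarrow> nat \<Rightarrow> 'a series) \<Rightarrow> (nat \<Rightarrow> nat \<Rightarrow> 'a series) \<Rightarrow> nat \<Rightarrow> nat \<Rightarrow> 'a series" where
  "mm m A B i j = (\<lambda>k. \<Sum>h<m. (A i h \<star> B h j) k)"

lemma mm_cong:
  "(\<And>h. h < m \<Longrightarrow> A i h = A' i h) \<Longrightarrow> (\<And>h. h < m \<Longrightarrow> B h j = B' h j) \<Longrightarrow> mm m A B i j = mm m A' B' i j"
  unfolding mm_def by (intro ext sum.cong) auto

lemma mm_assoc:
  assumes ab: "0 < a" "a < b" and A: "\<And>h. h < n \<Longrightarrow> A i h \<in> SR a b"
    and B: "\<And>h k. h < n \<Longrightarrow> k < m \<Longrightarrow> B h k \<in> SR a b" and C: "\<And>k. k < m \<Longrightarrow> C k j \<in> SR a b"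
  shows "mm m (mm n A B) C i j = mm n A (mm m B C) i j"
proof
  fix t
  have "mm m (mm n A B) C i j t = (\<Sum>k<m. \<Sum>h<n. ((A i h \<star> B h k) \<star> C k j) t)"
    unfolding mm_def[of m]
  proof (intro sum.cong HOL.refl)
    fix k assume "k \<in> {..<m}"
    then have "mm n A B i k \<star> C k j = (\<lambda>t. \<Sum>h<n. ((A i h \<star> B h k) \<star> C k j) t)"
      unfolding mm_def by (intro conv_sum_left[OF ab]) (auto intro!: SR_conv[OF ab] A B C)
    thus "(mm n A B i k \<star> C k j) t = (\<Sum>h<n. ((A i h \<star> B h k) \<star> C k j) t)" by simp
  qed
  also have "\<dots> = (\<Sum>h<n. \<Sum>k<m. (A i h \<star> (B h k \<star> C k j)) t)"
    by (subst sum.swap) (intro sum.cong HOL.refl, simp add: conv_assoc[OF ab A B C])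
  also have "\<dots> = mm n A (mm m B C) i j t"
    unfolding mm_def[of n]
  proof (intro sum.cong HOL.refl)
    fix h assume "h \<in> {..<n}"
    then have "A i h \<star> mm m B C h j = (\<lambda>t. \<Sum>k<m. (A i h \<star> (B h k \<star> C k j)) t)"
      unfolding mm_def by (intro conv_sum_right[OF ab]) (auto intro!: SR_conv[OF ab] A B C)
    thus "(\<Sum>k<m. (A i h \<star> (B h k \<star> C k j)) t) = (A i h \<star> mm m B C h j) t" by simp
  qed
  finally show "mm m (mm n A B) C i j t = mm n A (mm m B C) i j t" .
qed

definition dm :: "(nat \<Rightarrow> 'a) \<Rightarrow> nat \<Rightarrow> nat \<Rightarrow> 'a series" where
  "dm l i j = series_const (if i = j then l i else 0)"

abbreviation "im \<equiv> dm (\<lambda>_. 1)"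

lemma mm_dm_left: "i < m \<Longrightarrow> mm m (dm l) A i j = (\<lambda>k. l i * A i j k)"
proof
  fix k assume i: "i < m"
  have "(\<Sum>h<m. (dm l i h \<star> A h j) k) = (\<Sum>h<m. if h = i then l i * A i j k else 0)"
    by (intro sum.cong) (auto simp: dm_def conv_const_left)
  thus "mm m (dm l) A i j k = l i * A i j k" using i by (simp add: mm_def)
qed

lemma mm_dm_right: "j < m \<Longrightarrow> mm m A (dm l) i j = (\<lambda>k. l j * A i j k)"
proof
  fix k assume j: "j < m"
  have "(\<Sum>h<m. (A i h \<star> dm l h j) k) = (\<Sum>h<m. if h = j then l j * A i j k else 0)"
    by (intro sum.cong) (auto simp: dm_def conv_const_right)
  thus "mm m A (dm l) i j k = l j * A i j k" using j by (simp add: mm_def)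
qed

lemma mm_im: "i < m \<Longrightarrow> mm m im A i j = A i j" "j < m \<Longrightarrow> mm m A im i j = A i j"
  by (simp_all add: mm_dm_left mm_dm_right)

lemma dm_PS: assumes "(if i = j then l i else 0) \<in> L" shows "dm l i j \<in> PS s"
proof -
  have "dm l i j \<in> SR s s" unfolding dm_def by (rule SR_const[OF assms])
  thus ?thesis by (rule SR_PS) (auto simp: dm_def series_const_def)
qed

lemma im_PS: "im i j \<in> PS s"
  by (rule dm_PS) (auto simp: in_L)

lemma PS_add: "x \<in> PS s \<Longrightarrow> y \<in> PS s \<Longrightarrow> (\<lambda>i. x i + y i) \<in> PS s"
  unfolding PS_def by (auto intro!: in_L(5) well_ordered_add bnd_add)

text \<open>A square matrix close to \<open>1\<close> is invertible: its right inverse, found by successive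
  approximation, is again close to \<open>1\<close>, so it has a right inverse as well.\<close>
lemma near_identity_inverse:
  fixes n :: nat
  assumes s: "0 < s" and P: "\<And>i j. i < n \<Longrightarrow> j < n \<Longrightarrow> P i j \<in> PosSeries s (1 / p)"
  shows "\<exists>Y. (\<forall>i<n. \<forall>j<n. Y i j \<in> PosSeries s (1 / p)) \<and>
     (\<forall>i<n. \<forall>j<n. mm n (\<lambda>i j k. im i j k + P i j k) (\<lambda>i j k. im i j k + Y i j k) i j = im i j) \<and>
     (\<forall>i<n. \<forall>j<n. mm n (\<lambda>i j k. im i j k + Y i j k) (\<lambda>i j k. im i j k + P i j k) i j = im i j)"
proof -
  define one :: "(nat \<Rightarrow> nat \<Rightarrow> 'a series) \<Rightarrow> nat \<Rightarrow> nat \<Rightarrow> 'a series" where "one P = (\<lambda>i j k. im i j k + P i j k)" for P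
  have ab: "0 < s" "s < 2 * s" using s by auto
  have SR: "x \<in> SR s (2 * s)" if "x \<in> PS s" for x using that s by (intro PS_SR) auto
  have Pos_SR: "x \<in> SR s (2 * s)" if "x \<in> PosSeries s C" for x C by (rule SR[OF PosSeries_PS[OF that]])
  have im_SR: "im i j \<in> SR s (2 * s)" for i j by (rule SR[OF im_PS])
  have one_SR: "one P i j \<in> SR s (2 * s)" if "P i j \<in> PosSeries s C" for P i j C
    unfolding one_def by (intro SR PS_add im_PS PosSeries_PS[OF that])
  have right: "\<exists>Y. (\<forall>i<n. \<forall>j<n. Y i j \<in> PosSeries s (1 / p)) \<and> (\<forall>i<n. \<forall>j<n. mm n (one P) (one Y) i j = im i j)"
    if P: "\<And>i j. i < n \<Longrightarrow> j < n \<Longrightarrow> P i j \<in> PosSeries s (1 / p)" for P :: "nat \<Rightarrow> nat \<Rightarrow> 'a series"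
  proof -
    have "\<exists>Y. (\<forall>i<n. \<forall>j<n. Y i j \<in> PosSeries s (1 / p)) \<and>
      (\<forall>i<n. \<forall>j<n. \<forall>k. 0 * \<sigma> (Y i j (k / of_nat p)) - (- 1) * Y i j k = - P i j k + (\<Sum>h<n. ((\<lambda>k. - P i h k) \<star> Y h j) k))"
      by (rule perturbed_system[where \<theta> = "\<lambda>x. x" and \<eta> = "1 / p" and P = "\<lambda>i j k. - P i j k" and \<kappa> = "\<lambda>_. 0" and \<mu> = "\<lambda>_. - 1"])
         (use s P in \<open>auto simp: in_L(1,2) in_L(3)[OF in_L(2)] intro: PosSeries_minus\<close>)
    then obtain Y where Y': "\<forall>i<n. \<forall>j<n. Y i j \<in> PosSeries s (1 / p)"
      "\<forall>i<n. \<forall>j<n. \<forall>k. 0 * \<sigma> (Y i j (k / of_nat p)) - (- 1) * Y i j k = - P i j k + (\<Sum>h<n. ((\<lambda>k. - P i h k) \<star> Y h j) k)"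
      by (elim exE conjE)
    have Y: "\<And>i j. i < n \<Longrightarrow> j < n \<Longrightarrow> Y i j \<in> PosSeries s (1 / p)" using Y'(1) by simp
    have Y_eq: "Y i j k = - P i j k + (\<Sum>h<n. ((\<lambda>k. - P i h k) \<star> Y h j) k)" if "i < n" "j < n" for i j k
      using Y'(2)[rule_format, OF that, of k] by simp
    have "mm n (one P) (one Y) i j = im i j" if ij: "i < n" "j < n" for i j
    proof
      fix k
      have exp: "(one P i h \<star> one Y h j) k = (im i h \<star> im h j) k + (im i h \<star> Y h j) k + ((P i h \<star> im h j) k + (P i h \<star> Y h j) k)"
        if h: "h < n" for h
        unfolding one_def
        using conv_add_left[OF ab im_SR Pos_SR[OF P[OF ij(1) h]], of "\<lambda>k. im h j k + Y h j k" i h] one_SR[of Y, OF Y[OF h ij(2)]]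
          conv_add_right[OF ab im_SR Pos_SR[OF Y[OF h ij(2)]] im_SR, of i h h j]
          conv_add_right[OF ab im_SR Pos_SR[OF Y[OF h ij(2)]] Pos_SR[OF P[OF ij(1) h]], of h j]
        by (simp add: one_def)
      have neg: "((\<lambda>k. - P i h k) \<star> Y h j) k = - (P i h \<star> Y h j) k" if h: "h < n" for h
        using conv_cmult_left[OF ab Pos_SR[OF P[OF ij(1) h]] Pos_SR[OF Y[OF h ij(2)]], of "-1"] by simp
      have "mm n (one P) (one Y) i j k = mm n im im i j k + mm n im Y i j k + (mm n P im i j k + (\<Sum>h<n. (P i h \<star> Y h j) k))"
        unfolding mm_def by (simp add: exp sum.distrib)
      also have "\<dots> = im i j k + Y i j k + (P i j k + (\<Sum>h<n. (P i h \<star> Y h j) k))" using ij by (simp add: mm_im)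
      also have "(\<Sum>h<n. (P i h \<star> Y h j) k) = - (\<Sum>h<n. ((\<lambda>k. - P i h k) \<star> Y h j) k)" by (simp add: neg sum_negf)
      also have "im i j k + Y i j k + (P i j k + - (\<Sum>h<n. ((\<lambda>k. - P i h k) \<star> Y h j) k)) = im i j k"
        by (subst Y_eq[OF ij]) (simp add: algebra_simps)
      finally show "mm n (one P) (one Y) i j k = im i j k" .
    qed
    thus ?thesis using Y by (intro exI[of _ Y]) simp
  qed
  have "\<exists>Y. (\<forall>i<n. \<forall>j<n. Y i j \<in> PosSeries s (1 / p)) \<and> (\<forall>i<n. \<forall>j<n. mm n (one P) (one Y) i j = im i j)"
    by (rule right) (rule P)
  then obtain Y where Y: "\<forall>i<n. \<forall>j<n. Y i j \<in> PosSeries s (1 / p)" "\<forall>i<n. \<forall>j<n. mm n (one P) (one Y) i j = im i j"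
    by (elim exE conjE)
  have "\<exists>Z. (\<forall>i<n. \<forall>j<n. Z i j \<in> PosSeries s (1 / p)) \<and> (\<forall>i<n. \<forall>j<n. mm n (one Y) (one Z) i j = im i j)"
    by (rule right) (rule Y(1)[rule_format])
  then obtain Z where Z: "\<forall>i<n. \<forall>j<n. Z i j \<in> PosSeries s (1 / p)" "\<forall>i<n. \<forall>j<n. mm n (one Y) (one Z) i j = im i j"
    by (elim exE conjE)
  have ZP: "one P i j = one Z i j" if ij: "i < n" "j < n" for i j
  proof -
    have "one P i j = mm n (one P) im i j" using ij by (simp add: mm_im)
    also have "\<dots> = mm n (one P) (mm n (one Y) (one Z)) i j" using Z(2) ij by - (rule mm_cong, auto)
    also have "\<dots> = mm n (mm n (one P) (one Y)) (one Z) i j"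
      using ij by (intro mm_assoc[OF ab, symmetric] one_SR[of P, OF P] one_SR[of Y, OF Y(1)[rule_format]] one_SR[of Z, OF Z(1)[rule_format]])
    also have "\<dots> = mm n im (one Z) i j" using Y(2) ij by - (rule mm_cong, auto)
    also have "\<dots> = one Z i j" using ij by (simp add: mm_im)
    finally show ?thesis .
  qed
  have "mm n (one Y) (one P) i j = im i j" if ij: "i < n" "j < n" for i j
  proof -
    have "mm n (one Y) (one P) i j = mm n (one Y) (one Z) i j" using ZP ij by - (rule mm_cong, auto)
    thus ?thesis using Z(2) ij by simp
  qed
  thus ?thesis using Y unfolding one_def by blast
qed

section \<open>Dwork's trick\<close>

definition PB :: "'a series set" where
  "PB = {x. (\<forall>i. x i \<in> L) \<and> (\<forall>i<0. x i = 0) \<and> (\<forall>e>0. well_ordered {i. N (x i) > e}) \<and> (\<exists>C. \<forall>i. N (x i) \<le> C)}"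

lemma PB_PS: assumes "x \<in> PB" "0 < s" shows "x \<in> PS s"
proof -
  obtain C where C: "\<And>i. N (x i) \<le> C" using assms unfolding PB_def by blast
  have C0: "C \<ge> 0" using order.trans[OF N_nonneg C] .
  have "N (x i) \<le> C * wt s i" for i
  proof (cases "i < 0")
    case False
    then have "C * 1 \<le> C * wt s i" using C0 assms(2) by (intro mult_left_mono wt_ge_1) auto
    thus ?thesis using C[of i] by simp
  qed (use assms(1) C0 in \<open>simp add: PB_def\<close>)
  thus ?thesis using assms(1) unfolding PS_def PB_def bnd_def by blast
qed

text \<open>The part of a bounded series with exponents \<open>> 0\<close> becomes small at large radius.\<close>
lemma PB_small:
  assumes x: "x \<in> PB" "x 0 = 0" and e: "0 < e"
  shows "\<exists>s0>0. \<forall>s\<ge>s0. x \<in> PosSeries s e"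
proof -
  obtain C where C: "\<And>i. N (x i) \<le> C" using x unfolding PB_def by blast
  have C0: "C \<ge> 0" using order.trans[OF N_nonneg C] .
  have x0: "x i = 0" if "i \<le> 0" for i using x that unfolding PB_def by (cases "i = 0") auto
  have wo: "well_ordered {i. N (x i) > d}" if "d > 0" for d using x(1) that unfolding PB_def by blast
  have "\<exists>s0>0. \<forall>s\<ge>s0. \<forall>i. N (x i) \<le> e * wt s i"
  proof (cases "{i. N (x i) > e} = {}")
    case True
    then have xe: "N (x i) \<le> e" for i by (simp add: Collect_empty_eq not_less)
    have "N (x i) \<le> e * wt s i" if "1 \<le> s" for s i
    proof (cases "i \<le> 0")
      case False
      then have "e * 1 \<le> e * wt s i" using e that by (intro mult_left_mono wt_ge_1) auto
      thus ?thesis using xe[of i] by simp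
    qed (use x0 e in simp)
    thus ?thesis by (intro exI[of _ 1]) auto
  next
    case False
    then obtain m where m: "m \<in> {i. N (x i) > e}" "\<And>i. i \<in> {i. N (x i) > e} \<Longrightarrow> m \<le> i"
      using well_ordered_min[OF wo[OF e], of "{i. N (x i) > e}"] by blast
    have m0: "m > 0" using m(1) x0[of m] e by (cases "m \<le> 0") auto
    define s0 where "s0 = max 1 (log p (max 1 (C / e)) / of_rat m)"
    have "N (x i) \<le> e * wt s i" if s: "s0 \<le> s" for s i
    proof (cases "N (x i) > e")
      case True
      then have mi: "m \<le> i" using m(2) by simp
      have s1: "1 \<le> s" "log p (max 1 (C / e)) / of_rat m \<le> s" using s by (auto simp: s0_def)
      then have "log p (max 1 (C / e)) \<le> s * of_rat m" using m0 by (simp add: field_simps)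
      then have "max 1 (C / e) \<le> wt s m" using p_gt_1 by (subst (asm) log_le_iff) auto
      also have "\<dots> \<le> wt s i" using mi s1 by (intro wt_mono) auto
      finally have "C \<le> e * wt s i" using e by (simp add: field_simps)
      thus ?thesis using C[of i] by linarith
    next
      case False
      show ?thesis
      proof (cases "i \<le> 0")
        case i: False
        have "1 \<le> s" using s by (simp add: s0_def)
        then have "e * 1 \<le> e * wt s i" using e i by (intro mult_left_mono wt_ge_1) auto
        thus ?thesis using False by simp
      qed (use x0 e in simp)
    qed
    thus ?thesis by (intro exI[of _ s0]) (auto simp: s0_def)
  qed
  then obtain s0 where "s0 > 0" "\<And>s i. s \<ge> s0 \<Longrightarrow> N (x i) \<le> e * wt s i" by blast
  thus ?thesis using x x0 unfolding PosSeries_def PB_def by (intro exI[of _ s0]) auto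
qed

text \<open>Once a matrix equation transports finiteness from the radius \<open>s\<close> to \<open>s / p\<close>, its solutions have
  finite norm at every radius.\<close>
lemma Gamma_if_radius_step:
  fixes M :: "'i \<Rightarrow> 'a series"
  assumes s: "0 < s" and start: "\<And>i. M i \<in> PS s" and step: "\<And>t i. 0 < t \<Longrightarrow> (\<And>i. M i \<in> PS t) \<Longrightarrow> M i \<in> PS (t / p)"
  shows "M i \<in> \<Gamma>"
proof -
  have all: "\<forall>i. M i \<in> PS (s / real p ^ k)" for k
  proof (induction k)
    case (Suc k)
    have "0 < s / real p ^ k" using s p_gt_1 by simp
    from step[OF this Suc[rule_format]] show ?case by (simp add: mult.commute)
  qed (use start in simp)
  have "bnd t (M i)" if t: "0 < t" for t
  proof -
    obtain k where "s / real p ^ k < t" using small_p_power[OF t] by blast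
    from PS_mono[OF all[rule_format] less_imp_le[OF this]] have "M i \<in> PS t" .
    thus ?thesis by (simp add: PS_def)
  qed
  thus ?thesis using start[of i] unfolding Gamma_iff PS_def by (auto intro!: exI[of _ 1])
qed

text \<open>At a large radius \<open>A\<close> is close to its constant term, the diagonal matrix of the \<open>l j\<close>, so that successive
  approximation gives a solution close to the identity matrix, which is then invertible. The equation itself expresses
  the solution through its image under \<open>frob\<close>, which is finite at a radius smaller by the factor \<open>p\<close>; iterating this
  brings the solution and its inverse to every positive radius.\<close>
theorem dwork_trick:
  fixes n :: nat
  assumes l: "\<And>i. i < n \<Longrightarrow> l i \<in> L \<and> l i \<noteq> 0"
    and A: "\<And>i j. i < n \<Longrightarrow> j < n \<Longrightarrow> A i j \<in> PB" and A': "\<And>i j. i < n \<Longrightarrow> j < n \<Longrightarrow> A' i j \<in> PB"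
    and A0: "\<And>i j. i < n \<Longrightarrow> j < n \<Longrightarrow> A i j 0 = (if i = j then l i else 0)"
    and AA': "\<And>i j. i < n \<Longrightarrow> j < n \<Longrightarrow> mm n A A' i j = im i j"
  shows "\<exists>U V. (\<forall>i<n. \<forall>j<n. U i j \<in> \<Gamma> \<and> V i j \<in> \<Gamma>) \<and>
     (\<forall>i<n. \<forall>j<n. mm n U V i j = im i j \<and> mm n V U i j = im i j) \<and>
     (\<forall>i<n. \<forall>j<n. mm n A (\<lambda>i j. frob (U i j)) i j = (\<lambda>k. l j * U i j k))"
proof -
  define P where "P = (\<lambda>i j (k::rat). if k = 0 then (0::'a) else A i j k)"
  have A_P: "A i j = (\<lambda>k. dm l i j k + P i j k)" if "i < n" "j < n" for i j
    using A0[OF that] by (auto simp: P_def dm_def series_const_def)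
  have P_PB: "P i j \<in> PB" if "i < n" "j < n" for i j
  proof -
    have AL: "A i j k \<in> L" and A_neg: "k < 0 \<Longrightarrow> A i j k = 0" and A_wo: "e > 0 \<Longrightarrow> well_ordered {k. N (A i j k) > e}" for k e
      using A[OF that] by (simp_all add: PB_def)
    have "\<exists>C. \<forall>k. N (A i j k) \<le> C" using A[OF that] by (simp add: PB_def)
    then obtain C where C: "\<forall>k. N (A i j k) \<le> C" by (elim exE)
    have C0: "0 \<le> C" using order.trans[OF N_nonneg C[rule_format, of 0]] .
    show ?thesis
      unfolding PB_def
    proof (intro CollectI conjI allI impI exI[of _ C])
      fix k show "P i j k \<in> L" using AL in_L(1) by (simp add: P_def)
      show "N (P i j k) \<le> C" using C C0 by (simp add: P_def)
    next
      fix k :: rat assume "k < 0" thus "P i j k = 0" using A_neg by (simp add: P_def)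
    next
      fix e :: real assume e: "e > 0"
      have "{k. N (P i j k) > e} \<subseteq> {k. N (A i j k) > e}" using e by (auto simp: P_def split: if_splits)
      thus "well_ordered {k. N (P i j k) > e}" by (rule well_ordered_subset[OF A_wo[OF e]])
    qed
  qed
  define \<mu>0 where "\<mu>0 = Min (insert 1 ((\<lambda>j. N (l j)) ` {..<n}))"
  have \<mu>0: "0 < \<mu>0" unfolding \<mu>0_def using l by (subst Min_gr_iff) (auto intro: N_pos)
  have \<mu>0_le: "\<mu>0 \<le> N (l j)" if "j < n" for j unfolding \<mu>0_def using that by (intro Min_le) auto
  define \<eta> where "\<eta> = \<mu>0 / p"
  have \<eta>: "0 < \<eta>" using \<mu>0 p_gt_1 by (simp add: \<eta>_def)
  have \<eta>_le: "\<eta> / N (l j) \<le> 1 / p" if "j < n" for j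
  proof -
    have "0 < N (l j)" using l[OF that] N_pos by blast
    thus ?thesis using \<mu>0_le[OF that] p_gt_1 by (simp add: \<eta>_def field_simps)
  qed
  have "\<exists>s0>0. \<forall>s\<ge>s0. P i j \<in> PosSeries s \<eta>" if "i < n" "j < n" for i j
    by (rule PB_small[OF P_PB[OF that] _ \<eta>]) (simp add: P_def)
  then have ex: "\<exists>s0. i < n \<longrightarrow> j < n \<longrightarrow> (\<forall>s\<ge>s0. P i j \<in> PosSeries s \<eta>)" for i j by meson
  have "\<exists>s0. \<forall>i j. i < n \<longrightarrow> j < n \<longrightarrow> (\<forall>s\<ge>s0 i j. P i j \<in> PosSeries s \<eta>)" by (rule choice2) (rule ex)
  then obtain s0 where s0: "\<forall>i j. i < n \<longrightarrow> j < n \<longrightarrow> (\<forall>s\<ge>s0 i j. P i j \<in> PosSeries s \<eta>)" by (elim exE)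
  define s where "s = Max (insert (1::real) ((\<lambda>(i, j). s0 i j) ` ({..<n} \<times> {..<n})))"
  have s: "0 < s" unfolding s_def by (subst Max_gr_iff) auto
  have Ps: "P i j \<in> PosSeries s \<eta>" if "i < n" "j < n" for i j
  proof -
    have "s0 i j \<le> s" unfolding s_def using that by (intro Max_ge) (auto intro!: rev_image_eqI[of "(i, j)"])
    thus ?thesis using s0 that by simp
  qed
  have ab: "0 < s" "s < 2 * s" using s by auto
  have SR: "x \<in> SR s (2 * s)" if "x \<in> PS s" for x using that s by (intro PS_SR) auto
  have Pos_SR: "x \<in> SR s (2 * s)" if "x \<in> PosSeries s C" for x C by (rule SR[OF PosSeries_PS[OF that]])
  have "\<exists>Xs. (\<forall>i<n. \<forall>j<n. Xs i j \<in> PosSeries s (1 / p)) \<and>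
      (\<forall>i<n. \<forall>j<n. \<forall>k. l i * \<sigma> (Xs i j (k / of_nat p)) - l j * Xs i j k
         = - P i j k + (\<Sum>h<n. ((\<lambda>k. - P i h k) \<star> frob (Xs h j)) k))"
  proof (rule perturbed_system[where \<theta> = frob and \<eta> = \<eta> and P = "\<lambda>i j k. - P i j k" and \<kappa> = l and \<mu> = l])
    show "0 < s" "0 \<le> \<eta>" using s \<eta> by simp_all
    fix i assume i: "i < n"
    show "l i \<in> L" "l i \<in> L \<and> l i \<noteq> 0" "\<eta> / N (l i) \<le> 1 / p" using l[OF i] \<eta>_le[OF i] by simp_all
    fix j assume "j < n"
    thus "(\<lambda>k. - P i j k) \<in> PosSeries s \<eta>" by (rule PosSeries_minus[OF Ps[OF i]])
  next
    fix x :: "'a series" and C :: real assume "0 \<le> C" "x \<in> PosSeries s C"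
    thus "frob x \<in> PosSeries s C" using s by (intro PosSeries_frob)
  next
    fix x y :: "'a series" assume "\<And>i. x i \<in> L" "\<And>i. y i \<in> L"
    thus "frob (\<lambda>i. x i + y i) = (\<lambda>i. frob x i + frob y i)" by (rule frob_add)
  qed
  then obtain Xs where Xs': "\<forall>i<n. \<forall>j<n. Xs i j \<in> PosSeries s (1 / p)"
    "\<forall>i<n. \<forall>j<n. \<forall>k. l i * \<sigma> (Xs i j (k / of_nat p)) - l j * Xs i j k
         = - P i j k + (\<Sum>h<n. ((\<lambda>k. - P i h k) \<star> frob (Xs h j)) k)" by (elim exE conjE)
  note Xs = Xs'[rule_format]
  define U where "U = (\<lambda>i j k. im i j k + Xs i j k)"
  have "\<exists>Y. (\<forall>i<n. \<forall>j<n. Y i j \<in> PosSeries s (1 / p)) \<and>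
     (\<forall>i<n. \<forall>j<n. mm n U (\<lambda>i j k. im i j k + Y i j k) i j = im i j) \<and>
     (\<forall>i<n. \<forall>j<n. mm n (\<lambda>i j k. im i j k + Y i j k) U i j = im i j)"
    unfolding U_def by (rule near_identity_inverse[OF s]) (rule Xs(1))
  then obtain Y where Y': "\<forall>i<n. \<forall>j<n. Y i j \<in> PosSeries s (1 / p)"
      "\<forall>i<n. \<forall>j<n. mm n U (\<lambda>i j k. im i j k + Y i j k) i j = im i j"
      "\<forall>i<n. \<forall>j<n. mm n (\<lambda>i j k. im i j k + Y i j k) U i j = im i j" by (elim exE conjE)
  define V where "V = (\<lambda>i j k. im i j k + Y i j k)"
  note Y = Y'(1)[rule_format] and UV = Y'(2)[rule_format, folded V_def] and VU = Y'(3)[rule_format, folded V_def]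
  have U_PS: "U i j \<in> PS s" if "i < n" "j < n" for i j
    unfolding U_def by (intro PS_add im_PS PosSeries_PS[OF Xs(1)] that)
  have V_PS: "V i j \<in> PS s" if "i < n" "j < n" for i j
    unfolding V_def by (intro PS_add im_PS PosSeries_PS[OF Y] that)
  have U_L: "U i j k \<in> L" if "i < n" "j < n" for i j k using U_PS[OF that] by (simp add: PS_def)
  have frob_im: "frob (im i j) = im i j" for i j by (simp add: dm_def frob_const \<sigma>_0 \<sigma>_1 if_distrib cong: if_cong)
  define FU where "FU = (\<lambda>i j. frob (U i j))"
  define FV where "FV = (\<lambda>i j. frob (V i j))"
  have eq: "mm n A FU i j = (\<lambda>k. l j * U i j k)" if ij: "i < n" "j < n" for i j
  proof
    fix k
    have FU_eq: "FU h j = (\<lambda>k. im h j k + frob (Xs h j) k)" if h: "h < n" for h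
    proof -
      have "frob (\<lambda>k. im h j k + Xs h j k) = (\<lambda>k. frob (im h j) k + frob (Xs h j) k)"
        using im_PS[of h j s] PosSeriesD(1)[OF Xs(1)[OF h ij(2)]] by (intro frob_add) (auto simp: PS_def)
      thus ?thesis by (simp add: FU_def U_def frob_im)
    qed
    have dl: "dm l i h \<in> SR s (2 * s)" for h using l[OF ij(1)] in_L(1) by (intro SR dm_PS) auto
    have F: "frob (Xs h j) \<in> SR s (2 * s)" if h: "h < n" for h
      by (rule Pos_SR[OF PosSeries_frob[OF Xs(1)[OF h ij(2)] s]]) simp
    have exp: "(A i h \<star> FU h j) k = (dm l i h \<star> im h j) k + (dm l i h \<star> frob (Xs h j)) k
        + ((P i h \<star> im h j) k + (P i h \<star> frob (Xs h j)) k)" if h: "h < n" for h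
    proof -
      have sr: "P i h \<in> SR s (2 * s)" "im h j \<in> SR s (2 * s)" by (rule Pos_SR[OF Ps[OF ij(1) h]], rule SR[OF im_PS])
      show ?thesis unfolding A_P[OF ij(1) h] FU_eq[OF h]
        using conv_add_left[OF ab dl sr(1) SR_add[OF sr(2) F[OF h]], of h]
          conv_add_right[OF ab sr(2) F[OF h] dl] conv_add_right[OF ab sr(2) F[OF h] sr(1)] by simp
    qed
    have neg: "((\<lambda>k. - P i h k) \<star> frob (Xs h j)) k = - (P i h \<star> frob (Xs h j)) k" if h: "h < n" for h
      using conv_cmult_left[OF ab Pos_SR[OF Ps[OF ij(1) h]] F[OF h], of "-1"] by simp
    have "mm n A FU i j k = mm n (dm l) im i j k + mm n (dm l) (\<lambda>h j. frob (Xs h j)) i j k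
        + (mm n P im i j k + (\<Sum>h<n. (P i h \<star> frob (Xs h j)) k))"
      unfolding mm_def by (simp add: exp sum.distrib)
    also have "\<dots> = dm l i j k + l i * frob (Xs i j) k + (P i j k + (\<Sum>h<n. (P i h \<star> frob (Xs h j)) k))"
      using ij by (simp add: mm_im(2) mm_dm_left)
    also have "(\<Sum>h<n. (P i h \<star> frob (Xs h j)) k) = - (\<Sum>h<n. ((\<lambda>k. - P i h k) \<star> frob (Xs h j)) k)" by (simp add: neg sum_negf)
    also have "dm l i j k = l j * im i j k" by (simp add: dm_def series_const_def)
    finally have E: "mm n A FU i j k = l j * im i j k + l i * frob (Xs i j) k
        + (P i j k - (\<Sum>h<n. ((\<lambda>k. - P i h k) \<star> frob (Xs h j)) k))" by simp
    have "l i * frob (Xs i j) k = l j * Xs i j k - P i j k + (\<Sum>h<n. ((\<lambda>k. - P i h k) \<star> frob (Xs h j)) k)"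
      using Xs(2)[OF ij, of k] by (simp add: frob_apply[of "Xs i j"] diff_eq_eq)
    then show "mm n A FU i j k = l j * U i j k"
      unfolding E by (simp add: U_def distrib_left)
  qed
  have A_PS: "A i j \<in> PS t" "A' i j \<in> PS t" if "i < n" "j < n" "0 < t" for i j t
    by (rule PB_PS[OF A[OF that(1,2)] that(3)], rule PB_PS[OF A'[OF that(1,2)] that(3)])
  have FU_SR: "FU i j \<in> SR s (2 * s)" "FV i j \<in> SR s (2 * s)" if "i < n" "j < n" for i j
    unfolding FU_def FV_def
    by (rule SR[OF PS_frob(2)[OF U_PS[OF that] s]], rule SR[OF PS_frob(2)[OF V_PS[OF that] s]])
  have A_SR: "A i j \<in> SR s (2 * s)" "A' i j \<in> SR s (2 * s)" if "i < n" "j < n" for i j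
    by (rule SR[OF A_PS(1)[OF that s]], rule SR[OF A_PS(2)[OF that s]])
  have U_SR: "U i j \<in> SR s (2 * s)" "V i j \<in> SR s (2 * s)" if "i < n" "j < n" for i j
    by (rule SR[OF U_PS[OF that]], rule SR[OF V_PS[OF that]])
  have mm_SR: "mm n B C i j \<in> SR s (2 * s)" if "\<And>h. h < n \<Longrightarrow> B i h \<in> SR s (2 * s)" "\<And>h. h < n \<Longrightarrow> C h j \<in> SR s (2 * s)" for B C i j
    unfolding mm_def using that by (intro SR_sum SR_conv[OF ab]) auto
  have FUV: "mm n FU FV i j = im i j" if ij: "i < n" "j < n" for i j
  proof
    fix k
    have "frob (mm n U V i j) k = (\<Sum>h<n. frob (U i h \<star> V h j) k)"
      unfolding mm_def frob_apply using ij U_SR by (intro \<sigma>_sum conv_psums(2)[OF ab]) auto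
    also have "\<dots> = mm n FU FV i j k"
      unfolding mm_def FU_def FV_def using ij U_SR by (intro sum.cong) (auto simp: frob_conv[OF ab])
    finally show "mm n FU FV i j k = im i j k" using UV[OF ij] frob_im by simp
  qed
  have V_eq: "V i j = mm n (\<lambda>i h k. l i * FV i h k) A' i j" if ij: "i < n" "j < n" for i j
  proof -
    have VA: "mm n V A i q = (\<lambda>k. l i * FV i q k)" if q: "q < n" for q
    proof -
      have "mm n V A i q = mm n (mm n V A) im i q" using q by (simp add: mm_im)
      also have "\<dots> = mm n (mm n V A) (mm n FU FV) i q" using FUV q by - (rule mm_cong, auto)
      also have "\<dots> = mm n (mm n (mm n V A) FU) FV i q"
        using ij q by (intro mm_assoc[OF ab, symmetric] mm_SR FU_SR A_SR U_SR)
      also have "\<dots> = mm n (dm l) FV i q"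
      proof (rule mm_cong)
        fix h assume h: "h < n"
        have "mm n (mm n V A) FU i h = mm n V (mm n A FU) i h"
          using ij h by (intro mm_assoc[OF ab] FU_SR A_SR U_SR)
        also have "\<dots> = mm n V (mm n U (dm l)) i h" using eq h by - (rule mm_cong, auto simp: mm_dm_right)
        also have "\<dots> = mm n (mm n V U) (dm l) i h"
          using ij h l in_L(1) by (intro mm_assoc[OF ab, symmetric] U_SR SR dm_PS) auto
        also have "\<dots> = mm n im (dm l) i h" using VU ij by - (rule mm_cong, auto)
        also have "\<dots> = dm l i h" using ij by (simp add: mm_im)
        finally show "mm n (mm n V A) FU i h = dm l i h" .
      qed simp
      finally show ?thesis using ij by (simp add: mm_dm_left)
    qed
    have "V i j = mm n V im i j" using ij by (simp add: mm_im)
    also have "\<dots> = mm n V (mm n A A') i j" using AA' ij by - (rule mm_cong, auto)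
    also have "\<dots> = mm n (mm n V A) A' i j"
      using ij by (intro mm_assoc[OF ab, symmetric] A_SR U_SR)
    also have "\<dots> = mm n (\<lambda>i h k. l i * FV i h k) A' i j" using VA by - (rule mm_cong, auto)
    finally show ?thesis .
  qed
  have PS_sum_conv: "(\<lambda>k. \<Sum>h<n. (B h \<star> C h) k) \<in> PS t" if "0 < t" "\<And>h. h < n \<Longrightarrow> B h \<in> PS t" "\<And>h. h < n \<Longrightarrow> C h \<in> PS t" for B C t
  proof (rule SR_PS[of _ t "2 * t"])
    show "(\<lambda>k. \<Sum>h<n. (B h \<star> C h) k) \<in> SR t (2 * t)"
      using that by (intro SR_sum PS_SR[OF PS_conv]) auto
    fix k :: rat assume k: "k < 0"
    have "(B h \<star> C h) k = 0" if "h \<in> {..<n}" for h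
      using \<open>\<And>h. h < n \<Longrightarrow> B h \<in> PS t\<close>[of h] \<open>\<And>h. h < n \<Longrightarrow> C h \<in> PS t\<close>[of h] that k by (intro conv_neg) (auto simp: PS_def)
    thus "(\<Sum>h<n. (B h \<star> C h) k) = 0" by (rule sum.neutral[rule_format])
  qed
  have cmult_PS: "(\<lambda>k. c * x k) \<in> PS t" if "x \<in> PS t" "c \<in> L" for c x t
    using that unfolding PS_def by (auto intro!: in_L(6) bnd_const_mult well_ordered_cmult)
  have zero_PS: "(\<lambda>_. 0) \<in> PS t" for t
    using in_L(1) by (auto simp: PS_def not_less well_ordered_empty bnd_def intro: exI[of _ 0])
  have U_Gamma: "U i j \<in> \<Gamma>" if ij: "i < n" "j < n" for i j
  proof -
    define Mx where "Mx q = (if fst q < n \<and> snd q < n then U (fst q) (snd q) else (\<lambda>_. 0))" for q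
    have "Mx (i, j) \<in> \<Gamma>"
    proof (rule Gamma_if_radius_step[of s Mx])
      show "Mx q \<in> PS s" for q using U_PS zero_PS by (simp add: Mx_def)
      fix t q assume t: "0 < t" and IH: "\<And>q. Mx q \<in> PS t"
      have tp: "0 < t / p" using t p_gt_1 by simp
      show "Mx q \<in> PS (t / p)"
      proof (cases "fst q < n \<and> snd q < n")
        case True
        define i j where "i = fst q" and "j = snd q"
        have ij: "i < n" "j < n" using True by (auto simp: i_def j_def)
        have UPS: "U h j \<in> PS t" if "h < n" for h using IH[of "(h, j)"] that ij by (simp add: Mx_def)
        have "(\<lambda>k. inverse (l j) * mm n A FU i j k) \<in> PS (t / p)"
          unfolding mm_def FU_def using l[OF ij(2)] in_L(4) ij tp t
          by (intro cmult_PS PS_sum_conv A_PS PS_frob(1) UPS) auto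
        moreover have "(\<lambda>k. inverse (l j) * mm n A FU i j k) = U i j"
          using l[OF ij(2)] by (simp add: eq[OF ij] mult.assoc[symmetric])
        ultimately show ?thesis using True by (simp add: Mx_def i_def j_def)
      next
        case False
        then have "Mx q = (\<lambda>_. 0)" by (auto simp: Mx_def)
        thus ?thesis using zero_PS by simp
      qed
    qed (rule s)
    thus ?thesis using ij by (simp add: Mx_def)
  qed
  have V_Gamma: "V i j \<in> \<Gamma>" if ij: "i < n" "j < n" for i j
  proof -
    define Mx where "Mx q = (if fst q < n \<and> snd q < n then V (fst q) (snd q) else (\<lambda>_. 0))" for q
    have "Mx (i, j) \<in> \<Gamma>"
    proof (rule Gamma_if_radius_step[of s Mx])
      show "Mx q \<in> PS s" for q using V_PS zero_PS by (simp add: Mx_def)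
      fix t q assume t: "0 < t" and IH: "\<And>q. Mx q \<in> PS t"
      have tp: "0 < t / p" using t p_gt_1 by simp
      show "Mx q \<in> PS (t / p)"
      proof (cases "fst q < n \<and> snd q < n")
        case True
        define i j where "i = fst q" and "j = snd q"
        have ij: "i < n" "j < n" using True by (auto simp: i_def j_def)
        have VPS: "V i h \<in> PS t" if "h < n" for h using IH[of "(i, h)"] that ij by (simp add: Mx_def)
        have "mm n (\<lambda>i h k. l i * FV i h k) A' i j \<in> PS (t / p)"
          unfolding mm_def FV_def using l[OF ij(1)] ij tp t
          by (intro PS_sum_conv cmult_PS A_PS PS_frob(1) VPS) auto
        thus ?thesis using True V_eq[OF ij] by (simp add: Mx_def i_def j_def)
      next
        case False
        then have "Mx q = (\<lambda>_. 0)" by (auto simp: Mx_def)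
        thus ?thesis using zero_PS by simp
      qed
    qed (rule s)
    thus ?thesis using ij by (simp add: Mx_def)
  qed
  show ?thesis
    by (rule exI[of _ U], rule exI[of _ V])
       (use U_Gamma V_Gamma UV VU eq in \<open>simp add: FU_def\<close>)
qed

end

section \<open>Eigenbases over the series ring and over the constants\<close>

lemma doubly_exponential_decay:
  fixes K q c :: real assumes "K \<ge> 1" "q > 1" "c > 0"
  shows "(\<lambda>k::nat. K ^ k * q powr (- c * q ^ k)) \<longlonglongrightarrow> 0"
proof (rule tendsto_sandwich[of "\<lambda>_. 0" _ _ "\<lambda>k. exp (- 1) ^ k"])
  have pos: "0 < c * ln q / (ln K + 1)" using assms by (intro divide_pos_pos mult_pos_pos add_nonneg_pos) auto
  have "(\<lambda>k. real k / q ^ k) \<longlonglongrightarrow> 0" using lim_n_over_pown[of q] assms by simp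
  then have "\<forall>\<^sub>F k in sequentially. real k / q ^ k < c * ln q / (ln K + 1)" using pos by (rule order_tendstoD(2))
  thus "\<forall>\<^sub>F k in sequentially. K ^ k * q powr (- c * q ^ k) \<le> exp (- 1) ^ k"
  proof eventually_elim
    case (elim k)
    have "ln K + 1 > 0" using assms by (intro add_nonneg_pos) auto
    then have "real k * (ln K + 1) \<le> c * ln q * q ^ k" using elim assms by (simp add: field_simps)
    then have "real k * ln K + - c * q ^ k * ln q \<le> - real k" by (simp add: algebra_simps)
    moreover have "K ^ k = exp (real k * ln K)" using assms by (simp add: exp_of_nat_mult)
    moreover have "q powr (- c * q ^ k) = exp (- c * q ^ k * ln q)" using assms by (simp add: powr_def)
    ultimately have "K ^ k * q powr (- c * q ^ k) \<le> exp (- real k)" by (simp only: exp_add[symmetric] exp_le_cancel_iff)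
    also have "exp (- real k) = exp (- 1) ^ k" by (simp add: exp_of_nat_mult[symmetric])
    finally show ?case .
  qed
qed (use assms in \<open>auto intro!: LIMSEQ_realpow_zero\<close>)

lemma finsum_subring_of_type:
  assumes "finite I" "\<And>i. i \<in> I \<Longrightarrow> f i \<in> A" and A: "0 \<in> A" "\<And>x y. x \<in> A \<Longrightarrow> y \<in> A \<Longrightarrow> x + y \<in> A"
  shows "(\<Oplus>\<^bsub>subring_of_type A\<^esub>i\<in>I. f i) = sum f I"
  using assms(1,2)
proof (induction I rule: finite_induct)
  interpret abelian_monoid "subring_of_type A"
    by (rule abelian_monoidI) (auto simp: subring_of_type_simps A add_ac)
  {
    case empty thus ?case by (simp add: finsum_empty subring_of_type_simps)
  next
    case (insert i I)
    have "(\<Oplus>\<^bsub>subring_of_type A\<^esub>i\<in>insert i I. f i) = f i \<oplus>\<^bsub>subring_of_type A\<^esub> (\<Oplus>\<^bsub>subring_of_type A\<^esub>i\<in>I. f i)"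
      using insert by (intro finsum_insert) (auto simp: subring_of_type_simps)
    thus ?case using insert by (simp add: subring_of_type_simps)
  }
qed

context isometric_automorphism begin

lemma PB_cmult: assumes "x \<in> PB" "c \<in> L" shows "(\<lambda>k. c * x k) \<in> PB"
proof -
  obtain C where "\<forall>k. N (x k) \<le> C" using assms(1) by (auto simp: PB_def)
  then have "\<forall>k. N (c * x k) \<le> N c * C" by (simp add: N_mult mult_left_mono)
  thus ?thesis using assms unfolding PB_def by (auto intro!: in_L(6) well_ordered_cmult)
qed

lemma PB_add: assumes "x \<in> PB" "y \<in> PB" shows "(\<lambda>k. x k + y k) \<in> PB"
proof -
  obtain C D where "\<forall>k. N (x k) \<le> C" "\<forall>k. N (y k) \<le> D" using assms by (auto simp: PB_def)
  then have "\<forall>k. N (x k + y k) \<le> max C D"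
    by (intro allI N_add_le) (auto intro: le_max_iff_disj[THEN iffD2])
  thus ?thesis using assms unfolding PB_def by (auto intro!: in_L(5) well_ordered_add)
qed

lemma PB_zero: "(\<lambda>_. 0) \<in> PB"
  by (auto simp: PB_def in_L(1) not_less well_ordered_empty intro: exI[of _ 0])

lemma PB_sum: "(\<And>h. h \<in> I \<Longrightarrow> x h \<in> PB) \<Longrightarrow> (\<lambda>k. \<Sum>h\<in>I. x h k) \<in> PB"
  by (induction I rule: infinite_finite_induct) (auto simp: PB_zero PB_add)

lemma PB_SR: "x \<in> PB \<Longrightarrow> 0 < a \<Longrightarrow> 0 < b \<Longrightarrow> x \<in> SR a b"
  using PS_SR[OF PB_PS[of x "min a b"]] by auto

lemma PB_Gamma: "x \<in> PB \<Longrightarrow> x \<in> \<Gamma>"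
  by (rule GammaI[of 1]) (auto intro: PB_SR)

text \<open>Solving for the coefficient at \<open>i\<close> through the one at \<open>p i\<close> multiplies the constant in a norm
  bound and squeezes its weight from \<open>i\<close> to \<open>p i\<close>. For \<open>i < 0\<close> the weight wins.\<close>
lemma frobenius_solution_support:
  fixes n :: nat and x :: "nat \<Rightarrow> 'a series" and A :: "nat \<Rightarrow> nat \<Rightarrow> 'a series"
  assumes x: "\<And>q. q < n \<Longrightarrow> x q \<in> \<Gamma>" and A: "\<And>q h. q < n \<Longrightarrow> h < n \<Longrightarrow> A q h \<in> PB"
    and c: "c \<noteq> 0" and eq: "\<And>q k. q < n \<Longrightarrow> c * frob (x q) k = l * (\<Sum>h<n. (A q h \<star> x h) k)"
    and q: "q < n" and i: "i < 0"
  shows "x q i = 0"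
proof -
  have "\<exists>s0>0. \<forall>a b. 0 < a \<longrightarrow> a \<le> s0 \<longrightarrow> 0 < b \<longrightarrow> b \<le> s0 \<longrightarrow> x ` {..<n} \<subseteq> SR a b"
    by (rule Gamma_SR_family) (use x in auto)
  then obtain s0 where s0: "s0 > 0" "\<forall>a b. 0 < a \<longrightarrow> a \<le> s0 \<longrightarrow> 0 < b \<longrightarrow> b \<le> s0 \<longrightarrow> x ` {..<n} \<subseteq> SR a b"
    by (elim exE conjE)
  define s where "s = s0 / 2"
  have ab: "0 < s" "s < s0" using s0(1) by (auto simp: s_def)
  have xSR: "x h \<in> SR s s0" if "h < n" for h using s0(2)[rule_format, of s s0] ab that by auto
  have ASR: "A q h \<in> SR s s0" if "q < n" "h < n" for q h using A[OF that] ab s0(1) by (intro PB_SR) auto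
  have "\<exists>C. \<forall>h i. h < n \<longrightarrow> N (x h i) \<le> C * wt s i"
  proof -
    have "\<exists>C. h < n \<longrightarrow> (\<forall>i. N (x h i) \<le> C * wt s i)" for h
      using xSR[of h] by (auto simp: SR_def bnd_def)
    then obtain Cx where Cx: "\<And>h i. h < n \<Longrightarrow> N (x h i) \<le> Cx h * wt s i" by metis
    have "N (x h i) \<le> (\<Sum>h<n. \<bar>Cx h\<bar>) * wt s i" if "h < n" for h i
    proof -
      have "\<bar>Cx h\<bar> \<le> (\<Sum>h<n. \<bar>Cx h\<bar>)" using that by (intro member_le_sum) auto
      then have "Cx h * wt s i \<le> (\<Sum>h<n. \<bar>Cx h\<bar>) * wt s i" by (intro mult_right_mono) auto
      thus ?thesis using Cx[OF that, of i] by linarith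
    qed
    thus ?thesis by blast
  qed
  then obtain C where C: "\<And>h i. h < n \<Longrightarrow> N (x h i) \<le> C * wt s i" by blast
  have C0: "0 \<le> C" using order.trans[OF N_nonneg C[OF q, of 0]] p_gt_1 by simp
  have "\<exists>D. \<forall>q h i. q < n \<longrightarrow> h < n \<longrightarrow> N (A q h i) \<le> D"
  proof -
    have ex: "\<exists>D. q < n \<longrightarrow> h < n \<longrightarrow> (\<forall>i. N (A q h i) \<le> D)" for q h
      using A[of q h] by (auto simp: PB_def)
    have "\<exists>D. \<forall>q h. q < n \<longrightarrow> h < n \<longrightarrow> (\<forall>i. N (A q h i) \<le> D q h)" by (rule choice2) (rule ex)
    then obtain D where D: "\<And>q h i. q < n \<Longrightarrow> h < n \<Longrightarrow> N (A q h i) \<le> D q h" by blast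
    have "N (A q h i) \<le> (\<Sum>(q, h)\<in>{..<n}\<times>{..<n}. \<bar>D q h\<bar>)" if "q < n" "h < n" for q h i
      using D[OF that, of i] member_le_sum[of "(q, h)" "{..<n}\<times>{..<n}" "\<lambda>(q, h). \<bar>D q h\<bar>"] that by auto
    thus ?thesis by blast
  qed
  then obtain D where D: "\<And>q h i. q < n \<Longrightarrow> h < n \<Longrightarrow> N (A q h i) \<le> D" by blast
  have D0: "0 \<le> D" using order.trans[OF N_nonneg D[OF q q, of 0]] .
  define K where "K = max 1 (N l / N c * D)"
  have K: "K \<ge> 1" "N l / N c * D \<le> K" by (auto simp: K_def)
  have bound: "N (x q i) \<le> C * K ^ k * wt s (of_nat p ^ k * i)" if "q < n" for q i k
    using that
  proof (induction k arbitrary: q i)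
    case 0 thus ?case using C by simp
  next
    case (Suc k)
    let ?B = "C * K ^ k * wt s (of_nat p ^ Suc k * i)"
    have B: "0 \<le> ?B" using C0 K by simp
    have "N (\<Sum>h<n. (A q h \<star> x h) (of_nat p * i)) \<le> D * ?B"
    proof (rule N_sum_le)
      show "0 \<le> D * ?B" using D0 B by (rule mult_nonneg_nonneg)
      fix h assume "h \<in> {..<n}"
      then have h: "h < n" by simp
      show "N ((A q h \<star> x h) (of_nat p * i)) \<le> D * ?B"
      proof (rule conv_bound[OF ab ASR[OF Suc.prems h] xSR[OF h]])
        show "0 \<le> D * ?B" using D0 B by (rule mult_nonneg_nonneg)
        fix r
        show "N (A q h r) * N (x h (of_nat p * i - r)) \<le> D * ?B"
        proof (cases "r < 0")
          case True
          then have "A q h r = 0" using A[OF Suc.prems h] by (simp add: PB_def)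
          thus ?thesis using D0 B by simp
        next
          case False
          have "N (x h (of_nat p * i - r)) \<le> C * K ^ k * wt s (of_nat p ^ k * (of_nat p * i - r))" by (rule Suc.IH[OF h])
          also have "\<dots> \<le> ?B"
          proof (intro mult_left_mono wt_mono)
            have "of_nat p ^ k * r \<ge> 0" using False of_nat_p_pos by simp
            thus "of_nat p ^ k * (of_nat p * i - r) \<le> of_nat p ^ Suc k * i" by (simp add: algebra_simps)
          qed (use ab C0 K in auto)
          finally show ?thesis using D[OF Suc.prems h, of r] D0 by (intro mult_mono) auto
        qed
      qed
    qed
    then have "N l * N (\<Sum>h<n. (A q h \<star> x h) (of_nat p * i)) \<le> N l * (D * ?B)" by (intro mult_left_mono) auto
    moreover have "N c * N (x q i) = N l * N (\<Sum>h<n. (A q h \<star> x h) (of_nat p * i))"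
    proof -
      have "N (frob (x q) (of_nat p * i)) = N (x q i)"
        using SR_in_L[OF xSR[OF Suc.prems]] of_nat_p_pos by (simp add: frob_apply N_\<sigma>)
      moreover have "N (c * frob (x q) (of_nat p * i)) = N (l * (\<Sum>h<n. (A q h \<star> x h) (of_nat p * i)))"
        by (simp only: eq[OF Suc.prems])
      ultimately show ?thesis by (simp add: N_mult)
    qed
    ultimately have "N (x q i) \<le> (N l / N c * D) * ?B"
      using N_pos[OF c] by (simp add: field_simps)
    also have "\<dots> \<le> K * ?B" using K(2) B by (rule mult_right_mono)
    finally show ?case by (simp add: mult_ac)
  qed
  have "(\<lambda>k::nat. C * (K ^ k * real p powr (- (s * of_rat (- i)) * real p ^ k))) \<longlonglongrightarrow> C * 0"
    using K p_gt_1 ab i by (intro tendsto_mult tendsto_const doubly_exponential_decay) auto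
  moreover have "C * (K ^ k * real p powr (- (s * of_rat (- i)) * real p ^ k)) = C * K ^ k * wt s (of_nat p ^ k * i)" for k
    by (simp add: of_rat_mult of_rat_power of_rat_minus mult_ac)
  ultimately have lim: "(\<lambda>k. C * K ^ k * wt s (of_nat p ^ k * i)) \<longlonglongrightarrow> 0" by (simp only: mult_zero_right)
  have "N (x q i) \<le> 0" by (rule LIMSEQ_le_const[OF lim]) (use bound[OF q] in auto)
  thus ?thesis by (metis N_eq_0 N_nonneg antisym)
qed

lemma eigenmatrix_L_iff:
  assumes "\<And>i j. i < n \<Longrightarrow> j < n \<Longrightarrow> B i j \<in> L"
  shows "eigenmatrix (subring_of_type L) \<sigma> n B m U V l \<longleftrightarrow>
    (\<forall>i<n. \<forall>j<m. U i j \<in> L) \<and> (\<forall>i<m. \<forall>j<n. V i j \<in> L) \<and>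
    (\<forall>i<n. \<forall>j<n. (\<Sum>k<m. U i k * V k j) = (if i = j then 1 else 0)) \<and>
    (\<forall>i<m. \<forall>j<m. (\<Sum>k<n. V i k * U k j) = (if i = j then 1 else 0)) \<and>
    (\<forall>i<n. \<forall>j<m. (\<Sum>k<n. B i k * \<sigma> (U k j)) = l j * U i j)"
proof -
  have sum: "(\<Oplus>\<^bsub>subring_of_type L\<^esub>k\<in>{..<h}. P k * RR k) = (\<Sum>k<h. P k * RR k)"
    if "\<And>k. k < h \<Longrightarrow> P k \<in> L" "\<And>k. k < h \<Longrightarrow> RR k \<in> L" for h :: nat and P RR
    by (rule finsum_subring_of_type) (use that in \<open>auto intro!: in_L(1,5,6)\<close>)
  have "?thesis" if U: "\<forall>i<n. \<forall>j<m. U i j \<in> L" and V: "\<forall>i<m. \<forall>j<n. V i j \<in> L"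
  proof -
    have UV: "(\<Oplus>\<^bsub>subring_of_type L\<^esub>k\<in>{..<m}. U i k * V k j) = (\<Sum>k<m. U i k * V k j)" if "i < n" "j < n" for i j
      by (rule sum) (use U V that in auto)
    have VU: "(\<Oplus>\<^bsub>subring_of_type L\<^esub>k\<in>{..<n}. V i k * U k j) = (\<Sum>k<n. V i k * U k j)" if "i < m" "j < m" for i j
      by (rule sum) (use U V that in auto)
    have BU: "(\<Oplus>\<^bsub>subring_of_type L\<^esub>k\<in>{..<n}. B i k * \<sigma> (U k j)) = (\<Sum>k<n. B i k * \<sigma> (U k j))" if "i < n" "j < m" for i j
      by (rule sum) (use U assms that in \<open>auto intro!: \<sigma>_in_L\<close>)
    show ?thesis unfolding eigenmatrix_def subring_of_type_simps using UV VU BU by simp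
  qed
  thus ?thesis unfolding eigenmatrix_def subring_of_type_simps by blast
qed

lemma eigenmatrix_GR_iff:
  assumes "\<And>i j. i < n \<Longrightarrow> j < n \<Longrightarrow> B i j \<in> \<Gamma>"
  shows "eigenmatrix GR frob n B m U V (\<lambda>j. series_const (l j)) \<longleftrightarrow>
    (\<forall>i<n. \<forall>j<m. U i j \<in> \<Gamma>) \<and> (\<forall>i<m. \<forall>j<n. V i j \<in> \<Gamma>) \<and>
    (\<forall>i<n. \<forall>j<n. mm m U V i j = im i j) \<and>
    (\<forall>i<m. \<forall>j<m. mm n V U i j = im i j) \<and>
    (\<forall>i<n. \<forall>j<m. mm n B (\<lambda>i j. frob (U i j)) i j = (\<lambda>k. l j * U i j k))"
proof -
  have im: "im i j = (if i = j then series_const 1 else (\<lambda>_. 0))" for i j :: nat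
    by (auto simp: dm_def series_const_def)
  have mm: "(\<Oplus>\<^bsub>GR\<^esub>k\<in>{..<h}. P i k \<star> RR k j) = mm h P RR i j"
    if "\<And>k. k < h \<Longrightarrow> P i k \<in> \<Gamma>" "\<And>k. k < h \<Longrightarrow> RR k j \<in> \<Gamma>" for h :: nat and P RR :: "nat \<Rightarrow> nat \<Rightarrow> 'a series" and i j :: nat
    unfolding mm_def by (rule finsum_GR) (use that in \<open>auto intro!: Gamma_conv\<close>)
  have "?thesis" if U: "\<forall>i<n. \<forall>j<m. U i j \<in> \<Gamma>" and V: "\<forall>i<m. \<forall>j<n. V i j \<in> \<Gamma>"
  proof -
    have UV: "(\<Oplus>\<^bsub>GR\<^esub>k\<in>{..<m}. U i k \<star> V k j) = mm m U V i j" if "i < n" "j < n" for i j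
      by (rule mm) (use U V that in auto)
    have VU: "(\<Oplus>\<^bsub>GR\<^esub>k\<in>{..<n}. V i k \<star> U k j) = mm n V U i j" if "i < m" "j < m" for i j
      by (rule mm) (use U V that in auto)
    have BU: "(\<Oplus>\<^bsub>GR\<^esub>k\<in>{..<n}. B i k \<star> frob (U k j)) = mm n B (\<lambda>i j. frob (U i j)) i j" if "i < n" "j < m" for i j
    proof -
      define FU where "FU = (\<lambda>i j. frob (U i j))"
      have "(\<Oplus>\<^bsub>GR\<^esub>k\<in>{..<n}. B i k \<star> FU k j) = mm n B FU i j"
        by (rule mm) (use U assms that in \<open>auto simp: FU_def intro!: Gamma_frob\<close>)
      thus ?thesis by (simp only: FU_def)
    qed
    have lU: "series_const (l j) \<star> U i j = (\<lambda>k. l j * U i j k)" for i j by (rule ext) (simp add: conv_const_left)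
    have 1: "(\<forall>i<n. \<forall>j<n. (\<Oplus>\<^bsub>GR\<^esub>k\<in>{..<m}. U i k \<star> V k j) = (if i = j then series_const 1 else (\<lambda>_. 0))) \<longleftrightarrow>
      (\<forall>i<n. \<forall>j<n. mm m U V i j = im i j)" using UV by (simp only: im) simp
    have 2: "(\<forall>i<m. \<forall>j<m. (\<Oplus>\<^bsub>GR\<^esub>k\<in>{..<n}. V i k \<star> U k j) = (if i = j then series_const 1 else (\<lambda>_. 0))) \<longleftrightarrow>
      (\<forall>i<m. \<forall>j<m. mm n V U i j = im i j)" using VU by (simp only: im) simp
    have 3: "(\<forall>i<n. \<forall>j<m. (\<Oplus>\<^bsub>GR\<^esub>k\<in>{..<n}. B i k \<star> frob (U k j)) = series_const (l j) \<star> U i j) \<longleftrightarrow>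
      (\<forall>i<n. \<forall>j<m. mm n B (\<lambda>i j. frob (U i j)) i j = (\<lambda>k. l j * U i j k))" using BU by (simp only: lU) simp
    show ?thesis unfolding eigenmatrix_def series_ring_simps 1 2 3 ..
  qed
  thus ?thesis unfolding eigenmatrix_def series_ring_simps by blast
qed

text \<open>For the direction from left to right, the equation expresses \<open>frob U\<close> through \<open>U\<close>, with the help of \<open>B'\<close>, and
  \<open>frob V\<close> through \<open>V\<close>. Both force all exponents to be nonnegative, so that the coefficients at \<open>0\<close> satisfy the same equations. For the converse,
  changing the basis by the constant matrix \<open>P\<close> turns the constant term of \<open>B\<close> into a diagonal matrix, to which Dwork's
  trick applies.\<close>
theorem eigenmatrix_reduction_iff:
  assumes B: "\<And>i j. i < n \<Longrightarrow> j < n \<Longrightarrow> B i j \<in> PB" and B': "\<And>i j. i < n \<Longrightarrow> j < n \<Longrightarrow> B' i j \<in> PB"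
    and c: "c \<in> L" "c \<noteq> 0" and l: "\<And>j. j < m \<Longrightarrow> l j \<in> L \<and> l j \<noteq> 0"
    and BB': "\<And>i j. i < n \<Longrightarrow> j < n \<Longrightarrow> mm n B B' i j = (\<lambda>k. c * im i j k)"
    and B'B: "\<And>i j. i < n \<Longrightarrow> j < n \<Longrightarrow> mm n B' B i j = (\<lambda>k. c * im i j k)"
  shows "(\<exists>U V. eigenmatrix GR frob n B m U V (\<lambda>j. series_const (l j))) \<longleftrightarrow>
    (\<exists>U V. eigenmatrix (subring_of_type L) \<sigma> n (\<lambda>i j. B i j 0) m U V l)"
proof -
  have B\<Gamma>: "B i j \<in> \<Gamma>" "B' i j \<in> \<Gamma>" if "i < n" "j < n" for i j using B[OF that] B'[OF that] by (auto intro: PB_Gamma)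
  have B0: "B i j 0 \<in> L" if "i < n" "j < n" for i j using B[OF that] by (simp add: PB_def)
  show ?thesis
  proof
    assume "\<exists>U V. eigenmatrix GR frob n B m U V (\<lambda>j. series_const (l j))"
    then obtain U V where em: "eigenmatrix GR frob n B m U V (\<lambda>j. series_const (l j))" by (elim exE)
    note em' = iffD1[OF eigenmatrix_GR_iff[OF B\<Gamma>(1)] em]
    have U: "\<forall>i<n. \<forall>j<m. U i j \<in> \<Gamma>" by (rule conjunct1[OF em'])
    have V: "\<forall>i<m. \<forall>j<n. V i j \<in> \<Gamma>" by (rule conjunct1[OF conjunct2[OF em']])
    have UV: "\<forall>i<n. \<forall>j<n. mm m U V i j = im i j" by (rule conjunct1[OF conjunct2[OF conjunct2[OF em']]])
    have VU: "\<forall>i<m. \<forall>j<m. mm n V U i j = im i j" by (rule conjunct1[OF conjunct2[OF conjunct2[OF conjunct2[OF em']]]])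
    have eq: "\<forall>i<n. \<forall>j<m. mm n B (\<lambda>i j. frob (U i j)) i j = (\<lambda>k. l j * U i j k)"
      by (rule conjunct2[OF conjunct2[OF conjunct2[OF conjunct2[OF em']]]])
    define FU where "FU = (\<lambda>i j. frob (U i j))"
    define FV where "FV = (\<lambda>i j. frob (V i j))"
    have FU\<Gamma>: "FU i j \<in> \<Gamma>" if "i < n" "j < m" for i j unfolding FU_def using U that by (intro Gamma_frob) auto
    have FV\<Gamma>: "FV i j \<in> \<Gamma>" if "i < m" "j < n" for i j unfolding FV_def using V that by (intro Gamma_frob) auto
    let ?S = "(\<lambda>(i, j). U i j) ` ({..<n} \<times> {..<m}) \<union> (\<lambda>(i, j). V i j) ` ({..<m} \<times> {..<n})
      \<union> (\<lambda>(i, j). FU i j) ` ({..<n} \<times> {..<m}) \<union> (\<lambda>(i, j). FV i j) ` ({..<m} \<times> {..<n})"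
    have "?S \<subseteq> \<Gamma>" using U V FU\<Gamma> FV\<Gamma> by auto
    from Gamma_SR_family[OF _ this]
    have "\<exists>s0>0. \<forall>a b. 0 < a \<longrightarrow> a \<le> s0 \<longrightarrow> 0 < b \<longrightarrow> b \<le> s0 \<longrightarrow> ?S \<subseteq> SR a b" by blast
    then obtain s0 where s0: "s0 > 0" "\<forall>a b. 0 < a \<longrightarrow> a \<le> s0 \<longrightarrow> 0 < b \<longrightarrow> b \<le> s0 \<longrightarrow> ?S \<subseteq> SR a b"
      by (elim exE conjE)
    define a where "a = s0 / 2"
    have ab: "0 < a" "a < s0" using s0(1) by (auto simp: a_def)
    have S: "?S \<subseteq> SR a s0" using s0(2) ab by auto
    have U_SR: "U i j \<in> SR a s0" "FU i j \<in> SR a s0" if "i < n" "j < m" for i j using S that by auto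
    have V_SR: "V i j \<in> SR a s0" "FV i j \<in> SR a s0" if "i < m" "j < n" for i j using S that by auto
    have B_SR: "B i j \<in> SR a s0" "B' i j \<in> SR a s0" if "i < n" "j < n" for i j
      using ab s0(1) by (auto intro!: PB_SR B[OF that] B'[OF that])
    have mm_SR: "mm h A1 A2 i j \<in> SR a s0" if "\<And>k. k < h \<Longrightarrow> A1 i k \<in> SR a s0" "\<And>k. k < h \<Longrightarrow> A2 k j \<in> SR a s0" for h A1 A2 i j
      unfolding mm_def using that by (intro SR_sum SR_conv[OF ab]) auto
    have U_neg: "U q j k = 0" if j: "j < m" and q: "q < n" and k: "k < 0" for q j k
    proof (rule frobenius_solution_support[where A = B' and c = c and l = "l j" and x = "\<lambda>q. U q j" and n = n])
      fix q k assume q: "q < n"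
      have "mm n (mm n B' B) FU q j = mm n B' (mm n B FU) q j"
        using q j by (intro mm_assoc[OF ab] B_SR U_SR)
      also have "\<dots> = mm n B' (mm m U (dm l)) q j"
        using eq j by - (rule mm_cong, auto simp: FU_def mm_dm_right)
      also have "\<dots> = mm m (mm n B' U) (dm l) q j"
        using q j l in_L(1) by (intro mm_assoc[OF ab, symmetric] B_SR U_SR) (auto simp: dm_def intro!: SR_const)
      also have "\<dots> = (\<lambda>k. l j * mm n B' U q j k)" using j by (simp add: mm_dm_right)
      finally have 1: "mm n (mm n B' B) FU q j = (\<lambda>k. l j * mm n B' U q j k)" .
      have "mm n (mm n B' B) FU q j = mm n (dm (\<lambda>_. c)) FU q j"
        using B'B q by - (rule mm_cong, auto simp: dm_def series_const_def)
      also have "\<dots> = (\<lambda>k. c * FU q j k)" using q by (simp add: mm_dm_left)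
      finally have "c * FU q j k = l j * mm n B' U q j k" using 1 by (metis)
      thus "c * frob (U q j) k = l j * (\<Sum>h<n. (B' q h \<star> U h j) k)" by (simp add: FU_def mm_def)
    qed (use U B' c q k j in auto)
    have FUV: "mm m FU FV i j = im i j" if ij: "i < n" "j < n" for i j
    proof
      fix k
      have "frob (mm m U V i j) k = (\<Sum>h<m. frob (U i h \<star> V h j) k)"
        unfolding mm_def frob_apply using ij U_SR V_SR by (intro \<sigma>_sum conv_psums(2)[OF ab]) auto
      also have "\<dots> = mm m FU FV i j k"
        unfolding mm_def FU_def FV_def using ij U_SR V_SR by (intro sum.cong) (auto simp: frob_conv[OF ab])
      finally have "mm m FU FV i j k = frob (im i j) k" using UV ij by simp
      also have "frob (im i j) = im i j" by (simp add: dm_def frob_const \<sigma>_0 \<sigma>_1 if_distrib cong: if_cong)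
      finally show "mm m FU FV i j k = im i j k" .
    qed
    have VB: "mm n V B i q = (\<lambda>k. l i * FV i q k)" if i: "i < m" and q: "q < n" for i q
    proof -
      have "mm n V B i q = mm n (mm n V B) im i q" using q by (simp add: mm_im)
      also have "\<dots> = mm n (mm n V B) (mm m FU FV) i q" using FUV q by - (rule mm_cong, auto)
      also have "\<dots> = mm m (mm n (mm n V B) FU) FV i q"
        using i q by (intro mm_assoc[OF ab, symmetric] mm_SR U_SR V_SR B_SR)
      also have "\<dots> = mm m (dm l) FV i q"
      proof (rule mm_cong)
        fix h assume h: "h < m"
        have "mm n (mm n V B) FU i h = mm n V (mm n B FU) i h"
          using i h by (intro mm_assoc[OF ab] U_SR V_SR B_SR)
        also have "\<dots> = mm n V (mm m U (dm l)) i h" using eq h by - (rule mm_cong, auto simp: FU_def mm_dm_right)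
        also have "\<dots> = mm m (mm n V U) (dm l) i h"
          using i h l in_L(1) by (intro mm_assoc[OF ab, symmetric] U_SR V_SR) (auto simp: dm_def intro!: SR_const)
        also have "\<dots> = mm m im (dm l) i h" using VU i by - (rule mm_cong, auto)
        also have "\<dots> = dm l i h" using i by (simp add: mm_im)
        finally show "mm n (mm n V B) FU i h = dm l i h" .
      qed simp
      finally show ?thesis using i by (simp add: mm_dm_left)
    qed
    have V_neg: "V i q k = 0" if i: "i < m" and q: "q < n" and k: "k < 0" for i q k
    proof (rule frobenius_solution_support[where A = "\<lambda>q h. B h q" and c = "l i" and l = 1 and x = "\<lambda>q. V i q" and n = n])
      fix q k assume q: "q < n"
      show "l i * frob (V i q) k = 1 * (\<Sum>h<n. (B h q \<star> V i h) k)"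
        using fun_cong[OF VB[OF i q], of k] by (simp add: mm_def FV_def conv_commute)
    qed (use V B l i q k in auto)
    have "eigenmatrix (subring_of_type L) \<sigma> n (\<lambda>i j. B i j 0) m (\<lambda>i j. U i j 0) (\<lambda>i j. V i j 0) l"
    proof (rule iffD2[OF eigenmatrix_L_iff[of n "\<lambda>i j. B i j 0", OF B0]], assumption, assumption, intro conjI allI impI)
      show "U i j 0 \<in> L" if "i < n" "j < m" for i j using U that by (auto intro: Gamma_in_L)
      show "V i j 0 \<in> L" if "i < m" "j < n" for i j using V that by (auto intro: Gamma_in_L)
    next
      fix i j assume ij: "i < n" "j < n"
      have "(\<Sum>k<m. U i k 0 * V k j 0) = mm m U V i j 0"
        unfolding mm_def using ij by (intro sum.cong HOL.refl conv_at_0[symmetric]) (auto intro: U_neg V_neg)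
      thus "(\<Sum>k<m. U i k 0 * V k j 0) = (if i = j then 1 else 0)" using UV ij by (simp add: dm_def series_const_def)
    next
      fix i j assume ij: "i < m" "j < m"
      have "(\<Sum>k<n. V i k 0 * U k j 0) = mm n V U i j 0"
        unfolding mm_def using ij by (intro sum.cong HOL.refl conv_at_0[symmetric]) (auto intro: U_neg V_neg)
      thus "(\<Sum>k<n. V i k 0 * U k j 0) = (if i = j then 1 else 0)" using VU ij by (simp add: dm_def series_const_def)
    next
      fix i j assume ij: "i < n" "j < m"
      have "(\<Sum>k<n. B i k 0 * \<sigma> (U k j 0)) = mm n B FU i j 0"
        unfolding mm_def
      proof (intro sum.cong HOL.refl)
        fix h assume "h \<in> {..<n}"
        then have h: "h < n" by simp
        have "(B i h \<star> FU h j) 0 = B i h 0 * FU h j 0"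
        proof (rule conv_at_0)
          fix k :: rat assume k: "k < 0"
          show "B i h k = 0" using B[OF ij(1) h] k by (simp add: PB_def)
          have "k / of_nat p < 0" using k of_nat_p_pos by (simp add: divide_neg_pos)
          thus "FU h j k = 0" using U_neg[OF ij(2) h] by (simp add: FU_def frob_apply \<sigma>_0)
        qed
        thus "B i h 0 * \<sigma> (U h j 0) = (B i h \<star> FU h j) 0" by (simp add: FU_def frob_apply)
      qed
      thus "(\<Sum>k<n. B i k 0 * \<sigma> (U k j 0)) = l j * U i j 0" using eq ij by (simp add: FU_def)
    qed
    thus "\<exists>U V. eigenmatrix (subring_of_type L) \<sigma> n (\<lambda>i j. B i j 0) m U V l" by blast
  next
    assume "\<exists>U V. eigenmatrix (subring_of_type L) \<sigma> n (\<lambda>i j. B i j 0) m U V l"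
    then obtain P Q where em: "eigenmatrix (subring_of_type L) \<sigma> n (\<lambda>i j. B i j 0) m P Q l" by (elim exE)
    note em' = iffD1[OF eigenmatrix_L_iff[of n "\<lambda>i j. B i j 0", OF B0] em]
    have P: "\<forall>i<n. \<forall>j<m. P i j \<in> L" by (rule conjunct1[OF em'])
    have Q: "\<forall>i<m. \<forall>j<n. Q i j \<in> L" by (rule conjunct1[OF conjunct2[OF em']])
    have PQ: "\<forall>i<n. \<forall>j<n. (\<Sum>k<m. P i k * Q k j) = (if i = j then 1 else 0)"
      by (rule conjunct1[OF conjunct2[OF conjunct2[OF em']]])
    have QP: "\<forall>i<m. \<forall>j<m. (\<Sum>k<n. Q i k * P k j) = (if i = j then 1 else 0)"
      by (rule conjunct1[OF conjunct2[OF conjunct2[OF conjunct2[OF em']]]])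
    have eqP: "\<forall>i<n. \<forall>j<m. (\<Sum>k<n. B i k 0 * \<sigma> (P k j)) = l j * P i j"
      by (rule conjunct2[OF conjunct2[OF conjunct2[OF conjunct2[OF em']]]])
    define cP where "cP = (\<lambda>i j. series_const (P i j))"
    define cQ where "cQ = (\<lambda>i j. series_const (Q i j))"
    define FP where "FP = (\<lambda>i j. series_const (\<sigma> (P i j)))"
    define FQ where "FQ = (\<lambda>i j. series_const (\<sigma> (Q i j)))"
    have const_mm: "mm h (\<lambda>i j. series_const (X1 i j)) (\<lambda>i j. series_const (X2 i j)) i j = series_const (\<Sum>k<h. X1 i k * X2 k j)"
      for h X1 X2 i j by (rule ext) (simp add: mm_def conv_const_left, simp add: series_const_def)
    have im_eq: "im i j = series_const (if i = j then 1 else 0)" for i j by (simp add: dm_def)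
    have cPQ: "mm m cP cQ i j = im i j" if "i < n" "j < n" for i j
      unfolding cP_def cQ_def const_mm im_eq using PQ that by simp
    have cQP: "mm n cQ cP i j = im i j" if "i < m" "j < m" for i j
      unfolding cP_def cQ_def const_mm im_eq using QP that by simp
    have FPQ: "mm m FP FQ i j = im i j" if ij: "i < n" "j < n" for i j
    proof -
      have "(\<Sum>k<m. \<sigma> (P i k) * \<sigma> (Q k j)) = (\<Sum>k<m. \<sigma> (P i k * Q k j))"
        using P Q ij by (intro sum.cong) (auto simp: \<sigma>_mult)
      also have "\<dots> = \<sigma> (\<Sum>k<m. P i k * Q k j)" using P Q ij by (intro \<sigma>_sum[symmetric] in_L(6)) auto
      also have "\<dots> = (if i = j then 1 else 0)" using PQ ij by (simp add: \<sigma>_0 \<sigma>_1)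
      finally show ?thesis unfolding FP_def FQ_def const_mm im_eq by simp
    qed
    define A where "A = mm n (mm n cQ B) FP"
    define A' where "A' = mm n (mm n FQ B') (\<lambda>i j k. inverse c * cP i j k)"
    have A_eq: "A i j = (\<lambda>k. \<Sum>h<n. \<sigma> (P h j) * (\<Sum>g<n. Q i g * B g h k))" for i j
      by (simp add: A_def mm_def cQ_def FP_def conv_const_left conv_const_right)
    have A'_eq: "A' i j = (\<lambda>k. \<Sum>h<n. inverse c * P h j * (\<Sum>g<n. \<sigma> (Q i g) * B' g h k))" for i j
    proof -
      have "(\<lambda>k. inverse c * cP h j k) = series_const (inverse c * P h j)" for h by (auto simp: cP_def series_const_def)
      thus ?thesis by (simp add: A'_def mm_def FQ_def conv_const_left conv_const_right)
    qed
    have A_PB: "A i j \<in> PB" if "i < m" "j < m" for i j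
      unfolding A_eq using that P Q by (intro PB_sum PB_cmult B \<sigma>_in_L) auto
    have A'_PB: "A' i j \<in> PB" if "i < m" "j < m" for i j
      unfolding A'_eq using that P Q c by (intro PB_sum PB_cmult B' \<sigma>_in_L in_L(6) in_L(4)) auto
    have A0: "A i j 0 = (if i = j then l i else 0)" if ij: "i < m" "j < m" for i j
    proof -
      have "A i j 0 = (\<Sum>g<n. Q i g * (\<Sum>h<n. B g h 0 * \<sigma> (P h j)))"
        unfolding A_eq sum_distrib_left by (subst sum.swap) (simp add: mult_ac)
      also have "\<dots> = (\<Sum>g<n. Q i g * (l j * P g j))" using eqP ij by (intro sum.cong) auto
      also have "\<dots> = l j * (\<Sum>g<n. Q i g * P g j)" by (simp add: sum_distrib_left mult_ac)
      finally show ?thesis using QP ij by simp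
    qed
    have c_SR: "cP i j \<in> SR a b" "FP i j \<in> SR a b" if "i < n" "j < m" for i j a b
      unfolding cP_def FP_def using P that \<sigma>_in_L by (auto intro!: SR_const)
    have cQ_SR: "cQ i j \<in> SR a b" "FQ i j \<in> SR a b" if "i < m" "j < n" for i j a b
      unfolding cQ_def FQ_def using Q that \<sigma>_in_L by (auto intro!: SR_const)
    have B_SR: "B i j \<in> SR a b" "B' i j \<in> SR a b" if "i < n" "j < n" "0 < a" "0 < b" for i j a b
      using that by (auto intro!: PB_SR B B')
    have mm_SR: "mm h A1 A2 i j \<in> SR a b" if "0 < a" "a < b" "\<And>k. k < h \<Longrightarrow> A1 i k \<in> SR a b" "\<And>k. k < h \<Longrightarrow> A2 k j \<in> SR a b" for h A1 A2 i j a b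
      unfolding mm_def using that by (intro SR_sum SR_conv[of a b]) auto
    have AA': "mm m A A' i j = im i j" if ij: "i < m" "j < m" for i j
    proof -
      have ab: "(0::real) < 1" "(1::real) < 2" by auto
      have ic: "(\<lambda>k. inverse c * cP h j k) \<in> SR 1 2" if "h < n" for h
        using that ij c by (intro SR_cmult c_SR in_L(4)) auto
      have "mm m A A' i j = mm n (mm n cQ B) (mm m FP A') i j"
        unfolding A_def using ij A'_PB
        by (intro mm_assoc[OF ab] mm_SR[OF ab] c_SR cQ_SR B_SR PB_SR) auto
      also have "\<dots> = mm n (mm n cQ B) (mm n B' (\<lambda>i j k. inverse c * cP i j k)) i j"
      proof (rule mm_cong)
        fix h assume h: "h < n"
        have "mm m FP A' h j = mm n (mm m FP (mm n FQ B')) (\<lambda>i j k. inverse c * cP i j k) h j"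
          unfolding A'_def using ij h ic
          by (intro mm_assoc[OF ab, symmetric] mm_SR[OF ab] c_SR cQ_SR B_SR) auto
        also have "\<dots> = mm n B' (\<lambda>i j k. inverse c * cP i j k) h j"
        proof (rule mm_cong)
          fix g assume g: "g < n"
          have "mm m FP (mm n FQ B') h g = mm n (mm m FP FQ) B' h g"
            using h g by (intro mm_assoc[OF ab, symmetric] c_SR cQ_SR B_SR) auto
          also have "\<dots> = mm n im B' h g" using FPQ h by - (rule mm_cong, auto)
          also have "\<dots> = B' h g" using h by (simp add: mm_im)
          finally show "mm m FP (mm n FQ B') h g = B' h g" .
        qed simp
        finally show "mm m FP A' h j = mm n B' (\<lambda>i j k. inverse c * cP i j k) h j" .
      qed simp
      also have "\<dots> = mm n cQ (mm n B (mm n B' (\<lambda>i j k. inverse c * cP i j k))) i j"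
        using ij ic by (intro mm_assoc[OF ab] mm_SR[OF ab] cQ_SR B_SR) auto
      also have "\<dots> = mm n cQ cP i j"
      proof (rule mm_cong)
        fix h assume h: "h < n"
        have "mm n B (mm n B' (\<lambda>i j k. inverse c * cP i j k)) h j = mm n (mm n B B') (\<lambda>i j k. inverse c * cP i j k) h j"
          using h ic by (intro mm_assoc[OF ab, symmetric] B_SR) auto
        also have "\<dots> = mm n (dm (\<lambda>_. c)) (\<lambda>i j k. inverse c * cP i j k) h j"
          using BB' h by - (rule mm_cong, auto simp: dm_def series_const_def)
        also have "\<dots> = cP h j" using h c(2) by (simp add: mm_dm_left mult.assoc[symmetric])
        finally show "mm n B (mm n B' (\<lambda>i j k. inverse c * cP i j k)) h j = cP h j" .
      qed simp
      also have "\<dots> = im i j" by (rule cQP[OF ij])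
      finally show ?thesis .
    qed
    have "\<exists>U V. (\<forall>i<m. \<forall>j<m. U i j \<in> \<Gamma> \<and> V i j \<in> \<Gamma>) \<and>
     (\<forall>i<m. \<forall>j<m. mm m U V i j = im i j \<and> mm m V U i j = im i j) \<and>
     (\<forall>i<m. \<forall>j<m. mm m A (\<lambda>i j. frob (U i j)) i j = (\<lambda>k. l j * U i j k))"
      by (rule dwork_trick[where A' = A']) (use l A_PB A'_PB A0 AA' in auto)
    then obtain U V where UVG: "\<forall>i<m. \<forall>j<m. U i j \<in> \<Gamma> \<and> V i j \<in> \<Gamma>"
      and UV: "\<forall>i<m. \<forall>j<m. mm m U V i j = im i j \<and> mm m V U i j = im i j"
      and eqU: "\<forall>i<m. \<forall>j<m. mm m A (\<lambda>i j. frob (U i j)) i j = (\<lambda>k. l j * U i j k)" by (elim exE conjE)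
    define FU where "FU = (\<lambda>i j. frob (U i j))"
    have FU\<Gamma>: "FU i j \<in> \<Gamma>" if "i < m" "j < m" for i j unfolding FU_def using UVG that by (intro Gamma_frob) auto
    let ?S = "(\<lambda>(i, j). U i j) ` ({..<m} \<times> {..<m}) \<union> (\<lambda>(i, j). V i j) ` ({..<m} \<times> {..<m})
      \<union> (\<lambda>(i, j). FU i j) ` ({..<m} \<times> {..<m})"
    have "?S \<subseteq> \<Gamma>" using UVG FU\<Gamma> by auto
    from Gamma_SR_family[OF _ this]
    have "\<exists>s0>0. \<forall>a b. 0 < a \<longrightarrow> a \<le> s0 \<longrightarrow> 0 < b \<longrightarrow> b \<le> s0 \<longrightarrow> ?S \<subseteq> SR a b" by blast
    then obtain s0 where s0: "s0 > 0" "\<forall>a b. 0 < a \<longrightarrow> a \<le> s0 \<longrightarrow> 0 < b \<longrightarrow> b \<le> s0 \<longrightarrow> ?S \<subseteq> SR a b"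
      by (elim exE conjE)
    define a where "a = s0 / 2"
    have ab: "0 < a" "a < s0" using s0(1) by (auto simp: a_def)
    have S: "?S \<subseteq> SR a s0" using s0(2) ab by auto
    have U_SR: "U i j \<in> SR a s0" "V i j \<in> SR a s0" "FU i j \<in> SR a s0" if "i < m" "j < m" for i j using S that by auto
    note BSR = B_SR[OF _ _ ab(1) s0(1)] and mmSR = mm_SR[OF ab]
    define U' where "U' = mm m cP U"
    define V' where "V' = mm m V cQ"
    have cP\<Gamma>: "cP i j \<in> \<Gamma>" if "i < n" "j < m" for i j unfolding cP_def using P that by (intro Gamma_const) auto
    have cQ\<Gamma>: "cQ i j \<in> \<Gamma>" if "i < m" "j < n" for i j unfolding cQ_def using Q that by (intro Gamma_const) auto
    have "eigenmatrix GR frob n B m U' V' (\<lambda>j. series_const (l j))"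
    proof (rule iffD2[OF eigenmatrix_GR_iff[OF B\<Gamma>(1)]], assumption, assumption, intro conjI allI impI)
      show "U' i j \<in> \<Gamma>" if "i < n" "j < m" for i j
        unfolding U'_def mm_def using that UVG cP\<Gamma> by (intro Gamma_sum Gamma_conv) auto
      show "V' i j \<in> \<Gamma>" if "i < m" "j < n" for i j
        unfolding V'_def mm_def using that UVG cQ\<Gamma> by (intro Gamma_sum Gamma_conv) auto
    next
      fix i j assume ij: "i < n" "j < n"
      have "mm m U' V' i j = mm m cP (mm m U (mm m V cQ)) i j"
        unfolding U'_def V'_def using ij by (intro mm_assoc[OF ab] mmSR c_SR cQ_SR U_SR)
      also have "\<dots> = mm m cP cQ i j"
      proof (rule mm_cong)
        fix h assume h: "h < m"
        have "mm m U (mm m V cQ) h j = mm m (mm m U V) cQ h j"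
          using ij h by (intro mm_assoc[OF ab, symmetric] cQ_SR U_SR)
        also have "\<dots> = mm m im cQ h j" using UV h by - (rule mm_cong, auto)
        finally show "mm m U (mm m V cQ) h j = cQ h j" using h by (simp add: mm_im)
      qed simp
      finally show "mm m U' V' i j = im i j" using cPQ[OF ij] by simp
    next
      fix i j assume ij: "i < m" "j < m"
      have "mm n V' U' i j = mm m V (mm n cQ (mm m cP U)) i j"
        unfolding U'_def V'_def using ij by (intro mm_assoc[OF ab] mmSR c_SR cQ_SR U_SR)
      also have "\<dots> = mm m V U i j"
      proof (rule mm_cong)
        fix h assume h: "h < m"
        have "mm n cQ (mm m cP U) h j = mm m (mm n cQ cP) U h j"
          using ij h by (intro mm_assoc[OF ab, symmetric] cQ_SR c_SR U_SR)
        also have "\<dots> = mm m im U h j" using cQP h by - (rule mm_cong, auto)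
        finally show "mm n cQ (mm m cP U) h j = U h j" using h by (simp add: mm_im)
      qed simp
      finally show "mm n V' U' i j = im i j" using UV ij by simp
    next
      fix i j assume ij: "i < n" "j < m"
      have FU': "frob (U' h j) = mm m FP FU h j" if h: "h < n" for h
      proof
        fix k
        have "frob (U' h j) k = (\<Sum>g<m. frob (cP h g \<star> U g j) k)"
          unfolding U'_def mm_def frob_apply using h ij U_SR c_SR by (intro \<sigma>_sum conv_psums(2)[OF ab]) auto
        also have "\<dots> = (\<Sum>g<m. (frob (cP h g) \<star> FU g j) k)"
          unfolding FU_def using h ij U_SR c_SR by (intro sum.cong) (auto simp: frob_conv[OF ab])
        finally show "frob (U' h j) k = mm m FP FU h j k" by (simp add: mm_def cP_def FP_def frob_const)
      qed
      have "mm n B (\<lambda>i j. frob (U' i j)) i j = mm n B (mm m FP FU) i j" using FU' by - (rule mm_cong, auto)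
      also have "\<dots> = mm n (mm m cP cQ) (mm n B (mm m FP FU)) i j"
      proof -
        have "mm n (mm m cP cQ) (mm n B (mm m FP FU)) i j = mm n im (mm n B (mm m FP FU)) i j"
          using cPQ ij by - (rule mm_cong, auto)
        thus ?thesis using ij by (simp add: mm_im)
      qed
      also have "\<dots> = mm m cP (mm n cQ (mm n B (mm m FP FU))) i j"
        using ij by (intro mm_assoc[OF ab] mmSR c_SR cQ_SR BSR U_SR)
      also have "\<dots> = mm m cP (mm m U (dm l)) i j"
      proof (rule mm_cong)
        fix h assume h: "h < m"
        have "mm n cQ (mm n B (mm m FP FU)) h j = mm n (mm n cQ B) (mm m FP FU) h j"
          using ij h by (intro mm_assoc[OF ab, symmetric] mmSR c_SR cQ_SR BSR U_SR)
        also have "\<dots> = mm m A FU h j"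
          unfolding A_def using ij h by (intro mm_assoc[OF ab, symmetric] mmSR c_SR cQ_SR BSR U_SR)
        also have "\<dots> = mm m U (dm l) h j" using eqU h ij by (simp add: FU_def mm_dm_right)
        finally show "mm n cQ (mm n B (mm m FP FU)) h j = mm m U (dm l) h j" .
      qed simp
      also have "\<dots> = mm m U' (dm l) i j"
        unfolding U'_def using ij l in_L(1)
        by (intro mm_assoc[OF ab, symmetric] c_SR U_SR) (auto simp: dm_def intro!: SR_const)
      finally show "mm n B (\<lambda>i j. frob (U' i j)) i j = (\<lambda>k. l j * U' i j k)" using ij by (simp add: mm_dm_right)
    qed
    thus "\<exists>U V. eigenmatrix GR frob n B m U V (\<lambda>j. series_const (l j))" by blast
  qed
qed

end

section \<open>The coefficient rings\<close>

lemma witt_extension_of_setting: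
  assumes cs: "coefficient_setting p v res W K"
  shows "witt_extension p v res W K"
proof -
  have p: "p > 1"
  proof -
    have "CHAR('b) \<noteq> Suc 0" by simp
    moreover have "CHAR('b) = p" "p > 0" using cs by (auto simp: coefficient_setting_def)
    ultimately show ?thesis by simp
  qed
  interpret p_adic_norm p v
    by unfold_locales (use cs p in \<open>auto simp: coefficient_setting_def\<close>)
  have res0: "{x \<in> integers_of v K. res x = 0} = {x \<in> K. x = 0 \<or> v x > 0}"
    using cs unfolding coefficient_setting_def by blast
  have WK: "W \<subseteq> K" and Wv: "\<forall>x\<in>W. x \<noteq> 0 \<longrightarrow> v x \<ge> 0"
    using cs unfolding coefficient_setting_def by blast+
  show ?thesis
  proof
    show "is_witt_ring p res W" using cs unfolding coefficient_setting_def by blast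
    fix w assume w: "w \<in> W"
    show "N w \<le> 1" using Wv w by (auto simp: N_le_1_iff)
    have "w \<in> integers_of v K" using w Wv WK by (auto simp: integers_of_def)
    then have "res w = 0 \<longleftrightarrow> w \<in> {x \<in> integers_of v K. res x = 0}" by simp
    also have "\<dots> \<longleftrightarrow> N w < 1" unfolding res0 using w WK by (auto simp: N_less_1_iff)
    finally show "res w = 0 \<longleftrightarrow> N w < 1" .
  next
    show "is_subfield K" using cs unfolding coefficient_setting_def subfield_of_type_iff by blast
    show "W \<subseteq> K" by fact
    show "ring.finite_dimension ring_of_type_algebra (fractions W) K"
      using cs unfolding coefficient_setting_def by blast
  qed
qed

lemma (in witt_extension) witt_extension_finite_extension:
  assumes fe: "finite_extension v L \<sigma> L' \<sigma>'"
  shows "witt_extension p v res W L'"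
proof -
  interpret R: Ring.field "ring_of_type_algebra :: 'a ring" by (rule field_from_type_algebra)
  have L': "subfield L' (ring_of_type_algebra :: 'a ring)" "L \<subseteq> L'" "R.finite_dimension L L'"
    using fe unfolding finite_extension_def by auto
  have 1: "subfield (fractions W) (ring_of_type_algebra :: 'a ring)" "subfield L (ring_of_type_algebra :: 'a ring)"
    using fractions_is_subfield L_subfield subfield_of_type_iff by blast+
  have "R.finite_dimension (fractions W) L'" using R.telescopic_base_dim(1)[OF 1 finite_dim L'(3)] .
  thus ?thesis
    using L' W_subset subfield_of_type_iff[of L'] by unfold_locales auto
qed

lemma (in witt_extension) complete_subfield: "complete_subfield p v L"
  using L_subfield L_complete by unfold_locales auto

lemma (in p_adic_norm) integers_of_iff: "x \<in> integers_of v A \<longleftrightarrow> x \<in> A \<and> N x \<le> 1"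
  by (auto simp: integers_of_def N_le_1_iff)

text \<open>The valuation of \<open>x\<close> is determined by the integers of the form \<open>x\<^sup>b p\<^sup>m / p\<^sup>n\<close>, and an automorphism
  that preserves integrality keeps their shape.\<close>
lemma (in complete_subfield) isometric_if_integral:
  assumes ia: "integral_automorphism v L \<tau>"
  shows "isometric_automorphism p v L \<tau>"
proof -
  have hom: "\<tau> \<in> ring_hom (subring_of_type L) (subring_of_type L)" and bij: "bij_betw \<tau> L L"
    using ia by (auto simp: integral_automorphism_def ring_iso_def subring_of_type_simps)
  have clo: "\<tau> x \<in> L" if "x \<in> L" for x using ring_hom_closed[OF hom] that by (simp add: subring_of_type_simps)
  have mult: "\<tau> (x * y) = \<tau> x * \<tau> y" if "x \<in> L" "y \<in> L" for x y
    using ring_hom_mult[OF hom] that by (simp add: subring_of_type_simps)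
  have add: "\<tau> (x + y) = \<tau> x + \<tau> y" if "x \<in> L" "y \<in> L" for x y
    using ring_hom_add[OF hom] that by (simp add: subring_of_type_simps)
  have one: "\<tau> 1 = 1" using ring_hom_one[OF hom] by (simp add: subring_of_type_simps)
  have zero: "\<tau> 0 = 0" using add[OF in_L(1) in_L(1)] by (metis add_0_right add_left_cancel)
  have power: "\<tau> (x ^ k) = \<tau> x ^ k" if "x \<in> L" for x k
    by (induction k) (use that in \<open>auto simp: one mult in_L(9)\<close>)
  have nat: "\<tau> (of_nat k) = of_nat k" for k
    by (induction k) (auto simp: zero one add in_L(2,10))
  have nz: "\<tau> x \<noteq> 0" if "x \<in> L" "x \<noteq> 0" for x
    using bij that zero in_L(1) unfolding bij_betw_def inj_on_def by metis
  have int: "N (\<tau> x) \<le> 1" if "x \<in> L" "N x \<le> 1" for x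
  proof -
    have "x \<in> integers_of v L" using that by (simp add: integers_of_iff)
    then have "\<tau> x \<in> integers_of v L" using ia unfolding integral_automorphism_def by blast
    thus ?thesis by (simp add: integers_of_iff)
  qed
  have v_ge: "v x \<le> v (\<tau> x)" if x: "x \<in> L" "x \<noteq> 0" for x
  proof (rule ccontr)
    assume "\<not> v x \<le> v (\<tau> x)"
    then obtain b :: nat where b: "1 < real b * (v x - v (\<tau> x))" using reals_Archimedean3[of "v x - v (\<tau> x)"] by auto
    define n where "n = nat \<lfloor>real b * v x\<rfloor>"
    define m where "m = nat (- \<lfloor>real b * v x\<rfloor>)"
    have nm: "real n - real m = \<lfloor>real b * v x\<rfloor>" by (simp add: n_def m_def)
    define y where "y = x ^ b * of_nat p ^ m * inverse (of_nat p ^ n)"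
    have y: "y \<in> L" "y \<noteq> 0" using x p_nonzero by (auto simp: y_def intro!: in_L)
    have ypn: "y * of_nat p ^ n = x ^ b * of_nat p ^ m" using p_nonzero by (simp add: y_def)
    have "v y + real n = real b * v x + real m"
      using arg_cong[OF ypn, of v] x y p_nonzero by (simp add: v_mult v_power v_p)
    then have "v y \<ge> 0" using nm by linarith
    then have "N (\<tau> y) \<le> 1" using y by (intro int) (auto simp: N_le_1_iff)
    then have vy: "v (\<tau> y) \<ge> 0" using nz[OF y] by (simp add: N_le_1_iff)
    have pL: "of_nat p ^ k \<in> L" for k by (intro in_L)
    have "\<tau> y * of_nat p ^ n = \<tau> (y * of_nat p ^ n)" using y(1) pL by (simp add: mult power in_L(10) nat)
    also have "\<dots> = \<tau> x ^ b * of_nat p ^ m" using x(1) pL by (simp add: ypn mult power in_L(9,10) nat)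
    finally have "v (\<tau> y) + real n = real b * v (\<tau> x) + real m"
      using nz[OF y] nz[OF x] p_nonzero by (metis v_mult v_power v_p mult.right_neutral power_not_zero)
    then have "real_of_int \<lfloor>real b * v x\<rfloor> \<le> real b * v (\<tau> x)" using vy nm by linarith
    then have "real b * v x - 1 < real b * v (\<tau> x)" by linarith
    thus False using b by (simp add: algebra_simps)
  qed
  have v_eq: "v (\<tau> x) = v x" if x: "x \<in> L" "x \<noteq> 0" for x
  proof -
    have i: "inverse x \<in> L" "inverse x \<noteq> 0" using x in_L(4) by auto
    have "\<tau> x * \<tau> (inverse x) = 1" using mult[OF x(1) i(1)] x one by simp
    then have "v (\<tau> x) + v (\<tau> (inverse x)) = 0" using v_mult[OF nz[OF x] nz[OF i]] v_1 by simp
    thus ?thesis using v_ge[OF x] v_ge[OF i] v_inverse[OF x(2)] by linarith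
  qed
  show ?thesis
  proof
    show "N (\<tau> x) = N x" if "x \<in> L" for x
      by (cases "x = 0") (use that nz[of x] v_eq[of x] zero in \<open>auto simp: pabs_def\<close>)
    show "\<exists>x\<in>L. \<tau> x = y" if "y \<in> L" for y
    proof -
      have "y \<in> \<tau> ` L" using bij that by (simp add: bij_betw_def)
      thus ?thesis by auto
    qed
  qed (use clo add mult one in auto)
qed

section \<open>Extension of scalars of the series ring\<close>

text \<open>A series over \<open>L\<close> is a combination, with the finitely many coefficients in \<open>G\<close>, of series over
  \<open>Q = W[1/p]\<close> which are at most \<open>p\<close> times as large, coefficient by coefficient.\<close>
lemma (in witt_extension) Gamma_ext_eq:
  assumes K: "witt_extension p v res W K" and KL: "K \<subseteq> L"
  shows "Gamma_ext p v K L = series_ring p v (Gamma_imm_an_con p v L)"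
proof -
  interpret K: witt_extension p v res W K by (rule K)
  interpret LC: complete_subfield p v L by (rule complete_subfield)
  interpret KC: complete_subfield p v K by (rule K.complete_subfield)
  have "x \<in> {(\<lambda>i. \<Sum>l<m. e l * x l i) | (m :: nat) e x.
        \<forall>l<m. e l \<in> integers_of v L \<and> x l \<in> Gamma_imm_an_con p v K}" (is "_ \<in> ?E")
    if x: "x \<in> LC.\<Gamma>" for x
  proof -
    have "\<exists>c. (\<forall>g\<in>G. c g \<in> Q \<and> N (c g) \<le> p * N (x i)) \<and> x i = (\<Sum>g\<in>G. c g * g)" for i
      by (rule expansion) (rule LC.Gamma_in_L[OF x])
    then have "\<exists>c. \<forall>i. (\<forall>g\<in>G. c i g \<in> Q \<and> N (c i g) \<le> p * N (x i)) \<and> x i = (\<Sum>g\<in>G. c i g * g)"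
      by (intro choice allI)
    then obtain c where cQ: "\<And>i g. g \<in> G \<Longrightarrow> c i g \<in> Q" and Nc: "\<And>i g. g \<in> G \<Longrightarrow> N (c i g) \<le> p * N (x i)"
      and xc: "\<And>i. x i = (\<Sum>g\<in>G. c i g * g)" by blast
    have comp: "(\<lambda>i. c i g) \<in> KC.\<Gamma>" if g: "g \<in> G" for g
      unfolding KC.Gamma_iff
    proof (intro conjI allI impI)
      show "c i g \<in> K" for i using cQ[OF g] K.Q_subset by blast
      fix e :: real assume e: "e > 0"
      have "well_ordered {i. N (x i) > e / p}" using x e p_gt_1 unfolding LC.Gamma_iff by simp
      moreover have "{i. N (c i g) > e} \<subseteq> {i. N (x i) > e / p}"
        using Nc[OF g] p_gt_1 by (auto simp: field_simps intro: less_le_trans)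
      ultimately show "well_ordered {i. N (c i g) > e}" by (rule well_ordered_subset)
    next
      obtain s0 where s0: "s0 > 0" "\<And>s. 0 < s \<Longrightarrow> s \<le> s0 \<Longrightarrow> bnd s x" using x unfolding LC.Gamma_iff by blast
      have "bnd s (\<lambda>i. c i g)" if "bnd s x" for s
      proof -
        obtain C where C: "\<And>i. N (x i) \<le> C * wt s i" using \<open>bnd s x\<close> unfolding bnd_def by blast
        have "N (c i g) \<le> (p * C) * wt s i" for i
          using order.trans[OF Nc[OF g, of i] mult_left_mono[OF C[of i], of "real p"]] by (simp add: mult.assoc)
        thus ?thesis unfolding bnd_def by blast
      qed
      thus "\<exists>s0>0. \<forall>s. 0 < s \<longrightarrow> s \<le> s0 \<longrightarrow> bnd s (\<lambda>i. c i g)" using s0 by blast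
    qed
    obtain e where e: "bij_betw e {..<card G} G" using ex_bij_betw_nat_finite[OF G(1)] by (auto simp: atLeast0LessThan)
    then have eG: "e l \<in> G" if "l < card G" for l using that by (auto simp: bij_betw_def)
    have "x = (\<lambda>i. \<Sum>l<card G. e l * c i (e l))"
    proof
      fix i
      have "x i = (\<Sum>g\<in>G. g * c i g)" by (simp add: xc[of i] mult.commute)
      also have "\<dots> = (\<Sum>l<card G. e l * c i (e l))" by (rule sum.reindex_bij_betw[OF e, symmetric])
      finally show "x i = (\<Sum>l<card G. e l * c i (e l))" .
    qed
    moreover have "\<forall>l<card G. e l \<in> integers_of v L \<and> (\<lambda>i. c i (e l)) \<in> KC.\<Gamma>"
      using eG comp G_integral by (auto simp: integers_of_iff)
    ultimately show ?thesis by (intro CollectI exI[of _ "card G"] exI[of _ e] exI[of _ "\<lambda>l i. c i (e l)"] conjI)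
  qed
  moreover have "(\<lambda>i. \<Sum>l<m. e l * x l i) \<in> LC.\<Gamma>"
    if "\<forall>l<m. e l \<in> integers_of v L \<and> x l \<in> KC.\<Gamma>" for m :: nat and e x
  proof (rule LC.Gamma_sum)
    fix l assume "l \<in> {..<m}"
    then have "e l \<in> L" "x l \<in> KC.\<Gamma>" using that by (auto simp: integers_of_iff)
    moreover have "KC.\<Gamma> \<subseteq> LC.\<Gamma>" using KL unfolding Gamma_imm_an_con_def by blast
    ultimately show "(\<lambda>i. e l * x l i) \<in> LC.\<Gamma>" by (intro LC.Gamma_cmult) auto
  qed
  ultimately have "?E = LC.\<Gamma>" by blast
  thus ?thesis by (simp only: Gamma_ext_def)
qed

section \<open>The embedding of the power series ring\<close>

context complete_subfield begin

primrec spow :: "'a series \<Rightarrow> nat \<Rightarrow> 'a series" where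
  "spow x 0 = series_const 1"
| "spow x (Suc m) = x \<star> spow x m"

lemma SR_spow: "0 < a \<Longrightarrow> a < b \<Longrightarrow> x \<in> SR a b \<Longrightarrow> spow x m \<in> SR a b"
  by (induction m) (auto intro: SR_conv SR_const in_L(2))

lemma conv_integral:
  assumes "0 < a" "a < b" "x \<in> SR a b" "y \<in> SR a b" "\<And>i. N (x i) \<le> C" "\<And>i. N (y i) \<le> D" "0 \<le> C" "0 \<le> D"
  shows "N ((x \<star> y) i) \<le> C * D"
  by (rule conv_bound[OF assms(1-4)]) (use assms in \<open>auto intro: mult_mono\<close>)

lemma SR_restrict: assumes "x \<in> SR a b" shows "(\<lambda>i. if P i then x i else 0) \<in> SR a b"
proof -
  have "well_ordered {i. N (if P i then x i else 0) > e}" if "e > 0" for e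
    by (rule well_ordered_subset[OF SR_well_ordered[OF assms that]]) (use that in auto)
  moreover have "bnd s (\<lambda>i. if P i then x i else 0)" if "bnd s x" for s
  proof -
    obtain C where C: "C \<ge> 0" "\<And>i. N (x i) \<le> C * wt s i" using bndE[OF \<open>bnd s x\<close>] by blast
    have "N (if P i then x i else 0) \<le> C * wt s i" for i using C by auto
    thus ?thesis unfolding bnd_def by blast
  qed
  ultimately show ?thesis using assms in_L(1) unfolding SR_def by auto
qed

text \<open>Write \<open>x = u + w\<close> with \<open>w\<close> the part of \<open>x\<close> with exponents in \<open>I\<close>. Modulo norm \<open>\<eta>\<^sup>2\<close>, the power \<open>x\<^sup>p\<close>
  is \<open>u\<^sup>p + p u\<^sup>p\<^sup>-\<^sup>1 w\<close>, and the exponents of \<open>u\<^sup>p\<close> avoid \<open>I\<close>.\<close>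
lemma spow_p_small:
  assumes ab: "0 < a" "a < b" and x: "x \<in> SR a b" "\<And>i. N (x i) \<le> 1"
    and I: "\<And>i j. i \<notin> I \<Longrightarrow> j \<notin> I \<Longrightarrow> i + j \<notin> I"
    and x_small: "\<And>i. i \<in> I \<Longrightarrow> N (x i) \<le> \<eta>" and \<eta>: "0 \<le> \<eta>" "\<eta> \<le> \<nu>" "\<nu> \<le> 1" "1 / p \<le> \<nu>"
    and i: "i \<in> I"
  shows "N (spow x p i) \<le> \<eta> * \<nu>"
proof -
  have \<eta>1: "\<eta> \<le> 1" and \<nu>0: "0 \<le> \<nu>" using \<eta> by linarith+
  define u where "u = (\<lambda>i. if i \<notin> I then x i else 0)"
  define w where "w = (\<lambda>i. if i \<in> I then x i else 0)"
  have u: "u \<in> SR a b" and w: "w \<in> SR a b" unfolding u_def w_def by (rule SR_restrict[OF x(1)])+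
  have xuw: "x = (\<lambda>i. u i + w i)" by (auto simp: u_def w_def)
  have Nu: "N (u i) \<le> 1" and Nw: "N (w i) \<le> \<eta>" for i using x(2) x_small \<eta> by (auto simp: u_def w_def)
  note um = SR_spow[OF ab u]
  have Num: "N (spow u m i) \<le> 1" for m i
  proof (induction m arbitrary: i)
    case (Suc m)
    have "N ((u \<star> spow u m) i) \<le> 1 * 1" by (rule conv_integral[OF ab u um Nu Suc]) auto
    thus ?case by simp
  qed (auto simp: series_const_def)
  define E where "E = rec_nat (\<lambda>_. 0) (\<lambda>m e i. (u \<star> e) i + (w \<star> spow u m) i)"
  have E0: "E 0 = (\<lambda>_. 0)" and ES: "E (Suc m) = (\<lambda>i. (u \<star> E m) i + (w \<star> spow u m) i)" for m by (simp_all add: E_def)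
  have E: "E m \<in> SR a b" for m
    by (induction m) (auto simp: E0 ES SR_zero intro!: SR_add SR_conv[OF ab] u w um)
  have NE: "N (E m i) \<le> \<eta>" for m i
  proof (induction m arbitrary: i)
    case (Suc m)
    have "N ((u \<star> E m) i) \<le> 1 * \<eta>" by (rule conv_integral[OF ab u E Nu Suc]) (use \<eta> in auto)
    moreover have "N ((w \<star> spow u m) i) \<le> \<eta> * 1" by (rule conv_integral[OF ab w um Nw Num]) (use \<eta> in auto)
    ultimately show ?case unfolding ES by (intro N_add_le) auto
  qed (use \<eta> in \<open>auto simp: E0\<close>)
  have "\<exists>r\<in>SR a b. (\<forall>i. N (r i) \<le> \<eta> * \<eta>) \<and> spow x m = (\<lambda>i. spow u m i + (E m i + r i))" for m
  proof (induction m)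
    case 0 show ?case by (rule bexI[of _ "\<lambda>_. 0"]) (use \<eta> in \<open>auto simp: E0 SR_zero\<close>)
  next
    case (Suc m)
    then obtain r where r: "r \<in> SR a b" "\<And>i. N (r i) \<le> \<eta> * \<eta>"
      and eq: "spow x m = (\<lambda>i. spow u m i + (E m i + r i))" by blast
    define r' where "r' = (\<lambda>i. (x \<star> r) i + (w \<star> E m) i)"
    have Er: "(\<lambda>i. E m i + r i) \<in> SR a b" by (intro SR_add E r)
    have 1: "x \<star> spow x m = (\<lambda>i. (x \<star> spow u m) i + ((x \<star> E m) i + (x \<star> r) i))"
      unfolding eq by (simp add: conv_add_right[OF ab _ _ x(1)] um E r Er)
    have 2: "x \<star> y = (\<lambda>i. (u \<star> y) i + (w \<star> y) i)" if "y \<in> SR a b" for y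
      unfolding xuw by (rule conv_add_left[OF ab u w that])
    have "x \<star> spow x m = (\<lambda>i. (u \<star> spow u m) i + (((u \<star> E m) i + (w \<star> spow u m) i) + r' i))"
      unfolding 1 r'_def by (auto simp: 2[OF um] 2[OF E] add_ac)
    then have "spow x (Suc m) = (\<lambda>i. spow u (Suc m) i + (E (Suc m) i + r' i))" by (simp add: ES)
    moreover have "r' \<in> SR a b" unfolding r'_def by (intro SR_add SR_conv[OF ab] x w E r)
    moreover have "N (r' i) \<le> \<eta> * \<eta>" for i
    proof -
      have "N ((x \<star> r) i) \<le> 1 * (\<eta> * \<eta>)" by (rule conv_integral[OF ab x(1) r(1) x(2) r(2)]) (use \<eta> in auto)
      moreover have "N ((w \<star> E m) i) \<le> \<eta> * \<eta>" by (rule conv_integral[OF ab w E Nw NE]) (use \<eta> in auto)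
      ultimately show ?thesis unfolding r'_def by (intro N_add_le) auto
    qed
    ultimately show ?case by blast
  qed
  then obtain r where r: "N (r i) \<le> \<eta> * \<eta>" and eq: "spow x p = (\<lambda>i. spow u p i + (E p i + r i))" by metis
  have E_eq: "E (Suc m) = (\<lambda>i. of_nat (Suc m) * (w \<star> spow u m) i)" for m
  proof (induction m)
    case 0 show ?case by (simp add: ES E0)
  next
    case (Suc m)
    have "u \<star> (\<lambda>i. of_nat (Suc m) * (w \<star> spow u m) i) = (\<lambda>i. of_nat (Suc m) * (u \<star> (w \<star> spow u m)) i)"
      by (subst (1 2) conv_commute[of u], rule conv_cmult_left[OF ab]) (auto intro: SR_conv[OF ab] u w um)
    moreover have "u \<star> (w \<star> spow u m) = w \<star> spow u (Suc m)"
      by (simp add: conv_assoc[OF ab u w um, symmetric] conv_assoc[OF ab w u um, symmetric] conv_commute[of u w])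
    ultimately show ?case by (simp only: ES[of "Suc m"] Suc.IH) (auto simp: algebra_simps)
  qed
  obtain p' where p': "p = Suc p'" using p_gt_1 by (cases p) auto
  have "N (E p i) \<le> \<eta> * \<nu>"
  proof -
    have "N ((w \<star> spow u p') i) \<le> \<eta> * 1" by (rule conv_integral[OF ab w um Nw Num]) (use \<eta> in auto)
    then have "N (of_nat p) * N ((w \<star> spow u p') i) \<le> \<nu> * \<eta>" using \<eta> \<nu>0 by (intro mult_mono) (auto simp: N_p)
    moreover have "E p i = of_nat p * (w \<star> spow u p') i" unfolding p' E_eq ..
    ultimately show ?thesis by (simp add: N_mult mult.commute)
  qed
  moreover have "spow u p i = 0"
  proof -
    have "\<forall>i\<in>I. spow u (Suc m) i = 0" for m
    proof (induction m)
      case 0 show ?case by (simp add: conv_const_right u_def)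
    next
      case (Suc m)
      show ?case
      proof
        fix k assume k: "k \<in> I"
        have "N ((u \<star> spow u (Suc m)) k) \<le> 0"
        proof (rule conv_bound[OF ab u um])
          fix r show "N (u r) * N (spow u (Suc m) (k - r)) \<le> 0"
            using Suc I[of r "k - r"] k by (cases "r \<in> I"; cases "k - r \<in> I") (auto simp del: spow.simps simp: u_def)
        qed simp
        thus "spow u (Suc (Suc m)) k = 0" using N_nonneg N_eq_0 by (simp only: spow.simps(2)) (meson antisym)
      qed
    qed
    thus ?thesis unfolding p' using i by blast
  qed
  moreover have "N (r i) \<le> \<eta> * \<nu>" using order.trans[OF r mult_left_mono[OF \<eta>(2,1)]] .
  ultimately show ?thesis unfolding eq by (auto intro!: N_add_le)
qed

lemma Gamma_imm_con_subset: "Gamma_imm_con p v L \<subseteq> \<Gamma>" and Gamma_imm_con_integral: "x \<in> Gamma_imm_con p v L \<Longrightarrow> N (x i) \<le> 1"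
proof -
  have int: "x i \<in> L \<and> N (x i) \<le> 1" if "x \<in> Gamma_imm_con p v L" for x i
  proof -
    have "x i \<in> integers_of v L" using that by (simp add: Gamma_imm_con_def Gamma_imm_def)
    thus ?thesis by (simp add: integers_of_iff)
  qed
  show "x \<in> Gamma_imm_con p v L \<Longrightarrow> N (x i) \<le> 1" using int by blast
  show "Gamma_imm_con p v L \<subseteq> \<Gamma>"
  proof
    fix x assume x: "x \<in> Gamma_imm_con p v L"
    have "well_ordered {i. N (x i) > real p powr r}" for r
    proof (cases "r < 0")
      case True thus ?thesis using x by (auto simp: Gamma_imm_con_def Gamma_imm_def dest!: spec[of _ "- r"])
    next
      case False
      then have "1 \<le> real p powr r" using p_gt_1 by (intro ge_one_powr_ge_zero) auto
      then have "{i. N (x i) > real p powr r} = {}" using int[OF x] by (auto simp: not_less intro: order.trans)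
      thus ?thesis by (simp add: well_ordered_empty)
    qed
    moreover have "bounded {N (x i) | i. i < j}" for j
      by (rule boundedI[of _ 1]) (use int[OF x] in auto)
    moreover have "\<forall>\<^sub>F i in at_top. N (x i) < wt d i" if "d > 0" for d
      using eventually_gt_at_top[of 0]
    proof eventually_elim
      case (elim i)
      then have "real p powr 0 < wt d i" using that p_gt_1 by (subst powr_less_cancel_iff) auto
      thus ?case using int[OF x, of i] p_gt_1 by auto
    qed
    ultimately show "x \<in> \<Gamma>" using x int[OF x] unfolding Gamma_imm_an_con_def Gamma_imm_con_def by blast
  qed
qed

end

lemma cring_subring_of_type:
  fixes A :: "'a::comm_ring_1 set"
  assumes "0 \<in> A" "1 \<in> A" "\<And>x. x \<in> A \<Longrightarrow> - x \<in> A" "\<And>x y. x \<in> A \<Longrightarrow> y \<in> A \<Longrightarrow> x + y \<in> A"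
    "\<And>x y. x \<in> A \<Longrightarrow> y \<in> A \<Longrightarrow> x * y \<in> A"
  shows "cring (subring_of_type A)"
proof (rule cringI)
  show "abelian_group (subring_of_type A)"
  proof (rule abelian_groupI)
    fix x assume "x \<in> carrier (subring_of_type A)"
    thus "\<exists>y\<in>carrier (subring_of_type A). y \<oplus>\<^bsub>subring_of_type A\<^esub> x = \<zero>\<^bsub>subring_of_type A\<^esub>"
      using assms(3)[of x] by (intro bexI[of _ "- x"]) (auto simp: subring_of_type_simps)
  qed (auto simp: subring_of_type_simps assms add_ac)
  show "comm_monoid (subring_of_type A)"
    by (rule comm_monoidI) (auto simp: subring_of_type_simps assms mult_ac)
qed (auto simp: subring_of_type_simps algebra_simps)

locale omega_embedding = witt_extension p v res W K
  for p :: nat and v :: "'a::field \<Rightarrow> real" and res :: "'a \<Rightarrow> 'k::alg_closed_field" and W K +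
  fixes \<sigma> :: "'a \<Rightarrow> 'a" and \<phi> :: "'a fps \<Rightarrow> 'a fps" and \<psi> :: "'a fps \<Rightarrow> 'a series"
  assumes res_hom: "res \<in> ring_hom (subring_of_type (integers_of v K)) ring_of_type_algebra"
    and res_kernel: "x \<in> K \<Longrightarrow> N x \<le> 1 \<Longrightarrow> res x = 0 \<longleftrightarrow> N x < 1"
    and \<sigma>_automorphism: "integral_automorphism v K \<sigma>"
    and omega_frobenius: "Omega_frobenius p v res K \<sigma> \<phi>"
    and omega_emb: "Omega_embedding p v res K \<sigma> \<phi> \<psi>"
begin

sublocale KC: complete_subfield p v K by (rule complete_subfield)

sublocale KI: isometric_automorphism p v K \<sigma>
  by (rule KC.isometric_if_integral[OF \<sigma>_automorphism])

abbreviation \<Omega> :: "'a fps set" where "\<Omega> \<equiv> Omega_set v K"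

lemma Omega_iff: "f \<in> \<Omega> \<longleftrightarrow> (\<forall>n. fps_nth f n \<in> K \<and> N (fps_nth f n) \<le> 1)"
  by (simp add: Omega_set_def integers_of_iff)

lemma Omega_closed:
  shows "0 \<in> \<Omega>" "1 \<in> \<Omega>" "f \<in> \<Omega> \<Longrightarrow> - f \<in> \<Omega>" "f \<in> \<Omega> \<Longrightarrow> g \<in> \<Omega> \<Longrightarrow> f + g \<in> \<Omega>"
    "f \<in> \<Omega> \<Longrightarrow> g \<in> \<Omega> \<Longrightarrow> f - g \<in> \<Omega>"
    "f \<in> \<Omega> \<Longrightarrow> g \<in> \<Omega> \<Longrightarrow> f * g \<in> \<Omega>" "c \<in> K \<Longrightarrow> N c \<le> 1 \<Longrightarrow> fps_const c \<in> \<Omega>"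
proof -
  show "0 \<in> \<Omega>" "1 \<in> \<Omega>" "c \<in> K \<Longrightarrow> N c \<le> 1 \<Longrightarrow> fps_const c \<in> \<Omega>" "f \<in> \<Omega> \<Longrightarrow> - f \<in> \<Omega>"
    by (auto simp: Omega_iff L_closed)
  show "f \<in> \<Omega> \<Longrightarrow> g \<in> \<Omega> \<Longrightarrow> f + g \<in> \<Omega>" by (auto simp: Omega_iff L_closed intro: N_add_le)
  show "f \<in> \<Omega> \<Longrightarrow> g \<in> \<Omega> \<Longrightarrow> f - g \<in> \<Omega>" by (auto simp: Omega_iff L_closed intro: N_diff_le)
  show "f * g \<in> \<Omega>" if "f \<in> \<Omega>" "g \<in> \<Omega>"
    using that unfolding Omega_iff fps_mult_nth
    by (auto intro!: L_closed(11) L_closed(6) N_sum_le mult_le_one simp: N_mult)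
qed

lemma Omega_power: "f \<in> \<Omega> \<Longrightarrow> f ^ m \<in> \<Omega>"
  by (induction m) (auto simp: Omega_closed)

lemma Omega_sum: "(\<And>i. i \<in> I \<Longrightarrow> f i \<in> \<Omega>) \<Longrightarrow> sum f I \<in> \<Omega>"
  by (induction I rule: infinite_finite_induct) (auto simp: Omega_closed)

lemma cring_Omega: "cring (Omega v K)"
  unfolding Omega_def by (rule cring_subring_of_type) (auto simp: Omega_closed)

abbreviation \<O> :: "'a set" where "\<O> \<equiv> integers_of v K"

lemma integers_closed: "0 \<in> \<O>" "1 \<in> \<O>" "x \<in> \<O> \<Longrightarrow> - x \<in> \<O>" "x \<in> \<O> \<Longrightarrow> y \<in> \<O> \<Longrightarrow> x + y \<in> \<O>"
    "x \<in> \<O> \<Longrightarrow> y \<in> \<O> \<Longrightarrow> x * y \<in> \<O>"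
  by (auto simp: integers_of_iff L_closed N_mult intro: N_add_le mult_le_one)

lemma integers_sum: "(\<And>i. i \<in> I \<Longrightarrow> f i \<in> \<O>) \<Longrightarrow> sum f I \<in> \<O>"
  by (induction I rule: infinite_finite_induct) (auto simp: integers_closed)

lemma cring_integers: "cring (subring_of_type \<O>)"
  by (rule cring_subring_of_type) (auto simp: integers_closed)

lemma res_int_add: "x \<in> \<O> \<Longrightarrow> y \<in> \<O> \<Longrightarrow> res (x + y) = res x + res y"
  and res_int_mult: "x \<in> \<O> \<Longrightarrow> y \<in> \<O> \<Longrightarrow> res (x * y) = res x * res y"
  and res_int_1: "res 1 = 1"
  using ring_hom_add[OF res_hom, of x y] ring_hom_mult[OF res_hom, of x y] ring_hom_one[OF res_hom]
  by (simp_all add: subring_of_type_simps ring_of_type_simps)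

lemma res_int_0: "res 0 = 0" using res_kernel[of 0] L_closed(1) by simp

lemma res_int_sum: "(\<And>i. i \<in> I \<Longrightarrow> f i \<in> \<O>) \<Longrightarrow> res (sum f I) = (\<Sum>i\<in>I. res (f i))"
  by (induction I rule: infinite_finite_induct) (auto simp: res_int_0 res_int_add integers_sum)

lemma Omega_nth: "f \<in> \<Omega> \<Longrightarrow> fps_nth f n \<in> \<O>" by (simp add: Omega_set_def)

lemma fps_res_mult: "f \<in> \<Omega> \<Longrightarrow> g \<in> \<Omega> \<Longrightarrow> fps_res res (f * g) = fps_res res f * fps_res res g"
  by (rule fps_ext) (simp add: fps_res_def fps_mult_nth res_int_sum res_int_mult integers_closed Omega_nth)

lemma fps_res_power: "f \<in> \<Omega> \<Longrightarrow> fps_res res (f ^ m) = fps_res res f ^ m"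
proof (induction m)
  case 0 show ?case by (rule fps_ext) (simp add: fps_res_def res_int_1 res_int_0)
qed (simp add: fps_res_mult Omega_power)

lemma \<phi>_hom: "\<phi> \<in> ring_hom (Omega v K) (Omega v K)"
  using omega_frobenius by (simp add: Omega_frobenius_def)

lemma \<phi>_closed: "f \<in> \<Omega> \<Longrightarrow> \<phi> f \<in> \<Omega>"
  using ring_hom_closed[OF \<phi>_hom] by (simp add: Omega_def subring_of_type_simps)

lemma \<phi>_nth_0: assumes f: "f \<in> \<Omega>" shows "fps_nth (\<phi> f) 0 = \<sigma> (fps_nth f 0)"
proof -
  let ?c = "fps_const (fps_nth f 0)" and ?g = "fps_shift 1 f"
  have g: "?g \<in> \<Omega>" and c: "?c \<in> \<Omega>" "fps_nth f 0 \<in> \<O>" using f by (auto simp: Omega_iff integers_of_iff L_closed)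
  have Xg: "fps_X * ?g \<in> \<Omega>"
  proof -
    have "fps_X * ?g = f - ?c" by (rule fps_ext) (auto simp: fps_X_mult_nth)
    thus ?thesis using f c by (simp add: Omega_closed)
  qed
  have "f = ?c + fps_X * ?g" by (rule fps_ext) (auto simp: fps_X_mult_nth)
  then have "\<phi> f = \<phi> ?c + \<phi> (fps_X * ?g)"
    using ring_hom_add[OF \<phi>_hom, of ?c "fps_X * ?g"] c Xg by (simp add: Omega_def subring_of_type_simps)
  moreover have "\<phi> ?c = fps_const (\<sigma> (fps_nth f 0))" using omega_frobenius c(2) by (simp add: Omega_frobenius_def)
  moreover have "\<phi> (fps_X * ?g) \<in> (\<lambda>f. fps_X * f) ` \<Omega>" using omega_frobenius g unfolding Omega_frobenius_def by blast
  ultimately show ?thesis by auto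
qed

lemma \<psi>_hom: "\<psi> \<in> ring_hom (Omega v K) (series_ring p v (Gamma_imm_con p v K))"
  using omega_emb by (simp add: Omega_embedding_def)

lemma \<psi>_closed: "f \<in> \<Omega> \<Longrightarrow> \<psi> f \<in> Gamma_imm_con p v K"
  and \<psi>_add: "f \<in> \<Omega> \<Longrightarrow> g \<in> \<Omega> \<Longrightarrow> \<psi> (f + g) = (\<lambda>i. \<psi> f i + \<psi> g i)"
  and \<psi>_mult: "f \<in> \<Omega> \<Longrightarrow> g \<in> \<Omega> \<Longrightarrow> \<psi> (f * g) = \<psi> f \<star> \<psi> g"
  and \<psi>_1: "\<psi> 1 = series_const 1"
  using ring_hom_closed[OF \<psi>_hom, of f] ring_hom_add[OF \<psi>_hom, of f g] ring_hom_mult[OF \<psi>_hom, of f g] ring_hom_one[OF \<psi>_hom]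
  by (simp_all add: Omega_def subring_of_type_simps KC.series_ring_simps)

lemma \<psi>_const: "c \<in> K \<Longrightarrow> N c \<le> 1 \<Longrightarrow> \<psi> (fps_const c) = series_const c"
  using omega_emb by (simp add: Omega_embedding_def integers_of_iff)

lemma \<psi>_\<phi>: "f \<in> \<Omega> \<Longrightarrow> \<psi> (\<phi> f) = series_frob p \<sigma> (\<psi> f)"
  using omega_emb by (simp add: Omega_embedding_def)

lemma \<psi>_power: "f \<in> \<Omega> \<Longrightarrow> \<psi> (f ^ m) = KC.spow (\<psi> f) m"
  by (induction m) (simp_all add: \<psi>_1 \<psi>_mult Omega_power)

lemma \<psi>_sum: "finite I \<Longrightarrow> (\<And>i. i \<in> I \<Longrightarrow> f i \<in> \<Omega>) \<Longrightarrow> \<psi> (sum f I) = (\<lambda>k. \<Sum>i\<in>I. \<psi> (f i) k)"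
proof (induction I rule: finite_induct)
  case empty
  have "\<psi> (fps_const 0) = series_const 0" by (rule \<psi>_const) (simp_all add: L_closed)
  thus ?case by (simp add: series_const_0)
qed (simp add: \<psi>_add Omega_sum)

lemma \<psi>_Gamma: "f \<in> \<Omega> \<Longrightarrow> \<psi> f \<in> KC.\<Gamma>" using \<psi>_closed KC.Gamma_imm_con_subset by blast
lemma \<psi>_in_K: "f \<in> \<Omega> \<Longrightarrow> \<psi> f i \<in> K" using \<psi>_Gamma KC.Gamma_in_L by blast
lemma N_\<psi>: "f \<in> \<Omega> \<Longrightarrow> N (\<psi> f i) \<le> 1" using \<psi>_closed KC.Gamma_imm_con_integral by blast

text \<open>\<open>\<phi>\<close> lifts the Frobenius, so that \<open>\<phi> f - f\<^sup>p\<close> is divisible by a uniformizer \<open>w\<close>.\<close>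
lemma frobenius_decomposition:
  assumes w: "w \<in> K" "w \<noteq> 0" "\<And>x. x \<in> K \<Longrightarrow> N x < 1 \<Longrightarrow> N x \<le> N w" and f: "f \<in> \<Omega>"
  shows "\<exists>h\<in>\<Omega>. \<phi> f = f ^ p + fps_const w * h \<and> (fps_nth f 0 = 0 \<longrightarrow> fps_nth h 0 = 0)"
proof -
  define d where "d = \<phi> f - f ^ p"
  define h where "h = fps_const (inverse w) * d"
  have d: "d \<in> \<Omega>" unfolding d_def by (intro Omega_closed(5) \<phi>_closed Omega_power f)
  have "N (fps_nth d n) \<le> N w" for n
  proof -
    have "fps_res res (\<phi> f) = fps_res res (f ^ p)"
      using omega_frobenius f by (simp add: Omega_frobenius_def fps_res_power)
    from arg_cong[OF this, of "\<lambda>g. fps_nth g n"]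
    have "res (fps_nth (\<phi> f) n) = res (fps_nth (f ^ p) n)" by (simp add: fps_res_def)
    moreover have "\<phi> f = d + f ^ p" by (simp add: d_def)
    ultimately have "res (fps_nth d n) = 0"
      using res_int_add[OF Omega_nth[OF d, of n] Omega_nth[OF Omega_power[OF f, of p], of n]] by simp
    thus ?thesis using w(3)[of "fps_nth d n"] res_kernel[of "fps_nth d n"] d by (simp add: Omega_iff)
  qed
  then have "h \<in> \<Omega>"
    using d w N_pos[OF w(2)] unfolding Omega_iff h_def
    by (auto simp: L_closed N_mult N_inverse N_divide field_simps)
  moreover have "\<phi> f = f ^ p + fps_const w * h"
    using w(2) by (simp add: h_def d_def mult.assoc[symmetric] del: fps_const_mult) (simp add: fps_const_mult)
  moreover have "fps_nth h 0 = 0" if "fps_nth f 0 = 0"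
    using that p_gt_1 f by (simp add: h_def d_def \<phi>_nth_0 KI.\<sigma>_0 fps_nth_power_0)
  ultimately show ?thesis by blast
qed

text \<open>Iterate \<open>\<phi> f = f\<^sup>p + w h\<close>: a bound for the coefficients of \<open>\<psi> f\<close> with exponents in \<open>I\<close> that holds for all
  \<open>f\<close> improves by the factor \<open>|w|\<close>.\<close>
lemma \<psi>_vanish:
  assumes f: "f \<in> \<Omega>" "z \<Longrightarrow> fps_nth f 0 = 0" and i: "i < 0 \<or> z \<and> i = 0"
  shows "\<psi> f i = 0"
proof -
  obtain w where w: "w \<in> K" "w \<noteq> 0" "N w < 1" "\<And>x. x \<in> K \<Longrightarrow> N x < 1 \<Longrightarrow> N x \<le> N w" using uniformizer by blast
  define I where "I = {i::rat. i < 0 \<or> z \<and> i = 0}"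
  have I: "i + j \<notin> I" if "i \<notin> I" "j \<notin> I" for i j using that by (auto simp: I_def)
  have pI: "of_nat p * i \<in> I" if "i \<in> I" for i using that p_gt_1 by (auto simp: I_def mult_pos_neg)
  have Np: "1 / p \<le> N w" using w(4)[of "of_nat p"] p_gt_1 by (simp add: N_p L_closed)
  have base: "N (\<psi> f i) \<le> N w" if f: "f \<in> \<Omega>" "z \<longrightarrow> fps_nth f 0 = 0" and i: "i \<in> I" for f i
  proof -
    have "res (\<psi> f i) = 0"
    proof (cases "i < 0")
      case True
      then have "i \<notin> \<nat>" by (auto elim: Nats_cases)
      thus ?thesis using omega_emb f by (simp add: Omega_embedding_def)
    next
      case False
      then have "i = of_nat 0" "fps_nth f 0 = 0" using i f by (auto simp: I_def)
      moreover have "res (\<psi> f (of_nat 0)) = fps_nth (fps_res res f) 0" using omega_emb f(1) unfolding Omega_embedding_def by blast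
      ultimately show ?thesis by (simp add: fps_res_def res_int_0)
    qed
    thus ?thesis using w(4) res_kernel[OF \<psi>_in_K[OF f(1), of i] N_\<psi>[OF f(1)]] \<psi>_in_K[OF f(1)] by simp
  qed
  have bound: "N (\<psi> f i) \<le> N w ^ Suc m" if "f \<in> \<Omega>" "z \<longrightarrow> fps_nth f 0 = 0" "i \<in> I" for f i m
    using that
  proof (induction m arbitrary: f i)
    case 0 thus ?case using base by simp
  next
    case (Suc m)
    obtain h where h: "h \<in> \<Omega>" "\<phi> f = f ^ p + fps_const w * h" "fps_nth f 0 = 0 \<longrightarrow> fps_nth h 0 = 0"
      using frobenius_decomposition[OF w(1,2) w(4) Suc.prems(1)] by blast
    let ?j = "of_nat p * i"
    have j: "?j \<in> I" by (rule pI[OF Suc.prems(3)])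
    have pw: "N w ^ Suc m \<le> N w" using w(3) power_decreasing[of 1 "Suc m" "N w"] by simp
    obtain s0 where "s0 > 0" "\<And>a b. 0 < a \<Longrightarrow> a \<le> s0 \<Longrightarrow> 0 < b \<Longrightarrow> b \<le> s0 \<Longrightarrow> \<psi> f \<in> KC.SR a b"
      using KC.Gamma_SR[OF \<psi>_Gamma[OF Suc.prems(1)]] by blast
    then have "N (KC.spow (\<psi> f) p ?j) \<le> N w ^ Suc m * N w"
      by (intro KC.spow_p_small[where a = "s0 / 2" and b = s0 and I = I] I N_\<psi> Suc j pw Np) (use w(3) in auto)
    moreover have "N (w * \<psi> h ?j) \<le> N w ^ Suc m * N w"
      using Suc.IH[OF h(1) _ j] h(3) Suc.prems(2) by (simp add: N_mult mult.commute mult_right_mono mult_left_mono)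
    moreover have "\<sigma> (\<psi> f i) = KC.spow (\<psi> f) p ?j + w * \<psi> h ?j"
    proof -
      have "\<sigma> (\<psi> f i) = \<psi> (\<phi> f) ?j" using p_gt_1 by (simp add: \<psi>_\<phi>[OF Suc.prems(1)] series_frob_def)
      also have "\<dots> = KC.spow (\<psi> f) p ?j + w * \<psi> h ?j"
        using w by (simp add: h(2) \<psi>_add \<psi>_mult \<psi>_const \<psi>_power Omega_closed Omega_power h(1) Suc.prems(1) conv_const_left)
      finally show ?thesis .
    qed
    ultimately have "N (\<sigma> (\<psi> f i)) \<le> N w ^ Suc m * N w" by (simp add: N_add_le)
    thus ?case using KI.N_\<sigma>[OF \<psi>_in_K[OF Suc.prems(1)]] by (simp add: mult.commute)
  qed
  have "(\<lambda>m. N w ^ Suc m) \<longlonglongrightarrow> 0" using w(3) by (intro LIMSEQ_Suc LIMSEQ_realpow_zero) auto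
  then have "N (\<psi> f i) \<le> 0"
    by (rule LIMSEQ_le_const) (use bound f i in \<open>auto simp: I_def simp del: power_Suc\<close>)
  thus ?thesis using N_nonneg N_eq_0 antisym by metis
qed

text \<open>Subtracting the constant term leaves a series to which the vanishing at the exponent \<open>0\<close> applies.\<close>
lemma \<psi>_nth_0: assumes f: "f \<in> \<Omega>" shows "\<psi> f 0 = fps_nth f 0"
proof -
  let ?c = "fps_const (fps_nth f 0)"
  have c: "fps_nth f 0 \<in> K" "N (fps_nth f 0) \<le> 1" using f by (auto simp: Omega_iff)
  have g: "f - ?c \<in> \<Omega>" by (intro Omega_closed f c)
  have "\<psi> (f - ?c) 0 = 0" by (rule \<psi>_vanish[OF g, of True]) auto
  moreover have "\<psi> ((f - ?c) + ?c) = (\<lambda>i. \<psi> (f - ?c) i + \<psi> ?c i)" by (rule \<psi>_add[OF g Omega_closed(7)[OF c]])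
  ultimately show ?thesis by (simp add: \<psi>_const[OF c] series_const_def fun_eq_iff)
qed

end

section \<open>Comparison of the slopes\<close>

lemma add_pow_subring_of_type: "add_pow (subring_of_type A) (k::nat) 1 = of_nat k"
  by (induction k) (simp_all add: add_pow_def nat_pow_def subring_of_type_simps add.commute)

context omega_embedding begin

lemma \<psi>_PB:
  assumes L: "isometric_automorphism p v L \<tau>" "K \<subseteq> L" and f: "f \<in> \<Omega>"
  shows "\<psi> f \<in> isometric_automorphism.PB p v L"
proof -
  interpret LI: isometric_automorphism p v L \<tau> by (rule L(1))
  have "\<psi> f i \<in> L" for i using L(2) \<psi>_in_K[OF f] by blast
  moreover have "well_ordered {i. N (\<psi> f i) > e}" if "e > 0" for e
    using \<psi>_Gamma[OF f] that unfolding KC.Gamma_iff by blast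
  moreover have "\<psi> f i = 0" if "i < 0" for i by (rule \<psi>_vanish[OF f, of False]) (use that in auto)
  ultimately show ?thesis unfolding LI.PB_def using N_\<psi>[OF f] by blast
qed

text \<open>In coordinates both sides ask for an invertible matrix that diagonalizes \<open>F\<close> with the same eigenvalues. The
  matrix of \<open>F\<close> is \<open>\<psi>\<close> of a matrix over \<open>\<Omega>\<close> on the left, and its constant term, which is the coefficient of \<open>\<psi>\<close> at
  \<open>0\<close>, on the right.\<close>
lemma eigenbasis_slopes_reduction_iff:
  fixes M :: "('a fps, 'm) module"
  assumes fe: "finite_extension v K \<sigma> K' \<sigma>'" and cry: "F_crystal p (Omega v K) \<phi> M F"
  shows "eigenbasis_slopes v K' series_const (Gamma_ext p v K K')
          (base_ext (Omega v K) (Gamma_ext p v K K') \<psi> M)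
          (base_ext_F (Omega v K) (Gamma_ext p v K K') \<psi> M (series_frob p \<sigma>') F) S \<longleftrightarrow>
     eigenbasis_slopes v K' (\<lambda>x. x) (subring_of_type K')
          (base_ext (subring_of_type \<O>) (subring_of_type K') (\<lambda>x. x) (reduction v K M))
          (base_ext_F (subring_of_type \<O>) (subring_of_type K') (\<lambda>x. x) (reduction v K M) \<sigma>'
             (reduction_F v K \<sigma> M F)) S"
proof -
  have KK': "K \<subseteq> K'" and \<sigma>'K: "\<And>x. x \<in> K \<Longrightarrow> \<sigma>' x = \<sigma> x" and ia: "integral_automorphism v K' \<sigma>'"
    using fe by (auto simp: finite_extension_def)
  interpret L: witt_extension p v res W K' by (rule witt_extension_finite_extension[OF fe])
  interpret LC: complete_subfield p v K' by (rule L.complete_subfield)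
  interpret LI: isometric_automorphism p v K' \<sigma>' by (rule LC.isometric_if_integral[OF ia])
  have ext: "Gamma_ext p v K K' = LC.GR" by (rule L.Gamma_ext_eq[OF _ KK']) (rule witt_extension_axioms)
  have carrier: "carrier (Omega v K) = \<Omega>" by (simp add: Omega_def subring_of_type_simps)
  interpret Mo: Module.module "Omega v K" M using cry by (simp add: F_crystal_def)
  obtain n b A0 where bas: "is_basis (Omega v K) M n b" and A0: "\<forall>i<n. \<forall>j<n. A0 i j \<in> carrier (Omega v K)"
    and FA0: "\<forall>j<n. F (b j) = (\<Oplus>\<^bsub>M\<^esub>i\<in>{..<n}. A0 i j \<odot>\<^bsub>M\<^esub> b i)" and inv: "invertible_away_from_p p (Omega v K) n A0"
    using cry unfolding F_crystal_def by (elim conjE exE)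
  obtain B e where B0: "\<forall>i<n. \<forall>j<n. B i j \<in> carrier (Omega v K)"
    and AB0: "\<forall>i<n. \<forall>j<n.
       (\<Oplus>\<^bsub>Omega v K\<^esub>l\<in>{..<n}. A0 i l \<otimes>\<^bsub>Omega v K\<^esub> B l j) =
         (if i = j then add_pow (Omega v K) (p ^ e) \<one>\<^bsub>Omega v K\<^esub> else \<zero>\<^bsub>Omega v K\<^esub>) \<and>
       (\<Oplus>\<^bsub>Omega v K\<^esub>l\<in>{..<n}. B i l \<otimes>\<^bsub>Omega v K\<^esub> A0 l j) =
         (if i = j then add_pow (Omega v K) (p ^ e) \<one>\<^bsub>Omega v K\<^esub> else \<zero>\<^bsub>Omega v K\<^esub>)"
    using inv unfolding invertible_away_from_p_def by (elim conjE exE)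
  \<comment> \<open>The entries outside the \<open>n \<times> n\<close> block are set to \<open>0\<close>, so that identities of entries hold as identities of functions.\<close>
  define A where "A = (\<lambda>i j. if i < n \<and> j < n then A0 i j else 0)"
  have A: "A i j \<in> \<Omega>" for i j using A0 by (simp add: A_def carrier Omega_closed)
  have B: "B i j \<in> \<Omega>" if "i < n" "j < n" for i j using B0 that by (simp add: carrier)
  have b: "b i \<in> carrier M" if "i < n" for i using bas that by (auto simp: is_basis_def)
  have FA: "F (b j) = lin M n b (\<lambda>i. A i j)" if j: "j < n" for j
  proof -
    have "F (b j) = (\<Oplus>\<^bsub>M\<^esub>i\<in>{..<n}. A0 i j \<odot>\<^bsub>M\<^esub> b i)" using FA0 j by blast
    also have "\<dots> = (\<Oplus>\<^bsub>M\<^esub>i\<in>{..<n}. A i j \<odot>\<^bsub>M\<^esub> b i)"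
      by (rule Mo.M.finsum_cong') (use j b A0 in \<open>auto simp: A_def carrier intro!: Mo.smult_closed\<close>)
    finally show ?thesis by (simp only: lin_def)
  qed
  have scalar: "(if i = j then add_pow (Omega v K) (p ^ e) \<one>\<^bsub>Omega v K\<^esub> else \<zero>\<^bsub>Omega v K\<^esub>) =
      (if i = j then of_nat (p ^ e) else 0)" for i j :: nat
    by (simp only: Omega_def subring_of_type_simps add_pow_subring_of_type)
  have finsum_Omega: "(\<Oplus>\<^bsub>Omega v K\<^esub>l\<in>{..<n}. P l) = (\<Sum>l<n. P l)" if "\<And>l. l < n \<Longrightarrow> P l \<in> \<Omega>" for P
    unfolding Omega_def by (rule finsum_subring_of_type) (use that in \<open>auto simp: Omega_closed\<close>)
  have mult_Omega: "(\<otimes>\<^bsub>Omega v K\<^esub>) = (*)" by (simp add: Omega_def subring_of_type_simps)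
  have AB: "(\<Sum>l<n. A i l * B l j) = (if i = j then of_nat (p ^ e) else 0)" if ij: "i < n" "j < n" for i j
  proof -
    have "(\<Sum>l<n. A i l * B l j) = (\<Sum>l<n. A0 i l * B l j)" using ij by (intro sum.cong) (auto simp: A_def)
    also have "\<dots> = (\<Oplus>\<^bsub>Omega v K\<^esub>l\<in>{..<n}. A0 i l * B l j)"
      using A0 B ij by (intro finsum_Omega[symmetric]) (auto simp: carrier Omega_closed)
    finally show ?thesis using AB0[rule_format, OF ij] by (simp only: mult_Omega scalar)
  qed
  have BA: "(\<Sum>l<n. B i l * A l j) = (if i = j then of_nat (p ^ e) else 0)" if ij: "i < n" "j < n" for i j
  proof -
    have "(\<Sum>l<n. B i l * A l j) = (\<Sum>l<n. B i l * A0 l j)" using ij by (intro sum.cong) (auto simp: A_def)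
    also have "\<dots> = (\<Oplus>\<^bsub>Omega v K\<^esub>l\<in>{..<n}. B i l * A0 l j)"
      using A0 B ij by (intro finsum_Omega[symmetric]) (auto simp: carrier Omega_closed)
    finally show ?thesis using AB0[rule_format, OF ij] by (simp only: mult_Omega scalar)
  qed
  have F_closed: "F x \<in> carrier M" if "x \<in> carrier M" for x using cry that by (auto simp: F_crystal_def)
  have F_add: "F (x \<oplus>\<^bsub>M\<^esub> y) = F x \<oplus>\<^bsub>M\<^esub> F y" if "x \<in> carrier M" "y \<in> carrier M" for x y
    using cry that by (simp add: F_crystal_def)
  have F_smult: "F (r \<odot>\<^bsub>M\<^esub> x) = \<phi> r \<odot>\<^bsub>M\<^esub> F x" if "r \<in> carrier (Omega v K)" "x \<in> carrier M" for r x
    using cry that by (simp add: F_crystal_def)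
  have \<Gamma>K': "\<psi> f \<in> LC.\<Gamma>" if "f \<in> \<Omega>" for f
    using \<psi>_Gamma[OF that] KK' unfolding Gamma_imm_an_con_def by blast
  interpret E1: base_extension_F "Omega v K" LC.GR M \<psi> n b \<phi> F "series_frob p \<sigma>'" A
  proof (intro base_extension_F.intro base_extension.intro base_extension_axioms.intro base_extension_F_axioms.intro)
    show "\<psi> \<in> ring_hom (Omega v K) LC.GR"
      by (rule ring_hom_memI)
         (auto simp: Omega_def subring_of_type_simps LC.series_ring_simps \<psi>_add \<psi>_mult \<psi>_1 intro: \<Gamma>K')
    show "series_frob p \<sigma>' (\<psi> r) = \<psi> (\<phi> r)" if "r \<in> carrier (Omega v K)" for r
      using that by (auto simp: carrier \<psi>_\<phi> series_frob_def \<sigma>'K \<psi>_in_K)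
    show "A i j \<in> carrier (Omega v K)" for i j by (simp add: carrier A)
    show "\<phi> r \<in> carrier (Omega v K)" if "r \<in> carrier (Omega v K)" for r using that by (simp add: carrier \<phi>_closed)
  qed (use cring_Omega LC.cring_GR Mo.module_axioms bas F_closed F_add F_smult LI.frob_hom FA in auto)
  have \<sigma>_int: "\<sigma> x \<in> \<O>" if "x \<in> \<O>" for x using that by (simp add: integers_of_iff KI.\<sigma>_in_L KI.N_\<sigma>)
  interpret E2: base_extension_F "Omega v K" "subring_of_type \<O>" M "\<lambda>f. fps_nth f 0" n b \<phi> F \<sigma> A
  proof (intro base_extension_F.intro base_extension.intro base_extension_axioms.intro base_extension_F_axioms.intro)
    show "(\<lambda>f. fps_nth f 0) \<in> ring_hom (Omega v K) (subring_of_type \<O>)"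
      by (rule ring_hom_memI) (auto simp: Omega_def subring_of_type_simps intro: Omega_nth)
    show "\<sigma> \<in> ring_hom (subring_of_type \<O>) (subring_of_type \<O>)"
      by (rule ring_hom_memI)
         (auto simp: subring_of_type_simps KI.\<sigma>_1 integers_of_iff KI.\<sigma>_in_L KI.N_\<sigma> KI.\<sigma>_mult KI.\<sigma>_add)
    show "\<sigma> (fps_nth r 0) = fps_nth (\<phi> r) 0" if "r \<in> carrier (Omega v K)" for r
      using that by (simp add: carrier \<phi>_nth_0)
    show "A i j \<in> carrier (Omega v K)" for i j by (simp add: carrier A)
    show "\<phi> r \<in> carrier (Omega v K)" if "r \<in> carrier (Omega v K)" for r using that by (simp add: carrier \<phi>_closed)
  qed (use cring_Omega cring_integers Mo.module_axioms bas F_closed F_add F_smult FA in auto)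
  have red: "reduction v K M = E2.T" "reduction_F v K \<sigma> M F = E2.FT"
    by (simp_all only: reduction_def reduction_F_def)
  interpret E3: base_extension_F "subring_of_type \<O>" "subring_of_type K'" E2.T "\<lambda>x. x" n E2.e \<sigma> E2.FT \<sigma>'
    "\<lambda>i j. fps_nth (A i j) 0"
  proof (intro base_extension_F.intro base_extension.intro base_extension_axioms.intro base_extension_F_axioms.intro)
    show "cring (subring_of_type K')" by (rule cring_subring_of_type) (auto simp: LC.in_L)
    show "(\<lambda>x. x) \<in> ring_hom (subring_of_type \<O>) (subring_of_type K')"
      by (rule ring_hom_memI) (use KK' in \<open>auto simp: subring_of_type_simps integers_of_iff\<close>)
    show "\<sigma>' \<in> ring_hom (subring_of_type K') (subring_of_type K')"
      by (rule ring_hom_memI) (auto simp: subring_of_type_simps LI.\<sigma>_in_L LI.\<sigma>_add LI.\<sigma>_mult LI.\<sigma>_1)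
    show "\<sigma>' x = \<sigma> x" if "x \<in> carrier (subring_of_type \<O>)" for x
      using that by (simp add: \<sigma>'K subring_of_type_simps integers_of_iff)
    show "fps_nth (A i j) 0 \<in> carrier (subring_of_type \<O>)" for i j
      using A by (simp add: subring_of_type_simps Omega_nth)
    show "\<sigma> r \<in> carrier (subring_of_type \<O>)" if "r \<in> carrier (subring_of_type \<O>)" for r
      using that by (simp add: subring_of_type_simps \<sigma>_int)
  qed (use cring_integers E2.module_T E2.basis_T E2.FT_closed E2.FT_add E2.FT_smult E2.FT_e in auto)
  have A_0: "(\<lambda>i j. fps_nth (A i j) 0) = (\<lambda>i j. \<psi> (A i j) 0)" using A by (simp add: \<psi>_nth_0)
  have \<psi>_scalar: "\<psi> (if i = j then of_nat (p ^ e) else 0) = (\<lambda>k. of_nat (p ^ e) * LI.dm (\<lambda>_. 1) i j k)" for i j :: nat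
  proof -
    have "\<psi> (of_nat k) = series_const (of_nat k)" for k
      using \<psi>_const[of "of_nat k"] by (simp add: L_closed N_of_nat fps_of_nat)
    moreover have "\<psi> 0 = series_const 0" using \<psi>_const[of 0] by (simp add: L_closed)
    ultimately show ?thesis by (auto simp: LI.dm_def series_const_def simp del: of_nat_power)
  qed
  have prod: "LI.mm n (\<lambda>i j. \<psi> (P i j)) (\<lambda>i j. \<psi> (R i j)) i j = \<psi> (\<Sum>l<n. P i l * R l j)"
    if "\<And>l. l < n \<Longrightarrow> P i l \<in> \<Omega> \<and> R l j \<in> \<Omega>" for P R and i j :: nat
    unfolding LI.mm_def by (subst \<psi>_sum) (use that in \<open>auto simp: \<psi>_mult Omega_closed\<close>)
  have key: "(\<exists>U V. eigenmatrix LC.GR (series_frob p \<sigma>') n (\<lambda>i j. \<psi> (A i j)) m U V (\<lambda>j. series_const (l j))) \<longleftrightarrow>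
      (\<exists>U V. eigenmatrix (subring_of_type K') \<sigma>' n (\<lambda>i j. \<psi> (A i j) 0) m U V l)"
    if l: "\<forall>i<m. l i \<in> K' \<and> l i \<noteq> 0" for m l
  proof (rule LI.eigenmatrix_reduction_iff[where B' = "\<lambda>i j. \<psi> (B i j)" and c = "of_nat (p ^ e)"])
    show "\<psi> (A i j) \<in> LI.PB" for i j by (rule \<psi>_PB[OF LI.isometric_automorphism_axioms KK' A])
    show "\<psi> (B i j) \<in> LI.PB" if "i < n" "j < n" for i j
      by (rule \<psi>_PB[OF LI.isometric_automorphism_axioms KK' B[OF that]])
    show "LI.mm n (\<lambda>i j. \<psi> (A i j)) (\<lambda>i j. \<psi> (B i j)) i j = (\<lambda>k. of_nat (p ^ e) * LI.dm (\<lambda>_. 1) i j k)"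
      if ij: "i < n" "j < n" for i j
      using prod[of A i B j] A B ij by (simp only: AB[OF ij] \<psi>_scalar)
    show "LI.mm n (\<lambda>i j. \<psi> (B i j)) (\<lambda>i j. \<psi> (A i j)) i j = (\<lambda>k. of_nat (p ^ e) * LI.dm (\<lambda>_. 1) i j k)"
      if ij: "i < n" "j < n" for i j
      using prod[of B i A j] A B ij by (simp only: BA[OF ij] \<psi>_scalar)
    show "of_nat (p ^ e) \<in> K'" by (rule LC.in_L(10))
    show "(of_nat (p ^ e) :: 'a) \<noteq> 0" using p_nonzero by simp
  qed (use l in blast)
  have "eigenbasis_slopes v K' series_const LC.GR E1.T E1.FT S \<longleftrightarrow>
    (\<exists>m U V l. (\<forall>i<m. l i \<in> K' \<and> l i \<noteq> 0) \<and>
      eigenmatrix LC.GR (series_frob p \<sigma>') n (\<lambda>i j. \<psi> (A i j)) m U V (\<lambda>i. series_const (l i)) \<and>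
      S = image_mset (\<lambda>i. v (l i)) (mset_set {..<m}))"
    by (rule E1.base_ext_eigenbasis_slopes_iff) (simp add: LC.series_ring_simps LC.Gamma_const)
  also have "\<dots> \<longleftrightarrow> (\<exists>m l. (\<forall>i<m. l i \<in> K' \<and> l i \<noteq> 0) \<and> S = image_mset (\<lambda>i. v (l i)) (mset_set {..<m}) \<and>
      (\<exists>U V. eigenmatrix LC.GR (series_frob p \<sigma>') n (\<lambda>i j. \<psi> (A i j)) m U V (\<lambda>i. series_const (l i))))"
    by blast
  also have "\<dots> \<longleftrightarrow> (\<exists>m l. (\<forall>i<m. l i \<in> K' \<and> l i \<noteq> 0) \<and> S = image_mset (\<lambda>i. v (l i)) (mset_set {..<m}) \<and>
      (\<exists>U V. eigenmatrix (subring_of_type K') \<sigma>' n (\<lambda>i j. \<psi> (A i j) 0) m U V l))"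
  proof (rule ex_cong1, rule ex_cong1, rule conj_cong[OF HOL.refl], rule conj_cong[OF HOL.refl])
    fix m :: nat and l assume "\<forall>i<m. l i \<in> K' \<and> l i \<noteq> 0"
    thus "(\<exists>U V. eigenmatrix LC.GR (series_frob p \<sigma>') n (\<lambda>i j. \<psi> (A i j)) m U V (\<lambda>i. series_const (l i))) \<longleftrightarrow>
      (\<exists>U V. eigenmatrix (subring_of_type K') \<sigma>' n (\<lambda>i j. \<psi> (A i j) 0) m U V l)" by (rule key)
  qed
  also have "\<dots> \<longleftrightarrow> (\<exists>m U V l. (\<forall>i<m. l i \<in> K' \<and> l i \<noteq> 0) \<and>
      eigenmatrix (subring_of_type K') \<sigma>' n (\<lambda>i j. fps_nth (A i j) 0) m U V (\<lambda>i. l i) \<and>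
      S = image_mset (\<lambda>i. v (l i)) (mset_set {..<m}))"
    unfolding A_0 by blast
  also have "\<dots> \<longleftrightarrow> eigenbasis_slopes v K' (\<lambda>x. x) (subring_of_type K') E3.T E3.FT S"
    by (rule E3.base_ext_eigenbasis_slopes_iff[symmetric]) (simp add: subring_of_type_simps)
  finally show ?thesis by (simp only: ext red)
qed

end

theorem proposition6p1:
  fixes p :: nat
    and v :: "'a::alg_closed_field \<Rightarrow> real"
    and res :: "'a \<Rightarrow> 'k::alg_closed_field"
    and W K :: "'a set"
    and \<sigma> :: "'a \<Rightarrow> 'a"
    and \<phi> :: "'a fps \<Rightarrow> 'a fps"
    and \<psi> :: "'a fps \<Rightarrow> 'a series"
    and M :: "('a fps, 'm) module"
    and F :: "'m \<Rightarrow> 'm"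
  assumes "coefficient_setting p v res W K"
    and "frobenius_lift p v res K \<sigma>"
    and "Omega_frobenius p v res K \<sigma> \<phi>"
    and "Omega_embedding p v res K \<sigma> \<phi> \<psi>"
    and "F_crystal p (Omega v K) \<phi> M F"
  shows "special_newton_polygon p v K \<sigma> \<psi> M F
       = newton_polygon v K \<sigma> (reduction v K M) (reduction_F v K \<sigma> M F)"
proof -
  interpret witt_extension p v res W K by (rule witt_extension_of_setting[OF assms(1)])
  have kernel: "{x \<in> integers_of v K. res x = 0} = {x \<in> K. x = 0 \<or> v x > 0}"
    using assms(1) unfolding coefficient_setting_def by blast
  interpret omega_embedding p v res W K \<sigma> \<phi> \<psi>
  proof
    show "res \<in> ring_hom (subring_of_type (integers_of v K)) ring_of_type_algebra"
      using assms(1) unfolding coefficient_setting_def by blast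
    show "res x = 0 \<longleftrightarrow> N x < 1" if "x \<in> K" "N x \<le> 1" for x
    proof -
      have "res x = 0 \<longleftrightarrow> x \<in> {x \<in> integers_of v K. res x = 0}" using that by (simp add: integers_of_iff)
      thus ?thesis unfolding kernel using that by (simp add: N_less_1_iff)
    qed
    show "integral_automorphism v K \<sigma>" using assms(2) by (simp add: frobenius_lift_def)
  qed (rule assms(3,4))+
  have "special_slopes p v K \<sigma> \<psi> M F S \<longleftrightarrow>
      crystal_slopes v K \<sigma> (reduction v K M) (reduction_F v K \<sigma> M F) S" for S
    unfolding special_slopes_def crystal_slopes_def using eigenbasis_slopes_reduction_iff[OF _ assms(5)] by blast
  thus ?thesis by (simp only: special_newton_polygon_def newton_polygon_def)
qed

end
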